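(* Spherical functions of the Gelfand pair $(G_{\widehat{\mathbf n}},\mathfrak S_{\widehat{\mathbf n}})$ are parameterized by finite unordered (possibly empty) collections (multisets) $\mathbf m=(M_1,\ldots,M_l)$ of non-zero integers. More precisely, the assignment sending $\mathbf m=(M_1,\ldots,M_l)$ to the function $$\varphi(g)=\phi_{M_1}(\mathfrak t)\cdots\phi_{M_l}(\mathfrak t),\qquad g=(\mathfrak t,\sigma)\in G_{\widehat{\mathbf n}},$$ is a bijection from the set of such collections onto the set of spherical functions of $(G_{\widehat{\mathbf n}},\mathfrak S_{\widehat{\mathbf n}})$. In particular, for any spherical function $\varphi$ there exist $M_1,\ldots,M_l\in\mathbb Z\setminus\{0\}$ such that the displayed formula holds for all $g=(\mathfrak t,\sigma)\in G_{\widehat{\mathbf n}}$.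
   Context: Fix a sequence $\widehat{\mathbf n}=\{n_k\}_{k\ge 1}$ of integers $n_k>1$ and put $N_k=n_1\cdots n_k$. For $N\ge1$ let $\mathbb X_N=\{1,\ldots,N\}$, let $\mathfrak S_N$ be the group of permutations of $\mathbb X_N$, let $\mathbb T=\{z\in\mathbb C:|z|=1\}$, and let $\mathcal F_N(\mathbb T)\simeq\mathbb T^N$ be the group of functions $\mathbb X_N\to\mathbb T$ under pointwise multiplication, with the torus topology. Let $G_N=\mathcal F_N(\mathbb T)\rtimes\mathfrak S_N$ be the set of pairs $(\mathfrak t,\sigma)$ with product topology and multiplication $(\mathfrak t_1,\sigma_1)(\mathfrak t_2,\sigma_2)=(\mathfrak t_1\cdot(\mathfrak t_2\circ\sigma_1^{-1}),\sigma_1\sigma_2)$. The block-diagonal embedding $G_N\to G_{MN}$ sends $(\mathfrak t,\sigma)$ to $(\tilde{\mathfrak t},\tilde\sigma)$, where $\tilde{\mathfrak t}(Nq+r)=\mathfrak t(r)$ and $\tilde\sigma(Nq+r)=Nq+\sigma(r)$ for $0\le q\le M-1$, $1\le r\le N$. $\mathcal F_{\widehat{\mathbf n}}(\mathbb T)$, $\mathfrak S_{\widehat{\mathbf n}}$ and $G_{\widehat{\mathbf n}}$ are the inductive limits (unions) of $\mathcal F_{N_k}(\mathbb T)$, $\mathfrak S_{N_k}$, $G_{N_k}$ along these embeddings $G_{N_k}\to G_{N_{k+1}}$, with the inductive limit topology (a function is continuous iff its restriction to each $k$-th group is continuous). The groups with index $N_k$ are identified with their images; $\sigma\in\mathfrak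 S_{N_k}$ is identified with $(1,\sigma)$ and $\mathfrak t$ with $(\mathfrak t,1)$. A (continuous) unitary representation $\Pi$ of $G_{\widehat{\mathbf n}}$ in a Hilbert space $\mathcal H$ is called $\mathfrak S_{\widehat{\mathbf n}}$-spherical if it is irreducible and the subspace $\mathcal H^{\mathfrak S_{\widehat{\mathbf n}}}=\{\eta:\Pi(s)\eta=\eta\ \text{for all } s\in\mathfrak S_{\widehat{\mathbf n}}\}$ is one-dimensional. Its spherical function is $\varphi(g)=\langle\Pi(g)\eta,\eta\rangle$, where $\eta\in\mathcal H^{\mathfrak S_{\widehat{\mathbf n}}}$, $\|\eta\|=1$. Spherical functions of $(G_{\widehat{\mathbf n}},\mathfrak S_{\widehat{\mathbf n}})$ are the functions arising in this way. For $M\in\mathbb Z$ and $\mathfrak t\in\mathcal F_{N_k}(\mathbb T)\subset\mathcal F_{\widehat{\mathbf n}}(\mathbb T)$ put $\phi_M(\mathfrak t)=\frac1{N_k}\sum_{x\in\mathbb X_{N_k}}\mathfrak t(x)^M$ (independent of $k$). The empty product is $1$. *)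

theory Defs
  imports "HOL-Analysis.Analysis" "HOL-Algebra.Group_Action" "HOL-Algebra.Module"
begin

section \<open>Complex Hilbert spaces with an explicit carrier\<close>

definition complex_ring :: "complex ring" where
  "complex_ring = \<lparr>carrier = UNIV, mult = (*), one = 1, zero = 0, add = (+)\<rparr>"

record 'h hilbert = "(complex, 'h) module" +
  cinner :: "'h \<Rightarrow> 'h \<Rightarrow> complex"

text \<open>
  The case distinction only serves the locale \<^locale>\<open>Metric_space\<close>, which requires
  symmetry and nonnegativity also outside the carrier.
\<close>

definition hdist :: "'h hilbert \<Rightarrow> 'h \<Rightarrow> 'h \<Rightarrow> real" where
  "hdist H x y =
     (if x \<in> carrier H \<and> y \<in> carrier H
      then sqrt (Re (cinner H (x \<ominus>\<^bsub>H\<^esub> y) (x \<ominus>\<^bsub>H\<^esub> y))) else 0)"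

definition hilbert_topology :: "'h hilbert \<Rightarrow> 'h topology" where
  "hilbert_topology H = Metric_space.mtopology (carrier H) (hdist H)"

text \<open>The inner product is linear in the first and conjugate linear in the second argument.\<close>

locale complex_inner_space = module complex_ring H for H :: "'h hilbert" (structure) +
  assumes cinner_add_left:
      "\<lbrakk>x \<in> carrier H; y \<in> carrier H; z \<in> carrier H\<rbrakk>
        \<Longrightarrow> cinner H (x \<oplus> y) z = cinner H x z + cinner H y z"
    and cinner_smult_left:
      "\<lbrakk>x \<in> carrier H; y \<in> carrier H\<rbrakk> \<Longrightarrow> cinner H (a \<odot> x) y = a * cinner H x y"
    and cinner_commute:
      "\<lbrakk>x \<in> carrier H; y \<in> carrier H\<rbrakk> \<Longrightarrow> cinner H x y = cnj (cinner H y x)"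
    and cinner_nonneg: "x \<in> carrier H \<Longrightarrow> 0 \<le> Re (cinner H x x)"
    and cinner_definite: "\<lbrakk>x \<in> carrier H; cinner H x x = 0\<rbrakk> \<Longrightarrow> x = \<zero>"

locale complex_hilbert_space = complex_inner_space +
  assumes complete: "Metric_space.mcomplete (carrier H) (hdist H)"

lemma complex_ring_simps [simp]:
  "carrier complex_ring = UNIV" "\<one>\<^bsub>complex_ring\<^esub> = 1" "\<zero>\<^bsub>complex_ring\<^esub> = 0"
  "a \<otimes>\<^bsub>complex_ring\<^esub> b = a * b" "a \<oplus>\<^bsub>complex_ring\<^esub> b = a + b"
  by (simp_all add: complex_ring_def)

lemma cring_complex_ring: "cring complex_ring"
proof (rule cringI)
  show "abelian_group complex_ring"
    by (rule abelian_groupI) (auto simp: algebra_simps intro: exI[of _ "- x" for x])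
  show "comm_monoid complex_ring"
    by (rule comm_monoidI) (auto simp: algebra_simps)
qed (auto simp: algebra_simps)

context complex_inner_space
begin

lemma cinner_zero_left [simp]: "y \<in> carrier H \<Longrightarrow> cinner H \<zero> y = 0"
  using cinner_add_left[of "\<zero>" "\<zero>" y] by simp

lemma cinner_add_right:
  "\<lbrakk>x \<in> carrier H; y \<in> carrier H; z \<in> carrier H\<rbrakk>
    \<Longrightarrow> cinner H z (x \<oplus> y) = cinner H z x + cinner H z y"
  by (metis M.add.m_closed cinner_add_left cinner_commute complex_cnj_add)

lemma cinner_smult_right:
  assumes "x \<in> carrier H" "y \<in> carrier H"
  shows "cinner H y (a \<odot> x) = cnj a * cinner H y x"
proof -
  have "a \<odot> x \<in> carrier H" using assms by (simp add: smult_closed)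
  then show ?thesis
    by (metis assms cinner_commute cinner_smult_left complex_cnj_mult)
qed

lemma minus_eq_smult: "x \<in> carrier H \<Longrightarrow> \<ominus> x = (- 1) \<odot> x"
proof -
  assume x: "x \<in> carrier H"
  have c: "(- 1) \<odot> x \<in> carrier H" using x by (simp add: smult_closed)
  have "(- 1) \<odot> x \<oplus> x = ((- 1) \<odot> x) \<oplus> (1 \<odot> x)"
    using smult_one[OF x] by simp
  also have "\<dots> = (-1 + 1) \<odot> x"
    using smult_l_distr[of "-1" 1 x] x by simp
  also have "\<dots> = \<zero>" using smult_l_null[OF x] by simp
  finally show ?thesis using x c by (metis M.minus_equality)
qed

lemma cinner_self_real: "x \<in> carrier H \<Longrightarrow> Im (cinner H x x) = 0"
  using cinner_commute[of x x] by (metis complex_cnj_cancel_iff cnj.simps(2) neg_equal_zero)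

lemma Cauchy_Schwarz_Re:
  assumes x: "x \<in> carrier H" and y: "y \<in> carrier H"
  shows "(Re (cinner H x y))\<^sup>2 \<le> Re (cinner H x x) * Re (cinner H y y)"
proof -
  define A B C where "A = Re (cinner H x x)" and "B = Re (cinner H x y)"
    and "C = Re (cinner H y y)"
  have q: "0 \<le> A - 2 * r * B + r\<^sup>2 * C" for r
  proof -
    let ?r = "- complex_of_real r"
    have ry: "?r \<odot> y \<in> carrier H" using y by (simp add: smult_closed)
    have "cinner H (x \<oplus> ?r \<odot> y) (x \<oplus> ?r \<odot> y)
        = cinner H x x + ?r * cinner H x y + ?r * cinner H y x + ?r * ?r * cinner H y y"
      using x y ry by (simp add: cinner_add_left cinner_add_right cinner_smult_left
          cinner_smult_right M.add.m_closed algebra_simps)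
    moreover have "cinner H y x = cnj (cinner H x y)" using cinner_commute[OF y x] .
    ultimately have "Re (cinner H (x \<oplus> ?r \<odot> y) (x \<oplus> ?r \<odot> y))
        = Re (cinner H x x + ?r * cinner H x y + ?r * cnj (cinner H x y) + ?r * ?r * cinner H y y)"
      by (simp only:)
    also have "\<dots> = A - 2 * r * B + r\<^sup>2 * C"
      by (simp add: A_def B_def C_def power2_eq_square algebra_simps)
    finally have "Re (cinner H (x \<oplus> ?r \<odot> y) (x \<oplus> ?r \<odot> y)) = A - 2 * r * B + r\<^sup>2 * C" .
    then show ?thesis using cinner_nonneg[of "x \<oplus> ?r \<odot> y"] x ry by simp
  qed
  have C: "0 \<le> C" using cinner_nonneg[OF y] by (simp add: C_def)
  show ?thesis
  proof (cases "C = 0")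
    case True
    have "cinner H y y = 0"
      using True cinner_self_real[OF y] by (simp add: C_def complex_eq_iff)
    then have "y = \<zero>" using cinner_definite y by blast
    then have "cinner H x y = 0" using cinner_commute[OF x y] x by simp
    then show ?thesis using True by (simp add: C_def)
  next
    case False
    then have pos: "C > 0" using C by simp
    have "0 \<le> C * (A - 2 * (B / C) * B + (B / C)\<^sup>2 * C)"
      using q[of "B / C"] pos by simp
    also have "\<dots> = A * C - B\<^sup>2"
      using pos by (simp add: power2_eq_square field_simps)
    finally show ?thesis by (simp add: A_def B_def C_def)
  qed
qed

lemma Metric_space_hdist: "Metric_space (carrier H) (hdist H)"
proof
  fix x y show "0 \<le> hdist H x y"
    by (auto simp: hdist_def intro!: cinner_nonneg M.minus_closed)
next
  fix x y show "hdist H x y = hdist H y x"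
  proof (cases "x \<in> carrier H \<and> y \<in> carrier H")
    case True
    let ?u = "x \<ominus> y"
    have u: "?u \<in> carrier H" using True by simp
    have "y \<ominus> x = \<ominus> ?u" using True by (simp add: a_minus_def M.minus_add M.a_comm)
    also have "\<dots> = (- 1) \<odot> ?u" using minus_eq_smult[OF u] .
    finally have e: "y \<ominus> x = (- 1) \<odot> ?u" .
    have "(- 1) \<odot> ?u \<in> carrier H" using u by (simp add: smult_closed)
    then have "cinner H (y \<ominus> x) (y \<ominus> x) = cinner H ?u ?u"
      unfolding e using u by (simp add: cinner_smult_left cinner_smult_right)
    then show ?thesis using True by (simp add: hdist_def)
  qed (auto simp: hdist_def)
next
  fix x y assume xy: "x \<in> carrier H" "y \<in> carrier H"
  let ?u = "x \<ominus> y"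
  have u: "?u \<in> carrier H" using xy by simp
  have "hdist H x y = 0 \<longleftrightarrow> cinner H ?u ?u = 0"
    using xy cinner_self_real[OF u] by (simp add: hdist_def complex_eq_iff)
  also have "\<dots> \<longleftrightarrow> ?u = \<zero>" using cinner_definite[OF u] by auto
  also have "\<dots> \<longleftrightarrow> x = y"
  proof
    assume "?u = \<zero>"
    then have "x \<oplus> \<ominus> y = \<zero>" by (simp add: a_minus_def)
    then have "\<ominus> (\<ominus> y) = x" using xy by (intro M.minus_equality) simp_all
    then show "x = y" using xy by simp
  next
    assume "x = y"
    then show "?u = \<zero>" using xy by (simp add: a_minus_def M.r_neg)
  qed
  finally show "hdist H x y = 0 \<longleftrightarrow> x = y" .
next
  fix x y z assume xyz: "x \<in> carrier H" "y \<in> carrier H" "z \<in> carrier H"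
  let ?u = "x \<ominus> y" and ?v = "y \<ominus> z"
  have u: "?u \<in> carrier H" and v: "?v \<in> carrier H" using xyz by simp_all
  have e: "x \<ominus> z = ?u \<oplus> ?v"
    using xyz by (simp add: a_minus_def M.a_assoc M.r_neg1)
  define A B C where "A = Re (cinner H ?u ?u)" and "B = Re (cinner H ?u ?v)"
    and "C = Re (cinner H ?v ?v)"
  have nn: "0 \<le> A" "0 \<le> C" using cinner_nonneg u v by (simp_all add: A_def C_def)
  have "cinner H ?v ?u = cnj (cinner H ?u ?v)" using cinner_commute[OF v u] .
  then have s: "Re (cinner H (x \<ominus> z) (x \<ominus> z)) = A + 2 * B + C"
    unfolding e using u v
    by (simp add: cinner_add_left cinner_add_right A_def B_def C_def)
  have "B\<^sup>2 \<le> A * C" using Cauchy_Schwarz_Re[OF u v] by (simp add: A_def B_def C_def)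
  then have "B \<le> sqrt A * sqrt C"
    by (metis real_le_rsqrt real_sqrt_mult)
  then have "A + 2 * B + C \<le> (sqrt A + sqrt C)\<^sup>2"
    using nn by (simp add: power2_sum)
  then have "sqrt (A + 2 * B + C) \<le> sqrt A + sqrt C"
    using nn by (simp add: real_le_lsqrt)
  then show "hdist H x z \<le> hdist H x y + hdist H y z"
    using xyz s by (simp add: hdist_def A_def C_def)
qed

end

section \<open>Spherical representations and spherical functions\<close>

text \<open>
  \<^const>\<open>BijGroup\<close> makes every \<open>\<rho> g\<close> a bijection of the carrier (and undefined outside);
  continuity is meant in the strong operator topology.
\<close>

locale unitary_rep = complex_hilbert_space H + group_action G "carrier H" \<rho>
  for G :: "'g monoid" and T :: "'g topology" and H :: "'h hilbert" and \<rho> :: "'g \<Rightarrow> 'h \<Rightarrow> 'h" +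
  assumes rep_add:
      "\<lbrakk>g \<in> carrier G; v \<in> carrier H; w \<in> carrier H\<rbrakk>
        \<Longrightarrow> \<rho> g (v \<oplus>\<^bsub>H\<^esub> w) = \<rho> g v \<oplus>\<^bsub>H\<^esub> \<rho> g w"
    and rep_smult:
      "\<lbrakk>g \<in> carrier G; v \<in> carrier H\<rbrakk> \<Longrightarrow> \<rho> g (a \<odot>\<^bsub>H\<^esub> v) = a \<odot>\<^bsub>H\<^esub> \<rho> g v"
    and rep_cinner:
      "\<lbrakk>g \<in> carrier G; v \<in> carrier H; w \<in> carrier H\<rbrakk>
        \<Longrightarrow> cinner H (\<rho> g v) (\<rho> g w) = cinner H v w"
    and rep_continuous:
      "v \<in> carrier H \<Longrightarrow> continuous_map T (hilbert_topology H) (\<lambda>g. \<rho> g v)"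

definition irreducible_rep :: "'g monoid \<Rightarrow> 'g topology \<Rightarrow> 'h hilbert \<Rightarrow> ('g \<Rightarrow> 'h \<Rightarrow> 'h) \<Rightarrow> bool"
  where "irreducible_rep G T H \<rho> \<longleftrightarrow>
    unitary_rep G T H \<rho> \<and> carrier H \<noteq> {\<zero>\<^bsub>H\<^esub>} \<and>
    (\<forall>W. submodule W complex_ring H \<and> closedin (hilbert_topology H) W \<and>
         (\<forall>g\<in>carrier G. \<rho> g ` W \<subseteq> W)
       \<longrightarrow> W = {\<zero>\<^bsub>H\<^esub>} \<or> W = carrier H)"

definition fixed_space :: "'h hilbert \<Rightarrow> ('g \<Rightarrow> 'h \<Rightarrow> 'h) \<Rightarrow> 'g set \<Rightarrow> 'h set"
  where "fixed_space H \<rho> K = {\<eta> \<in> carrier H. \<forall>s\<in>K. \<rho> s \<eta> = \<eta>}"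

definition one_dimensional :: "'h hilbert \<Rightarrow> 'h set \<Rightarrow> bool"
  where "one_dimensional H V \<longleftrightarrow> (\<exists>e\<in>V. e \<noteq> \<zero>\<^bsub>H\<^esub> \<and> V = {a \<odot>\<^bsub>H\<^esub> e |a. True})"

definition spherical_rep ::
    "'g monoid \<Rightarrow> 'g topology \<Rightarrow> 'g set \<Rightarrow> 'h hilbert \<Rightarrow> ('g \<Rightarrow> 'h \<Rightarrow> 'h) \<Rightarrow> bool"
  where "spherical_rep G T K H \<rho> \<longleftrightarrow>
    irreducible_rep G T H \<rho> \<and> one_dimensional H (fixed_space H \<rho> K)"

text \<open>
  The spherical functions arising from Hilbert spaces whose vectors are drawn from the type
  \<^typ>\<open>'h\<close>.  HOL cannot quantify over all types in a definition; the type
  \<^typ>\<open>'g \<Rightarrow> complex\<close> already suffices, since a unitary representation with cyclic vector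
  \<open>\<eta>\<close> can be realized on functions on the group via \<open>v \<mapsto> (\<lambda>g. \<langle>v, \<rho> g \<eta>\<rangle>)\<close>.
\<close>

definition spherical_functions ::
    "'h itself \<Rightarrow> 'g monoid \<Rightarrow> 'g topology \<Rightarrow> 'g set \<Rightarrow> ('g \<Rightarrow> complex) set"
  where "spherical_functions TYPE('h) G T K =
    {\<lambda>g\<in>carrier G. cinner H (\<rho> g \<eta>) \<eta> |(H :: 'h hilbert) \<rho> \<eta>.
       spherical_rep G T K H \<rho> \<and> \<eta> \<in> fixed_space H \<rho> K \<and> cinner H \<eta> \<eta> = 1}"

section \<open>The groups $G_N$ and the block-diagonal embeddings\<close>

text \<open>
  Functions on \<open>{1..N}\<close> are extended by 1, and permutations of \<open>{1..N}\<close> by the identity, so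
  that one multiplication serves all \<open>N\<close>, as well as the inductive limit below.
\<close>

type_synonym wreath_elt = "(nat \<Rightarrow> complex) \<times> (nat \<Rightarrow> nat)"

definition torus_fun :: "nat \<Rightarrow> (nat \<Rightarrow> complex) set" where
  "torus_fun N = {t. (\<forall>x\<in>{1..N}. cmod (t x) = 1) \<and> (\<forall>x. x \<notin> {1..N} \<longrightarrow> t x = 1)}"

definition perms :: "nat \<Rightarrow> (nat \<Rightarrow> nat) set" where
  "perms N = {s. s permutes {1..N}}"

definition wreath_mult :: "wreath_elt \<Rightarrow> wreath_elt \<Rightarrow> wreath_elt" where
  "wreath_mult = (\<lambda>(t1, s1) (t2, s2). (\<lambda>x. t1 x * t2 (inv_into UNIV s1 x), s1 \<circ> s2))"

definition wreath :: "nat \<Rightarrow> wreath_elt monoid" where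
  "wreath N = \<lparr>carrier = torus_fun N \<times> perms N, mult = wreath_mult, one = (\<lambda>_. 1, id)\<rparr>"

definition wreath_top :: "nat \<Rightarrow> wreath_elt topology" where
  "wreath_top N = prod_topology (subtopology euclidean (torus_fun N)) (discrete_topology (perms N))"

text \<open>
  With \<open>D = {1..M * N}\<close> the following is the block-diagonal embedding of $G_N$ into $G_{MN}$;
  with \<open>D = {1..}\<close> it has infinitely many blocks and is the embedding of $G_N$ into the
  inductive limit.  See lemmas \<open>block_fun_apply\<close> and \<open>block_perm_apply\<close>.
\<close>

definition block_fun :: "nat \<Rightarrow> nat set \<Rightarrow> (nat \<Rightarrow> complex) \<Rightarrow> nat \<Rightarrow> complex" where
  "block_fun N D t = (\<lambda>x. if x \<in> D then t (Suc ((x - 1) mod N)) else 1)"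

definition block_perm :: "nat \<Rightarrow> nat set \<Rightarrow> (nat \<Rightarrow> nat) \<Rightarrow> nat \<Rightarrow> nat" where
  "block_perm N D s = (\<lambda>x. if x \<in> D then N * ((x - 1) div N) + s (Suc ((x - 1) mod N)) else x)"

definition block_emb :: "nat \<Rightarrow> nat set \<Rightarrow> wreath_elt \<Rightarrow> wreath_elt" where
  "block_emb N D = map_prod (block_fun N D) (block_perm N D)"

section \<open>The inductive limit\<close>

text \<open>
  The inductive limit is the union of the images of the $G_{N_k}$ under \<open>block_emb (Nprod n k) {1..}\<close>.
  Lemmas \<open>block_emb_block_emb\<close>, \<open>inj_on_block_emb\<close>, \<open>block_emb_hom\<close> and \<open>block_emb_hom_limit\<close> show
  that these are injective homomorphisms compatible with the embeddings of $G_{N_k}$ into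
  $G_{N_{k+1}}$.
\<close>

definition Nprod :: "(nat \<Rightarrow> nat) \<Rightarrow> nat \<Rightarrow> nat" where
  "Nprod n k = (\<Prod>i=1..k. n i)"

definition limit_group :: "(nat \<Rightarrow> nat) \<Rightarrow> wreath_elt monoid" where
  "limit_group n =
     \<lparr>carrier = (\<Union>k\<in>{1..}. block_emb (Nprod n k) {1..} ` carrier (wreath (Nprod n k))),
      mult = wreath_mult, one = (\<lambda>_. 1, id)\<rparr>"

definition limit_sym :: "(nat \<Rightarrow> nat) \<Rightarrow> wreath_elt set" where
  "limit_sym n = (\<Union>k\<in>{1..}. block_emb (Nprod n k) {1..} ` ({\<lambda>_. 1} \<times> perms (Nprod n k)))"

definition limit_top :: "(nat \<Rightarrow> nat) \<Rightarrow> wreath_elt topology" where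
  "limit_top n = topology (\<lambda>U. U \<subseteq> carrier (limit_group n) \<and>
     (\<forall>k\<ge>1. openin (wreath_top (Nprod n k))
        {g \<in> carrier (wreath (Nprod n k)). block_emb (Nprod n k) {1..} g \<in> U}))"

text \<open>By lemma \<open>phi_eq\<close>, any other admissible \<open>k\<close> gives the same value.\<close>

definition phi :: "(nat \<Rightarrow> nat) \<Rightarrow> int \<Rightarrow> (nat \<Rightarrow> complex) \<Rightarrow> complex" where
  "phi n M t =
     (let k = (LEAST k. k \<ge> 1 \<and> t \<in> block_fun (Nprod n k) {1..} ` torus_fun (Nprod n k))
      in (\<Sum>x=1..Nprod n k. t x powi M) / of_nat (Nprod n k))"

section \<open>Consistency of the definitions\<close>

lemma block_fun_apply:
  assumes "r \<in> {1..N}" "N * q + r \<in> D"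
  shows "block_fun N D t (N * q + r) = t r"
proof -
  have *: "N * q + r - 1 = N * q + (r - 1)" "r - 1 < N" using assms(1) by auto
  have "(N * q + r - 1) mod N = r - 1"
    unfolding *(1) using *(2) by simp
  then show ?thesis using assms by (simp add: block_fun_def)
qed

lemma block_perm_apply:
  assumes "r \<in> {1..N}" "N * q + r \<in> D"
  shows "block_perm N D s (N * q + r) = N * q + s r"
proof -
  have *: "N * q + r - 1 = N * q + (r - 1)" "r - 1 < N" using assms(1) by auto
  have "(N * q + r - 1) mod N = r - 1" "(N * q + r - 1) div N = q"
    unfolding *(1) using *(2) by simp_all
  then show ?thesis using assms by (simp add: block_perm_def)
qed

lemma block_coord:
  fixes N x :: nat
  assumes "N > 0" "x \<ge> 1"
  obtains q r where "r \<in> {1..N}" "x = N * q + r"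
proof
  show "Suc ((x - 1) mod N) \<in> {1..N}" using assms by (simp add: Suc_leI)
  show "x = N * ((x - 1) div N) + Suc ((x - 1) mod N)" using assms by simp
qed

definition block_closed :: "nat \<Rightarrow> nat set \<Rightarrow> bool" where
  "block_closed N D \<longleftrightarrow> N > 0 \<and> 0 \<notin> D \<and> {1..N} \<subseteq> D \<and>
     (\<forall>q. \<forall>r\<in>{1..N}. \<forall>r'\<in>{1..N}. N * q + r \<in> D \<longrightarrow> N * q + r' \<in> D)"

lemma block_closed_atLeast: "N > 0 \<Longrightarrow> block_closed N {1..}"
  by (auto simp: block_closed_def)

lemma block_closed_mult:
  assumes "N > 0" "M > 0" shows "block_closed N {1..M * N}"
proof -
  have "N * q + r' \<le> M * N" if "N * q + r \<le> M * N" "r \<ge> 1" "r' \<le> N" for q r r'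
  proof -
    have "N * q < N * M" using that by (metis add_le_imp_le_left le_trans mult.commute less_le_trans
        less_add_same_cancel1 zero_less_one less_le_trans)
    then have "Suc q \<le> M" using assms by simp
    then have "N * Suc q \<le> N * M" by (rule mult_le_mono2)
    then show ?thesis using that by (simp add: mult.commute)
  qed
  moreover have "N \<le> M * N" using assms by simp
  ultimately show ?thesis using assms
    unfolding block_closed_def by auto
qed

lemma block_cases [consumes 1, case_names out inside]:
  assumes "block_closed N D"
  obtains "x \<notin> D" | q r where "r \<in> {1..N}" "x = N * q + r" "x \<in> D"
proof (cases "x \<in> D")
  case True
  then have "x \<ge> 1" "N > 0" using assms by (auto simp: block_closed_def Suc_le_eq intro: gr0I)
  then obtain q r where "r \<in> {1..N}" "x = N * q + r" using block_coord by metis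
  then show ?thesis using that(2) True by blast
qed (use that in auto)

lemma perms_in: "s \<in> perms N \<Longrightarrow> r \<in> {1..N} \<Longrightarrow> s r \<in> {1..N}"
  unfolding perms_def by (metis mem_Collect_eq permutes_in_image)

lemma block_perm_comp:
  assumes D: "block_closed N D" and s: "s2 \<in> perms N"
  shows "block_perm N D s1 \<circ> block_perm N D s2 = block_perm N D (s1 \<circ> s2)"
proof
  fix x
  show "(block_perm N D s1 \<circ> block_perm N D s2) x = block_perm N D (s1 \<circ> s2) x"
    using D
  proof (cases rule: block_cases[where x = x])
    case out
    then show ?thesis by (simp add: block_perm_def)
  next
    case (inside q r)
    have "s2 r \<in> {1..N}" using perms_in s inside by blast
    moreover have "N * q + s2 r \<in> D"
      using D inside calculation unfolding block_closed_def by blast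
    ultimately show ?thesis using inside by (simp add: block_perm_apply)
  qed
qed

lemma block_perm_id: "block_closed N D \<Longrightarrow> block_perm N D id = id"
proof
  fix x assume D: "block_closed N D"
  then show "block_perm N D id x = id x"
  proof (cases rule: block_cases[where x = x])
    case out
    then show ?thesis by (simp add: block_perm_def)
  next
    case (inside q r)
    then show ?thesis by (simp add: block_perm_apply)
  qed
qed

lemma perms_inv: "s \<in> perms N \<Longrightarrow> inv_into UNIV s \<in> perms N"
  by (simp add: perms_def permutes_inv)

lemma perms_inv_o:
  "s \<in> perms N \<Longrightarrow> s \<circ> inv_into UNIV s = id" "s \<in> perms N \<Longrightarrow> inv_into UNIV s \<circ> s = id"
  by (simp_all add: perms_def permutes_inv_o)

lemma block_perm_inv_o:
  assumes D: "block_closed N D" and s: "s \<in> perms N"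
  shows "block_perm N D s \<circ> block_perm N D (inv_into UNIV s) = id"
    and "block_perm N D (inv_into UNIV s) \<circ> block_perm N D s = id"
  by (simp_all only: block_perm_comp[OF D perms_inv[OF s]] block_perm_comp[OF D s]
      perms_inv_o[OF s] block_perm_id[OF D])

lemma block_perm_bij: "block_closed N D \<Longrightarrow> s \<in> perms N \<Longrightarrow> bij (block_perm N D s)"
  by (rule o_bij[OF block_perm_inv_o(2) block_perm_inv_o(1)])

lemma block_perm_inv:
  "block_closed N D \<Longrightarrow> s \<in> perms N \<Longrightarrow>
   inv_into UNIV (block_perm N D s) = block_perm N D (inv_into UNIV s)"
  by (rule inv_unique_comp[OF block_perm_inv_o])

lemma block_fun_comp:
  assumes D: "block_closed N D" and s: "s \<in> perms N"
  shows "block_fun N D t (block_perm N D s x) = block_fun N D (t \<circ> s) x"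
  using D
proof (cases rule: block_cases[where x = x])
  case out
  then show ?thesis by (simp add: block_perm_def block_fun_def)
next
  case (inside q r)
  have r: "s r \<in> {1..N}" using perms_in s inside by blast
  moreover have "N * q + s r \<in> D"
    using D inside r unfolding block_closed_def by blast
  ultimately show ?thesis using inside by (simp add: block_perm_apply block_fun_apply)
qed

lemma block_emb_wreath_mult:
  assumes D: "block_closed N D" and g: "g \<in> carrier (wreath N)" "h \<in> carrier (wreath N)"
  shows "block_emb N D (wreath_mult g h) = wreath_mult (block_emb N D g) (block_emb N D h)"
proof -
  obtain t1 s1 t2 s2 where e: "g = (t1, s1)" "h = (t2, s2)" by fastforce
  have s: "s1 \<in> perms N" "s2 \<in> perms N" using g by (auto simp: e wreath_def)
  have "block_fun N D (\<lambda>x. t1 x * t2 (inv_into UNIV s1 x)) x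
      = block_fun N D t1 x * block_fun N D t2 (inv_into UNIV (block_perm N D s1) x)" for x
    unfolding block_perm_inv[OF D s(1)] block_fun_comp[OF D perms_inv[OF s(1)]]
    by (simp add: block_fun_def)
  then show ?thesis
    by (auto simp: e block_emb_def wreath_mult_def block_perm_comp[OF D s(2)])
qed

lemma block_emb_one: "block_closed N D \<Longrightarrow> block_emb N D (\<lambda>_. 1, id) = (\<lambda>_. 1, id)"
  by (simp add: block_emb_def block_perm_id) (simp add: block_fun_def)

lemma inj_on_block_emb:
  assumes D: "block_closed N D"
  shows "inj_on (block_emb N D) (carrier (wreath N))"
proof (rule inj_onI)
  fix g h assume g: "g \<in> carrier (wreath N)" "h \<in> carrier (wreath N)"
    and eq: "block_emb N D g = block_emb N D h"
  obtain t1 s1 t2 s2 where e: "g = (t1, s1)" "h = (t2, s2)" by fastforce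
  have m: "t1 \<in> torus_fun N" "t2 \<in> torus_fun N" "s1 \<in> perms N" "s2 \<in> perms N"
    using g by (auto simp: e wreath_def)
  have "t1 r = t2 r \<and> s1 r = s2 r" if r: "r \<in> {1..N}" for r
  proof -
    have r': "N * 0 + r \<in> D" using D r by (auto simp: block_closed_def)
    have "block_fun N D t1 r = block_fun N D t2 r" "block_perm N D s1 r = block_perm N D s2 r"
      using eq by (simp_all add: e block_emb_def)
    then show ?thesis
      using block_fun_apply[OF r r'] block_perm_apply[OF r r'] by simp
  qed
  moreover have "t1 r = t2 r \<and> s1 r = s2 r" if r: "r \<notin> {1..N}" for r
    using m r by (simp add: torus_fun_def perms_def permutes_not_in)
  ultimately have "t1 = t2" "s1 = s2" by (metis ext)+
  then show "g = h" by (simp add: e)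
qed

lemma block_emb_block_emb:
  assumes N: "N > 0" and M: "M > 0"
  shows "block_emb (M * N) {1..} (block_emb N {1..M * N} g) = block_emb N {1..} g"
proof -
  obtain t s where g: "g = (t, s)" by fastforce
  have "block_fun (M * N) {1..} (block_fun N {1..M * N} t) x = block_fun N {1..} t x \<and>
        block_perm (M * N) {1..} (block_perm N {1..M * N} s) x = block_perm N {1..} s x" for x
  proof (cases "x \<ge> 1")
    case True
    obtain q y where y: "y \<in> {1..M * N}" "x = M * N * q + y"
      by (rule block_coord[of "M * N" x]) (use True N M in auto)
    obtain p r where r: "r \<in> {1..N}" "y = N * p + r"
      by (rule block_coord[of N y]) (use y(1) N in auto)
    have x: "x = N * (M * q + p) + r" unfolding y(2) r(2) by (simp add: algebra_simps)
    have i1: "M * N * q + y \<in> {1..}" using y(1) by simp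
    have i2: "N * p + r \<in> {1..M * N}" using y(1) unfolding r(2) .
    have i3: "N * (M * q + p) + r \<in> {1..}" using r(1) by simp
    have "block_fun (M * N) {1..} (block_fun N {1..M * N} t) x = t r"
      unfolding y(2) block_fun_apply[OF y(1) i1] unfolding r(2) block_fun_apply[OF r(1) i2] ..
    moreover have "block_fun N {1..} t x = t r"
      unfolding x block_fun_apply[OF r(1) i3] ..
    moreover have "block_perm (M * N) {1..} (block_perm N {1..M * N} s) x = M * N * q + (N * p + s r)"
      unfolding y(2) block_perm_apply[OF y(1) i1] unfolding r(2) block_perm_apply[OF r(1) i2] ..
    moreover have "block_perm N {1..} s x = N * (M * q + p) + s r"
      unfolding x block_perm_apply[OF r(1) i3] ..
    ultimately show ?thesis by (simp add: algebra_simps)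
  qed (simp add: block_fun_def block_perm_def)
  then have "block_fun (M * N) {1..} (block_fun N {1..M * N} t) = block_fun N {1..} t"
    "block_perm (M * N) {1..} (block_perm N {1..M * N} s) = block_perm N {1..} s"
    by blast+
  then show ?thesis by (simp only: g block_emb_def map_prod_simp)
qed

lemma block_emb_closed:
  assumes N: "N > 0" and M: "M > 0" and g: "g \<in> carrier (wreath N)"
  shows "block_emb N {1..M * N} g \<in> carrier (wreath (M * N))"
proof -
  obtain t s where e: "g = (t, s)" by fastforce
  have m: "t \<in> torus_fun N" "s \<in> perms N" using g by (auto simp: e wreath_def)
  have D: "block_closed N {1..M * N}" using block_closed_mult N M .
  have "Suc ((x - 1) mod N) \<in> {1..N}" for x using N by (simp add: Suc_leI)
  then have "block_fun N {1..M * N} t \<in> torus_fun (M * N)"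
    using m by (auto simp: block_fun_def torus_fun_def)
  moreover have "block_perm N {1..M * N} s \<in> perms (M * N)"
  proof -
    have sub: "block_perm N {1..M * N} s' ` {1..M * N} \<subseteq> {1..M * N}" if s': "s' \<in> perms N" for s'
    proof
      fix z assume "z \<in> block_perm N {1..M * N} s' ` {1..M * N}"
      then obtain x where x: "x \<in> {1..M * N}" "z = block_perm N {1..M * N} s' x" by blast
      from D show "z \<in> {1..M * N}"
      proof (cases rule: block_cases[where x = x])
        case out
        then show ?thesis using x by blast
      next
        case (inside q r)
        have r: "s' r \<in> {1..N}" using perms_in s' inside by blast
        moreover have "N * q + s' r \<in> {1..M * N}"
          using D inside r unfolding block_closed_def by blast
        ultimately show ?thesis using inside x block_perm_apply by metis
      qed
    qed
    have "{1..M * N} \<subseteq> block_perm N {1..M * N} s ` {1..M * N}"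
    proof
      fix z assume z: "z \<in> {1..M * N}"
      have "z = block_perm N {1..M * N} s (block_perm N {1..M * N} (inv_into UNIV s) z)"
        using block_perm_inv_o(1)[OF D m(2)] by (metis comp_apply id_apply)
      then show "z \<in> block_perm N {1..M * N} s ` {1..M * N}"
        using sub[OF perms_inv[OF m(2)]] z by blast
    qed
    then have "block_perm N {1..M * N} s ` {1..M * N} = {1..M * N}"
      using sub[OF m(2)] by (rule subset_antisym[rotated])
    moreover have "inj_on (block_perm N {1..M * N} s) {1..M * N}"
      using block_perm_bij[OF D m(2)] by (metis bij_is_inj inj_on_subset subset_UNIV)
    ultimately have "bij_betw (block_perm N {1..M * N} s) {1..M * N} {1..M * N}"
      by (simp only: bij_betw_def)
    moreover have "block_perm N {1..M * N} s x = x" if "x \<notin> {1..M * N}" for x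
      using that by (simp only: block_perm_def if_False)
    ultimately show ?thesis
      unfolding perms_def by (blast intro: bij_imp_permutes)
  qed
  ultimately show ?thesis by (simp add: e block_emb_def wreath_def)
qed

lemma block_emb_hom:
  assumes "N > 0" "M > 0"
  shows "block_emb N {1..M * N} \<in> hom (wreath N) (wreath (M * N))"
  using assms block_emb_closed block_emb_wreath_mult block_closed_mult
  by (auto intro!: homI simp: wreath_def)

lemma torus_fun_mult:
  assumes "t1 \<in> torus_fun N" "t2 \<in> torus_fun N" "s \<in> perms N"
  shows "(\<lambda>x. t1 x * t2 (s x)) \<in> torus_fun N"
  using assms perms_in[of s N] permutes_not_in[of s "{1..N}"]
  by (auto simp: torus_fun_def norm_mult perms_def)

lemma wreath_mult_closed:
  assumes "g \<in> carrier (wreath N)" "h \<in> carrier (wreath N)"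
  shows "wreath_mult g h \<in> carrier (wreath N)"
  using assms torus_fun_mult[OF _ _ perms_inv]
  by (auto simp: wreath_def wreath_mult_def perms_def intro: permutes_compose)

lemma wreath_mult_assoc:
  assumes "bij (snd g)" "bij (snd h)"
  shows "wreath_mult (wreath_mult g h) l = wreath_mult g (wreath_mult h l)"
  using assms
  by (auto simp: wreath_mult_def case_prod_beta o_inv_distrib comp_assoc mult.assoc)

definition wreath_inv :: "wreath_elt \<Rightarrow> wreath_elt" where
  "wreath_inv = (\<lambda>(t, s). (\<lambda>x. inverse (t (s x)), inv_into UNIV s))"

lemma wreath_inv_closed:
  assumes "g \<in> carrier (wreath N)"
  shows "wreath_inv g \<in> carrier (wreath N)"
proof -
  obtain t s where e: "g = (t, s)" by fastforce
  have m: "t \<in> torus_fun N" "s \<in> perms N" using assms by (auto simp: e wreath_def)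
  have "(\<lambda>x. inverse (t (s x))) \<in> torus_fun N"
    using m perms_in[of s N] permutes_not_in[of s "{1..N}"]
    by (auto simp: torus_fun_def norm_inverse perms_def)
  then show ?thesis using m by (simp add: e wreath_inv_def wreath_def perms_inv)
qed

lemma wreath_inv_left:
  assumes "g \<in> carrier (wreath N)"
  shows "wreath_mult (wreath_inv g) g = (\<lambda>_. 1, id)"
proof -
  obtain t s where e: "g = (t, s)" by fastforce
  have m: "t \<in> torus_fun N" "s \<in> perms N" using assms by (auto simp: e wreath_def)
  have "bij s" using m by (auto simp: perms_def permutes_bij)
  moreover have "t x \<noteq> 0" for x
    using m unfolding torus_fun_def by (cases "x \<in> {1..N}") force+
  ultimately show ?thesis using perms_inv_o[OF m(2)]
    by (simp add: e wreath_inv_def wreath_mult_def inv_inv_eq)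
qed

lemma wreath_one: "(\<lambda>_. 1, id) \<in> carrier (wreath N)"
  by (auto simp: wreath_def torus_fun_def perms_def permutes_id)

lemma group_wreath: "group (wreath N)"
proof (rule groupI)
  fix x y z assume "x \<in> carrier (wreath N)" "y \<in> carrier (wreath N)" "z \<in> carrier (wreath N)"
  then show "x \<otimes>\<^bsub>wreath N\<^esub> y \<otimes>\<^bsub>wreath N\<^esub> z = x \<otimes>\<^bsub>wreath N\<^esub> (y \<otimes>\<^bsub>wreath N\<^esub> z)"
    using wreath_mult_assoc by (auto simp: wreath_def perms_def permutes_bij)
next
  fix x assume x: "x \<in> carrier (wreath N)"
  show "\<exists>y\<in>carrier (wreath N). y \<otimes>\<^bsub>wreath N\<^esub> x = \<one>\<^bsub>wreath N\<^esub>"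
    using wreath_inv_left[OF x] wreath_inv_closed[OF x] by (force simp: wreath_def)
qed (use wreath_one wreath_mult_closed in \<open>auto simp: wreath_def wreath_mult_def\<close>)

context
  fixes n :: "nat \<Rightarrow> nat"
  assumes n: "\<forall>k\<ge>1. n k > 1"
begin

lemma Nprod_pos: "Nprod n k > 0"
proof -
  have "0 < n i" if "i \<in> {1..k}" for i using n that by fastforce
  then show ?thesis unfolding Nprod_def by (intro prod_pos) blast
qed

lemma Nprod_dvd: "j \<le> k \<Longrightarrow> \<exists>M>0. Nprod n k = M * Nprod n j"
proof -
  assume jk: "j \<le> k"
  have "Nprod n j dvd Nprod n k"
    unfolding Nprod_def by (rule prod_dvd_prod_subset) (use jk in auto)
  then show ?thesis using Nprod_pos[of k] by (metis dvdE gr0I mult.commute mult_0_right nat_less_le)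
qed

abbreviation (input) emb :: "nat \<Rightarrow> wreath_elt \<Rightarrow> wreath_elt" where
  "emb k \<equiv> block_emb (Nprod n k) {1..}"

abbreviation (input) lev :: "nat \<Rightarrow> wreath_elt set" where
  "lev k \<equiv> carrier (wreath (Nprod n k))"

lemma level_mono: "j \<le> k \<Longrightarrow> emb j ` lev j \<subseteq> emb k ` lev k"
proof
  fix g assume jk: "j \<le> k" and g: "g \<in> emb j ` lev j"
  obtain M where M: "M > 0" "Nprod n k = M * Nprod n j" using Nprod_dvd jk by blast
  obtain h where h: "h \<in> lev j" "g = emb j h" using g by blast
  have "g = emb k (block_emb (Nprod n j) {1..M * Nprod n j} h)"
    using block_emb_block_emb[OF Nprod_pos M(1)] M h by simp
  then show "g \<in> emb k ` lev k"
    using block_emb_closed[OF Nprod_pos M(1) h(1)] M by auto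
qed

lemma limit_mult:
  assumes "g \<in> carrier (limit_group n)" "h \<in> carrier (limit_group n)"
  obtains k g' h' where "k \<ge> 1" "g' \<in> lev k" "h' \<in> lev k" "g = emb k g'" "h = emb k h'"
proof -
  obtain i j where ij: "i \<ge> 1" "j \<ge> 1" "g \<in> emb i ` lev i" "h \<in> emb j ` lev j"
    using assms by (auto simp: limit_group_def)
  have "g \<in> emb (max i j) ` lev (max i j)" "h \<in> emb (max i j) ` lev (max i j)"
    using level_mono[of i "max i j"] level_mono[of j "max i j"] ij by auto
  moreover have "max i j \<ge> 1" using ij by simp
  ultimately show ?thesis using that by blast
qed

lemma emb_in_limit: "k \<ge> 1 \<Longrightarrow> g \<in> lev k \<Longrightarrow> emb k g \<in> carrier (limit_group n)"
  by (auto simp: limit_group_def)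

lemma block_emb_hom_limit: "k \<ge> 1 \<Longrightarrow> emb k \<in> hom (wreath (Nprod n k)) (limit_group n)"
  using block_emb_wreath_mult[OF block_closed_atLeast[OF Nprod_pos]]
  by (intro homI) (auto intro: emb_in_limit simp: limit_group_def wreath_def)

lemma group_limit: "group (limit_group n)"
proof (rule groupI)
  note mult = block_emb_wreath_mult[OF block_closed_atLeast[OF Nprod_pos], symmetric]
  note one = block_emb_one[OF block_closed_atLeast[OF Nprod_pos]]
  fix x y assume xy: "x \<in> carrier (limit_group n)" "y \<in> carrier (limit_group n)"
  obtain k x' y' where k: "k \<ge> 1" "x' \<in> lev k" "y' \<in> lev k" "x = emb k x'" "y = emb k y'"
    using limit_mult[OF xy] .
  show "x \<otimes>\<^bsub>limit_group n\<^esub> y \<in> carrier (limit_group n)"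
    using mult k wreath_mult_closed emb_in_limit by (simp add: limit_group_def)
  have "bij (snd x)" "bij (snd y)"
    using k block_perm_bij[OF block_closed_atLeast[OF Nprod_pos]]
    by (auto simp: block_emb_def wreath_def)
  then show "x \<otimes>\<^bsub>limit_group n\<^esub> y \<otimes>\<^bsub>limit_group n\<^esub> z =
    x \<otimes>\<^bsub>limit_group n\<^esub> (y \<otimes>\<^bsub>limit_group n\<^esub> z)" for z
    using wreath_mult_assoc by (simp add: limit_group_def)
  have "emb k (wreath_inv x') \<in> carrier (limit_group n)"
    using emb_in_limit k wreath_inv_closed by blast
  moreover have "wreath_mult (emb k (wreath_inv x')) x = (\<lambda>_. 1, id)"
    using mult[OF wreath_inv_closed[OF k(2)] k(2)] wreath_inv_left[OF k(2)] one k(4) by simp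
  then have "emb k (wreath_inv x') \<otimes>\<^bsub>limit_group n\<^esub> x = \<one>\<^bsub>limit_group n\<^esub>"
    by (simp only: limit_group_def monoid.simps partial_object.simps)
  ultimately show "\<exists>y\<in>carrier (limit_group n). y \<otimes>\<^bsub>limit_group n\<^esub> x = \<one>\<^bsub>limit_group n\<^esub>"
    by blast
next
  have "emb 1 (\<lambda>_. 1, id) \<in> carrier (limit_group n)"
    using emb_in_limit wreath_one by blast
  then show "\<one>\<^bsub>limit_group n\<^esub> \<in> carrier (limit_group n)"
    using block_emb_one[OF block_closed_atLeast[OF Nprod_pos]] by (simp add: limit_group_def)
qed (auto simp: limit_group_def wreath_mult_def)

lemma topspace_wreath_top: "topspace (wreath_top N) = carrier (wreath N)"
  by (simp add: wreath_top_def wreath_def)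

lemma openin_limit_top:
  "openin (limit_top n) U \<longleftrightarrow> U \<subseteq> carrier (limit_group n) \<and>
     (\<forall>k\<ge>1. openin (wreath_top (Nprod n k)) {g \<in> lev k. emb k g \<in> U})"
proof -
  let ?P = "\<lambda>U. U \<subseteq> carrier (limit_group n) \<and>
     (\<forall>k\<ge>1. openin (wreath_top (Nprod n k)) {g \<in> lev k. emb k g \<in> U})"
  have "istopology ?P"
    unfolding istopology_def
  proof (intro conjI allI impI)
    fix S T k assume "?P S" "?P T" "k \<ge> (1::nat)"
    moreover have "{g \<in> lev k. emb k g \<in> S \<inter> T}
        = {g \<in> lev k. emb k g \<in> S} \<inter> {g \<in> lev k. emb k g \<in> T}" by auto
    ultimately show "openin (wreath_top (Nprod n k)) {g \<in> lev k. emb k g \<in> S \<inter> T}"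
      by auto
  next
    fix \<K> k assume *: "\<forall>S\<in>\<K>. ?P S" "k \<ge> (1::nat)"
    have "{g \<in> lev k. emb k g \<in> \<Union>\<K>} = (\<Union>S\<in>\<K>. {g \<in> lev k. emb k g \<in> S})" by auto
    then show "openin (wreath_top (Nprod n k)) {g \<in> lev k. emb k g \<in> \<Union>\<K>}"
      using * by auto
  qed blast+
  then show ?thesis unfolding limit_top_def by (simp add: topology_inverse')
qed

lemma topspace_limit_top: "topspace (limit_top n) = carrier (limit_group n)"
proof -
  have "{g \<in> lev k. emb k g \<in> carrier (limit_group n)} = topspace (wreath_top (Nprod n k))"
    if "k \<ge> 1" for k using that emb_in_limit by (auto simp: topspace_wreath_top)
  then have "openin (limit_top n) (carrier (limit_group n))"
    by (simp add: openin_limit_top)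
  then show ?thesis
    by (meson openin_limit_top openin_subset openin_topspace subset_antisym)
qed

lemma continuous_map_limit_top:
  "continuous_map (limit_top n) Y f \<longleftrightarrow>
     (\<forall>k\<ge>1. continuous_map (wreath_top (Nprod n k)) Y (f \<circ> emb k))"
proof -
  have "f \<in> carrier (limit_group n) \<rightarrow> topspace Y \<longleftrightarrow> (\<forall>k\<ge>1. f \<circ> emb k \<in> lev k \<rightarrow> topspace Y)"
    by (force simp: limit_group_def)
  moreover have "{g \<in> lev k. emb k g \<in> {x \<in> carrier (limit_group n). f x \<in> U}}
      = {g \<in> lev k. (f \<circ> emb k) g \<in> U}" if "k \<ge> 1" for k U
    using that emb_in_limit by auto
  ultimately show ?thesis
    unfolding continuous_map_def topspace_limit_top topspace_wreath_top openin_limit_top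
    by (auto simp del: mem_Collect_eq)
qed

lemma block_fun_average:
  assumes "N > 0" "M > 0"
  shows "(\<Sum>x=1..M * N. f (block_fun N {1..} u x)) / of_nat (M * N)
       = (\<Sum>x=1..N. f (u x)) / (of_nat N :: complex)"
proof -
  let ?h = "\<lambda>x. f (block_fun N {1..} u (Suc x))"
  have "(\<Sum>x=1..M * N. f (block_fun N {1..} u x)) = (\<Sum>x<M * N. ?h x)"
    by (simp add: sum.atLeast1_atMost_eq lessThan_atLeast0)
  also have "\<dots> = (\<Sum>q<M. sum ?h {q * N..<q * N + N})"
    by (simp add: sum.nat_group)
  also have "\<dots> = (\<Sum>q<M. \<Sum>x=1..N. f (u x))"
  proof (rule sum.cong, simp)
    fix q
    have "sum ?h {q * N..<q * N + N} = (\<Sum>r=0..<N. ?h (r + q * N))"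
      using sum.shift_bounds_nat_ivl[of ?h 0 "q * N" N] by (simp add: add.commute)
    also have "\<dots> = (\<Sum>r=0..<N. f (u (Suc r)))"
      by (rule sum.cong) (auto simp: block_fun_def)
    also have "\<dots> = (\<Sum>x=1..N. f (u x))"
      by (simp add: sum.atLeast1_atMost_eq lessThan_atLeast0)
    finally show "sum ?h {q * N..<q * N + N} = (\<Sum>x=1..N. f (u x))" .
  qed
  finally show ?thesis using assms by simp
qed

lemma phi_eq:
  assumes k: "k \<ge> 1" and u: "u \<in> torus_fun (Nprod n k)"
  shows "phi n M (block_fun (Nprod n k) {1..} u)
       = (\<Sum>x=1..Nprod n k. u x powi M) / of_nat (Nprod n k)"
proof -
  let ?t = "block_fun (Nprod n k) {1..} u"
  let ?P = "\<lambda>k. k \<ge> 1 \<and> ?t \<in> block_fun (Nprod n k) {1..} ` torus_fun (Nprod n k)"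
  define j where "j = (LEAST k. ?P k)"
  have Pk: "?P k" using k u by blast
  have "?P j" unfolding j_def using Pk by (rule LeastI)
  then obtain v where v: "v \<in> torus_fun (Nprod n j)" "?t = block_fun (Nprod n j) {1..} v" by blast
  have "j \<le> k" unfolding j_def using Pk by (rule Least_le)
  then obtain Q where Q: "Q > 0" "Nprod n k = Q * Nprod n j" using Nprod_dvd by blast
  have "phi n M ?t = (\<Sum>x=1..Nprod n j. ?t x powi M) / of_nat (Nprod n j)"
    by (simp add: phi_def j_def)
  also have "\<dots> = (\<Sum>x=1..Nprod n j. v x powi M) / of_nat (Nprod n j)"
    using block_fun_average[of "Nprod n j" 1 "\<lambda>z. z powi M" v] Nprod_pos v by simp
  also have "\<dots> = (\<Sum>x=1..Nprod n k. ?t x powi M) / of_nat (Nprod n k)"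
    using block_fun_average[OF Nprod_pos[of j] Q(1), of "\<lambda>z. z powi M" v] Q v by simp
  also have "\<dots> = (\<Sum>x=1..Nprod n k. u x powi M) / of_nat (Nprod n k)"
    using block_fun_average[of "Nprod n k" 1 "\<lambda>z. z powi M" u] Nprod_pos by simp
  finally show ?thesis .
qed

end

end

theory Submission
  imports Defs
begin

text \<open>
  The group is $G=\bigcup_k G_{N_k}$ and $K=\bigcup_k K_k$ with the finite groups $K_k=\mathfrak
  S_{N_k}$. Such a pair admits a description of spherical functions without representations: a
  normalized continuous positive definite $K$-biinvariant function $f$ is spherical iff \[
  \frac1{|K_k|}\sum_{s\in K_k} f(gsh)\to f(g)\,f(h)\qquad\text{for all } g,h\in G, \] which is
  the definition of \<open>spherical_kernel\<close> below. In one direction, the means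
  $P_kv=|K_k|^{-1}\sum_{s\in K_k}\rho(s)v$ are decreasing orthogonal projections and converge to
  the projection onto the invariant vectors; if these form a line, the limit of $P_k\rho(h)\eta$
  is $f(h)\eta$ (lemma \<open>matrix_coefficient_spherical_kernel\<close>). In the other
  direction, $f$ defines a Hilbert space of functions on $G$ with a cyclic vector $\eta$, and
  the limit relation says that $P_k\rho(h)\eta$ converges in norm to $f(h)\eta$; hence the
  invariant vectors are the multiples of $\eta$, and every nonzero closed invariant subspace
  contains $\eta$ (theorem \<open>kernel_in_spherical_functions\<close>).

  A product of power means $\phi_M$ satisfies the limit relation because a random permutation of
  a large set moves finitely many distinct points to nearly independent uniform points (lemmas
  \<open>average_permutations_approx\<close> and \<open>prod_mean_independent\<close>). So all
  these products are spherical.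

  For the converse, $f$ is determined by its restriction to the torus functions, and on the
  finite group of $m$-torsion elements of $\mathbb T^{N_k}$ it is a convex combination of the
  orbit averages of the characters $t\mapsto\prod_x t(x)^{l(x)}$. The limit relation with
  $h=g^{-1}$ says that the variance of this mixture tends to $0$, so a single orbit average
  approximates $f$ (lemma \<open>orbit_approximation\<close>). Now $f$ is near $1$ on functions
  $t$ near $1$ that take only one value $z\ne1$, namely on one point in each block of length
  $N_1$. Pairing points where $t=z$ with points where $t=1$ and swapping the pairs at random
  shows that the orbit average of $l$ can be large at such $t$ only if most of the numbers
  $z^{l(x)}$ nearly agree (lemma \<open>large_average_imp_nearly_constant\<close>). Averaging
  over $z$ in an arc shows that $l(x)$ is congruent mod $m$ to one residue $c$ for all $x$ but a
  number of exceptions that depends on neither $m$ nor $k$ (lemma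
  \<open>model_on_torsion\<close>). Therefore $f$ is, on the $m$-torsion, a power of $\prod_x
  t(x)$ times a product of power means $\phi_a$ whose number is bounded. Continuity bounds the
  exponents $a$ too, so one list of exponents serves infinitely many $m$ and all levels. The
  power of $\prod_x t(x)$ is trivial, because its exponent is bounded on every level but
  divisible by the quotients $N_k/N_j$ when it comes from level $k$ (lemma
  \<open>product_of_power_means_on_torsion\<close>). Torsion elements are dense, so $f$ is a
  product of power means everywhere.

  Finally the exponents can be recovered from the product: at the function on $\{1,\ldots,N_k\}$
  with value $z$ at one point and $1$ elsewhere it equals $\prod_i(1+(z^{M_i}-1)/N_k)$, whence
  $\sum_i(z^{M_i}-1)$ by letting $k\to\infty$, and the multiplicities of the nonzero exponents
  are Fourier coefficients of this sum.
\<close>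

section \<open>Means over growing finite subgroups\<close>

context complex_inner_space
begin

lemma minus_closed [simp]: "x \<in> carrier H \<Longrightarrow> y \<in> carrier H \<Longrightarrow> x \<ominus> y \<in> carrier H"
  by (rule M.minus_closed)

lemma cinner_diff_left:
  assumes "x \<in> carrier H" "y \<in> carrier H" "z \<in> carrier H"
  shows "cinner H (x \<ominus> y) z = cinner H x z - cinner H y z"
proof -
  have "(- 1) \<odot> y \<in> carrier H" using assms by (simp add: smult_closed)
  then show ?thesis
    using assms by (simp add: a_minus_def minus_eq_smult cinner_add_left cinner_smult_left)
qed

lemma cinner_diff_right:
  assumes "x \<in> carrier H" "y \<in> carrier H" "z \<in> carrier H"
  shows "cinner H z (x \<ominus> y) = cinner H z x - cinner H z y"
proof -
  have "cinner H z (x \<ominus> y) = cnj (cinner H (x \<ominus> y) z)" using assms by (intro cinner_commute) auto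
  also have "\<dots> = cnj (cinner H x z) - cnj (cinner H y z)" using assms by (simp add: cinner_diff_left)
  finally show ?thesis
    unfolding cinner_commute[OF assms(3,1), symmetric] cinner_commute[OF assms(3,2), symmetric] .
qed

lemma cinner_self: "x \<in> carrier H \<Longrightarrow> cinner H x x = of_real (Re (cinner H x x))"
  using cinner_self_real[of x] by (simp add: complex_eq_iff)

lemma cinner_ext:
  assumes x: "x \<in> carrier H" and y: "y \<in> carrier H"
    and eq: "\<And>w. w \<in> carrier H \<Longrightarrow> cinner H x w = cinner H y w"
  shows "x = y"
proof -
  have "cinner H (x \<ominus> y) (x \<ominus> y) = 0"
    using x y eq by (simp add: cinner_diff_left)
  then have "x \<ominus> y = \<zero>" using x y by (intro cinner_definite) auto
  then have "hdist H x y = 0" using x y by (simp add: hdist_def)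
  then show ?thesis using Metric_space.zero[OF Metric_space_hdist x y] by simp
qed

text \<open>
  The version for the real part, applied after rotating \<open>x\<close> so that the inner
  product becomes nonnegative.
\<close>

lemma Cauchy_Schwarz:
  assumes x: "x \<in> carrier H" and y: "y \<in> carrier H"
  shows "(cmod (cinner H x y))\<^sup>2 \<le> Re (cinner H x x) * Re (cinner H y y)"
proof -
  let ?z = "cinner H x y"
  define a where "a = (if ?z = 0 then 1 else cnj ?z / of_real (cmod ?z))"
  have a: "a * cnj a = 1" "a * ?z = of_real (cmod ?z)"
  proof -
    have zz: "?z * cnj ?z = of_real (cmod ?z) * of_real (cmod ?z)"
      using complex_norm_square[of ?z] by (simp add: power2_eq_square)
    then show "a * ?z = of_real (cmod ?z)" by (simp add: a_def mult.commute)
    show "a * cnj a = 1" using zz by (simp add: a_def mult.commute)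
  qed
  have ax: "a \<odot> x \<in> carrier H" using x by (simp add: smult_closed)
  have "cinner H (a \<odot> x) y = of_real (cmod ?z)" using x y a by (simp add: cinner_smult_left)
  moreover have "cinner H (a \<odot> x) (a \<odot> x) = cinner H x x"
  proof -
    have "cinner H (a \<odot> x) (a \<odot> x) = (a * cnj a) * cinner H x x"
      using x ax by (simp add: cinner_smult_left cinner_smult_right)
    then show ?thesis using a(1) by simp
  qed
  ultimately show ?thesis using Cauchy_Schwarz_Re[OF ax y] by simp
qed

lemma cmod_cinner_diff_le:
  assumes "x \<in> carrier H" "y \<in> carrier H" "w \<in> carrier H"
  shows "cmod (cinner H x w - cinner H y w) \<le> hdist H x y * sqrt (Re (cinner H w w))"
proof -
  have "(cmod (cinner H (x \<ominus> y) w))\<^sup>2 \<le> Re (cinner H (x \<ominus> y) (x \<ominus> y)) * Re (cinner H w w)"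
    using assms by (intro Cauchy_Schwarz) auto
  then have "cmod (cinner H (x \<ominus> y) w) \<le> sqrt (Re (cinner H (x \<ominus> y) (x \<ominus> y)) * Re (cinner H w w))"
    by (rule real_le_rsqrt)
  then show ?thesis using assms by (simp add: hdist_def cinner_diff_left real_sqrt_mult)
qed

lemma cinner_finsum_left:
  assumes "finite S" "f \<in> S \<rightarrow> carrier H" "w \<in> carrier H"
  shows "cinner H (finsum H f S) w = (\<Sum>s\<in>S. cinner H (f s) w)"
  using assms
proof (induction S rule: finite_induct)
  case (insert x S)
  then have "f \<in> S \<rightarrow> carrier H" "f x \<in> carrier H" by auto
  then show ?case using insert by (simp add: M.finsum_insert M.finsum_closed cinner_add_left)
qed simp

lemma continuous_map_cinner:
  assumes w: "w \<in> carrier H"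
  shows "continuous_map (hilbert_topology H) euclidean (\<lambda>v. cinner H v w)"
proof -
  interpret Metric_space "carrier H" "hdist H" by (rule Metric_space_hdist)
  have top: "topspace (hilbert_topology H) = carrier H" by (simp add: hilbert_topology_def)
  show ?thesis
    unfolding continuous_map_def top
  proof (intro conjI allI impI)
    fix U :: "complex set" assume "openin euclidean U"
    then have U: "open U" by simp
    show "openin (hilbert_topology H) {x \<in> carrier H. cinner H x w \<in> U}"
      unfolding hilbert_topology_def openin_mtopology
    proof (intro conjI allI impI)
      fix x assume x: "x \<in> {x \<in> carrier H. cinner H x w \<in> U}"
      then obtain e where e: "e > 0" "ball (cinner H x w) e \<subseteq> U" using U by (auto elim: openE)
      define C where "C = sqrt (Re (cinner H w w)) + 1"
      have C: "C > 0" "sqrt (Re (cinner H w w)) \<le> C"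
      proof -
        have "0 \<le> sqrt (Re (cinner H w w))" using cinner_nonneg[OF w] by simp
        then show "C > 0" unfolding C_def by linarith
      qed (simp add: C_def)
      have "mball x (e / C) \<subseteq> {x \<in> carrier H. cinner H x w \<in> U}"
      proof
        fix y assume "y \<in> mball x (e / C)"
        then have y: "y \<in> carrier H" "hdist H x y < e / C" by (auto simp: in_mball)
        have "cmod (cinner H x w - cinner H y w) \<le> hdist H x y * sqrt (Re (cinner H w w))"
          using x y w by (intro cmod_cinner_diff_le) auto
        also have "\<dots> \<le> hdist H x y * C" using C by (intro mult_left_mono) auto
        also have "\<dots> < e" using y(2) C(1) by (simp add: field_simps)
        finally have "cinner H y w \<in> U" using e(2) by (auto simp: dist_norm)
        then show "y \<in> {x \<in> carrier H. cinner H x w \<in> U}" using y by simp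
      qed
      then show "\<exists>r>0. mball x r \<subseteq> {x \<in> carrier H. cinner H x w \<in> U}"
        using e C by (intro exI[of _ "e / C"]) auto
    qed blast
  qed auto
qed

end

text \<open>
  The setting of the limit group: \<open>K\<close> may be infinite and far from compact, but it
  is exhausted by finite subgroups, over which one can average.
\<close>

locale exhausted_pair = group G for G :: "'g monoid" (structure) +
  fixes T :: "'g topology" and K :: "'g set" and Ks :: "nat \<Rightarrow> 'g set"
  assumes topspace: "topspace T = carrier G"
    and subgroup_Ks: "subgroup (Ks k) G"
    and finite_Ks: "finite (Ks k)"
    and mono_Ks: "j \<le> k \<Longrightarrow> Ks j \<subseteq> Ks k"
    and K_eq: "K = (\<Union>k. Ks k)"
begin

lemma Ks_carrier: "s \<in> Ks k \<Longrightarrow> s \<in> carrier G"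
  using subgroup.subset[OF subgroup_Ks] by blast

lemma Ks_card: "card (Ks k) > 0"
  using subgroup.one_closed[OF subgroup_Ks, of k] finite_Ks[of k] by (auto simp: card_gt_0_iff)

lemma sum_Ks_mult_left:
  assumes s: "s \<in> Ks k"
  shows "(\<Sum>r\<in>Ks k. f (s \<otimes> r)) = (\<Sum>r\<in>Ks k. f r)"
proof -
  have sG: "s \<in> carrier G" using s by (rule Ks_carrier)
  have i: "inv s \<in> Ks k" using s by (rule subgroup.m_inv_closed[OF subgroup_Ks])
  show ?thesis
  proof (rule sum.reindex_bij_witness[where i = "\<lambda>r. inv s \<otimes> r" and j = "\<lambda>r. s \<otimes> r"])
    fix r assume r: "r \<in> Ks k"
    then have rG: "r \<in> carrier G" by (rule Ks_carrier)
    show "inv s \<otimes> (s \<otimes> r) = r" "s \<otimes> (inv s \<otimes> r) = r"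
      using sG rG m_assoc[of "inv s" s r] m_assoc[of s "inv s" r] by simp_all
    show "s \<otimes> r \<in> Ks k" "inv s \<otimes> r \<in> Ks k"
      using s i r by (simp_all add: subgroup.m_closed[OF subgroup_Ks])
  qed simp
qed

text \<open>
  Positive definiteness is expressed on lists of pairs (coefficient, group element), in which
  elements may be repeated; addition of finite combinations is then just concatenation of lists.
  The last condition replaces the classical functional equation, in which one integrates over a
  compact group \<open>K\<close>. Two-sided translates in the continuity condition make up for
  the fact that multiplication is not assumed to be continuous for \<open>T\<close>.
\<close>

definition spherical_kernel :: "('g \<Rightarrow> complex) \<Rightarrow> bool" where
  "spherical_kernel f \<longleftrightarrow> f \<one> = 1 \<and>
    (\<forall>xs. snd ` set xs \<subseteq> carrier G \<longrightarrow>
       (\<Sum>(c, g)\<leftarrow>xs. \<Sum>(d, h)\<leftarrow>xs. c * cnj d * f (inv h \<otimes> g)) \<in> \<real> \<and>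
       0 \<le> Re (\<Sum>(c, g)\<leftarrow>xs. \<Sum>(d, h)\<leftarrow>xs. c * cnj d * f (inv h \<otimes> g))) \<and>
    (\<forall>a\<in>carrier G. \<forall>b\<in>carrier G. continuous_map T euclidean (\<lambda>g. f (a \<otimes> g \<otimes> b))) \<and>
    (\<forall>g\<in>carrier G. \<forall>s\<in>K. f (s \<otimes> g) = f g \<and> f (g \<otimes> s) = f g) \<and>
    (\<forall>g\<in>carrier G. \<forall>h\<in>carrier G.
       (\<lambda>k. (\<Sum>s\<in>Ks k. f (g \<otimes> s \<otimes> h)) / of_nat (card (Ks k))) \<longlonglongrightarrow> f g * f h)"

end

locale exhausted_rep = exhausted_pair G T K Ks + unitary_rep G T H \<rho>
  for G :: "'g monoid" (structure) and T K Ks and H :: "'h hilbert" and \<rho>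
begin

lemma rep_closed [simp]: "g \<in> carrier G \<Longrightarrow> v \<in> carrier H \<Longrightarrow> \<rho> g v \<in> carrier H"
  by (rule element_image) auto

lemma rep_mult: "g \<in> carrier G \<Longrightarrow> h \<in> carrier G \<Longrightarrow> v \<in> carrier H \<Longrightarrow> \<rho> (g \<otimes> h) v = \<rho> g (\<rho> h v)"
  by (rule composition_rule)

lemma rep_one: "v \<in> carrier H \<Longrightarrow> \<rho> \<one> v = v"
  using id_eq_one by (metis restrict_apply')

lemma rep_adjoint:
  assumes "g \<in> carrier G" "v \<in> carrier H" "w \<in> carrier H"
  shows "cinner H (\<rho> g v) w = cinner H v (\<rho> (inv g) w)"
proof -
  have "cinner H (\<rho> g v) w = cinner H (\<rho> g v) (\<rho> g (\<rho> (inv g) w))"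
    using assms by (simp add: rep_mult[symmetric] rep_one)
  then show ?thesis using assms by (simp add: rep_cinner)
qed

definition mean :: "nat \<Rightarrow> 'h \<Rightarrow> 'h" where
  "mean k v = (1 / of_nat (card (Ks k))) \<odot>\<^bsub>H\<^esub> finsum H (\<lambda>s. \<rho> s v) (Ks k)"

lemma mean_closed [simp]: "v \<in> carrier H \<Longrightarrow> mean k v \<in> carrier H"
  unfolding mean_def using Ks_carrier by (intro smult_closed M.finsum_closed) auto

lemma cinner_mean:
  assumes "v \<in> carrier H" "w \<in> carrier H"
  shows "cinner H (mean k v) w = (\<Sum>s\<in>Ks k. cinner H (\<rho> s v) w) / of_nat (card (Ks k))"
proof -
  have *: "(\<lambda>s. \<rho> s v) \<in> Ks k \<rightarrow> carrier H" using assms Ks_carrier by auto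
  show ?thesis
    unfolding mean_def
    using assms cinner_smult_left[OF M.finsum_closed[OF *] assms(2)] cinner_finsum_left[OF finite_Ks * assms(2)]
    by simp
qed

text \<open>
  Together with \<open>cinner_mean_fixed\<close>, this says that \<open>mean k\<close> is the
  orthogonal projection onto the vectors fixed by \<open>Ks k\<close>.
\<close>

lemma mean_fixed:
  assumes s: "s \<in> Ks k" and v: "v \<in> carrier H"
  shows "\<rho> s (mean k v) = mean k v"
proof (rule cinner_ext)
  note sG = Ks_carrier[OF s]
  fix w assume w: "w \<in> carrier H"
  have "cinner H (\<rho> s (mean k v)) w = (\<Sum>r\<in>Ks k. cinner H (\<rho> r v) (\<rho> (inv s) w)) / of_nat (card (Ks k))"
    using sG v w by (simp add: rep_adjoint cinner_mean)
  also have "(\<Sum>r\<in>Ks k. cinner H (\<rho> r v) (\<rho> (inv s) w)) = (\<Sum>r\<in>Ks k. cinner H (\<rho> (s \<otimes> r) v) w)"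
    using sG v w Ks_carrier by (intro sum.cong refl) (simp add: rep_adjoint rep_mult)
  also have "\<dots> = (\<Sum>r\<in>Ks k. cinner H (\<rho> r v) w)" by (rule sum_Ks_mult_left[OF s])
  finally show "cinner H (\<rho> s (mean k v)) w = cinner H (mean k v) w"
    using v w by (simp add: cinner_mean)
qed (use Ks_carrier[OF s] v in auto)

lemma cinner_mean_fixed:
  assumes v: "v \<in> carrier H" and u: "u \<in> carrier H" "\<And>s. s \<in> Ks k \<Longrightarrow> \<rho> s u = u"
  shows "cinner H (mean k v) u = cinner H v u"
proof -
  have "(\<Sum>s\<in>Ks k. cinner H (\<rho> s v) u) = (\<Sum>s\<in>Ks k. cinner H v u)"
  proof (rule sum.cong[OF refl])
    fix s assume s: "s \<in> Ks k"
    then have "cinner H (\<rho> s v) u = cinner H (\<rho> s v) (\<rho> s u)" using u by simp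
    also have "\<dots> = cinner H v u" using Ks_carrier[OF s] v u(1) by (rule rep_cinner)
    finally show "cinner H (\<rho> s v) u = cinner H v u" .
  qed
  then show ?thesis using v u Ks_card[of k] by (simp add: cinner_mean)
qed

text \<open>
  The projections decrease with \<open>k\<close>, since the groups \<open>Ks k\<close> increase.
  So the squared lengths of the means decrease, the means form a Cauchy sequence, and the limit
  is fixed by every \<open>Ks k\<close>.
\<close>

lemma mean_converges:
  assumes v: "v \<in> carrier H"
  obtains u where "u \<in> fixed_space H \<rho> K"
    "\<And>w. w \<in> carrier H \<Longrightarrow> (\<lambda>k. cinner H (mean k v) w) \<longlonglongrightarrow> cinner H u w"
proof -
  interpret MS: Metric_space "carrier H" "hdist H" by (rule Metric_space_hdist)
  define q where "q k = Re (cinner H (mean k v) (mean k v))" for k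
  have cross: "cinner H (mean j v) (mean k v) = of_real (q k)" if "j \<le> k" for j k
  proof -
    have fix1: "\<rho> s (mean k v) = mean k v" if "s \<in> Ks j" for s
      using that mean_fixed[of s k v] mono_Ks[OF \<open>j \<le> k\<close>] v by blast
    have "cinner H (mean j v) (mean k v) = cinner H v (mean k v)"
      using v fix1 by (intro cinner_mean_fixed) auto
    also have "\<dots> = cinner H (mean k v) (mean k v)"
      using v mean_fixed by (intro cinner_mean_fixed[symmetric]) auto
    finally show ?thesis using cinner_self[of "mean k v"] v by (simp add: q_def)
  qed
  \<comment> \<open>Pythagoras for nested projections.\<close>
  have dist: "(hdist H (mean j v) (mean k v))\<^sup>2 = q j - q k" if "j \<le> k" for j k
  proof -
    have "cinner H (mean j v \<ominus>\<^bsub>H\<^esub> mean k v) (mean j v \<ominus>\<^bsub>H\<^esub> mean k v) = of_real (q j) - of_real (q k)"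
      using v cross[OF that] cross[OF order_refl, of j] cross[OF order_refl, of k]
        cinner_commute[of "mean k v" "mean j v"]
      by (simp add: cinner_diff_left cinner_diff_right)
    moreover have "0 \<le> Re (cinner H (mean j v \<ominus>\<^bsub>H\<^esub> mean k v) (mean j v \<ominus>\<^bsub>H\<^esub> mean k v))"
      using v by (intro cinner_nonneg) auto
    ultimately show ?thesis using v by (simp add: hdist_def)
  qed
  have "decseq q"
    unfolding decseq_def by (metis dist diff_ge_0_iff_ge zero_le_power2)
  moreover have "0 \<le> q k" for k using v by (simp add: q_def cinner_nonneg)
  ultimately have "convergent q" using decseq_convergent[of q 0] by (metis convergentI)
  then have "Cauchy q" by (rule convergent_Cauchy)
  have "MS.MCauchy (\<lambda>k. mean k v)"
    unfolding MS.MCauchy_def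
  proof (intro conjI allI impI)
    show "range (\<lambda>k. mean k v) \<subseteq> carrier H" using v by auto
    fix e :: real assume e: "e > 0"
    then obtain N where N: "\<And>i j. i \<ge> N \<Longrightarrow> j \<ge> N \<Longrightarrow> norm (q i - q j) < e\<^sup>2"
      using CauchyD[OF \<open>Cauchy q\<close>, of "e\<^sup>2"] by auto
    have close: "hdist H (mean i v) (mean j v) < e" if "i \<ge> N" "j \<ge> N" "i \<le> j" for i j
    proof -
      have "(hdist H (mean i v) (mean j v))\<^sup>2 < e\<^sup>2" using dist[OF that(3)] N[OF that(1,2)] by simp
      then show ?thesis using e by (rule power_less_imp_less_base[OF _ less_imp_le])
    qed
    have "hdist H (mean i v) (mean j v) < e" if "N \<le> i" "N \<le> j" for i j
      using close[of i j] close[of j i] that MS.commute by (cases "i \<le> j") auto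
    then show "\<exists>N. \<forall>n n'. N \<le> n \<longrightarrow> N \<le> n' \<longrightarrow> hdist H (mean n v) (mean n' v) < e" by blast
  qed
  then obtain u where u: "limitin MS.mtopology (\<lambda>k. mean k v) u sequentially"
    using complete unfolding MS.mcomplete_def by blast
  then have uH: "u \<in> carrier H" and lim: "(\<lambda>k. hdist H (mean k v) u) \<longlonglongrightarrow> 0"
    using v unfolding MS.limit_metric_sequentially by (auto intro!: LIMSEQ_I) 
  have weak: "(\<lambda>k. cinner H (mean k v) w) \<longlonglongrightarrow> cinner H u w" if w: "w \<in> carrier H" for w
  proof -
    have "(\<lambda>k. cinner H (mean k v) w - cinner H u w) \<longlonglongrightarrow> 0"
    proof (rule Lim_null_comparison)
      show "\<forall>\<^sub>F k in sequentially. norm (cinner H (mean k v) w - cinner H u w)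
          \<le> hdist H (mean k v) u * sqrt (Re (cinner H w w))"
        using v uH w by (intro always_eventually allI cmod_cinner_diff_le) auto
      show "(\<lambda>k. hdist H (mean k v) u * sqrt (Re (cinner H w w))) \<longlonglongrightarrow> 0"
        using tendsto_mult_left_zero[OF lim] by simp
    qed
    then show ?thesis by (simp add: LIM_zero_iff)
  qed
  have "\<rho> s u = u" if sK: "s \<in> K" for s
  proof (rule cinner_ext)
    obtain k0 where k0: "s \<in> Ks k0" using sK K_eq by blast
    then have s: "s \<in> carrier G" by (rule Ks_carrier)
    then show "\<rho> s u \<in> carrier H" using uH by simp
    fix w assume w: "w \<in> carrier H"
    have "(\<lambda>k. cinner H (mean k v) (\<rho> (inv s) w)) \<longlonglongrightarrow> cinner H u (\<rho> (inv s) w)"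
      using s w by (intro weak) auto
    moreover have "\<forall>\<^sub>F k in sequentially. cinner H (mean k v) (\<rho> (inv s) w) = cinner H (mean k v) w"
      using eventually_ge_at_top[of k0]
    proof eventually_elim
      case (elim k)
      then have "s \<in> Ks k" using mono_Ks k0 by blast
      then show ?case using mean_fixed[of s k v] rep_adjoint[OF s _ w, of "mean k v"] v by simp
    qed
    ultimately have "(\<lambda>k. cinner H (mean k v) w) \<longlonglongrightarrow> cinner H u (\<rho> (inv s) w)"
      by (rule Lim_transform_eventually)
    then have "cinner H u (\<rho> (inv s) w) = cinner H u w" using weak[OF w] LIMSEQ_unique by blast
    then show "cinner H (\<rho> s u) w = cinner H u w" using rep_adjoint[OF s uH w] by simp
  qed (rule uH)
  then show ?thesis using that uH weak unfolding fixed_space_def by blast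
qed

text \<open>
  The only condition that needs an argument is the limit relation. The means of \<open>\<rho> h
  \<eta>\<close> converge to an invariant vector, which is a multiple of \<open>\<eta>\<close>;
  pairing with \<open>\<eta>\<close>, which the means do not change, identifies the factor as
  \<open>f h\<close>.
\<close>

lemma matrix_coefficient_spherical_kernel:
  assumes one: "one_dimensional H (fixed_space H \<rho> K)"
    and \<eta>: "\<eta> \<in> fixed_space H \<rho> K" "cinner H \<eta> \<eta> = 1"
  shows "spherical_kernel (\<lambda>g. cinner H (\<rho> g \<eta>) \<eta>)"
proof -
  have \<eta>H: "\<eta> \<in> carrier H" and fix1: "\<And>s. s \<in> K \<Longrightarrow> \<rho> s \<eta> = \<eta>"
    using \<eta> by (auto simp: fixed_space_def)
  have KG: "s \<in> carrier G" if "s \<in> K" for s using that K_eq Ks_carrier by auto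
  have span: "u = cinner H u \<eta> \<odot>\<^bsub>H\<^esub> \<eta>" if u: "u \<in> fixed_space H \<rho> K" for u
  proof -
    obtain e where e: "e \<in> fixed_space H \<rho> K" "fixed_space H \<rho> K = {a \<odot>\<^bsub>H\<^esub> e |a. True}"
      using one unfolding one_dimensional_def by blast
    have eH: "e \<in> carrier H" using e(1) by (simp add: fixed_space_def)
    obtain b where b: "\<eta> = b \<odot>\<^bsub>H\<^esub> e" using \<eta>(1) e(2) by blast
    obtain a where a: "u = a \<odot>\<^bsub>H\<^esub> e" using u e(2) by blast
    have b0: "b \<noteq> 0" using \<eta>(2) b eH smult_closed[of b e] by (auto simp: cinner_smult_left)
    have "(a / b) \<odot>\<^bsub>H\<^esub> \<eta> = (a / b * b) \<odot>\<^bsub>H\<^esub> e"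
      unfolding b using smult_assoc1[of "a / b" b e] eH by simp
    then have ue: "u = (a / b) \<odot>\<^bsub>H\<^esub> \<eta>" using a b0 by simp
    then have "cinner H u \<eta> = a / b" using \<eta>H \<eta>(2) by (simp add: cinner_smult_left)
    then show ?thesis using ue by simp
  qed
  show ?thesis
    unfolding spherical_kernel_def
  proof (intro conjI allI ballI impI)
    show "cinner H (\<rho> \<one> \<eta>) \<eta> = 1" using \<eta>H \<eta>(2) by (simp add: rep_one)
  next
    fix xs :: "(complex \<times> 'g) list" assume xs: "snd ` set xs \<subseteq> carrier G"
    \<comment> \<open>The double sum is the squared length of this vector.\<close>
    define v where "v ys = foldr (\<lambda>(c, g) u. c \<odot>\<^bsub>H\<^esub> \<rho> g \<eta> \<oplus>\<^bsub>H\<^esub> u) ys \<zero>\<^bsub>H\<^esub>" for ys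
    have v: "v ys \<in> carrier H \<and> (\<forall>w\<in>carrier H. cinner H (v ys) w = (\<Sum>(c, g)\<leftarrow>ys. c * cinner H (\<rho> g \<eta>) w))"
      if "snd ` set ys \<subseteq> carrier G" for ys
      using that
    proof (induction ys)
      case (Cons y ys)
      obtain c g where y: "y = (c, g)" by fastforce
      have g: "g \<in> carrier G" using Cons.prems y by simp
      then have "c \<odot>\<^bsub>H\<^esub> \<rho> g \<eta> \<in> carrier H" using \<eta>H by (simp add: smult_closed)
      moreover have "v (y # ys) = c \<odot>\<^bsub>H\<^esub> \<rho> g \<eta> \<oplus>\<^bsub>H\<^esub> v ys" by (simp add: v_def y)
      ultimately show ?case using Cons g \<eta>H y by (simp add: cinner_add_left cinner_smult_left M.add.m_closed)
    qed (simp add: v_def)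
    let ?S = "\<Sum>(c, g)\<leftarrow>xs. \<Sum>(d, h)\<leftarrow>xs. c * cnj d * cinner H (\<rho> (inv h \<otimes> g) \<eta>) \<eta>"
    have vH: "v xs \<in> carrier H" using v[OF xs] by blast
    have right: "cinner H w (v xs) = (\<Sum>(d, h)\<leftarrow>xs. cnj d * cinner H w (\<rho> h \<eta>))" if w: "w \<in> carrier H" for w
    proof -
      have "cinner H w (v xs) = cnj (\<Sum>(d, h)\<leftarrow>xs. d * cinner H (\<rho> h \<eta>) w)"
        using v[OF xs] w cinner_commute[OF w vH] by simp
      also have "\<dots> = (\<Sum>(d, h)\<leftarrow>xs. cnj d * cnj (cinner H (\<rho> h \<eta>) w))"
        by (induction xs) auto
      also have "\<dots> = (\<Sum>(d, h)\<leftarrow>xs. cnj d * cinner H w (\<rho> h \<eta>))"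
        using xs w \<eta>H by (intro arg_cong[where f = sum_list] map_cong refl)
          (auto simp: image_subset_iff cinner_commute[of w] split: prod.split)
      finally show ?thesis .
    qed
    have "cinner H (v xs) (v xs) = (\<Sum>(c, g)\<leftarrow>xs. c * (\<Sum>(d, h)\<leftarrow>xs. cnj d * cinner H (\<rho> g \<eta>) (\<rho> h \<eta>)))"
    proof -
      have "cinner H (v xs) (v xs) = (\<Sum>(c, g)\<leftarrow>xs. c * cinner H (\<rho> g \<eta>) (v xs))"
        using v[OF xs] vH by blast
      also have "\<dots> = (\<Sum>(c, g)\<leftarrow>xs. c * (\<Sum>(d, h)\<leftarrow>xs. cnj d * cinner H (\<rho> g \<eta>) (\<rho> h \<eta>)))"
      proof (intro arg_cong[where f = sum_list] map_cong refl, clarify)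
        fix c g assume "(c, g) \<in> set xs"
        then have "g \<in> carrier G" using xs by force
        then show "c * cinner H (\<rho> g \<eta>) (v xs) = c * (\<Sum>(d, h)\<leftarrow>xs. cnj d * cinner H (\<rho> g \<eta>) (\<rho> h \<eta>))"
          using \<eta>H by (simp add: right)
      qed
      finally show ?thesis .
    qed
    also have "\<dots> = ?S"
    proof (intro arg_cong[where f = sum_list] map_cong refl, clarify)
      fix c g assume "(c, g) \<in> set xs"
      then have g: "g \<in> carrier G" using xs by force
      have "c * (\<Sum>(d, h)\<leftarrow>xs. cnj d * cinner H (\<rho> g \<eta>) (\<rho> h \<eta>))
          = (\<Sum>(d, h)\<leftarrow>xs. c * cnj d * cinner H (\<rho> g \<eta>) (\<rho> h \<eta>))"
        by (simp add: sum_list_const_mult[symmetric] case_prod_unfold mult.assoc)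
      also have "\<dots> = (\<Sum>(d, h)\<leftarrow>xs. c * cnj d * cinner H (\<rho> (inv h \<otimes> g) \<eta>) \<eta>)"
      proof (intro arg_cong[where f = sum_list] map_cong refl, clarify)
        fix d h assume "(d, h) \<in> set xs"
        then have h: "h \<in> carrier G" using xs by force
        then show "c * cnj d * cinner H (\<rho> g \<eta>) (\<rho> h \<eta>) = c * cnj d * cinner H (\<rho> (inv h \<otimes> g) \<eta>) \<eta>"
          using g \<eta>H by (simp add: rep_mult rep_adjoint[of "inv h"])
      qed
      finally show "c * (\<Sum>(d, h)\<leftarrow>xs. cnj d * cinner H (\<rho> g \<eta>) (\<rho> h \<eta>))
          = (\<Sum>(d, h)\<leftarrow>xs. c * cnj d * cinner H (\<rho> (inv h \<otimes> g) \<eta>) \<eta>)" .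
    qed
    finally have e: "cinner H (v xs) (v xs) = ?S" .
    then show "?S \<in> \<real>" "0 \<le> Re ?S"
      using cinner_nonneg[OF vH] cinner_self_real[OF vH] by (auto simp: complex_is_Real_iff)
  next
    fix a b assume ab: "a \<in> carrier G" "b \<in> carrier G"
    have "continuous_map T euclidean ((\<lambda>v. cinner H v (\<rho> (inv a) \<eta>)) \<circ> (\<lambda>g. \<rho> g (\<rho> b \<eta>)))"
      using ab \<eta>H by (intro continuous_map_compose[OF rep_continuous continuous_map_cinner]) auto
    then show "continuous_map T euclidean (\<lambda>g. cinner H (\<rho> (a \<otimes> g \<otimes> b) \<eta>) \<eta>)"
      by (rule continuous_map_eq) (use ab \<eta>H in \<open>simp add: topspace rep_mult rep_adjoint[of a]\<close>)
  next
    fix g s assume g: "g \<in> carrier G" and s: "s \<in> K"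
    show "cinner H (\<rho> (g \<otimes> s) \<eta>) \<eta> = cinner H (\<rho> g \<eta>) \<eta>"
      using g KG[OF s] \<eta>H fix1[OF s] by (simp add: rep_mult)
    have "cinner H (\<rho> (s \<otimes> g) \<eta>) \<eta> = cinner H (\<rho> s (\<rho> g \<eta>)) (\<rho> s \<eta>)"
      using g KG[OF s] \<eta>H fix1[OF s] by (simp add: rep_mult)
    then show "cinner H (\<rho> (s \<otimes> g) \<eta>) \<eta> = cinner H (\<rho> g \<eta>) \<eta>"
      using g KG[OF s] \<eta>H by (simp add: rep_cinner)
  next
    fix g h assume gh: "g \<in> carrier G" "h \<in> carrier G"
    obtain u where u: "u \<in> fixed_space H \<rho> K"
      "\<And>w. w \<in> carrier H \<Longrightarrow> (\<lambda>k. cinner H (mean k (\<rho> h \<eta>)) w) \<longlonglongrightarrow> cinner H u w"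
      using mean_converges[of "\<rho> h \<eta>"] gh \<eta>H by auto
    \<comment> \<open>Pairing with \<open>\<eta>\<close> determines the multiple.\<close>
    have "cinner H (mean k (\<rho> h \<eta>)) \<eta> = cinner H (\<rho> h \<eta>) \<eta>" for k
      using gh \<eta>H fix1 K_eq by (intro cinner_mean_fixed) auto
    then have "cinner H u \<eta> = cinner H (\<rho> h \<eta>) \<eta>"
      using u(2)[OF \<eta>H] by (simp add: LIMSEQ_const_iff)
    then have "u = cinner H (\<rho> h \<eta>) \<eta> \<odot>\<^bsub>H\<^esub> \<eta>" using span[OF u(1)] by simp
    then have lim: "cinner H u (\<rho> (inv g) \<eta>) = cinner H (\<rho> g \<eta>) \<eta> * cinner H (\<rho> h \<eta>) \<eta>"
      using gh \<eta>H by (simp add: cinner_smult_left rep_adjoint[of g])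
    have "cinner H (mean k (\<rho> h \<eta>)) (\<rho> (inv g) \<eta>)
       = (\<Sum>s\<in>Ks k. cinner H (\<rho> (g \<otimes> s \<otimes> h) \<eta>) \<eta>) / of_nat (card (Ks k))" for k
    proof -
      have "(\<Sum>s\<in>Ks k. cinner H (\<rho> s (\<rho> h \<eta>)) (\<rho> (inv g) \<eta>)) = (\<Sum>s\<in>Ks k. cinner H (\<rho> (g \<otimes> s \<otimes> h) \<eta>) \<eta>)"
        using gh \<eta>H Ks_carrier by (intro sum.cong refl) (simp add: rep_mult rep_adjoint[of g])
      then show ?thesis using gh \<eta>H by (simp add: cinner_mean)
    qed
    then show "(\<lambda>k. (\<Sum>s\<in>Ks k. cinner H (\<rho> (g \<otimes> s \<otimes> h) \<eta>) \<eta>) / of_nat (card (Ks k)))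
      \<longlonglongrightarrow> cinner H (\<rho> g \<eta>) \<eta> * cinner H (\<rho> h \<eta>) \<eta>"
      using u(2)[of "\<rho> (inv g) \<eta>"] gh \<eta>H unfolding lim by simp
  qed
qed

end

section \<open>The Hilbert space of a positive definite kernel\<close>

text \<open>
  The Hilbert space of the kernel $(g,h)\mapsto f(h^{-1}g)$ is realized by functions on the
  group. A vector \<open>v\<close> is represented by the function $g\mapsto\langle
  v,\rho(g)\eta\rangle$, where \<open>\<eta>\<close> is the cyclic vector with
  $f(g)=\langle\rho(g)\eta,\eta\rangle$.
\<close>

locale kernel_space = exhausted_pair G T K Ks
  for G :: "'g monoid" (structure) and T K Ks +
  fixes f :: "'g \<Rightarrow> complex"
  assumes kernel: "spherical_kernel f"
begin

definition valid :: "(complex \<times> 'g) list \<Rightarrow> bool" where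
  "valid xs \<longleftrightarrow> snd ` set xs \<subseteq> carrier G"

text \<open>
  The inner product of the vector \<open>F\<close> with the finite combination $\sum
  d\,\rho(h)\eta$ that the list encodes.
\<close>

definition pair :: "('g \<Rightarrow> complex) \<Rightarrow> (complex \<times> 'g) list \<Rightarrow> complex" where
  "pair F ys = (\<Sum>(d, h)\<leftarrow>ys. cnj d * F h)"

text \<open>
  The function that represents the finite combination $\sum c\,\rho(h)\eta$ encoded by the list.
  All functions of the model vanish outside the group, so that equality of functions is equality
  of vectors.
\<close>

definition comb :: "(complex \<times> 'g) list \<Rightarrow> 'g \<Rightarrow> complex" where
  "comb xs g = (if g \<in> carrier G then \<Sum>(c, h)\<leftarrow>xs. c * f (inv g \<otimes> h) else 0)"

definition scale :: "complex \<Rightarrow> (complex \<times> 'g) list \<Rightarrow> (complex \<times> 'g) list" where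
  "scale a xs = map (\<lambda>(c, h). (a * c, h)) xs"

definition translate :: "'g \<Rightarrow> (complex \<times> 'g) list \<Rightarrow> (complex \<times> 'g) list" where
  "translate a xs = map (\<lambda>(c, h). (c, a \<otimes> h)) xs"

text \<open>The squared length of the finite combination.\<close>

definition sq :: "(complex \<times> 'g) list \<Rightarrow> real" where
  "sq xs = Re (pair (comb xs) xs)"

lemma valid_simps [simp]:
  "valid []" "valid (p # xs) \<longleftrightarrow> snd p \<in> carrier G \<and> valid xs" "valid (xs @ ys) \<longleftrightarrow> valid xs \<and> valid ys"
  "valid (scale a xs) \<longleftrightarrow> valid xs"
  by (auto simp: valid_def scale_def image_image case_prod_unfold)

lemma valid_translate [simp]: "a \<in> carrier G \<Longrightarrow> valid xs \<Longrightarrow> valid (translate a xs)"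
  by (auto simp: valid_def translate_def)

lemma pair_simps [simp]:
  "pair F [] = 0" "pair F (p # ys) = cnj (fst p) * F (snd p) + pair F ys"
  "pair F (xs @ ys) = pair F xs + pair F ys" "pair F (scale a xs) = cnj a * pair F xs"
  by (auto simp: pair_def scale_def case_prod_unfold comp_def sum_list_const_mult mult.assoc)

lemma pair_fun_simps:
  "pair (\<lambda>g. F g + F' g) ys = pair F ys + pair F' ys" "pair (\<lambda>g. F g - F' g) ys = pair F ys - pair F' ys"
  "pair (\<lambda>g. a * F g) ys = a * pair F ys" "pair (\<lambda>_. 0) ys = 0"
  by (induction ys) (auto simp: algebra_simps)

lemma comb_simps [simp]:
  "comb [] = (\<lambda>_. 0)" "comb (xs @ ys) = (\<lambda>g. comb xs g + comb ys g)"
  "comb (scale a xs) = (\<lambda>g. a * comb xs g)"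
  by (auto simp: comb_def scale_def case_prod_unfold comp_def sum_list_const_mult mult.assoc fun_eq_iff)

lemma comb_Cons: "comb (p # xs) = (\<lambda>g. fst p * comb [(1, snd p)] g + comb xs g)"
  by (auto simp: comb_def fun_eq_iff case_prod_unfold)

lemma comb_out [simp]: "g \<notin> carrier G \<Longrightarrow> comb xs g = 0"
  by (simp add: comb_def)

lemma pair_comb:
  assumes "valid ys"
  shows "pair (comb xs) ys = (\<Sum>(c, g)\<leftarrow>xs. \<Sum>(d, h)\<leftarrow>ys. c * cnj d * f (inv h \<otimes> g))"
  using assms
proof (induction ys)
  case Nil
  then show ?case by (induction xs) auto
next
  case (Cons p ys)
  then have "comb xs (snd p) = (\<Sum>(c, g)\<leftarrow>xs. c * f (inv (snd p) \<otimes> g))" by (simp add: comb_def)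
  then have "cnj (fst p) * comb xs (snd p) = (\<Sum>(c, g)\<leftarrow>xs. c * cnj (fst p) * f (inv (snd p) \<otimes> g))"
    by (simp add: case_prod_unfold mult_ac flip: sum_list_const_mult)
  then show ?case using Cons by (simp add: case_prod_unfold sum_list_addf)
qed

lemma sq_nonneg: "valid xs \<Longrightarrow> 0 \<le> sq xs"
  and pair_comb_self: "valid xs \<Longrightarrow> pair (comb xs) xs = of_real (sq xs)"
proof -
  assume v: "valid xs"
  then have "pair (comb xs) xs \<in> \<real> \<and> 0 \<le> Re (pair (comb xs) xs)"
    using kernel unfolding pair_comb[OF v] spherical_kernel_def valid_def by blast
  then show "0 \<le> sq xs" "pair (comb xs) xs = of_real (sq xs)"
    by (auto simp: sq_def complex_is_Real_iff complex_eq_iff)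
qed

lemma f_one: "f \<one> = 1"
  using kernel by (simp add: spherical_kernel_def)

text \<open>
  Positivity makes the quadratic form of \<open>[(1, \<one>), (a, g)]\<close> real for every
  coefficient \<open>a\<close>.
\<close>

lemma f_inv: assumes g: "g \<in> carrier G" shows "f (inv g) = cnj (f g)"
proof -
  have "pair (comb [(1, \<one>), (a, g)]) [(1, \<one>), (a, g)] \<in> \<real>" for a
    using pair_comb_self[of "[(1, \<one>), (a, g)]"] g by simp
  moreover have "pair (comb [(1, \<one>), (a, g)]) [(1, \<one>), (a, g)] = 1 + a * f g + (cnj a * f (inv g) + cnj a * a)" for a
    using g f_one by (simp add: comb_def algebra_simps)
  ultimately have *: "Im (1 + a * f g + (cnj a * f (inv g) + cnj a * a)) = 0" for a
    by (metis complex_is_Real_iff)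
  \<comment> \<open>The coefficient 1 compares imaginary parts, the coefficient \<open>\<i>\<close> real parts.\<close>
  from *[of 1] *[of \<i>] show ?thesis by (simp add: complex_eq_iff)
qed

lemma pair_comb_commute:
  assumes "valid xs" "valid ys"
  shows "pair (comb xs) ys = cnj (pair (comb ys) xs)"
  using assms(1)
proof (induction xs)
  case (Cons p xs)
  then have p: "snd p \<in> carrier G" by simp
  have "pair (comb [(1, snd p)]) ys = cnj (comb ys (snd p))"
    using assms(2)
  proof (induction ys)
    case (Cons r ys)
    then have r: "snd r \<in> carrier G" by simp
    have "inv (inv (snd r) \<otimes> snd p) = inv (snd p) \<otimes> snd r" using p r by (simp add: inv_mult_group)
    then have "f (inv (snd r) \<otimes> snd p) = cnj (f (inv (snd p) \<otimes> snd r))"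
      using f_inv[of "inv (snd p) \<otimes> snd r"] p r by (simp add: inv_mult_group)
    then show ?case using Cons p r by (simp add: comb_def case_prod_unfold)
  qed (simp add: comb_def)
  then show ?case using Cons by (simp add: comb_Cons[of p xs] pair_fun_simps)
qed (simp add: pair_fun_simps)

lemma sq_append_scale:
  assumes "valid xs" "valid ys"
  shows "sq (xs @ scale a ys) = sq xs + 2 * Re (cnj a * pair (comb xs) ys) + (cmod a)\<^sup>2 * sq ys"
proof -
  have "pair (comb (xs @ scale a ys)) (xs @ scale a ys)
    = pair (comb xs) xs + cnj a * pair (comb xs) ys + (a * pair (comb ys) xs + a * cnj a * pair (comb ys) ys)"
    by (simp add: pair_fun_simps algebra_simps)
  moreover have "a * pair (comb ys) xs = cnj (cnj a * pair (comb xs) ys)"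
    using pair_comb_commute[OF assms(2,1)] by simp
  moreover have "a * cnj a * pair (comb ys) ys = of_real ((cmod a)\<^sup>2 * sq ys)"
    using pair_comb_self[OF assms(2)] by (simp only: complex_norm_square of_real_mult)
  ultimately show ?thesis using pair_comb_self[OF assms(1)] by (simp add: sq_def[of "xs @ scale a ys"])
qed

text \<open>
  The form is only semidefinite at this point, so the quadratic polynomial in the scaling factor
  is treated separately when its leading coefficient vanishes.
\<close>

lemma kernel_Cauchy_Schwarz:
  assumes "valid xs" "valid ys"
  shows "cmod (pair (comb xs) ys) \<le> sqrt (sq xs) * sqrt (sq ys)"
proof -
  define z where "z = pair (comb xs) ys"
  have q: "0 \<le> sq xs - 2 * r * (cmod z)\<^sup>2 + r\<^sup>2 * (cmod z)\<^sup>2 * sq ys" for r :: real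
  proof -
    \<comment> \<open>The multiple of \<open>z\<close> makes the cross term real and leaves \<open>r\<close> free.\<close>
    let ?a = "- of_real r * z"
    have "cnj ?a * z = of_real (- r) * (z * cnj z)" by simp
    also have "\<dots> = of_real (- r * (cmod z)\<^sup>2)" by (simp only: of_real_mult complex_norm_square)
    finally have re: "Re (cnj ?a * z) = - r * (cmod z)\<^sup>2" by (simp only: Re_complex_of_real)
    have norm: "(cmod ?a)\<^sup>2 = r\<^sup>2 * (cmod z)\<^sup>2" by (simp add: norm_mult power_mult_distrib)
    have "0 \<le> sq (xs @ scale ?a ys)" using assms by (intro sq_nonneg) simp
    then show ?thesis unfolding sq_append_scale[OF assms] z_def[symmetric] re norm by linarith
  qed
  have "(cmod z)\<^sup>2 \<le> sq xs * sq ys"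
  proof (cases "sq ys = 0")
    case True
    show ?thesis
    proof (rule ccontr)
      assume "\<not> ?thesis"
      then have pos: "(cmod z)\<^sup>2 > 0" using True by simp
      \<comment> \<open>The expression is linear in \<open>r\<close>, and this \<open>r\<close> makes it equal to
        \<open>- 1\<close>.\<close>
      then show False using q[of "(sq xs + 1) / (2 * (cmod z)\<^sup>2)"] True by (simp add: field_simps)
    qed
  next
    case False
    then have pos: "sq ys > 0" using sq_nonneg[OF assms(2)] by simp
    have "0 \<le> sq ys * (sq xs - 2 * (1 / sq ys) * (cmod z)\<^sup>2 + (1 / sq ys)\<^sup>2 * (cmod z)\<^sup>2 * sq ys)"
      using mult_nonneg_nonneg[OF less_imp_le[OF pos] q[of "1 / sq ys"]] .
    also have "\<dots> = sq xs * sq ys - (cmod z)\<^sup>2" using pos by (simp add: power2_eq_square field_simps)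
    finally show ?thesis by simp
  qed
  then show ?thesis unfolding z_def by (metis real_le_rsqrt real_sqrt_mult)
qed

text \<open>
  \<open>C\<close> bounds the norm of \<open>F\<close> as a functional on finite combinations.
  The norm of a vector is thereby available before there is an inner product, and a pointwise
  limit of functions with a common bound satisfies the same bound, which yields completeness.
\<close>

definition bounded_by :: "('g \<Rightarrow> complex) \<Rightarrow> real \<Rightarrow> bool" where
  "bounded_by F C \<longleftrightarrow> 0 \<le> C \<and> (\<forall>ys. valid ys \<longrightarrow> cmod (pair F ys) \<le> C * sqrt (sq ys))"

lemma bounded_byD: "bounded_by F C \<Longrightarrow> valid ys \<Longrightarrow> cmod (pair F ys) \<le> C * sqrt (sq ys)"
  by (simp add: bounded_by_def)

lemma sqrt_sq_nonneg: "valid ys \<Longrightarrow> 0 \<le> sqrt (sq ys)"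
  using sq_nonneg by simp

lemma bounded_by_comb: "valid xs \<Longrightarrow> bounded_by (comb xs) (sqrt (sq xs))"
  unfolding bounded_by_def using kernel_Cauchy_Schwarz sqrt_sq_nonneg by blast

lemma bounded_by_add: "bounded_by F C \<Longrightarrow> bounded_by F' C' \<Longrightarrow> bounded_by (\<lambda>g. F g + F' g) (C + C')"
  unfolding bounded_by_def pair_fun_simps by (auto simp: algebra_simps intro: norm_triangle_mono)

lemma bounded_by_mult: "bounded_by F C \<Longrightarrow> bounded_by (\<lambda>g. a * F g) (cmod a * C)"
  unfolding bounded_by_def pair_fun_simps by (auto simp: norm_mult mult.assoc intro: mult_left_mono)

lemma bounded_by_commute: "bounded_by (\<lambda>g. F g - F' g) C \<Longrightarrow> bounded_by (\<lambda>g. F' g - F g) C"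
  using bounded_by_mult[of "\<lambda>g. F g - F' g" C "- 1"] by simp

lemma bounded_by_mono: "bounded_by F C \<Longrightarrow> C \<le> C' \<Longrightarrow> bounded_by F C'"
  unfolding bounded_by_def
proof (intro conjI allI impI)
  fix ys assume *: "0 \<le> C \<and> (\<forall>ys. valid ys \<longrightarrow> cmod (pair F ys) \<le> C * sqrt (sq ys))" "C \<le> C'" "valid ys"
  then have "cmod (pair F ys) \<le> C * sqrt (sq ys)" by blast
  also have "\<dots> \<le> C' * sqrt (sq ys)" using * sqrt_sq_nonneg by (intro mult_right_mono) auto
  finally show "cmod (pair F ys) \<le> C' * sqrt (sq ys)" .
qed auto

lemma bounded_by_trans: "bounded_by (\<lambda>g. F g - F' g) C \<Longrightarrow> bounded_by (\<lambda>g. F' g - F'' g) C' \<Longrightarrow> bounded_by (\<lambda>g. F g - F'' g) (C + C')"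
  using bounded_by_add[of "\<lambda>g. F g - F' g" C "\<lambda>g. F' g - F'' g" C'] by simp

lemma sqrt_sq_le: "valid xs \<Longrightarrow> bounded_by (comb xs) C \<Longrightarrow> sqrt (sq xs) \<le> C"
proof -
  assume v: "valid xs" and b: "bounded_by (comb xs) C"
  have "cmod (pair (comb xs) xs) = sq xs" using pair_comb_self[OF v] sq_nonneg[OF v] by simp
  then have "sqrt (sq xs) * sqrt (sq xs) \<le> C * sqrt (sq xs)" using bounded_byD[OF b v] sq_nonneg[OF v] by simp
  then show ?thesis using b sqrt_sq_nonneg[OF v] mult_right_le_imp_le[of "sqrt (sq xs)" "sqrt (sq xs)" C]
    unfolding bounded_by_def by (cases "sqrt (sq xs) = 0") auto
qed

lemma bounded_by_eval: "bounded_by F C \<Longrightarrow> g \<in> carrier G \<Longrightarrow> cmod (F g) \<le> C"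
  using bounded_byD[of F C "[(1, g)]"] f_one by (simp add: sq_def comb_def)

lemma bounded_by_zero: "bounded_by (\<lambda>_. 0) 0"
  by (simp add: bounded_by_def pair_fun_simps)

text \<open>
  The closure of the finite combinations; unlike an abstract completion it consists of
  functions.
\<close>

definition space :: "('g \<Rightarrow> complex) set" where
  "space = {F. (\<forall>g. g \<notin> carrier G \<longrightarrow> F g = 0) \<and>
     (\<forall>e>0. \<exists>ys. valid ys \<and> bounded_by (\<lambda>g. F g - comb ys g) e)}"

lemma spaceI:
  assumes "\<And>g. g \<notin> carrier G \<Longrightarrow> F g = 0" "\<And>e. e > 0 \<Longrightarrow> \<exists>ys. valid ys \<and> bounded_by (\<lambda>g. F g - comb ys g) e"
  shows "F \<in> space"
  using assms by (simp add: space_def)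

lemma space_out: "F \<in> space \<Longrightarrow> g \<notin> carrier G \<Longrightarrow> F g = 0"
  by (simp add: space_def)

lemma space_approx:
  assumes "F \<in> space" "e > 0"
  obtains ys where "valid ys" "bounded_by (\<lambda>g. F g - comb ys g) e"
  using assms unfolding space_def by blast

lemma comb_space [simp]: "valid xs \<Longrightarrow> comb xs \<in> space"
proof (rule spaceI)
  fix e :: real assume "valid xs" "e > 0"
  then show "\<exists>ys. valid ys \<and> bounded_by (\<lambda>g. comb xs g - comb ys g) e"
    using bounded_by_mono[OF bounded_by_zero, of e] by (intro exI[of _ xs]) simp
qed simp

lemma zero_space [simp]: "(\<lambda>_. 0) \<in> space"
  using comb_space[of "[]"] by simp

lemma add_space [simp]:
  assumes "F \<in> space" "F' \<in> space" shows "(\<lambda>g. F g + F' g) \<in> space"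
proof (rule spaceI)
  fix e :: real assume e: "e > 0"
  obtain ys where ys: "valid ys" "bounded_by (\<lambda>g. F g - comb ys g) (e / 2)"
    using space_approx[OF assms(1), of "e / 2"] e by auto
  obtain ys' where ys': "valid ys'" "bounded_by (\<lambda>g. F' g - comb ys' g) (e / 2)"
    using space_approx[OF assms(2), of "e / 2"] e by auto
  have "bounded_by (\<lambda>g. F g + F' g - comb (ys @ ys') g) e"
    using bounded_by_add[OF ys(2) ys'(2)] by (simp add: algebra_simps)
  then show "\<exists>ys. valid ys \<and> bounded_by (\<lambda>g. F g + F' g - comb ys g) e" using ys(1) ys'(1) valid_simps(3) by blast
qed (simp add: space_out[OF assms(1)] space_out[OF assms(2)])

lemma mult_space [simp]:
  assumes "F \<in> space" shows "(\<lambda>g. a * F g) \<in> space"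
proof (rule spaceI)
  fix e :: real assume e: "e > 0"
  have "e / (cmod a + 1) > 0" using e by (simp add: add_nonneg_pos)
  then obtain ys where ys: "valid ys" "bounded_by (\<lambda>g. F g - comb ys g) (e / (cmod a + 1))"
    using space_approx[OF assms] by blast
  have "cmod a * (e / (cmod a + 1)) \<le> e"
  proof -
    have "cmod a / (cmod a + 1) \<le> 1" by (simp add: divide_le_eq add_nonneg_pos)
    then have "e * (cmod a / (cmod a + 1)) \<le> e * 1" using e by (intro mult_left_mono) auto
    then show ?thesis by (simp add: mult.commute)
  qed
  then have "bounded_by (\<lambda>g. a * F g - comb (scale a ys) g) e"
    using bounded_by_mono[OF bounded_by_mult[OF ys(2), of a]] by (simp add: algebra_simps)
  then show "\<exists>ys. valid ys \<and> bounded_by (\<lambda>g. a * F g - comb ys g) e" using ys(1) valid_simps(4) by blast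
qed (simp add: space_out[OF assms])

lemma diff_space [simp]: "F \<in> space \<Longrightarrow> F' \<in> space \<Longrightarrow> (\<lambda>g. F g - F' g) \<in> space"
  using add_space[OF _ mult_space[of F' "- 1"]] by simp

lemma space_bounded:
  assumes "F \<in> space" obtains C where "bounded_by F C"
proof -
  obtain ys where ys: "valid ys" "bounded_by (\<lambda>g. F g - comb ys g) 1"
    using space_approx[OF assms, of 1] by auto
  have "bounded_by F (1 + sqrt (sq ys))" using bounded_by_add[OF ys(2) bounded_by_comb[OF ys(1)]] by simp
  then show ?thesis using that by blast
qed

lemma space_eqI:
  assumes "F \<in> space" "F' \<in> space" "\<And>e. e > 0 \<Longrightarrow> bounded_by (\<lambda>g. F g - F' g) e"
  shows "F = F'"
proof
  fix g show "F g = F' g"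
  proof (cases "g \<in> carrier G")
    case True
    have "cmod (F g - F' g) \<le> e" if "e > 0" for e using bounded_by_eval[OF assms(3)[OF that] True] .
    then have "cmod (F g - F' g) \<le> 0" by (meson dense_ge)
    then show ?thesis by simp
  qed (simp add: space_out[OF assms(1)] space_out[OF assms(2)])
qed

definition approx :: "('g \<Rightarrow> complex) \<Rightarrow> nat \<Rightarrow> (complex \<times> 'g) list" where
  "approx F i = (SOME ys. valid ys \<and> bounded_by (\<lambda>g. F g - comb ys g) (1 / real (Suc i)))"

lemma approx:
  assumes "F \<in> space"
  shows "valid (approx F i)" "bounded_by (\<lambda>g. F g - comb (approx F i) g) (1 / real (Suc i))"
proof -
  have "\<exists>ys. valid ys \<and> bounded_by (\<lambda>g. F g - comb ys g) (1 / real (Suc i))"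
    using assms unfolding space_def by simp
  from someI_ex[OF this] show "valid (approx F i)" "bounded_by (\<lambda>g. F g - comb (approx F i) g) (1 / real (Suc i))"
    unfolding approx_def by blast+
qed

text \<open>
  The pairing with finite combinations, extended by continuity in the second argument.
\<close>

definition ip :: "('g \<Rightarrow> complex) \<Rightarrow> ('g \<Rightarrow> complex) \<Rightarrow> complex" where
  "ip F F' = lim (\<lambda>i. pair F (approx F' i))"

lemma pair_close:
  assumes F: "bounded_by F C" and ys: "valid ys" "bounded_by (\<lambda>g. F' g - comb ys g) e" and zs: "valid zs" "bounded_by (\<lambda>g. F' g - comb zs g) e'"
  shows "cmod (pair F ys - pair F zs) \<le> C * (e + e')"
proof -
  have "bounded_by (\<lambda>g. comb zs g - comb ys g) (e' + e)"
    using bounded_by_trans[OF bounded_by_commute[OF zs(2)] ys(2)] .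
  then have b: "bounded_by (comb (zs @ scale (- 1) ys)) (e' + e)" by simp
  have v: "valid (zs @ scale (- 1) ys)" using ys zs by simp
  have "cmod (pair F ys - pair F zs) = cmod (pair F (zs @ scale (- 1) ys))" by (simp add: norm_minus_commute)
  also have "\<dots> \<le> C * sqrt (sq (zs @ scale (- 1) ys))" by (rule bounded_byD[OF F v])
  also have "\<dots> \<le> C * (e' + e)" using sqrt_sq_le[OF v b] F by (intro mult_left_mono) (auto simp: bounded_by_def)
  finally show ?thesis by (simp add: add.commute)
qed

lemma inverse_Suc_tendsto: "(\<lambda>i. 1 / real (Suc i)) \<longlonglongrightarrow> 0"
  using LIMSEQ_inverse_real_of_nat by (simp add: inverse_eq_divide)

lemma ip_tendsto:
  assumes F: "bounded_by F C" and F': "F' \<in> space"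
  shows "(\<lambda>i. pair F (approx F' i)) \<longlonglongrightarrow> ip F F'"
proof -
  have C: "0 \<le> C" using F by (simp add: bounded_by_def)
  have close: "cmod (pair F (approx F' i) - pair F (approx F' j)) \<le> C * (1 / real (Suc i) + 1 / real (Suc j))" for i j
    using pair_close[OF F approx[OF F'] approx[OF F']] .
  have "Cauchy (\<lambda>i. pair F (approx F' i))"
  proof (rule CauchyI)
    fix e :: real assume e: "e > 0"
    have "(\<lambda>i. 2 * C * (1 / real (Suc i))) \<longlonglongrightarrow> 2 * C * 0" by (intro tendsto_mult tendsto_const inverse_Suc_tendsto)
    then have "\<forall>\<^sub>F i in sequentially. 2 * C * (1 / real (Suc i)) < e"
      using e by (intro order_tendstoD(2)[where a = e]) simp_all
    then obtain M where M: "2 * C * (1 / real (Suc M)) < e" by (auto simp: eventually_sequentially)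
    have "norm (pair F (approx F' i) - pair F (approx F' j)) < e" if "i \<ge> M" "j \<ge> M" for i j
    proof -
      have "1 / real (Suc i) \<le> 1 / real (Suc M)" "1 / real (Suc j) \<le> 1 / real (Suc M)"
        using that by (auto intro!: frac_le)
      then have "C * (1 / real (Suc i) + 1 / real (Suc j)) \<le> C * (1 / real (Suc M) + 1 / real (Suc M))"
        using C by (intro mult_left_mono add_mono)
      then show ?thesis using close[of i j] M by (simp add: algebra_simps)
    qed
    then show "\<exists>M. \<forall>m\<ge>M. \<forall>n\<ge>M. norm (pair F (approx F' m) - pair F (approx F' n)) < e" by blast
  qed
  then show ?thesis unfolding ip_def by (simp add: Cauchy_convergent_iff convergent_LIMSEQ_iff)
qed

lemma ip_close:
  assumes F: "bounded_by F C" and F': "F' \<in> space" and ys: "valid ys" "bounded_by (\<lambda>g. F' g - comb ys g) e"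
  shows "cmod (pair F ys - ip F F') \<le> C * e"
proof (rule LIMSEQ_le)
  show "(\<lambda>i. C * (e + 1 / real (Suc i))) \<longlonglongrightarrow> C * e"
    using tendsto_mult[OF tendsto_const tendsto_add[OF tendsto_const inverse_Suc_tendsto], of C e] by simp
  show "(\<lambda>i. cmod (pair F ys - pair F (approx F' i))) \<longlonglongrightarrow> cmod (pair F ys - ip F F')"
    by (intro tendsto_intros ip_tendsto[OF F F'])
  show "\<exists>N. \<forall>i\<ge>N. cmod (pair F ys - pair F (approx F' i)) \<le> C * (e + 1 / real (Suc i))"
    using pair_close[OF F ys approx[OF F']] by blast
qed

lemma ip_comb: "F \<in> space \<Longrightarrow> valid ys \<Longrightarrow> ip F (comb ys) = pair F ys"
proof -
  assume F: "F \<in> space" and ys: "valid ys"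
  obtain C where C: "bounded_by F C" using space_bounded[OF F] .
  have "cmod (pair F ys - ip F (comb ys)) \<le> C * 0"
    using bounded_by_zero by (intro ip_close[OF C comb_space[OF ys] ys]) simp
  then show ?thesis by simp
qed

lemma ip_add: 
  assumes "F \<in> space" "F' \<in> space" "F'' \<in> space"
  shows "ip (\<lambda>g. F g + F' g) F'' = ip F F'' + ip F' F''"
proof -
  obtain C where C1: "bounded_by F C" using space_bounded[OF assms(1)] .
  obtain C' where C2: "bounded_by F' C'" using space_bounded[OF assms(2)] .
  note C = C1 C2
  have "(\<lambda>i. pair F (approx F'' i) + pair F' (approx F'' i)) \<longlonglongrightarrow> ip F F'' + ip F' F''"
    by (intro tendsto_add ip_tendsto[OF C(1) assms(3)] ip_tendsto[OF C(2) assms(3)])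
  with ip_tendsto[OF bounded_by_add[OF C] assms(3)] show ?thesis
    unfolding pair_fun_simps by (rule LIMSEQ_unique)
qed

lemma ip_mult:
  assumes "F \<in> space" "F' \<in> space"
  shows "ip (\<lambda>g. a * F g) F' = a * ip F F'"
proof -
  obtain C where C: "bounded_by F C" using space_bounded[OF assms(1)] .
  have "(\<lambda>i. a * pair F (approx F' i)) \<longlonglongrightarrow> a * ip F F'"
    by (intro tendsto_mult tendsto_const ip_tendsto[OF C assms(2)])
  with ip_tendsto[OF bounded_by_mult[OF C] assms(2)] show ?thesis
    unfolding pair_fun_simps by (rule LIMSEQ_unique)
qed

lemma ip_tendsto2:
  assumes F: "F \<in> space" and F': "F' \<in> space"
  shows "(\<lambda>i. pair (comb (approx F i)) (approx F' i)) \<longlonglongrightarrow> ip F F'"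
proof -
  obtain C where C: "bounded_by F C" using space_bounded[OF F] .
  obtain C' where C': "bounded_by F' C'" using space_bounded[OF F'] .
  note a = approx[OF F] and a' = approx[OF F']
  have sq: "sqrt (sq (approx F' i)) \<le> C' + 1" for i
  proof (rule sqrt_sq_le[OF a'(1)])
    have "bounded_by (comb (approx F' i)) (1 / real (Suc i) + C')"
      using bounded_by_add[OF bounded_by_commute[OF a'(2)] C'] by simp
    then show "bounded_by (comb (approx F' i)) (C' + 1)" by (rule bounded_by_mono) simp
  qed
  have "(\<lambda>i. pair (\<lambda>g. F g - comb (approx F i) g) (approx F' i)) \<longlonglongrightarrow> 0"
  proof (rule Lim_null_comparison)
    show "\<forall>\<^sub>F i in sequentially. norm (pair (\<lambda>g. F g - comb (approx F i) g) (approx F' i)) \<le> 1 / real (Suc i) * (C' + 1)"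
    proof (intro always_eventually allI)
      fix i
      have "norm (pair (\<lambda>g. F g - comb (approx F i) g) (approx F' i)) \<le> 1 / real (Suc i) * sqrt (sq (approx F' i))"
        by (rule bounded_byD[OF a(2) a'(1)])
      also have "\<dots> \<le> 1 / real (Suc i) * (C' + 1)" using sq by (intro mult_left_mono) auto
      finally show "norm (pair (\<lambda>g. F g - comb (approx F i) g) (approx F' i)) \<le> 1 / real (Suc i) * (C' + 1)" .
    qed
    show "(\<lambda>i. 1 / real (Suc i) * (C' + 1)) \<longlonglongrightarrow> 0"
      using tendsto_mult[OF inverse_Suc_tendsto tendsto_const, of "C' + 1"] by simp
  qed
  from tendsto_diff[OF ip_tendsto[OF C F'] this] show ?thesis by (simp add: pair_fun_simps)
qed

lemma ip_commute:
  assumes "F \<in> space" "F' \<in> space" shows "ip F F' = cnj (ip F' F)"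
proof -
  have "(\<lambda>i. cnj (pair (comb (approx F' i)) (approx F i))) \<longlonglongrightarrow> cnj (ip F' F)"
    by (intro tendsto_cnj ip_tendsto2 assms)
  moreover have "cnj (pair (comb (approx F' i)) (approx F i)) = pair (comb (approx F i)) (approx F' i)" for i
    using pair_comb_commute[of "approx F i" "approx F' i"] approx assms by simp
  ultimately have "(\<lambda>i. pair (comb (approx F i)) (approx F' i)) \<longlonglongrightarrow> cnj (ip F' F)" by simp
  with ip_tendsto2[OF assms] show ?thesis by (rule LIMSEQ_unique)
qed

text \<open>
  The inner product induces the functional norm: together with \<open>sqrt_ip_le\<close>, the
  length of \<open>F\<close> is the least bound for \<open>F\<close>.
\<close>

lemma ip_self:
  assumes F: "F \<in> space"
  shows "0 \<le> Re (ip F F)" "(\<lambda>i. sqrt (sq (approx F i))) \<longlonglongrightarrow> sqrt (Re (ip F F))" "bounded_by F (sqrt (Re (ip F F)))"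
proof -
  have lim: "(\<lambda>i. sq (approx F i)) \<longlonglongrightarrow> Re (ip F F)"
    unfolding sq_def by (intro tendsto_Re ip_tendsto2 F)
  then show nn: "0 \<le> Re (ip F F)"
    using sq_nonneg[OF approx(1)[OF F]] by (intro LIMSEQ_le_const) auto
  show lims: "(\<lambda>i. sqrt (sq (approx F i))) \<longlonglongrightarrow> sqrt (Re (ip F F))"
    by (intro tendsto_real_sqrt lim)
  show "bounded_by F (sqrt (Re (ip F F)))"
    unfolding bounded_by_def
  proof (intro conjI allI impI)
    fix ys assume ys: "valid ys"
    have "(\<lambda>i. (1 / real (Suc i) + sqrt (sq (approx F i))) * sqrt (sq ys)) \<longlonglongrightarrow> (0 + sqrt (Re (ip F F))) * sqrt (sq ys)"
      by (intro tendsto_mult tendsto_add inverse_Suc_tendsto lims tendsto_const)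
    moreover have "cmod (pair F ys) \<le> (1 / real (Suc i) + sqrt (sq (approx F i))) * sqrt (sq ys)" for i
      using bounded_byD[OF bounded_by_add[OF approx(2)[OF F, of i] bounded_by_comb[OF approx(1)[OF F, of i]]] ys] by simp
    ultimately show "cmod (pair F ys) \<le> sqrt (Re (ip F F)) * sqrt (sq ys)"
      using LIMSEQ_le_const[of _ "(0 + sqrt (Re (ip F F))) * sqrt (sq ys)" "cmod (pair F ys)"] by simp
  qed (use nn in simp)
qed

lemma sqrt_ip_le:
  assumes F: "F \<in> space" and C: "bounded_by F C"
  shows "sqrt (Re (ip F F)) \<le> C"
proof -
  let ?s = "sqrt (Re (ip F F))"
  have "(\<lambda>i. cmod (pair F (approx F i))) \<longlonglongrightarrow> cmod (ip F F)"
    by (intro tendsto_norm ip_tendsto[OF C F])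
  moreover have "(\<lambda>i. C * sqrt (sq (approx F i))) \<longlonglongrightarrow> C * ?s"
    by (intro tendsto_mult tendsto_const ip_self F)
  ultimately have "cmod (ip F F) \<le> C * ?s"
    by (rule LIMSEQ_le) (use bounded_byD[OF C approx(1)[OF F]] in blast)
  then have "Re (ip F F) \<le> C * ?s" using complex_Re_le_cmod order_trans by blast
  then have "?s * ?s \<le> C * ?s" using ip_self(1)[OF F] by simp
  then show ?thesis using ip_self(1)[OF F] C mult_right_le_imp_le[of ?s ?s C]
    unfolding bounded_by_def by (cases "?s = 0") auto
qed

end

section \<open>The spherical representation of a kernel\<close>

context kernel_space
begin

definition kernel_hilbert :: "('g \<Rightarrow> complex) hilbert" where
  "kernel_hilbert = \<lparr>carrier = space, mult = (\<lambda>_ _ _. 0), one = (\<lambda>_. 0), zero = (\<lambda>_. 0),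
    add = (\<lambda>F F' g. F g + F' g), smult = (\<lambda>a F g. a * F g), cinner = ip\<rparr>"

lemma kernel_hilbert_simps [simp]:
  "carrier kernel_hilbert = space" "\<zero>\<^bsub>kernel_hilbert\<^esub> = (\<lambda>_. 0)" "F \<oplus>\<^bsub>kernel_hilbert\<^esub> F' = (\<lambda>g. F g + F' g)"
  "a \<odot>\<^bsub>kernel_hilbert\<^esub> F = (\<lambda>g. a * F g)" "cinner kernel_hilbert = ip"
  by (simp_all add: kernel_hilbert_def)

lemma inner_space_kernel_hilbert: "complex_inner_space kernel_hilbert"
proof (intro complex_inner_space.intro complex_inner_space_axioms.intro moduleI cring_complex_ring abelian_groupI)
  fix F assume F: "F \<in> carrier kernel_hilbert"
  show "\<exists>F'\<in>carrier kernel_hilbert. F' \<oplus>\<^bsub>kernel_hilbert\<^esub> F = \<zero>\<^bsub>kernel_hilbert\<^esub>"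
    using F mult_space[of F "- 1"] by (intro bexI[of _ "\<lambda>g. - 1 * F g"]) auto
  show "0 \<le> Re (cinner kernel_hilbert F F)" using F ip_self by simp
  assume "cinner kernel_hilbert F F = 0"
  then have "bounded_by F 0" using ip_self(3)[of F] F by simp
  then show "F = \<zero>\<^bsub>kernel_hilbert\<^esub>" using F by (auto intro!: space_eqI bounded_by_mono[OF \<open>bounded_by F 0\<close>])
qed (auto simp: algebra_simps ip_add ip_mult intro: ip_commute)

lemma minus_kernel_hilbert:
  assumes "F \<in> space" "F' \<in> space" shows "F \<ominus>\<^bsub>kernel_hilbert\<^esub> F' = (\<lambda>g. F g - F' g)"
proof -
  interpret complex_inner_space kernel_hilbert by (rule inner_space_kernel_hilbert)
  show ?thesis using assms minus_eq_smult[of F'] by (simp add: a_minus_def)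
qed

lemma hdist_kernel_hilbert:
  assumes "F \<in> space" "F' \<in> space"
  shows "bounded_by (\<lambda>g. F g - F' g) C \<Longrightarrow> hdist kernel_hilbert F F' \<le> C" "bounded_by (\<lambda>g. F g - F' g) (hdist kernel_hilbert F F')"
  using assms sqrt_ip_le[of "\<lambda>g. F g - F' g"] ip_self(3)[of "\<lambda>g. F g - F' g"]
  by (simp_all add: hdist_def minus_kernel_hilbert)

lemma pair_tendsto:
  assumes "valid ys" "\<And>g. (\<lambda>i. F i g) \<longlonglongrightarrow> F' g"
  shows "(\<lambda>i. pair (F i) ys) \<longlonglongrightarrow> pair F' ys"
  using assms(1) by (induction ys) (auto intro!: tendsto_intros assms(2))

text \<open>
  A Cauchy sequence in the norm is pointwise Cauchy, and the bound for the differences survives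
  the pointwise limit.
\<close>

lemma hilbert_space_kernel_hilbert: "complex_hilbert_space kernel_hilbert"
proof (intro complex_hilbert_space.intro complex_hilbert_space_axioms.intro inner_space_kernel_hilbert)
  interpret complex_inner_space kernel_hilbert by (rule inner_space_kernel_hilbert)
  interpret MS: Metric_space "carrier kernel_hilbert" "hdist kernel_hilbert" by (rule Metric_space_hdist)
  show "MS.mcomplete"
    unfolding MS.mcomplete_def
  proof (intro allI impI)
    fix \<sigma> assume "MS.MCauchy \<sigma>"
    then have \<sigma>: "\<And>n. \<sigma> n \<in> space" and
      cau: "\<And>e. e > 0 \<Longrightarrow> \<exists>N. \<forall>n n'. N \<le> n \<longrightarrow> N \<le> n' \<longrightarrow> hdist kernel_hilbert (\<sigma> n) (\<sigma> n') < e"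
      unfolding MS.MCauchy_def by auto
    have ptw: "cmod (\<sigma> n g - \<sigma> n' g) \<le> hdist kernel_hilbert (\<sigma> n) (\<sigma> n')" for n n' g
      using bounded_by_eval[OF hdist_kernel_hilbert(2)[OF \<sigma> \<sigma>], of g n n'] space_out[OF \<sigma>] MS.nonneg
      by (cases "g \<in> carrier G") auto
    have "Cauchy (\<lambda>n. \<sigma> n g)" for g
    proof (rule CauchyI)
      fix e :: real assume "e > 0"
      then obtain N where "\<forall>n n'. N \<le> n \<longrightarrow> N \<le> n' \<longrightarrow> hdist kernel_hilbert (\<sigma> n) (\<sigma> n') < e" using cau by blast
      then show "\<exists>M. \<forall>m\<ge>M. \<forall>n\<ge>M. norm (\<sigma> m g - \<sigma> n g) < e" using ptw le_less_trans by blast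
    qed
    then obtain F where F: "\<And>g. (\<lambda>n. \<sigma> n g) \<longlonglongrightarrow> F g"
      unfolding Cauchy_convergent_iff convergent_def by metis
    have close: "\<exists>N. \<forall>n\<ge>N. bounded_by (\<lambda>g. \<sigma> n g - F g) e" if e: "e > 0" for e
    proof -
      obtain N where N: "\<And>n n'. N \<le> n \<Longrightarrow> N \<le> n' \<Longrightarrow> hdist kernel_hilbert (\<sigma> n) (\<sigma> n') < e" using cau[OF e] by blast
      have "bounded_by (\<lambda>g. \<sigma> n g - F g) e" if n: "n \<ge> N" for n
        unfolding bounded_by_def
      proof (intro conjI allI impI)
        fix ys assume ys: "valid ys"
        have "(\<lambda>i. cmod (pair (\<lambda>g. \<sigma> n g - \<sigma> i g) ys)) \<longlonglongrightarrow> cmod (pair (\<lambda>g. \<sigma> n g - F g) ys)"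
          by (intro tendsto_norm pair_tendsto ys tendsto_diff tendsto_const F)
        moreover have "cmod (pair (\<lambda>g. \<sigma> n g - \<sigma> i g) ys) \<le> e * sqrt (sq ys)" if "i \<ge> N" for i
          using bounded_byD[OF bounded_by_mono[OF hdist_kernel_hilbert(2)[OF \<sigma> \<sigma>] less_imp_le[OF N[OF n that]]] ys] .
        ultimately show "cmod (pair (\<lambda>g. \<sigma> n g - F g) ys) \<le> e * sqrt (sq ys)"
          by (intro LIMSEQ_le_const2) auto
      qed (use e in simp)
      then show ?thesis by blast
    qed
    have Fs: "F \<in> space"
    proof (rule spaceI)
      fix g assume "g \<notin> carrier G"
      then have "(\<lambda>n. \<sigma> n g) = (\<lambda>_. 0)" using space_out[OF \<sigma>] by auto
      then show "F g = 0" using F[of g] by (simp add: LIMSEQ_const_iff)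
    next
      fix e :: real assume e: "e > 0"
      then obtain N where N: "bounded_by (\<lambda>g. \<sigma> N g - F g) (e / 2)" using close[of "e / 2"] by auto
      obtain ys where ys: "valid ys" "bounded_by (\<lambda>g. \<sigma> N g - comb ys g) (e / 2)"
        using space_approx[OF \<sigma>, of "e / 2"] e by auto
      have "bounded_by (\<lambda>g. F g - comb ys g) (e / 2 + e / 2)" using bounded_by_trans[OF bounded_by_commute[OF N] ys(2)] .
      then show "\<exists>ys. valid ys \<and> bounded_by (\<lambda>g. F g - comb ys g) e" using ys(1) by auto
    qed
    have "limitin MS.mtopology \<sigma> F sequentially"
      unfolding MS.limit_metric_sequentially
    proof (intro conjI allI impI)
      fix e :: real assume e: "e > 0"
      then obtain N where N: "\<And>n. n \<ge> N \<Longrightarrow> bounded_by (\<lambda>g. \<sigma> n g - F g) (e / 2)" using close[of "e / 2"] by auto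
      have "hdist kernel_hilbert (\<sigma> n) F < e" if "n \<ge> N" for n
        using hdist_kernel_hilbert(1)[OF \<sigma> Fs N[OF that]] e by simp
      then show "\<exists>N. \<forall>n\<ge>N. \<sigma> n \<in> carrier kernel_hilbert \<and> hdist kernel_hilbert (\<sigma> n) F < e" using \<sigma> by auto
    qed (use Fs in simp)
    then show "\<exists>x. limitin MS.mtopology \<sigma> x sequentially" by blast
  qed
qed

definition act :: "'g \<Rightarrow> ('g \<Rightarrow> complex) \<Rightarrow> 'g \<Rightarrow> complex" where
  "act a F g = (if g \<in> carrier G then F (inv a \<otimes> g) else 0)"

lemma translate_translate:
  assumes "a \<in> carrier G" "b \<in> carrier G" "valid ys"
  shows "translate a (translate b ys) = translate (a \<otimes> b) ys"
  using assms by (auto simp: translate_def valid_def m_assoc)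

lemma translate_one: "valid ys \<Longrightarrow> translate \<one> ys = ys"
  by (induction ys) (auto simp: translate_def)

lemma pair_act:
  assumes "a \<in> carrier G" "valid ys"
  shows "pair (act a F) ys = pair F (translate (inv a) ys)"
  using assms(2) by (induction ys) (auto simp: translate_def act_def case_prod_unfold)

lemma act_comb:
  assumes a: "a \<in> carrier G" and ys: "valid ys"
  shows "act a (comb ys) = comb (translate a ys)"
proof
  fix g show "act a (comb ys) g = comb (translate a ys) g"
  proof (cases "g \<in> carrier G")
    case True
    have "(\<Sum>(c, h)\<leftarrow>ys. c * f (inv (inv a \<otimes> g) \<otimes> h)) = (\<Sum>(c, h)\<leftarrow>ys. c * f (inv g \<otimes> (a \<otimes> h)))"
    proof (intro arg_cong[where f = sum_list] map_cong refl, clarify)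
      fix c h assume "(c, h) \<in> set ys"
      then have "h \<in> carrier G" using ys by (force simp: valid_def)
      then show "c * f (inv (inv a \<otimes> g) \<otimes> h) = c * f (inv g \<otimes> (a \<otimes> h))"
        using a True by (simp add: inv_mult_group m_assoc)
    qed
    then show ?thesis using a True by (simp add: act_def comb_def translate_def comp_def case_prod_unfold)
  qed (simp add: act_def)
qed

lemma sq_translate:
  assumes a: "a \<in> carrier G" and ys: "valid ys"
  shows "sq (translate a ys) = sq ys"
  using a ys by (simp add: sq_def act_comb[symmetric] pair_act translate_translate translate_one)

lemma bounded_by_act: "a \<in> carrier G \<Longrightarrow> bounded_by F C \<Longrightarrow> bounded_by (act a F) C"
  unfolding bounded_by_def
proof (intro conjI allI impI)
  fix ys assume *: "a \<in> carrier G" "0 \<le> C \<and> (\<forall>ys. valid ys \<longrightarrow> cmod (pair F ys) \<le> C * sqrt (sq ys))" "valid ys"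
  then have "cmod (pair F (translate (inv a) ys)) \<le> C * sqrt (sq (translate (inv a) ys))" by simp
  then show "cmod (pair (act a F) ys) \<le> C * sqrt (sq ys)" using * by (simp add: pair_act sq_translate)
qed simp

lemma act_linear:
  "act a (\<lambda>g. F g + F' g) = (\<lambda>g. act a F g + act a F' g)" "act a (\<lambda>g. F g - F' g) = (\<lambda>g. act a F g - act a F' g)"
  "act a (\<lambda>g. c * F g) = (\<lambda>g. c * act a F g)"
  by (auto simp: act_def fun_eq_iff)

lemma bounded_by_act_comb:
  assumes "a \<in> carrier G" "valid ys" "bounded_by (\<lambda>g. F g - comb ys g) e"
  shows "bounded_by (\<lambda>g. act a F g - comb (translate a ys) g) e"
  using bounded_by_act[OF assms(1,3)] by (simp add: act_linear act_comb[OF assms(1,2)])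

lemma act_space [simp]:
  assumes a: "a \<in> carrier G" and F: "F \<in> space" shows "act a F \<in> space"
proof (rule spaceI)
  fix e :: real assume "e > 0"
  then obtain ys where "valid ys" "bounded_by (\<lambda>g. F g - comb ys g) e" using space_approx[OF F] by blast
  then show "\<exists>ys. valid ys \<and> bounded_by (\<lambda>g. act a F g - comb ys g) e"
    using bounded_by_act_comb[OF a] valid_translate[OF a] by blast
qed (simp add: act_def)

lemma act_mult:
  "a \<in> carrier G \<Longrightarrow> b \<in> carrier G \<Longrightarrow> act (a \<otimes> b) F = act a (act b F)"
  by (auto simp: act_def fun_eq_iff inv_mult_group m_assoc)

lemma act_one: "F \<in> space \<Longrightarrow> act \<one> F = F"
  by (auto simp: act_def fun_eq_iff space_out)

lemma ip_act:
  assumes a: "a \<in> carrier G" and F: "F \<in> space" "F' \<in> space"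
  shows "ip (act a F) (act a F') = ip F F'"
proof -
  obtain C where C: "bounded_by F C" using space_bounded[OF F(1)] .
  have "cmod (ip (act a F) (act a F') - ip F F') \<le> C * (2 * (1 / real (Suc i)))" for i
  proof -
    let ?y = "approx F' i" and ?e = "1 / real (Suc i)"
    note y = approx[OF F(2), of i]
    have "cmod (pair (act a F) (translate a ?y) - ip (act a F) (act a F')) \<le> C * ?e"
      using a F y by (intro ip_close bounded_by_act C bounded_by_act_comb) auto
    moreover have "pair (act a F) (translate a ?y) = pair F ?y"
      using a y by (simp add: pair_act translate_translate translate_one)
    moreover have "cmod (pair F ?y - ip F F') \<le> C * ?e"
      using C F y by (intro ip_close) auto
    ultimately have "cmod ((pair F ?y - ip F F') - (pair F ?y - ip (act a F) (act a F'))) \<le> C * ?e + C * ?e"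
      by (intro order_trans[OF norm_triangle_ineq4]) (intro add_mono, auto)
    then show ?thesis by (simp add: algebra_simps)
  qed
  moreover have "(\<lambda>i. C * (2 * (1 / real (Suc i)))) \<longlonglongrightarrow> C * (2 * 0)"
    by (intro tendsto_mult tendsto_const inverse_Suc_tendsto)
  ultimately have "cmod (ip (act a F) (act a F') - ip F F') \<le> C * (2 * 0)"
    by (intro LIMSEQ_le_const[of _ _ "cmod (ip (act a F) (act a F') - ip F F')"]) auto
  then show ?thesis by simp
qed

definition rho :: "'g \<Rightarrow> ('g \<Rightarrow> complex) \<Rightarrow> 'g \<Rightarrow> complex" where
  "rho a = (\<lambda>F\<in>space. act a F)"

lemma rho [simp]: "F \<in> space \<Longrightarrow> rho a F = act a F"
  by (simp add: rho_def)

lemma rho_Bij: assumes a: "a \<in> carrier G" shows "rho a \<in> Bij space"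
proof -
  have "bij_betw (rho a) space space"
    by (rule bij_betwI[where g = "act (inv a)"])
      (use a in \<open>auto simp: act_mult[symmetric] act_one\<close>)
  then show ?thesis by (simp add: Bij_def rho_def)
qed

lemma action_kernel_hilbert: "group_action G (carrier kernel_hilbert) rho"
proof -
  have "rho \<in> hom G (BijGroup space)"
  proof (rule homI)
    fix a assume "a \<in> carrier G"
    then show "rho a \<in> carrier (BijGroup space)" using rho_Bij by (simp add: BijGroup_def)
  next
    fix a b assume ab: "a \<in> carrier G" "b \<in> carrier G"
    have "rho (a \<otimes> b) = compose space (rho a) (rho b)"
      using ab by (auto simp: rho_def compose_def act_mult fun_eq_iff)
    then show "rho (a \<otimes> b) = rho a \<otimes>\<^bsub>BijGroup space\<^esub> rho b"
      using rho_Bij ab by (simp add: BijGroup_def)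
  qed
  then show ?thesis
    by (simp add: group_action_def group_hom_def group_hom_axioms_def group_BijGroup is_group)
qed

lemma continuous_kernel: "a \<in> carrier G \<Longrightarrow> b \<in> carrier G \<Longrightarrow> continuous_map T euclidean (\<lambda>g. f (a \<otimes> g \<otimes> b))"
  using kernel unfolding spherical_kernel_def by blast

lemma continuous_pair_translate:
  assumes zs: "valid zs" and ys: "valid ys"
  shows "continuous_map T euclidean (\<lambda>g. pair (comb (translate g ys)) zs)"
proof -
  have one: "continuous_map T euclidean (\<lambda>g. comb (translate g ys) h)" if h: "h \<in> carrier G" for h
    using ys
  proof (induction ys)
    case Nil
    then show ?case by (simp add: translate_def)
  next
    case (Cons p ys)
    have "continuous_map T euclidean (\<lambda>g. fst p * f (inv h \<otimes> g \<otimes> snd p) + comb (translate g ys) h)"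
    proof (rule continuous_map_add)
      have "continuous_map T euclidean ((\<lambda>z. fst p * z) \<circ> (\<lambda>g. f (inv h \<otimes> g \<otimes> snd p)))"
        using h Cons.prems by (intro continuous_map_compose[OF continuous_kernel]) (auto intro!: continuous_intros)
      then show "continuous_map T euclidean (\<lambda>g. fst p * f (inv h \<otimes> g \<otimes> snd p))" by (simp add: comp_def)
      show "continuous_map T euclidean (\<lambda>g. comb (translate g ys) h)" using Cons by simp
    qed
    then show ?case
      by (rule continuous_map_eq)
        (use h Cons.prems in \<open>auto simp: topspace comb_def translate_def case_prod_unfold m_assoc\<close>)
  qed
  show ?thesis
    using zs
  proof (induction zs)
    case (Cons p zs)
    have "continuous_map T euclidean ((\<lambda>z. cnj (fst p) * z) \<circ> (\<lambda>g. comb (translate g ys) (snd p)))"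
      using Cons.prems by (intro continuous_map_compose[OF one]) (auto intro!: continuous_intros)
    then show ?case using Cons by (auto simp: comp_def intro!: continuous_map_add)
  qed simp
qed

text \<open>
  Replace \<open>F\<close> by a nearby finite combination \<open>ys\<close>; the translates of
  \<open>ys\<close> all have the same length, so their distance is controlled by an inner
  product that is continuous because \<open>f\<close> is.
\<close>

lemma continuous_rho:
  assumes F: "F \<in> space"
  shows "continuous_map T (hilbert_topology kernel_hilbert) (\<lambda>g. rho g F)"
proof -
  interpret complex_inner_space kernel_hilbert by (rule inner_space_kernel_hilbert)
  interpret MS: Metric_space "carrier kernel_hilbert" "hdist kernel_hilbert" by (rule Metric_space_hdist)
  have near: "\<exists>W. openin T W \<and> g0 \<in> W \<and> (\<forall>g\<in>W. bounded_by (\<lambda>h. act g0 F h - act g F h) (3 * e))"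
    if g0: "g0 \<in> carrier G" and e: "e > 0" for g0 e
  proof -
    obtain ys where ys: "valid ys" "bounded_by (\<lambda>g. F g - comb ys g) e" using space_approx[OF F e] .
    define D where "D g = pair (comb (translate g ys)) (translate g0 ys)" for g
    define W where "W = {g \<in> topspace T. D g \<in> {z. 2 * sq ys - 2 * Re z < e\<^sup>2}}"
    have v0: "valid (translate g0 ys)" using g0 ys by simp
    have "open {z. 2 * sq ys - 2 * Re z < e\<^sup>2}"
      by (intro open_Collect_less continuous_intros)
    then have "openin T W"
      unfolding W_def D_def
      by (intro openin_continuous_map_preimage[OF continuous_pair_translate[OF v0 ys(1)]]) simp
    moreover have "D g0 = of_real (sq ys)"
      unfolding D_def using pair_comb_self[OF v0] sq_translate[OF g0 ys(1)] by simp
    then have "g0 \<in> W" using g0 e by (simp add: W_def topspace)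
    moreover have "bounded_by (\<lambda>h. act g0 F h - act g F h) (3 * e)" if gW: "g \<in> W" for g
    proof -
      have g: "g \<in> carrier G" "2 * sq ys - 2 * Re (D g) < e\<^sup>2" using gW by (auto simp: W_def topspace)
      have v: "valid (translate g ys)" using g ys by simp
      let ?d = "translate g ys @ scale (- 1) (translate g0 ys)"
      have "sq ?d = 2 * sq ys - 2 * Re (D g)"
        using sq_append_scale[OF v v0, of "- 1"] g g0 ys by (simp add: sq_translate D_def)
      then have "sqrt (sq ?d) \<le> e" using g(2) e by (intro real_le_lsqrt) auto
      then have "bounded_by (comb ?d) e" using bounded_by_mono[OF bounded_by_comb[of ?d]] v v0 by simp
      then have mid: "bounded_by (\<lambda>h. comb (translate g0 ys) h - comb (translate g ys) h) e"
        using bounded_by_commute by simp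
      \<comment> \<open>Two approximation errors and the distance between the translates of \<open>ys\<close>.\<close>
      have "bounded_by (\<lambda>h. act g0 F h - act g F h) (e + (e + e))"
        using bounded_by_trans[OF bounded_by_act_comb[OF g0 ys] bounded_by_trans[OF mid bounded_by_commute[OF bounded_by_act_comb[OF g(1) ys]]]] .
      then show ?thesis by simp
    qed
    ultimately show ?thesis by blast
  qed
  have top: "topspace (hilbert_topology kernel_hilbert) = space"
    using MS.topspace_mtopology by (simp add: hilbert_topology_def)
  show ?thesis
    unfolding continuous_map_def top
  proof (intro conjI allI impI)
    show "(\<lambda>g. rho g F) \<in> topspace T \<rightarrow> space" using F by (auto simp: topspace)
    fix U assume U: "openin (hilbert_topology kernel_hilbert) U"
    show "openin T {g \<in> topspace T. rho g F \<in> U}"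
    proof (subst openin_subopen, intro ballI)
      fix g0 assume "g0 \<in> {g \<in> topspace T. rho g F \<in> U}"
      then have g0: "g0 \<in> carrier G" "act g0 F \<in> U" using F by (auto simp: topspace)
      obtain r where r: "r > 0" "MS.mball (act g0 F) r \<subseteq> U"
        using U g0(2) unfolding hilbert_topology_def MS.openin_mtopology by blast
      obtain W where W: "openin T W" "g0 \<in> W" "\<And>g. g \<in> W \<Longrightarrow> bounded_by (\<lambda>h. act g0 F h - act g F h) (3 * (r / 4))"
        using near[OF g0(1), of "r / 4"] r by auto
      have "rho g F \<in> U" if g: "g \<in> W" for g
      proof -
        have gG: "g \<in> carrier G" using g W(1) openin_subset topspace by blast
        have "hdist kernel_hilbert (act g0 F) (act g F) \<le> 3 * (r / 4)"
          using gG g0 F by (intro hdist_kernel_hilbert(1) W(3)[OF g]) auto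
        then have "act g F \<in> MS.mball (act g0 F) r" unfolding MS.in_mball using gG g0 F r(1) by simp
        then show ?thesis using r(2) F by auto
      qed
      then show "\<exists>W. openin T W \<and> g0 \<in> W \<and> W \<subseteq> {g \<in> topspace T. rho g F \<in> U}"
        using W(1,2) openin_subset[OF W(1)] by blast
    qed
  qed
qed

lemma unitary_rep_kernel_hilbert: "unitary_rep G T kernel_hilbert rho"
proof (intro unitary_rep.intro unitary_rep_axioms.intro hilbert_space_kernel_hilbert action_kernel_hilbert)
  fix v assume "v \<in> carrier kernel_hilbert"
  then show "continuous_map T (hilbert_topology kernel_hilbert) (\<lambda>g. rho g v)" using continuous_rho by simp
qed (auto simp: act_linear ip_act)

abbreviation eta :: "'g \<Rightarrow> complex" where
  "eta \<equiv> comb [(1, \<one>)]"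

lemma eta_one: "eta \<one> = 1" by (simp add: comb_def f_one)

lemma eta_nonzero: "eta \<noteq> (\<lambda>_. 0)"
  using eta_one fun_cong[of eta "\<lambda>_. 0" \<one>] by auto

lemma act_eta: "g \<in> carrier G \<Longrightarrow> act g eta = comb [(1, g)]"
  by (simp add: act_comb translate_def)

lemma f_invariant: "g \<in> carrier G \<Longrightarrow> s \<in> K \<Longrightarrow> f (s \<otimes> g) = f g \<and> f (g \<otimes> s) = f g"
  using kernel unfolding spherical_kernel_def by blast

lemma K_carrier: "s \<in> K \<Longrightarrow> s \<in> carrier G"
  using K_eq Ks_carrier by auto

lemma act_eta_K: "s \<in> K \<Longrightarrow> act s eta = eta"
  using f_invariant K_carrier by (auto simp: act_eta comb_def fun_eq_iff)

definition average :: "nat \<Rightarrow> ('g \<Rightarrow> complex) \<Rightarrow> 'g \<Rightarrow> complex" where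
  "average k F g = 1 / of_nat (card (Ks k)) * (\<Sum>s\<in>Ks k. act s F g)"

lemma average_linear:
  "average k (\<lambda>g. F g + F' g) = (\<lambda>g. average k F g + average k F' g)" "average k (\<lambda>g. F g - F' g) = (\<lambda>g. average k F g - average k F' g)"
  "average k (\<lambda>g. c * F g) = (\<lambda>g. c * average k F g)"
  by (auto simp: average_def fun_eq_iff act_linear sum.distrib sum_subtractf sum_distrib_left algebra_simps)

lemma bounded_by_average: assumes "bounded_by F C" shows "bounded_by (average k F) C"
proof -
  have "bounded_by (\<lambda>g. \<Sum>s\<in>S. act s F g) (real (card S) * C)" if "finite S" "S \<subseteq> carrier G" for S
    using that
  proof (induction S rule: finite_induct)
    case (insert s S)
    then have "bounded_by (\<lambda>g. act s F g + (\<Sum>s\<in>S. act s F g)) (C + real (card S) * C)"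
      by (intro bounded_by_add bounded_by_act assms) auto
    then show ?case using insert by (simp add: algebra_simps)
  qed (use bounded_by_zero in simp)
  then have "bounded_by (\<lambda>g. \<Sum>s\<in>Ks k. act s F g) (real (card (Ks k)) * C)" using finite_Ks Ks_carrier by blast
  from bounded_by_mult[OF this, of "1 / of_nat (card (Ks k))"] show ?thesis
    using Ks_card[of k] by (simp add: average_def[abs_def] norm_divide)
qed

text \<open>
  The squared distance between the mean of $\rho(h)\eta$ and $f(h)\eta$ is the mean of
  $f(h^{-1}sh)$ over \<open>s\<close> minus $|f(h)|^2$, and this tends to $0$ by the limit
  relation for $h^{-1}$ and \<open>h\<close>.
\<close>

lemma average_point_converges:
  assumes h: "h \<in> carrier G" and e: "e > 0"
  shows "\<forall>\<^sub>F k in sequentially. bounded_by (\<lambda>g. average k (comb [(1, h)]) g - f h * eta g) e"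
proof -
  define A where "A k = (\<Sum>s\<in>Ks k. f (inv h \<otimes> s \<otimes> h)) / of_nat (card (Ks k))" for k
  have "A \<longlonglongrightarrow> f (inv h) * f h"
    using kernel h unfolding A_def spherical_kernel_def by simp
  then have "(\<lambda>k. Re (A k)) \<longlonglongrightarrow> (cmod (f h))\<^sup>2"
    using tendsto_Re[of A "f (inv h) * f h" sequentially] f_inv[OF h]
    unfolding cmod_power2 by (simp add: power2_eq_square)
  then have "\<forall>\<^sub>F k in sequentially. dist (Re (A k)) ((cmod (f h))\<^sup>2) < e\<^sup>2"
    using e by (intro tendstoD) auto
  then show ?thesis
  proof eventually_elim
    case (elim k)
    let ?n = "of_nat (card (Ks k)) :: complex"
    have n: "?n \<noteq> 0" using Ks_card[of k] by simp
    obtain L where L: "set L = Ks k" "distinct L" using finite_distinct_list[OF finite_Ks] by blast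
    \<comment> \<open>The mean as a finite combination, so that its squared length is a double sum.\<close>
    define zs where "zs = map (\<lambda>s. (1 / ?n, s \<otimes> h)) L"
    have sum_L: "(\<Sum>s\<leftarrow>L. F s) = (\<Sum>s\<in>Ks k. F s)" for F :: "'g \<Rightarrow> complex"
      using sum_list_distinct_conv_sum_set[OF L(2)] L(1) by simp
    have zs: "valid zs" using L(1) Ks_carrier h by (auto simp: valid_def zs_def)
    have average: "average k (comb [(1, h)]) = comb zs"
    proof
      fix g show "average k (comb [(1, h)]) g = comb zs g"
      proof (cases "g \<in> carrier G")
        case True
        have "average k (comb [(1, h)]) g = 1 / ?n * (\<Sum>s\<in>Ks k. comb [(1, s \<otimes> h)] g)"
          unfolding average_def using h Ks_carrier
          by (intro arg_cong2[where f = "(*)"] sum.cong refl) (simp add: act_comb translate_def)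
        then show ?thesis using True
          by (simp add: comb_def zs_def comp_def sum_L sum_distrib_left)
      qed (simp add: average_def act_def)
    qed
    have "comb zs \<one> = f h"
    proof -
      have "(\<Sum>s\<in>Ks k. f (s \<otimes> h)) = (\<Sum>s\<in>Ks k. f h)"
        using f_invariant[OF h] K_eq by (intro sum.cong refl) auto
      moreover have "comb zs \<one> = 1 / ?n * (\<Sum>s\<in>Ks k. f (s \<otimes> h))"
        using h Ks_carrier by (simp add: comb_def zs_def comp_def sum_L sum_distrib_left cong: sum.cong)
      ultimately show ?thesis using n by simp
    qed
    moreover have "sq zs = Re (A k)"
    proof -
      \<comment> \<open>By left invariance of the sum over the subgroup, \<open>r\<close> can be absorbed.\<close>
      have inner: "(\<Sum>s\<in>Ks k. f (inv (r \<otimes> h) \<otimes> (s \<otimes> h))) = (\<Sum>s\<in>Ks k. f (inv h \<otimes> s \<otimes> h))" if r: "r \<in> Ks k" for r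
      proof -
        have rG: "r \<in> carrier G" using r by (rule Ks_carrier)
        have "(\<Sum>s\<in>Ks k. f (inv (r \<otimes> h) \<otimes> (s \<otimes> h))) = (\<Sum>s\<in>Ks k. f (inv h \<otimes> (inv r \<otimes> s) \<otimes> h))"
          using rG h Ks_carrier by (intro sum.cong refl) (simp add: inv_mult_group m_assoc)
        also have "\<dots> = (\<Sum>s\<in>Ks k. f (inv h \<otimes> s \<otimes> h))"
          using sum_Ks_mult_left[OF subgroup.m_inv_closed[OF subgroup_Ks r], of "\<lambda>s. f (inv h \<otimes> s \<otimes> h)"] .
        finally show ?thesis .
      qed
      have "pair (comb zs) zs = (\<Sum>s\<in>Ks k. \<Sum>r\<in>Ks k. 1 / ?n * cnj (1 / ?n) * f (inv (r \<otimes> h) \<otimes> (s \<otimes> h)))"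
        unfolding pair_comb[OF zs] by (simp add: zs_def comp_def sum_L)
      also have "\<dots> = (\<Sum>r\<in>Ks k. 1 / ?n * (1 / ?n) * (\<Sum>s\<in>Ks k. f (inv (r \<otimes> h) \<otimes> (s \<otimes> h))))"
        by (subst sum.swap) (simp add: sum_distrib_left)
      also have "\<dots> = (\<Sum>r\<in>Ks k. 1 / ?n * (1 / ?n) * (\<Sum>s\<in>Ks k. f (inv h \<otimes> s \<otimes> h)))"
        by (intro sum.cong refl) (simp add: inner)
      also have "\<dots> = A k" using n by (simp add: A_def)
      finally show ?thesis by (simp add: sq_def)
    qed
    moreover have "sq [(1, \<one>)] = 1" by (simp add: sq_def eta_one)
    ultimately have "sq (zs @ scale (- f h) [(1, \<one>)]) = Re (A k) - (cmod (f h))\<^sup>2"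
      using sq_append_scale[OF zs, of "[(1, \<one>)]" "- f h"] unfolding cmod_power2 by (simp add: power2_eq_square)
    then have "sqrt (sq (zs @ scale (- f h) [(1, \<one>)])) \<le> e"
      using elim e by (intro real_le_lsqrt) (auto simp: dist_norm)
    then have "bounded_by (comb (zs @ scale (- f h) [(1, \<one>)])) e"
      using zs by (intro bounded_by_mono[OF bounded_by_comb]) auto
    then show ?case by (simp add: average)
  qed
qed

lemma average_comb_converges:
  assumes ys: "valid ys" and e: "e > 0"
  shows "\<forall>\<^sub>F k in sequentially. bounded_by (\<lambda>g. average k (comb ys) g - comb ys \<one> * eta g) e"
  using ys e
proof (induction ys arbitrary: e)
  case Nil
  then have "bounded_by (\<lambda>_. 0) e" using bounded_by_mono[OF bounded_by_zero] by simp
  then show ?case by (simp add: average_def act_def)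
next
  case (Cons p ys)
  obtain c h where p: "p = (c, h)" by fastforce
  have h: "h \<in> carrier G" using Cons.prems p by simp
  define d where "d = e / (2 * (cmod c + 1))"
  have d: "d > 0" using Cons.prems by (simp add: d_def add_nonneg_pos)
  have cd: "cmod c * d \<le> e / 2"
  proof -
    have "cmod c / (cmod c + 1) \<le> 1" by (simp add: divide_le_eq add_nonneg_pos)
    then have "e / 2 * (cmod c / (cmod c + 1)) \<le> e / 2 * 1" using Cons.prems by (intro mult_left_mono) auto
    then show ?thesis by (simp add: d_def mult.commute)
  qed
  have "\<forall>\<^sub>F k in sequentially. bounded_by (\<lambda>g. average k (comb ys) g - comb ys \<one> * eta g) (e / 2)"
    using Cons by simp
  with average_point_converges[OF h d] show ?case
  proof eventually_elim
    case (elim k)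
    have "bounded_by (\<lambda>g. c * (average k (comb [(1, h)]) g - f h * eta g) + (average k (comb ys) g - comb ys \<one> * eta g)) (cmod c * d + e / 2)"
      by (intro bounded_by_add bounded_by_mult elim)
    then have "bounded_by (\<lambda>g. c * (average k (comb [(1, h)]) g - f h * eta g) + (average k (comb ys) g - comb ys \<one> * eta g)) e"
      by (rule bounded_by_mono) (use cd in simp)
    moreover have "comb (p # ys) \<one> = c * f h + comb ys \<one>" using h by (simp add: comb_def p)
    moreover have "average k (comb (p # ys)) = (\<lambda>g. c * average k (comb [(1, h)]) g + average k (comb ys) g)"
      unfolding comb_Cons[of p ys] average_linear by (simp add: p)
    ultimately show ?case by (simp add: algebra_simps)
  qed
qed

text \<open>
  The means do not increase bounds, so convergence passes from finite combinations to their
  closure.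
\<close>

lemma average_converges:
  assumes F: "F \<in> space" and e: "e > 0"
  obtains k where "bounded_by (\<lambda>g. average k F g - F \<one> * eta g) e"
proof -
  obtain ys where ys: "valid ys" "bounded_by (\<lambda>g. F g - comb ys g) (e / 3)"
    using space_approx[OF F, of "e / 3"] e by auto
  have "\<forall>\<^sub>F k in sequentially. bounded_by (\<lambda>g. average k (comb ys) g - comb ys \<one> * eta g) (e / 3)"
    using ys e by (intro average_comb_converges) auto
  then obtain k where k: "bounded_by (\<lambda>g. average k (comb ys) g - comb ys \<one> * eta g) (e / 3)"
    by (auto simp: eventually_sequentially)
  have 1: "bounded_by (\<lambda>g. average k F g - average k (comb ys) g) (e / 3)"
    using bounded_by_average[OF ys(2), of k] by (simp add: average_linear)
  have 2: "bounded_by (\<lambda>g. comb ys \<one> * eta g - F \<one> * eta g) (e / 3)"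
  proof -
    have "bounded_by (\<lambda>g. (comb ys \<one> - F \<one>) * eta g) (cmod (comb ys \<one> - F \<one>) * sqrt (sq [(1, \<one>)]))"
      by (intro bounded_by_mult bounded_by_comb) simp
    moreover have "cmod (comb ys \<one> - F \<one>) \<le> e / 3" using bounded_by_eval[OF bounded_by_commute[OF ys(2)]] by simp
    ultimately show ?thesis using bounded_by_mono by (simp add: sq_def eta_one algebra_simps)
  qed
  from bounded_by_trans[OF 1 bounded_by_trans[OF k 2]] show ?thesis by (intro that[of k]) simp
qed

text \<open>An invariant vector equals all its means, hence their limit.\<close>

lemma fixed_eq:
  assumes F: "F \<in> space" and fix1: "\<And>s. s \<in> K \<Longrightarrow> act s F = F"
  shows "F = (\<lambda>g. F \<one> * eta g)"
proof (rule space_eqI[OF F])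
  fix e :: real assume "e > 0"
  then obtain k where "bounded_by (\<lambda>g. average k F g - F \<one> * eta g) e" using average_converges[OF F] by blast
  moreover have "average k F = F"
  proof
    fix g
    have "(\<Sum>s\<in>Ks k. act s F g) = (\<Sum>s\<in>Ks k. F g)"
    proof (rule sum.cong[OF refl])
      fix s assume "s \<in> Ks k"
      then have "s \<in> K" using K_eq by blast
      then show "act s F g = F g" by (simp add: fix1)
    qed
    then show "average k F g = F g" using Ks_card[of k] by (simp add: average_def)
  qed
  ultimately show "bounded_by (\<lambda>g. F g - F \<one> * eta g) e" by simp
qed simp

lemma fixed_space_kernel_hilbert: "fixed_space kernel_hilbert rho K = {a \<odot>\<^bsub>kernel_hilbert\<^esub> eta |a. True}"
proof (intro equalityI subsetI)
  fix F assume "F \<in> fixed_space kernel_hilbert rho K"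
  then have "F \<in> space" "\<And>s. s \<in> K \<Longrightarrow> act s F = F" by (auto simp: fixed_space_def)
  then show "F \<in> {a \<odot>\<^bsub>kernel_hilbert\<^esub> eta |a. True}" using fixed_eq by auto
next
  fix F assume "F \<in> {a \<odot>\<^bsub>kernel_hilbert\<^esub> eta |a. True}"
  then obtain a where "F = (\<lambda>g. a * eta g)" by auto
  then show "F \<in> fixed_space kernel_hilbert rho K"
    by (auto simp: fixed_space_def act_linear act_eta_K)
qed

lemma closed_subspace_contains:
  assumes W: "closedin (hilbert_topology kernel_hilbert) W" and F: "F \<in> space"
    and e: "\<And>e. e > 0 \<Longrightarrow> \<exists>w\<in>W. bounded_by (\<lambda>g. F g - w g) e"
  shows "F \<in> W"
proof (rule ccontr)
  interpret complex_inner_space kernel_hilbert by (rule inner_space_kernel_hilbert)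
  interpret MS: Metric_space "carrier kernel_hilbert" "hdist kernel_hilbert" by (rule Metric_space_hdist)
  assume "F \<notin> W"
  have WH: "W \<subseteq> space" and sep: "\<And>x. x \<in> space - W \<Longrightarrow> \<exists>r>0. disjnt W (MS.mball x r)"
    using W unfolding hilbert_topology_def MS.closedin_metric by auto
  obtain r where r: "r > 0" "disjnt W (MS.mball F r)" using sep[of F] F \<open>F \<notin> W\<close> by blast
  obtain w where w: "w \<in> W" "bounded_by (\<lambda>g. F g - w g) (r / 2)" using e[of "r / 2"] r by auto
  then have ws: "w \<in> space" using WH by blast
  have "hdist kernel_hilbert F w \<le> r / 2" by (rule hdist_kernel_hilbert(1)[OF F ws w(2)])
  then have "w \<in> MS.mball F r" unfolding MS.in_mball using F ws r by simp
  then show False using r w by (auto simp: disjnt_iff)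
qed

text \<open>
  A nonzero closed invariant subspace contains a vector \<open>w\<close> with \<open>w \<one>
  \<noteq> 0\<close>, after translation. It contains the means of \<open>w\<close>, hence their
  limit \<open>w \<one> \<cdot> eta\<close>, and \<open>eta\<close> is cyclic.
\<close>

lemma irreducible_kernel_hilbert: "irreducible_rep G T kernel_hilbert rho"
  unfolding irreducible_rep_def
proof (intro conjI allI impI)
  show "unitary_rep G T kernel_hilbert rho" by (rule unitary_rep_kernel_hilbert)
  have "eta \<in> space" by simp
  moreover have "eta \<noteq> (\<lambda>_. 0)" by (rule eta_nonzero)
  ultimately show "carrier kernel_hilbert \<noteq> {\<zero>\<^bsub>kernel_hilbert\<^esub>}" unfolding kernel_hilbert_simps by blast
next
  fix W assume *: "submodule W complex_ring kernel_hilbert \<and> closedin (hilbert_topology kernel_hilbert) W \<and> (\<forall>g\<in>carrier G. rho g ` W \<subseteq> W)"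
  then have sub: "submodule W complex_ring kernel_hilbert" and closed: "closedin (hilbert_topology kernel_hilbert) W" by blast+
  have sg: "subgroup W (add_monoid kernel_hilbert)" using sub by (simp add: submodule_def)
  have Ws: "W \<subseteq> space" using subgroup.subset[OF sg] by simp
  have zero: "(\<lambda>_. 0) \<in> W" using subgroup.one_closed[OF sg] by simp
  have add: "(\<lambda>g. v g + w g) \<in> W" if "v \<in> W" "w \<in> W" for v w
    using subgroup.m_closed[OF sg that] by simp
  have smult: "(\<lambda>g. a * w g) \<in> W" if "w \<in> W" for a w
    using submodule.smult_closed[OF sub, of a w] that by simp
  have inv: "act g w \<in> W" if "g \<in> carrier G" "w \<in> W" for g w
  proof -
    have "rho g ` W \<subseteq> W" using * that(1) by simp
    then have "rho g w \<in> W" using that(2) by (rule subsetD[OF _ imageI])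
    moreover have "w \<in> space" using that Ws by blast
    ultimately show ?thesis by simp
  qed
  show "W = {\<zero>\<^bsub>kernel_hilbert\<^esub>} \<or> W = carrier kernel_hilbert"
  proof (cases "W = {\<zero>\<^bsub>kernel_hilbert\<^esub>}")
    case False
    then have "W \<noteq> {\<lambda>_. 0}" unfolding kernel_hilbert_simps(2) .
    then obtain w0 where w0: "w0 \<in> W" "w0 \<noteq> (\<lambda>_. 0)" using zero by blast
    then obtain g where g: "w0 g \<noteq> 0" by (auto simp: fun_eq_iff)
    then have gG: "g \<in> carrier G" using space_out[of w0 g] w0 Ws by auto
    \<comment> \<open>The translate takes the nonzero value \<open>w0 g\<close> at \<open>\<one>\<close>.\<close>
    define w where "w = act (inv g) w0"
    have w1: "w \<in> W" unfolding w_def using gG w0(1) by (intro inv) auto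
    have w2: "w \<one> \<noteq> 0" using g gG by (simp add: w_def act_def)
    note w = w1 w2
    have averageW: "average k w \<in> W" for k
    proof -
      have "(\<lambda>g. \<Sum>s\<in>S. act s w g) \<in> W" if "finite S" "S \<subseteq> carrier G" for S
        using that by (induction S rule: finite_induct) (auto simp: zero intro!: add inv w)
      then have "(\<lambda>g. \<Sum>s\<in>Ks k. act s w g) \<in> W" using finite_Ks Ks_carrier by blast
      from smult[OF this, of "1 / of_nat (card (Ks k))"] show ?thesis by (simp add: average_def[abs_def])
    qed
    have "(\<lambda>g. w \<one> * eta g) \<in> W"
    proof (rule closed_subspace_contains[OF closed])
      fix e :: real assume "e > 0"
      then obtain k where k: "bounded_by (\<lambda>g. average k w g - w \<one> * eta g) e" using average_converges[of w] w Ws by blast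
      show "\<exists>v\<in>W. bounded_by (\<lambda>g. w \<one> * eta g - v g) e" 
      proof (rule bexI)
        show "average k w \<in> W" by (rule averageW)
      qed (rule bounded_by_commute[OF k])
    qed simp
    from smult[OF this, of "1 / w \<one>"] have "eta \<in> W" using w(2) by simp
    note etaW = this
    have point: "comb [(1, h)] \<in> W" if "h \<in> carrier G" for h
      using inv[OF that etaW] unfolding act_eta[OF that] .
    have combW: "comb ys \<in> W" if "valid ys" for ys
      using that
    proof (induction ys)
      case (Cons p ys)
      then have "(\<lambda>g. fst p * comb [(1, snd p)] g + comb ys g) \<in> W" by (intro add smult point) auto
      then show ?case by (subst comb_Cons)
    qed (simp add: zero)
    have "F \<in> W" if F: "F \<in> space" for F
    proof (rule closed_subspace_contains[OF closed F])
      fix e :: real assume "e > 0"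
      then show "\<exists>w\<in>W. bounded_by (\<lambda>g. F g - w g) e" using space_approx[OF F] combW by blast
    qed
    then show ?thesis using Ws by auto
  qed simp
qed

theorem kernel_in_spherical_functions:
  "restrict f (carrier G) \<in> spherical_functions TYPE('g \<Rightarrow> complex) G T K"
proof -
  have etaK: "eta \<in> fixed_space kernel_hilbert rho K"
    unfolding fixed_space_def by (auto simp: act_eta_K)
  have "one_dimensional kernel_hilbert (fixed_space kernel_hilbert rho K)"
    unfolding one_dimensional_def
  proof (intro bexI[OF _ etaK] conjI)
    show "eta \<noteq> \<zero>\<^bsub>kernel_hilbert\<^esub>" using eta_nonzero by simp
  qed (rule fixed_space_kernel_hilbert)
  then have "spherical_rep G T K kernel_hilbert rho"
    by (simp add: spherical_rep_def irreducible_kernel_hilbert)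
  moreover have "cinner kernel_hilbert eta eta = 1" by (simp add: ip_comb eta_one)
  moreover have "restrict f (carrier G) = (\<lambda>g\<in>carrier G. cinner kernel_hilbert (rho g eta) eta)"
    by (auto simp: fun_eq_iff act_eta ip_comb comb_def)
  ultimately show ?thesis using etaK unfolding spherical_functions_def by blast
qed

end

section \<open>Sampling without replacement\<close>

text \<open>
  The samples without replacement from \<open>X\<close>, indexed by \<open>I\<close>.
\<close>

definition inj_maps :: "'a set \<Rightarrow> 'b set \<Rightarrow> ('a \<Rightarrow> 'b) set" where
  "inj_maps I X = {h \<in> I \<rightarrow>\<^sub>E X. inj_on h I}"

lemma finite_inj_maps: "finite I \<Longrightarrow> finite X \<Longrightarrow> finite (inj_maps I X)"
  unfolding inj_maps_def by (rule finite_subset[OF _ finite_PiE]) auto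

lemma inj_extends_to_permutation:
  assumes X: "finite X" and p: "p ` I \<subseteq> X" "inj_on p I" and h: "h ` I \<subseteq> X" "inj_on h I"
  obtains r where "r permutes X" "\<And>i. i \<in> I \<Longrightarrow> r (p i) = h i"
proof -
  have "card (p ` I) = card (h ` I)"
    using p h by (simp add: card_image)
  then have "card (X - p ` I) = card (X - h ` I)"
    using p h X by (simp add: card_Diff_subset finite_subset)
  then obtain g where g: "bij_betw g (X - p ` I) (X - h ` I)"
    using X by (metis finite_Diff finite_same_card_bij)
  define r where "r x = (if x \<in> p ` I then h (inv_into I p x) else if x \<in> X then g x else x)" for x
  have "bij_betw (h \<circ> inv_into I p) (p ` I) (h ` I)"
    using bij_betw_trans[OF bij_betw_inv_into[OF inj_on_imp_bij_betw[OF p(2)]]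
        inj_on_imp_bij_betw[OF h(2)]] .
  then have "bij_betw r (p ` I) (h ` I)"
    by (rule bij_betw_cong[THEN iffD1, rotated]) (simp add: r_def)
  moreover have "bij_betw r (X - p ` I) (X - h ` I)"
    using g by (rule bij_betw_cong[THEN iffD1, rotated]) (simp add: r_def)
  ultimately have "bij_betw r (p ` I \<union> (X - p ` I)) (h ` I \<union> (X - h ` I))"
    by (rule bij_betw_combine) auto
  then have "bij_betw r X X"
    using p h by (simp add: Un_absorb1)
  moreover have "r x = x" if "x \<notin> X" for x
    using that p by (auto simp: r_def)
  ultimately have "r permutes X" by (rule bij_imp_permutes)
  moreover have "r (p i) = h i" if "i \<in> I" for i
    using that p by (simp add: r_def)
  ultimately show ?thesis using that by blast
qed

text \<open>
  Under a uniformly random permutation the images of the distinct points \<open>p i\<close> form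
  a uniformly random sample without replacement: the left-hand sum depends only on
  \<open>I\<close>, not on \<open>p\<close>, so it may be averaged over all choices of
  \<open>p\<close>.
\<close>

lemma sum_permutations_eq_sum_inj_maps:
  fixes F :: "('a \<Rightarrow> 'b) \<Rightarrow> 'c :: {comm_semiring_1,semiring_char_0}"
  assumes X: "finite X" and I: "finite I" and p: "p ` I \<subseteq> X" "inj_on p I"
  shows "of_nat (card (inj_maps I X)) * (\<Sum>s | s permutes X. F (\<lambda>i\<in>I. s (p i)))
       = fact (card X) * (\<Sum>h\<in>inj_maps I X. F h)"
proof -
  have *: "(\<Sum>s | s permutes X. F (\<lambda>i\<in>I. s (p i))) = (\<Sum>s | s permutes X. F (\<lambda>i\<in>I. s (h i)))"
    if h: "h \<in> inj_maps I X" for h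
  proof -
    obtain r where r: "r permutes X" "\<And>i. i \<in> I \<Longrightarrow> r (p i) = h i"
      using inj_extends_to_permutation[OF X p, of h] h by (auto simp: inj_maps_def)
    have "(\<Sum>s | s permutes X. F (\<lambda>i\<in>I. s (p i))) = (\<Sum>s | s permutes X. F (\<lambda>i\<in>I. (s \<circ> r) (p i)))"
      using sum_permutations_compose_right[OF r(1), of "\<lambda>s. F (\<lambda>i\<in>I. s (p i))"] by simp
    also have "\<dots> = (\<Sum>s | s permutes X. F (\<lambda>i\<in>I. s (h i)))"
      by (intro sum.cong refl arg_cong[where f = F]) (auto simp: r(2))
    finally show ?thesis .
  qed
  have "of_nat (card (inj_maps I X)) * (\<Sum>s | s permutes X. F (\<lambda>i\<in>I. s (p i)))
      = (\<Sum>h\<in>inj_maps I X. \<Sum>s | s permutes X. F (\<lambda>i\<in>I. s (p i)))"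
    by simp
  also have "\<dots> = (\<Sum>h\<in>inj_maps I X. \<Sum>s | s permutes X. F (\<lambda>i\<in>I. s (h i)))"
    by (intro sum.cong refl *)
  also have "\<dots> = (\<Sum>s | s permutes X. \<Sum>h\<in>inj_maps I X. F (\<lambda>i\<in>I. s (h i)))"
    by (rule sum.swap)
  also have "\<dots> = (\<Sum>s | s permutes X. \<Sum>h\<in>inj_maps I X. F h)"
  proof (rule sum.cong[OF refl])
    fix s assume "s \<in> {s. s permutes X}"
    then have s: "s permutes X" by simp
    then have i: "inv_into UNIV s permutes X" by (rule permutes_inv)
    note ss = permutes_inverses[OF s]
    have "(\<lambda>i\<in>I. t (h i)) \<in> inj_maps I X" if "t permutes X" "h \<in> inj_maps I X" for t h
      using that by (auto simp: inj_maps_def inj_on_def permutes_in_image dest: permutes_inj injD)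
    then show "(\<Sum>h\<in>inj_maps I X. F (\<lambda>i\<in>I. s (h i))) = (\<Sum>h\<in>inj_maps I X. F h)"
      using s i
      by (intro sum.reindex_bij_witness[where i = "\<lambda>h. \<lambda>i\<in>I. inv_into UNIV s (h i)" and j = "\<lambda>h. \<lambda>i\<in>I. s (h i)"])
        (auto simp: ss inj_maps_def fun_eq_iff PiE_def extensional_def)
  qed
  also have "\<dots> = fact (card X) * (\<Sum>h\<in>inj_maps I X. F h)"
    using card_permutations[OF refl X] by (simp add: of_nat_fact)
  finally show ?thesis .
qed

text \<open>
  The fraction of injective maps among all maps is $\prod_{i<d}(1-i/|X|)$ with $d=|I|$, which is
  at least $1-\sum_{i<d}i/|X|$.
\<close>

lemma card_inj_maps_ge:
  assumes "finite X" "finite I" "X \<noteq> {}"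
  shows "real (card X) ^ card I * (1 - real ((card I)\<^sup>2) / real (card X)) \<le> real (card (inj_maps I X))"
proof (cases "card I \<le> card X")
  case True
  let ?n = "card X" and ?d = "card I"
  have n: "real ?n > 0" using assms by (simp add: card_gt_0_iff)
  have "card (inj_maps I X) = prod ((-) ?n) {0..<?d}"
    using card_inj_on_subset_funcset[OF assms(2,1), of I] by (simp add: inj_maps_def)
  then have "real (card (inj_maps I X)) = (\<Prod>i\<in>{0..<?d}. real ?n * (1 - real i / real ?n))"
    using n True by (simp add: of_nat_diff algebra_simps)
  also have "\<dots> = real ?n ^ ?d * (\<Prod>i\<in>{0..<?d}. 1 - real i / real ?n)"
    by (simp add: prod.distrib)
  finally have e: "real (card (inj_maps I X)) = real ?n ^ ?d * (\<Prod>i\<in>{0..<?d}. 1 - real i / real ?n)" .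
  have "1 - real (?d\<^sup>2) / real ?n \<le> 1 - (\<Sum>i\<in>{0..<?d}. real i / real ?n)"
  proof -
    have "(\<Sum>i\<in>{0..<?d}. real i / real ?n) \<le> (\<Sum>i\<in>{0..<?d}. real ?d / real ?n)"
      using n by (intro sum_mono divide_right_mono) auto
    then show ?thesis by (simp add: power2_eq_square)
  qed
  also have "\<dots> \<le> (\<Prod>i\<in>{0..<?d}. 1 - real i / real ?n)"
    using n True by (intro Weierstrass_prod_ineq) auto
  finally show ?thesis using e n by (simp add: mult_left_mono)
next
  case False
  then have "real (card X) \<le> real (card I)" by simp
  moreover have "0 < real (card X)" using assms by (simp add: card_gt_0_iff)
  moreover have "real (card I) * 1 \<le> real (card I) * real (card I)"
    using False by (intro mult_left_mono) auto
  ultimately have "real (card X) \<le> real (card I) * real (card I)" "0 < real (card X)" by linarith+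
  then have "1 - real ((card I)\<^sup>2) / real (card X) \<le> 0" by (simp add: power2_eq_square)
  then have "real (card X) ^ card I * (1 - real ((card I)\<^sup>2) / real (card X)) \<le> 0"
    by (intro mult_nonneg_nonpos) auto
  then show ?thesis by linarith
qed

text \<open>
  Sampling with replacement differs from sampling without replacement only by the samples with a
  repetition, a fraction of at most $|I|^2/|X|$; they change the sum, and they change the number
  by which it is divided.
\<close>

lemma average_permutations_approx:
  fixes F :: "('a \<Rightarrow> 'b) \<Rightarrow> complex"
  assumes X: "finite X" "X \<noteq> {}" and I: "finite I" and p: "p ` I \<subseteq> X" "inj_on p I"
    and F: "\<And>h. h \<in> I \<rightarrow>\<^sub>E X \<Longrightarrow> cmod (F h) \<le> 1"
  shows "cmod ((\<Sum>s | s permutes X. F (\<lambda>i\<in>I. s (p i))) / fact (card X)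
             - (\<Sum>h\<in>I \<rightarrow>\<^sub>E X. F h) / of_nat (card X) ^ card I)
         \<le> 2 * real ((card I)\<^sup>2) / real (card X)"
proof -
  let ?J = "inj_maps I X" and ?E = "I \<rightarrow>\<^sub>E X"
  let ?A = "\<Sum>h\<in>?J. F h" and ?j = "real (card ?J)" and ?e = "real (card X) ^ card I"
  have sub: "?J \<subseteq> ?E" by (auto simp: inj_maps_def)
  have fin: "finite ?E" using X I by (simp add: finite_PiE)
  have e: "?e = real (card ?E)" using I by (simp add: card_funcsetE)
  have e0: "?e > 0" using X by (simp add: card_gt_0_iff)
  have je: "?j \<le> ?e" unfolding e using card_mono[OF fin sub] by simp
  have "(\<lambda>i\<in>I. p i) \<in> ?J" using p by (auto simp: inj_maps_def inj_on_def)
  then have j0: "?j > 0" using finite_inj_maps[OF I X(1)] by (auto simp: card_gt_0_iff)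
  have s: "(\<Sum>s | s permutes X. F (\<lambda>i\<in>I. s (p i))) / fact (card X) = ?A / of_real ?j"
    using sum_permutations_eq_sum_inj_maps[OF X(1) I p, of F] j0 by (simp add: field_simps)
  have split: "(\<Sum>h\<in>?E. F h) = ?A + (\<Sum>h\<in>?E - ?J. F h)"
    using sum.subset_diff[OF sub fin, of F] by (simp add: add.commute)
  have A: "cmod ?A \<le> ?j"
  proof -
    have "cmod ?A \<le> (\<Sum>h\<in>?J. 1)" by (rule sum_norm_le) (use F sub in auto)
    then show ?thesis by simp
  qed
  have B: "cmod (\<Sum>h\<in>?E - ?J. F h) \<le> ?e - ?j"
  proof -
    have "cmod (\<Sum>h\<in>?E - ?J. F h) \<le> (\<Sum>h\<in>?E - ?J. 1)" by (rule sum_norm_le) (use F in auto)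
    also have "\<dots> = ?e - ?j"
      using card_Diff_subset[OF finite_subset[OF sub fin] sub] card_mono[OF fin sub]
      unfolding e by (simp add: of_nat_diff)
    finally show ?thesis .
  qed
  have "?A / of_real ?j - (\<Sum>h\<in>?E. F h) / of_real ?e
      = ?A * of_real ((?e - ?j) / (?j * ?e)) - (\<Sum>h\<in>?E - ?J. F h) / of_real ?e"
    unfolding split using j0 e0 by (simp add: field_simps)
  also have "cmod \<dots> \<le> cmod ?A * ((?e - ?j) / (?j * ?e)) + cmod (\<Sum>h\<in>?E - ?J. F h) / ?e"
  proof (rule order_trans[OF norm_triangle_ineq4], rule add_mono)
    show "cmod (?A * of_real ((?e - ?j) / (?j * ?e))) \<le> cmod ?A * ((?e - ?j) / (?j * ?e))"
      unfolding norm_mult norm_of_real using je j0 e0 by simp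
    show "cmod ((\<Sum>h\<in>?E - ?J. F h) / of_real ?e) \<le> cmod (\<Sum>h\<in>?E - ?J. F h) / ?e"
      unfolding norm_divide norm_of_real using e0 by simp
  qed
  also have "\<dots> \<le> ?j * ((?e - ?j) / (?j * ?e)) + (?e - ?j) / ?e"
    using A B je j0 e0 by (intro add_mono mult_right_mono divide_right_mono) auto
  also have "\<dots> = 2 * (?e - ?j) / ?e" using j0 by simp
  also have "\<dots> \<le> 2 * real ((card I)\<^sup>2) / real (card X)"
  proof -
    have "?e - ?j \<le> ?e * (real ((card I)\<^sup>2) / real (card X))"
      using card_inj_maps_ge[OF X(1) I X(2)] by (simp add: algebra_simps)
    then show ?thesis using e0 by (simp add: field_simps)
  qed
  finally show ?thesis using s by simp
qed

section \<open>Products over randomly permuted positions\<close>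

lemma sum_PiE_insert:
  fixes F :: "('a \<Rightarrow> 'b) \<Rightarrow> 'c :: comm_monoid_add"
  assumes "x \<notin> S"
  shows "(\<Sum>h\<in>PiE (insert x S) T. F h) = (\<Sum>y\<in>T x. \<Sum>g\<in>PiE S T. F (g(x := y)))"
proof -
  have "(\<Sum>h\<in>PiE (insert x S) T. F h) = (\<Sum>(y, g)\<in>T x \<times> PiE S T. F (g(x := y)))"
    using assms
    by (intro sum.reindex_bij_witness[of _ "\<lambda>(y,g). g(x := y)" "\<lambda>g. (g x, g(x := undefined))"])
       (auto simp: PiE_def extensional_def)
  then show ?thesis by (simp add: sum.cartesian_product)
qed

text \<open>
  Exchanging the images of \<open>a i \<in> A\<close> and \<open>b i \<notin> A\<close> before
  summing over all permutations changes nothing, so the factor at \<open>a i\<close> may be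
  replaced by the mean of the two factors. For values on the unit circle, these means have
  absolute value less than 1 where the two values differ.
\<close>

lemma sum_permutations_swap_pairs:
  fixes f :: "'a \<Rightarrow> complex" and a b :: "nat \<Rightarrow> 'a"
  assumes X: "finite X" "A \<subseteq> X"
    and a: "inj_on a {..<q}" "a ` {..<q} \<subseteq> A" and b: "inj_on b {..<q}" "b ` {..<q} \<subseteq> X - A"
    and "r \<le> q"
  shows "(\<Sum>s | s permutes X. \<Prod>x\<in>A. f (s x))
       = (\<Sum>s | s permutes X. (\<Prod>x\<in>A - a ` {..<r}. f (s x)) * (\<Prod>i<r. (f (s (a i)) + f (s (b i))) / 2))"
  using \<open>r \<le> q\<close>
proof (induction r)
  case (Suc r)
  define R where "R = A - a ` {..<Suc r}"
  define g where "g s = (\<Prod>x\<in>R. f (s x)) * (\<Prod>i<r. (f (s (a i)) + f (s (b i))) / 2)" for s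
  let ?T = "Transposition.transpose (a r) (b r)"
  have r: "r < q" using Suc by simp
  have fin: "finite A" using X finite_subset by blast
  have ar: "a r \<in> X" "b r \<in> X" using a b r X by auto
  have T: "?T permutes X" using ar by (intro permutes_swap_id)
  have "A - a ` {..<r} = insert (a r) R" "a r \<notin> R"
    using a r by (auto simp: R_def lessThan_Suc dest!: inj_onD[OF a(1)])
  then have split: "(\<Prod>x\<in>A - a ` {..<r}. f (s x)) = f (s (a r)) * (\<Prod>x\<in>R. f (s x))" for s
    using fin by (simp add: R_def)
  have fixR: "?T x = x" if "x \<in> R" for x
    using that b r by (auto simp: R_def lessThan_Suc Transposition.transpose_def)
  have fixp: "?T (a i) = a i \<and> ?T (b i) = b i" if "i < r" for i
  proof -
    have i: "i < q" using that r by simp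
    have "a i \<noteq> a r" "b i \<noteq> b r" using that i r a b by (auto simp: inj_on_def)
    moreover have "a i \<in> A" "b i \<notin> A" "a r \<in> A" "b r \<notin> A" using i r a b by auto
    ultimately show ?thesis by (metis transpose_apply_other)
  qed
  \<comment> \<open>The other factors do not involve the images of \<open>a r\<close> and \<open>b r\<close>.\<close>
  have gT: "g (s \<circ> ?T) = g s" for s
    unfolding g_def by (intro arg_cong2[where f = "(*)"] prod.cong refl) (auto simp: fixR fixp)
  have "(\<Sum>s | s permutes X. g s * f (s (a r))) = (\<Sum>s | s permutes X. g (s \<circ> ?T) * f ((s \<circ> ?T) (a r)))"
    using sum_permutations_compose_right[OF T, of "\<lambda>s. g s * f (s (a r))"] by simp
  also have "\<dots> = (\<Sum>s | s permutes X. g s * f (s (b r)))" by (simp add: gT)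
  finally have eq: "(\<Sum>s | s permutes X. g s * f (s (a r))) = (\<Sum>s | s permutes X. g s * f (s (b r)))" .
  have "(\<Sum>s | s permutes X. \<Prod>x\<in>A. f (s x)) = (\<Sum>s | s permutes X. g s * f (s (a r)))"
    using Suc unfolding split g_def by (simp add: algebra_simps)
  also have "\<dots> = ((\<Sum>s | s permutes X. g s * f (s (a r))) + (\<Sum>s | s permutes X. g s * f (s (b r)))) / 2"
    using eq by simp
  also have "\<dots> = (\<Sum>s | s permutes X. g s * ((f (s (a r)) + f (s (b r))) / 2))"
    unfolding sum.distrib[symmetric] sum_divide_distrib by (intro sum.cong refl) (simp add: algebra_simps)
  finally show ?case by (simp add: g_def R_def mult.assoc)
qed simp

text \<open>
  The second Bonferroni inequality for independent events of probabilities \<open>w i\<close>.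
\<close>

lemma prod_one_minus_le:
  fixes w :: "nat \<Rightarrow> real"
  assumes "\<And>i. i < r \<Longrightarrow> 0 \<le> w i \<and> w i \<le> 1"
  shows "(\<Prod>i<r. 1 - w i) \<le> 1 - (\<Sum>i<r. w i) + (\<Sum>i<r. \<Sum>j<i. w i * w j)"
  using assms
proof (induction r)
  case (Suc r)
  have w: "0 \<le> w r" "w r \<le> 1" using Suc.prems by auto
  have "1 - (\<Sum>i<r. w i) \<le> (\<Prod>i<r. 1 - w i)"
    using Suc.prems by (intro Weierstrass_prod_ineq) auto
  then have "w r * (1 - (\<Sum>i<r. w i)) \<le> w r * (\<Prod>i<r. 1 - w i)" using w by (intro mult_left_mono)
  moreover have "(\<Prod>i<r. 1 - w i) \<le> 1 - (\<Sum>i<r. w i) + (\<Sum>i<r. \<Sum>j<i. w i * w j)"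
    using Suc by auto
  ultimately show ?case by (simp add: algebra_simps sum_distrib_left)
qed simp

text \<open>
  Since \<open>w\<close> vanishes on the diagonal, passing to samples without replacement only
  decreases the number of samples, not the sum.
\<close>

lemma average_pair_ge:
  fixes w :: "'a \<Rightarrow> 'a \<Rightarrow> real"
  assumes X: "finite X" and p: "p \<in> X" "p' \<in> X" "p \<noteq> p'"
    and w: "\<And>x y. 0 \<le> w x y" "\<And>x. w x x = 0"
  shows "(\<Sum>x\<in>X. \<Sum>y\<in>X. w x y) / real (card X) ^ 2
      \<le> (\<Sum>s | s permutes X. w (s p) (s p')) / fact (card X)"
proof -
  let ?I = "{0, 1} :: nat set" and ?S = "\<Sum>x\<in>X. \<Sum>y\<in>X. w x y"
  let ?p = "\<lambda>i::nat. if i = 0 then p else p'" and ?F = "\<lambda>h. w (h 0) (h (1::nat))"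
  have card: "card ?I = 2" by simp
  have "?S = (\<Sum>h\<in>?I \<rightarrow>\<^sub>E X. ?F h)"
    by (simp add: sum_PiE_insert PiE_empty_domain)
  also have "\<dots> = (\<Sum>h\<in>inj_maps ?I X. ?F h)"
    using X w(2) by (intro sum.mono_neutral_right finite_PiE) (auto simp: inj_maps_def inj_on_def)
  finally have S: "?S = (\<Sum>h\<in>inj_maps ?I X. ?F h)" .
  have "of_nat (card (inj_maps ?I X)) * (\<Sum>s | s permutes X. ?F (\<lambda>i\<in>?I. s (?p i)))
       = fact (card X) * (\<Sum>h\<in>inj_maps ?I X. ?F h)"
    using p by (intro sum_permutations_eq_sum_inj_maps X) (auto simp: inj_on_def)
  then have e: "real (card (inj_maps ?I X)) * ((\<Sum>s | s permutes X. w (s p) (s p')) / fact (card X)) = ?S"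
    unfolding S by (simp add: field_simps)
  have "card (inj_maps ?I X) \<le> card (?I \<rightarrow>\<^sub>E X)"
    using X by (intro card_mono finite_PiE) (auto simp: inj_maps_def)
  then have "real (card (inj_maps ?I X)) \<le> real (card X) ^ 2"
    using card_funcsetE[of ?I X] unfolding card by (metis finite.emptyI finite.insertI of_nat_le_iff of_nat_power)
  then have "real (card (inj_maps ?I X)) * ((\<Sum>s | s permutes X. w (s p) (s p')) / fact (card X))
     \<le> real (card X) ^ 2 * ((\<Sum>s | s permutes X. w (s p) (s p')) / fact (card X))"
    by (intro mult_right_mono divide_nonneg_nonneg sum_nonneg) (auto simp: w)
  moreover have "card X > 0" using X p by (auto simp: card_gt_0_iff)
  ultimately show ?thesis unfolding e by (simp add: divide_le_eq mult.commute)
qed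

text \<open>
  Two pairs of distinct points are not independent, but nonnegativity of \<open>w\<close> allows
  to compare their sum with that over all quadruples, and at least two thirds of the quadruples
  are without repetition.
\<close>

lemma average_two_pairs_le:
  fixes w :: "'a \<Rightarrow> 'a \<Rightarrow> real"
  assumes X: "finite X" "card X \<ge> 48" and p: "p ` {0,1,2,3} \<subseteq> X" "inj_on p {0,1,2,3::nat}"
    and w: "\<And>x y. 0 \<le> w x y"
  shows "(\<Sum>s | s permutes X. w (s (p 0)) (s (p 1)) * w (s (p 2)) (s (p 3))) / fact (card X)
      \<le> 3/2 * ((\<Sum>x\<in>X. \<Sum>y\<in>X. w x y) / real (card X) ^ 2)\<^sup>2"
proof -
  let ?I = "{0,1,2,3} :: nat set" and ?S = "\<Sum>x\<in>X. \<Sum>y\<in>X. w x y"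
  let ?F = "\<lambda>h. w (h 0) (h (1::nat)) * w (h 2) (h 3)"
  let ?j = "real (card (inj_maps ?I X))"
  have card: "card ?I = 4" by simp
  have fin: "finite ?I" by simp
  have "?S\<^sup>2 = (\<Sum>h\<in>?I \<rightarrow>\<^sub>E X. ?F h)"
    by (simp add: sum_PiE_insert PiE_empty_domain power2_eq_square
        flip: sum_distrib_left sum_distrib_right)
  moreover have "(\<Sum>h\<in>inj_maps ?I X. ?F h) \<le> (\<Sum>h\<in>?I \<rightarrow>\<^sub>E X. ?F h)"
    using X w by (intro sum_mono2 finite_PiE) (auto simp: inj_maps_def)
  ultimately have S: "(\<Sum>h\<in>inj_maps ?I X. ?F h) \<le> ?S\<^sup>2" by simp
  have "of_nat (card (inj_maps ?I X)) * (\<Sum>s | s permutes X. ?F (\<lambda>i\<in>?I. s (p i)))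
       = fact (card X) * (\<Sum>h\<in>inj_maps ?I X. ?F h)"
    using p X by (intro sum_permutations_eq_sum_inj_maps) auto
  then have e: "?j * ((\<Sum>s | s permutes X. w (s (p 0)) (s (p 1)) * w (s (p 2)) (s (p 3))) / fact (card X))
     = (\<Sum>h\<in>inj_maps ?I X. ?F h)"
    by (simp add: field_simps)
  have "X \<noteq> {}" using X by auto
  then have "real (card X) ^ 4 * (1 - 16 / real (card X)) \<le> ?j"
    using card_inj_maps_ge[OF X(1) fin] unfolding card by simp
  \<comment> \<open>This is where \<open>48 = 3 * 16\<close> comes from: \<open>1 - 16 / card X \<ge> 2/3\<close>.\<close>
  moreover have "real (card X) ^ 4 * (2/3) \<le> real (card X) ^ 4 * (1 - 16 / real (card X))"
    using X by (intro mult_left_mono) (auto simp: field_simps)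
  ultimately have j: "real (card X) ^ 4 * (2/3) \<le> ?j" by linarith
  let ?V = "(\<Sum>s | s permutes X. w (s (p 0)) (s (p 1)) * w (s (p 2)) (s (p 3))) / fact (card X)"
  have "0 \<le> ?V" by (intro divide_nonneg_nonneg sum_nonneg) (auto simp: w)
  then have "real (card X) ^ 4 * (2/3) * ?V \<le> ?S\<^sup>2"
    using mult_right_mono[OF j] e S by fastforce
  moreover have "card X > 0" using X by simp
  ultimately show ?thesis by (simp add: field_simps power_divide)
qed

text \<open>
  Here $|(u+v)/2|^2=(1+\mathrm{Re}(u\bar v))/2$, and $1-c\ge(1-c^2)/2$ for \<open>c \<le>
  1\<close>.
\<close>

lemma pair_defect:
  fixes u v :: complex
  assumes "cmod u = 1" "cmod v = 1"
  shows "cmod ((u + v) / 2) \<le> 1" "(1 - Re (u * cnj v)) / 4 \<le> 1 - cmod ((u + v) / 2)"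
proof -
  let ?c = "cmod ((u + v) / 2)"
  show c: "?c \<le> 1" using norm_triangle_ineq[of u v] assms by (simp add: norm_divide)
  have "(cmod (u + v))\<^sup>2 = (cmod u)\<^sup>2 + (cmod v)\<^sup>2 + 2 * Re (u * cnj v)"
    unfolding cmod_power2 by (simp add: power2_eq_square algebra_simps)
  then have "?c\<^sup>2 = (1 + Re (u * cnj v)) / 2"
    using assms by (simp add: norm_divide power_divide)
  moreover have "(1 - ?c) * (1 + ?c) = 1 - ?c\<^sup>2" by (simp add: power2_eq_square algebra_simps)
  ultimately have "(1 - Re (u * cnj v)) / 2 = (1 - ?c) * (1 + ?c)" by (simp add: field_simps)
  also have "\<dots> \<le> (1 - ?c) * 2" using c by (intro mult_left_mono) auto
  finally show "(1 - Re (u * cnj v)) / 4 \<le> 1 - ?c" by simp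
qed

text \<open>
  After swapping \<open>r\<close> pairs at random, the summands have absolute value
  $\prod_{i<r}(1-w_i)$, where $w_i$ is the defect of the \<open>i\<close>-th pair. With
  \<open>S\<close> the mean defect, Bonferroni bounds the average by $1-y+\frac34y^2$ for
  \<open>y = r S\<close>, and this is at most 3/4 for \<open>y\<close> in \<open>[1/2,
  1]\<close>. As \<open>r \<le> q\<close> is free, a large average forces \<open>q S <
  1\<close>.
\<close>

lemma large_average_imp_nearly_constant:
  fixes f :: "'a \<Rightarrow> complex" and a b :: "nat \<Rightarrow> 'a"
  assumes X: "finite X" "A \<subseteq> X" "card X \<ge> 48"
    and a: "inj_on a {..<q}" "a ` {..<q} \<subseteq> A" and b: "inj_on b {..<q}" "b ` {..<q} \<subseteq> X - A"
    and f: "\<And>x. cmod (f x) = 1" and q: "q > 0"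
    and large: "cmod ((\<Sum>s | s permutes X. \<Prod>x\<in>A. f (s x)) / fact (card X)) > 3/4"
  shows "(\<Sum>x\<in>X. \<Sum>y\<in>X. 1 - Re (f x * cnj (f y))) \<le> 4 * real (card X) ^ 2 / real q"
proof -
  define w where "w x y = 1 - cmod ((f x + f y) / 2)" for x y
  let ?P = "{s. s permutes X}" and ?n = "fact (card X) :: real"
  define S where "S = (\<Sum>x\<in>X. \<Sum>y\<in>X. w x y) / real (card X) ^ 2"
  have w01: "0 \<le> w x y" "w x y \<le> 1" for x y using pair_defect(1)[OF f f, of x y] by (auto simp: w_def)
  have w0: "w x x = 0" for x using f by (simp add: w_def)
  have fin: "finite ?P" using X by (simp add: finite_permutations)
  have cardP: "real (card ?P) = ?n" using card_permutations[OF refl X(1)] by (simp add: of_nat_fact)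
  have key: "3/4 < 1 - real r * S + 3/4 * (real r * S)\<^sup>2" if r: "r \<le> q" for r
  proof -
    have ab: "a i \<in> X" "b i \<in> X" "a i \<noteq> b i" if "i < r" for i
    proof -
      have "i < q" using that r by simp
      then show "a i \<in> X" "b i \<in> X" "a i \<noteq> b i" using a b X by auto
    qed
    have bound: "cmod ((\<Prod>x\<in>A - a ` {..<r}. f (s x)) * (\<Prod>i<r. (f (s (a i)) + f (s (b i))) / 2))
        \<le> 1 - (\<Sum>i<r. w (s (a i)) (s (b i))) + (\<Sum>i<r. \<Sum>j<i. w (s (a i)) (s (b i)) * w (s (a j)) (s (b j)))" for s
    proof -
      have "cmod ((\<Prod>x\<in>A - a ` {..<r}. f (s x)) * (\<Prod>i<r. (f (s (a i)) + f (s (b i))) / 2))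
          = (\<Prod>i<r. 1 - w (s (a i)) (s (b i)))"
        by (simp add: norm_mult f w_def flip: prod_norm)
      also have "\<dots> \<le> 1 - (\<Sum>i<r. w (s (a i)) (s (b i))) + (\<Sum>i<r. \<Sum>j<i. w (s (a i)) (s (b i)) * w (s (a j)) (s (b j)))"
        by (rule prod_one_minus_le) (auto simp: w01)
      finally show ?thesis .
    qed
    have "3/4 * ?n < cmod (\<Sum>s\<in>?P. \<Prod>x\<in>A. f (s x))"
      using large by (simp add: norm_divide field_simps)
    also have "\<dots> \<le> (\<Sum>s\<in>?P. 1 - (\<Sum>i<r. w (s (a i)) (s (b i))) + (\<Sum>i<r. \<Sum>j<i. w (s (a i)) (s (b i)) * w (s (a j)) (s (b j))))"
      unfolding sum_permutations_swap_pairs[OF X(1,2) a b r, of f] by (intro sum_norm_le bound)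
    also have "\<dots> = ?n - (\<Sum>i<r. \<Sum>s\<in>?P. w (s (a i)) (s (b i)))
        + (\<Sum>i<r. \<Sum>j<i. \<Sum>s\<in>?P. w (s (a i)) (s (b i)) * w (s (a j)) (s (b j)))"
      by (simp add: sum.distrib sum_subtractf cardP sum.swap[of _ _ ?P])
    also have "\<dots> \<le> ?n - (\<Sum>i<r. ?n * S) + (\<Sum>i<r. \<Sum>j<i. ?n * (3/2 * S\<^sup>2))"
    proof (intro add_mono diff_mono order_refl sum_mono)
      fix i assume "i \<in> {..<r}"
      then have i: "i < r" by simp
      show "?n * S \<le> (\<Sum>s\<in>?P. w (s (a i)) (s (b i)))"
        using average_pair_ge[OF X(1) ab[OF i], of w] w01 w0 unfolding S_def by (simp add: field_simps)
      fix j assume "j \<in> {..<i}"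
      then have j: "j < i" by simp
      define p where "p k = (if k = 0 then a i else if k = 1 then b i else if k = 2 then a j else b j)" for k :: nat
      have q: "i < q" "j < q" using i j r by auto
      have "a i \<noteq> a j" "b i \<noteq> b j"
        using inj_onD[OF a(1), of i j] inj_onD[OF b(1), of i j] j q by auto
      moreover have "a i \<in> A" "b i \<notin> A" "a j \<in> A" "b j \<notin> A" using q a b by auto
      ultimately have "inj_on p {0,1,2,3}" "p ` {0,1,2,3} \<subseteq> X"
        using ab[OF i] ab[of j] i j by (auto simp: inj_on_def p_def)
      then have "(\<Sum>s\<in>?P. w (s (p 0)) (s (p 1)) * w (s (p 2)) (s (p 3))) / ?n \<le> 3/2 * S\<^sup>2"
        unfolding S_def by (intro average_two_pairs_le X w01)
      then show "(\<Sum>s\<in>?P. w (s (a i)) (s (b i)) * w (s (a j)) (s (b j))) \<le> ?n * (3/2 * S\<^sup>2)"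
        by (simp add: p_def field_simps)
    qed
    also have "\<dots> \<le> ?n - real r * (?n * S) + (real r)\<^sup>2 / 2 * (?n * (3/2 * S\<^sup>2))"
    proof -
      have "(\<Sum>i<r. real i) \<le> (real r)\<^sup>2 / 2"
        by (induction r) (auto simp: power2_eq_square field_simps)
      then have "(\<Sum>i<r. real i) * (?n * (3/2 * S\<^sup>2)) \<le> (real r)\<^sup>2 / 2 * (?n * (3/2 * S\<^sup>2))"
        by (intro mult_right_mono) auto
      then show ?thesis unfolding sum_distrib_right by (simp add: sum_distrib_left)
    qed
    also have "\<dots> = (1 - real r * S + 3/4 * (real r * S)\<^sup>2) * ?n"
      by (simp add: power2_eq_square algebra_simps)
    finally show ?thesis by simp
  qed
  have S01: "0 \<le> S" "S \<le> 1"
  proof -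
    show "0 \<le> S" unfolding S_def by (intro divide_nonneg_nonneg sum_nonneg) (auto simp: w01)
    have "(\<Sum>x\<in>X. \<Sum>y\<in>X. w x y) \<le> (\<Sum>x\<in>X. \<Sum>y\<in>X. 1)" by (intro sum_mono w01)
    then show "S \<le> 1" using X unfolding S_def by (simp add: divide_le_eq power2_eq_square)
  qed
  have "real q * S < 1"
  proof (rule ccontr)
    assume "\<not> real q * S < 1"
    then have qS: "1 \<le> real q * S" by simp
    then have pos: "S > 0" using S01 by (cases "S = 0") auto
    \<comment> \<open>The largest \<open>r\<close> with \<open>r S \<le> 1\<close>; since \<open>S \<le>
      1\<close>, it satisfies \<open>r S \<ge> 1/2\<close>.\<close>
    define r where "r = nat \<lfloor>1 / S\<rfloor>"
    have r1: "real r \<le> 1 / S" using pos by (simp add: r_def)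
    have r2: "1 / S < real r + 1" using pos by (simp add: r_def)
    have "1 / S \<le> real q" using qS pos by (simp add: field_simps)
    then have rq: "r \<le> q" using r1 by linarith
    have "r \<ge> 1" using r2 pos S01 by (cases r) (auto simp: field_simps)
    then have "real r \<ge> 1" by simp
    then have y1: "real r * S \<le> 1" "1 < real r * S + S" "S \<le> real r * S"
      using r1 r2 pos by (auto simp: field_simps)
    then have "1/2 \<le> real r * S" by linarith
    with y1 have "0 \<le> (real r * S - 1/2) * (1 - real r * S)" by (intro mult_nonneg_nonneg) auto
    then have "(real r * S)\<^sup>2 \<le> 3/2 * (real r * S) - 1/2" by (simp add: power2_eq_square algebra_simps)
    then show False using key[OF rq] y1 by linarith
  qed
  moreover have c: "real (card X) ^ 2 > 0" using X by auto
  ultimately have "(\<Sum>x\<in>X. \<Sum>y\<in>X. w x y) \<le> real (card X) ^ 2 / real q"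
    using q c unfolding S_def by (simp add: field_simps)
  moreover have "(\<Sum>x\<in>X. \<Sum>y\<in>X. (1 - Re (f x * cnj (f y))) / 4) \<le> (\<Sum>x\<in>X. \<Sum>y\<in>X. w x y)"
    unfolding w_def by (intro sum_mono pair_defect f)
  ultimately show ?thesis by (simp flip: sum_divide_distrib)
qed

section \<open>Fourier analysis of invariant functions on the torus\<close>

text \<open>
  Intervals and moduli below are written with \<open>1\<close>; it is kept in this form.
\<close>

declare One_nat_def [simp del]

text \<open>
  The image of the torus of functions on \<open>{1..N}\<close> in the inductive limit, see
  \<open>periodic_eq_image\<close>. As periodic functions on the positive numbers, the levels are
  nested sets rather than a chain of embeddings.
\<close>

definition periodic :: "nat \<Rightarrow> (nat \<Rightarrow> complex) set" where
  "periodic N = {t. t 0 = 1 \<and> (\<forall>x. cmod (t x) = 1) \<and> (\<forall>x\<ge>1. t (x + N) = t x)}"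

abbreviation (input) shuffle :: "nat \<Rightarrow> (nat \<Rightarrow> nat) \<Rightarrow> (nat \<Rightarrow> complex) \<Rightarrow> nat \<Rightarrow> complex" where
  "shuffle N s t \<equiv> \<lambda>x. t (block_perm N {1..} s x)"

lemma periodic_shift: "t \<in> periodic N \<Longrightarrow> x \<ge> 1 \<Longrightarrow> t (x + N * q) = t x"
proof (induction q)
  case (Suc q)
  then have "t ((x + N * q) + N) = t (x + N * q)" by (simp add: periodic_def)
  then show ?case using Suc by (simp add: algebra_simps)
qed simp

lemma periodic_cmod: "t \<in> periodic N \<Longrightarrow> cmod (t x) = 1"
  by (simp add: periodic_def)

lemma periodic_mult_cnj: "t \<in> periodic N \<Longrightarrow> t x * cnj (t x) = 1"
  by (simp add: periodic_def complex_norm_square flip: complex_norm_square)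

lemma periodic_mono: "N dvd M \<Longrightarrow> periodic N \<subseteq> periodic M"
proof
  fix t assume "N dvd M" "t \<in> periodic N"
  then show "t \<in> periodic M" using periodic_shift[of t N] by (auto simp: periodic_def elim!: dvdE)
qed

lemma periodic_eq_image: "N > 0 \<Longrightarrow> periodic N = block_fun N {1..} ` torus_fun N"
proof (intro equalityI subsetI)
  fix t assume N: "N > 0" and t: "t \<in> periodic N"
  let ?u = "\<lambda>x. if x \<in> {1..N} then t x else 1"
  have "?u \<in> torus_fun N" using t by (auto simp: torus_fun_def periodic_def)
  moreover have "t x = block_fun N {1..} ?u x" for x
  proof (cases "x \<ge> 1")
    case True
    obtain q r where qr: "r \<in> {1..N}" "x = N * q + r" by (rule block_coord[OF N True])
    then have "t x = t r" using periodic_shift[OF t, of r q] by (simp add: add.commute)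
    moreover have "block_fun N {1..} ?u x = ?u r" unfolding qr(2) by (rule block_fun_apply) (use qr in auto)
    ultimately show ?thesis using qr by simp
  next
    case False
    then have "x = 0" by simp
    then show ?thesis using t by (simp add: block_fun_def periodic_def)
  qed
  ultimately show "t \<in> block_fun N {1..} ` torus_fun N" by blast
next
  fix t assume N: "N > 0" and "t \<in> block_fun N {1..} ` torus_fun N"
  then obtain u where u: "u \<in> torus_fun N" "t = block_fun N {1..} u" by blast
  have *: "Suc ((x - 1) mod N) \<in> {1..N}" for x using N by (simp add: Suc_leI)
  have "(x + N - 1) mod N = (x - 1) mod N" if "x \<ge> 1" for x
  proof -
    have "x + N - 1 = (x - 1) + N" using that by simp
    then show ?thesis by simp
  qed
  then show "t \<in> periodic N" using u * by (auto simp: periodic_def block_fun_def torus_fun_def)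
qed

lemma periodic_one: "(\<lambda>_. 1) \<in> periodic N" by (simp add: periodic_def)

lemma periodic_mult: "t \<in> periodic N \<Longrightarrow> u \<in> periodic N \<Longrightarrow> (\<lambda>x. t x * u x) \<in> periodic N"
  by (simp add: periodic_def norm_mult)

lemma periodic_cnj: "t \<in> periodic N \<Longrightarrow> (\<lambda>x. cnj (t x)) \<in> periodic N"
  by (simp add: periodic_def)

lemma block_perm_inside: "x \<in> {1..N} \<Longrightarrow> block_perm N {1..} s x = s x"
  using block_perm_apply[of x N 0 "{1..}" s] by simp

lemma periodic_shuffle:
  assumes N: "N > 0" and s: "s \<in> perms N" and t: "t \<in> periodic N"
  shows "shuffle N s t \<in> periodic N"
proof -
  obtain u where u: "u \<in> torus_fun N" "t = block_fun N {1..} u" using t periodic_eq_image[OF N] by blast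
  have "shuffle N s t = block_fun N {1..} (u \<circ> s)"
    unfolding u(2) block_fun_comp[OF block_closed_atLeast[OF N] s] ..
  moreover have "u \<circ> s \<in> torus_fun N"
    using torus_fun_mult[of "\<lambda>_. 1" N u s] u s by (simp add: torus_fun_def comp_def)
  ultimately show ?thesis using periodic_eq_image[OF N] by blast
qed

lemma shuffle_comp:
  assumes "N > 0" "r \<in> perms N"
  shows "block_perm N {1..} s (block_perm N {1..} r x) = block_perm N {1..} (s \<circ> r) x"
  using fun_cong[OF block_perm_comp[OF block_closed_atLeast[OF assms(1)] assms(2)], of s x] by simp

lemma periodic_ext:
  assumes "N > 0" "t \<in> periodic N" "u \<in> periodic N" "\<And>x. x \<in> {1..N} \<Longrightarrow> t x = u x"
  shows "t = u"
proof
  fix x show "t x = u x"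
  proof (cases "x \<ge> 1")
    case True
    then obtain q r where qr: "r \<in> {1..N}" "x = N * q + r" using block_coord[OF assms(1)] by blast
    then show ?thesis
      using periodic_shift[OF assms(2), of r q] periodic_shift[OF assms(3), of r q] assms(4)[of r]
      by (simp add: add.commute)
  next
    case False
    then have "x = 0" by simp
    then show ?thesis using assms(2,3) by (simp add: periodic_def)
  qed
qed

text \<open>
  So normalized sums do not depend on the level, but \<open>\<Prod>x=1..N. t x\<close> gets a
  power when the level is raised.
\<close>

lemma periodic_sum_blocks:
  fixes f :: "complex \<Rightarrow> 'a :: comm_semiring_1"
  assumes "t \<in> periodic N"
  shows "(\<Sum>x=1..k * N. f (t x)) = of_nat k * (\<Sum>x=1..N. f (t x))"
    and "(\<Prod>x=1..k * N. f (t x)) = (\<Prod>x=1..N. f (t x)) ^ k"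
proof -
  have *: "t (k * N + x) = t x" if "x \<ge> 1" for x k
    using periodic_shift[OF assms that, of k] by (simp add: algebra_simps)
  have "(\<Sum>x=k * N + 1..k * N + N. f (t x)) = (\<Sum>x=1..N. f (t x))" for k
    using sum.shift_bounds_cl_nat_ivl[of "\<lambda>x. f (t x)" 1 "k * N" N] *
    by (simp add: add.commute)
  moreover have "(\<Sum>x=1..Suc k * N. f (t x))
      = (\<Sum>x=1..k * N. f (t x)) + (\<Sum>x=k * N + 1..k * N + N. f (t x))" for k
    using sum.ub_add_nat[of 1 "k * N" "\<lambda>x. f (t x)" N] by (simp add: add.commute)
  ultimately show "(\<Sum>x=1..k * N. f (t x)) = of_nat k * (\<Sum>x=1..N. f (t x))"
    by (induction k) (auto simp: algebra_simps)
  have "(\<Prod>x=k * N + 1..k * N + N. f (t x)) = (\<Prod>x=1..N. f (t x))" for k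
    using prod.shift_bounds_cl_nat_ivl[of "\<lambda>x. f (t x)" 1 "k * N" N] *
    by (simp add: add.commute)
  moreover have "(\<Prod>x=1..Suc k * N. f (t x))
      = (\<Prod>x=1..k * N. f (t x)) * (\<Prod>x=k * N + 1..k * N + N. f (t x))" for k
    using prod.ub_add_nat[of 1 "k * N" "\<lambda>x. f (t x)" N] by (simp add: add.commute)
  ultimately show "(\<Prod>x=1..k * N. f (t x)) = (\<Prod>x=1..N. f (t x)) ^ k"
    by (induction k) (auto simp: algebra_simps)
qed

definition torsion :: "nat \<Rightarrow> nat \<Rightarrow> (nat \<Rightarrow> complex) set" where
  "torsion m N = {t \<in> periodic N. \<forall>x. t x ^ m = 1}"

lemma finite_torsion:
  assumes "N > 0" "m > 0"
  shows "finite (torsion m N)"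
proof (rule finite_imageD)
  let ?r = "\<lambda>t. restrict t {1..N}"
  have "?r ` torsion m N \<subseteq> {1..N} \<rightarrow>\<^sub>E {z::complex. z ^ m = 1}" by (auto simp: torsion_def)
  then show "finite (?r ` torsion m N)"
    by (rule finite_subset[OF _ finite_PiE]) (use assms in \<open>auto intro: finite_roots_unity\<close>)
  show "inj_on ?r (torsion m N)"
  proof (rule inj_onI)
    fix t u assume tu: "t \<in> torsion m N" "u \<in> torsion m N" "?r t = ?r u"
    have "t x = u x" if "x \<in> {1..N}" for x using fun_cong[OF tu(3), of x] that by simp
    then show "t = u" using tu periodic_ext[OF assms(1)] by (simp add: torsion_def)
  qed
qed

lemma torsion_mult: "t \<in> torsion m N \<Longrightarrow> u \<in> torsion m N \<Longrightarrow> (\<lambda>x. t x * u x) \<in> torsion m N"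
  by (simp add: torsion_def periodic_mult power_mult_distrib)

lemma torsion_cnj: "t \<in> torsion m N \<Longrightarrow> (\<lambda>x. cnj (t x)) \<in> torsion m N"
  by (simp add: torsion_def periodic_cnj flip: complex_cnj_power)

lemma torsion_one: "(\<lambda>_. 1) \<in> torsion m N" by (simp add: torsion_def periodic_one)

lemma torsion_shuffle: "N > 0 \<Longrightarrow> s \<in> perms N \<Longrightarrow> t \<in> torsion m N \<Longrightarrow> shuffle N s t \<in> torsion m N"
  by (simp add: torsion_def periodic_shuffle)

lemma torsion_mono: "N dvd M \<Longrightarrow> l dvd m \<Longrightarrow> torsion l N \<subseteq> torsion m M"
  using periodic_mono[of N M] by (auto simp: torsion_def power_mult elim!: dvdE)

text \<open>
  Every character of the \<open>m\<close>-torsion of the torus has this form with exponents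
  below \<open>m\<close>.
\<close>

definition character :: "nat \<Rightarrow> (nat \<Rightarrow> nat) \<Rightarrow> (nat \<Rightarrow> complex) \<Rightarrow> complex" where
  "character N l t = (\<Prod>x=1..N. t x ^ l x)"

lemma character_mult: "character N l (\<lambda>x. t x * u x) = character N l t * character N l u"
  by (simp add: character_def power_mult_distrib prod.distrib)

lemma character_cnj: "character N l (\<lambda>x. cnj (t x)) = cnj (character N l t)"
  by (simp add: character_def)

lemma character_one: "character N l (\<lambda>_. 1) = 1" by (simp add: character_def)

lemma sum_character:
  assumes m: "m > 0" and t: "t \<in> torsion m N"
  shows "(\<Sum>l\<in>{1..N} \<rightarrow>\<^sub>E {..<m}. character N l t) = (if \<forall>x\<in>{1..N}. t x = 1 then of_nat m ^ N else 0)"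
proof -
  have "(\<Sum>l\<in>{1..N} \<rightarrow>\<^sub>E {..<m}. character N l t) = (\<Prod>x=1..N. \<Sum>i<m. t x ^ i)"
    unfolding character_def by (subst prod_sum_PiE) auto
  moreover have "(\<Sum>i<m. t x ^ i) = (if t x = 1 then of_nat m else 0)" for x
    using t by (simp add: torsion_def geometric_sum)
  ultimately show ?thesis by auto
qed

text \<open>
  The average of a character over its orbit under the symmetric group, see
  \<open>orbit_average_eq\<close>.
\<close>

definition orbit_average :: "nat \<Rightarrow> (nat \<Rightarrow> nat) \<Rightarrow> (nat \<Rightarrow> complex) \<Rightarrow> complex" where
  "orbit_average N l t = (\<Sum>s\<in>perms N. \<Prod>x=1..N. t x ^ l (s x)) / fact N"

lemma card_perms: "card (perms N) = fact N"
  unfolding perms_def by (rule card_permutations) auto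

lemma finite_perms: "finite (perms N)"
  unfolding perms_def by (rule finite_permutations) auto

lemma orbit_average_eq: "orbit_average N l t = (\<Sum>s\<in>perms N. character N l (shuffle N s t)) / fact N"
proof -
  have "(\<Prod>x=1..N. t x ^ l (s x)) = character N l (shuffle N (inv_into UNIV s) t)" if "s \<in> perms N" for s
  proof -
    have s: "s permutes {1..N}" using that by (simp add: perms_def)
    then have "(\<Prod>x=1..N. t x ^ l (s x)) = (\<Prod>y=1..N. t (inv_into UNIV s y) ^ l (s (inv_into UNIV s y)))"
      using prod.permute[OF permutes_inv[OF s], of "\<lambda>x. t x ^ l (s x)"] by (simp add: comp_def)
    also have "\<dots> = character N l (shuffle N (inv_into UNIV s) t)"
      unfolding character_def using permutes_inverses[OF s]
      by (intro prod.cong refl) (simp add: block_perm_inside)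
    finally show ?thesis .
  qed
  then have "(\<Sum>s\<in>perms N. \<Prod>x=1..N. t x ^ l (s x)) = (\<Sum>s\<in>perms N. character N l (shuffle N (inv_into UNIV s) t))"
    by (intro sum.cong) auto
  also have "\<dots> = (\<Sum>s\<in>perms N. character N l (shuffle N s t))"
    unfolding perms_def by (rule sum_permutations_inverse[symmetric])
  finally show ?thesis by (simp add: orbit_average_def)
qed

text \<open>
  The properties that a spherical kernel retains after restriction to the torus.
\<close>

locale multiplicative_limit =
  fixes n :: "nat \<Rightarrow> nat" and \<phi> :: "(nat \<Rightarrow> complex) \<Rightarrow> complex"
  assumes n: "\<forall>k\<ge>1. n k > 1"
    and one: "\<phi> (\<lambda>_. 1) = 1"
    and pos: "\<And>k S c. k \<ge> 1 \<Longrightarrow> finite S \<Longrightarrow> S \<subseteq> periodic (Nprod n k) \<Longrightarrow>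
        0 \<le> Re (\<Sum>t\<in>S. \<Sum>u\<in>S. c t * cnj (c u) * \<phi> (\<lambda>x. t x * cnj (u x))) \<and>
        Im (\<Sum>t\<in>S. \<Sum>u\<in>S. c t * cnj (c u) * \<phi> (\<lambda>x. t x * cnj (u x))) = 0"
    and invariant: "\<And>k s t. k \<ge> 1 \<Longrightarrow> s \<in> perms (Nprod n k) \<Longrightarrow> t \<in> periodic (Nprod n k) \<Longrightarrow>
        \<phi> (shuffle (Nprod n k) s t) = \<phi> t"
    and cont: "\<And>k u t. k \<ge> 1 \<Longrightarrow> (\<And>i. u i \<in> periodic (Nprod n k)) \<Longrightarrow> t \<in> periodic (Nprod n k) \<Longrightarrow>
        (\<And>x. (\<lambda>i. u i x) \<longlonglongrightarrow> t x) \<Longrightarrow> (\<lambda>i. \<phi> (u i)) \<longlonglongrightarrow> \<phi> t"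
    and mult: "\<And>j t u. j \<ge> 1 \<Longrightarrow> t \<in> periodic (Nprod n j) \<Longrightarrow> u \<in> periodic (Nprod n j) \<Longrightarrow>
        (\<lambda>k. (\<Sum>s\<in>perms (Nprod n k). \<phi> (\<lambda>x. t x * shuffle (Nprod n k) s u x)) / fact (Nprod n k))
          \<longlonglongrightarrow> \<phi> t * \<phi> u"
begin

lemma N_pos: "Nprod n k > 0" using Nprod_pos[OF n] .

lemma N_dvd: "j \<le> k \<Longrightarrow> Nprod n j dvd Nprod n k"
  using Nprod_dvd[OF n, of j k] by auto

definition fourier_coeff :: "nat \<Rightarrow> nat \<Rightarrow> (nat \<Rightarrow> nat) \<Rightarrow> complex" where
  "fourier_coeff m N l = (\<Sum>t\<in>torsion m N. \<phi> t * cnj (character N l t)) / of_nat m ^ N"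

text \<open>
  Bochner's theorem for a finite abelian group: up to a positive factor, the Fourier coefficient
  at \<open>l\<close> is the value of the positive definite form at the coefficients given by
  the character \<open>l\<close>.
\<close>

lemma fourier_coeff_nonneg:
  assumes k: "k \<ge> 1" and m: "m > 0"
  shows "0 \<le> Re (fourier_coeff m (Nprod n k) l) \<and> Im (fourier_coeff m (Nprod n k) l) = 0"
proof -
  let ?N = "Nprod n k"
  let ?T = "torsion m ?N"
  let ?B = "\<Sum>t\<in>?T. \<phi> t * cnj (character ?N l t)"
  have fin: "finite ?T" using finite_torsion N_pos m by blast
  have card: "card ?T > 0" using fin torsion_one[of m ?N] by (auto simp: card_gt_0_iff)
  have "(\<Sum>t\<in>?T. \<Sum>u\<in>?T. cnj (character ?N l t) * cnj (cnj (character ?N l u)) * \<phi> (\<lambda>x. t x * cnj (u x)))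
     = (\<Sum>u\<in>?T. \<Sum>t\<in>?T. cnj (character ?N l t) * character ?N l u * \<phi> (\<lambda>x. t x * cnj (u x)))"
    by (subst sum.swap) simp
  also have "\<dots> = (\<Sum>u\<in>?T. ?B)"
  proof (rule sum.cong[OF refl])
    fix u assume u: "u \<in> ?T"
    then have uc: "u x * cnj (u x) = 1" for x using periodic_mult_cnj by (auto simp: torsion_def)
    then have uc': "z * u x * cnj (u x) = z" "z * cnj (u x) * u x = z" for z x
      by (metis mult.assoc mult.right_neutral, metis mult.assoc mult.commute mult.right_neutral)
    have cc: "cnj (character ?N l u) * character ?N l u = 1"
      using character_mult[of ?N l u "\<lambda>x. cnj (u x)"] uc by (simp add: character_cnj character_one mult.commute)
    show "(\<Sum>t\<in>?T. cnj (character ?N l t) * character ?N l u * \<phi> (\<lambda>x. t x * cnj (u x))) = ?B"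
      by (rule sum.reindex_bij_witness[where i = "\<lambda>v x. v x * u x" and j = "\<lambda>t x. t x * cnj (u x)"])
        (use u cc in \<open>auto simp: torsion_mult torsion_cnj uc uc' character_mult character_cnj mult_ac\<close>)
  qed
  also have "\<dots> = of_nat (card ?T) * ?B" by simp
  finally have e: "(\<Sum>t\<in>?T. \<Sum>u\<in>?T. cnj (character ?N l t) * cnj (cnj (character ?N l u)) * \<phi> (\<lambda>x. t x * cnj (u x)))
    = of_nat (card ?T) * ?B" .
  have "?T \<subseteq> periodic ?N" by (auto simp: torsion_def)
  from pos[OF k fin this, of "\<lambda>t. cnj (character ?N l t)"]
  have "0 \<le> Re (of_nat (card ?T) * ?B) \<and> Im (of_nat (card ?T) * ?B) = 0"
    unfolding e[symmetric] .
  then have B: "0 \<le> Re ?B" "Im ?B = 0" using card by (auto simp: zero_le_mult_iff)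
  have "fourier_coeff m ?N l = ?B / of_real (real m ^ ?N)" by (simp add: fourier_coeff_def)
  then show ?thesis using B by simp
qed

lemma fourier_inversion:
  assumes k: "k \<ge> 1" and m: "m > 0" and t: "t \<in> torsion m (Nprod n k)"
  shows "(\<Sum>l\<in>{1..Nprod n k} \<rightarrow>\<^sub>E {..<m}. fourier_coeff m (Nprod n k) l * character (Nprod n k) l t) = \<phi> t"
proof -
  let ?N = "Nprod n k"
  let ?T = "torsion m ?N" and ?L = "{1..?N} \<rightarrow>\<^sub>E {..<m}"
  have fin: "finite ?T" using finite_torsion N_pos m by blast
  have "(\<Sum>l\<in>?L. fourier_coeff m ?N l * character ?N l t) = (\<Sum>u\<in>?T. \<phi> u * (\<Sum>l\<in>?L. character ?N l (\<lambda>x. t x * cnj (u x)))) / of_nat m ^ ?N"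
    unfolding fourier_coeff_def sum_divide_distrib sum_distrib_right sum_distrib_left
    by (subst sum.swap) (simp add: character_mult character_cnj mult_ac)
  also have "(\<Sum>u\<in>?T. \<phi> u * (\<Sum>l\<in>?L. character ?N l (\<lambda>x. t x * cnj (u x)))) = (\<Sum>u\<in>?T. if u = t then \<phi> t * of_nat m ^ ?N else 0)"
  proof (rule sum.cong[OF refl])
    fix u assume u: "u \<in> ?T"
    have tp: "t \<in> periodic ?N" and up: "u \<in> periodic ?N" using t u by (auto simp: torsion_def)
    have "(\<forall>x\<in>{1..?N}. t x * cnj (u x) = 1) \<longleftrightarrow> u = t"
    proof
      assume *: "\<forall>x\<in>{1..?N}. t x * cnj (u x) = 1"
      have "u x = t x" if "x \<in> {1..?N}" for x
      proof -
        have "u x = t x * cnj (u x) * u x" using * that by simp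
        also have "\<dots> = t x" using periodic_mult_cnj[OF up, of x] by (simp add: mult_ac)
        finally show ?thesis .
      qed
      then show "u = t" using periodic_ext[OF N_pos up tp] by blast
    qed (use periodic_mult_cnj[OF tp] in simp)
    then show "\<phi> u * (\<Sum>l\<in>?L. character ?N l (\<lambda>x. t x * cnj (u x))) = (if u = t then \<phi> t * of_nat m ^ ?N else 0)"
      by (subst sum_character[OF m]) (use t u in \<open>auto simp: torsion_mult torsion_cnj\<close>)
  qed
  also have "\<dots> = \<phi> t * of_nat m ^ ?N" using t fin by simp
  finally show ?thesis using m by simp
qed

lemma cnj_\<phi>:
  assumes k: "k \<ge> 1" and m: "m > 0" and t: "t \<in> torsion m (Nprod n k)"
  shows "\<phi> (\<lambda>x. cnj (t x)) = cnj (\<phi> t)"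
proof -
  have real: "cnj (fourier_coeff m (Nprod n k) l) = fourier_coeff m (Nprod n k) l" for l
    using fourier_coeff_nonneg[OF k m, of l] by (simp add: complex_eq_iff)
  have "\<phi> (\<lambda>x. cnj (t x)) = cnj (\<Sum>l\<in>{1..Nprod n k} \<rightarrow>\<^sub>E {..<m}. fourier_coeff m (Nprod n k) l * character (Nprod n k) l t)"
    using fourier_inversion[OF k m torsion_cnj[OF t]] by (simp add: character_cnj real)
  then show ?thesis using fourier_inversion[OF k m t] by (simp add: real)
qed

text \<open>
  By invariance, \<open>\<phi> t\<close> is the mean of the orbit averages of the characters
  with weights \<open>fourier_coeff\<close>; the second moment of the same distribution is the average
  of \<open>\<phi>\<close> over the products of \<open>t\<close> with the conjugates of the
  permuted \<open>t\<close>.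
\<close>

lemma orbit_variance:
  assumes k: "k \<ge> 1" and m: "m > 0" and t: "t \<in> torsion m (Nprod n k)"
  defines "N \<equiv> Nprod n k"
  shows "of_real (\<Sum>l\<in>{1..N} \<rightarrow>\<^sub>E {..<m}. Re (fourier_coeff m N l) * (cmod (orbit_average N l t - \<phi> t))\<^sup>2)
       = (\<Sum>s\<in>perms N. \<phi> (\<lambda>x. t x * shuffle N s (\<lambda>x. cnj (t x)) x)) / fact N - \<phi> t * cnj (\<phi> t)"
proof -
  let ?L = "{1..N} \<rightarrow>\<^sub>E {..<m}" and ?a = "fourier_coeff m N" and ?P = "perms N"
  have N: "N > 0" unfolding N_def by (rule N_pos)
  have t': "t \<in> torsion m N" using t by (simp add: N_def)
  have real: "of_real (Re (?a l)) = ?a l" for l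
    using fourier_coeff_nonneg[OF k m, of l] by (simp add: N_def complex_eq_iff)
  have inv: "(\<Sum>l\<in>?L. ?a l * character N l u) = \<phi> u" if "u \<in> torsion m N" for u
    using fourier_inversion[OF k m, of u] that by (simp add: N_def)
  have sh: "\<phi> (shuffle N s u) = \<phi> u" if "s \<in> ?P" "u \<in> torsion m N" for s u
    using invariant[OF k, of s u] that by (simp add: N_def torsion_def)
  have mean: "(\<Sum>l\<in>?L. ?a l * orbit_average N l u) = \<phi> u" if u: "u \<in> torsion m N" for u
  proof -
    have "(\<Sum>l\<in>?L. ?a l * orbit_average N l u) = (\<Sum>s\<in>?P. \<Sum>l\<in>?L. ?a l * character N l (shuffle N s u)) / fact N"
      unfolding orbit_average_eq by (subst sum.swap) (simp add: sum_distrib_left sum_divide_distrib)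
    also have "(\<Sum>s\<in>?P. \<Sum>l\<in>?L. ?a l * character N l (shuffle N s u)) = (\<Sum>s\<in>?P. \<phi> u)"
      using u by (intro sum.cong refl) (simp add: inv sh torsion_shuffle N)
    finally show ?thesis by (simp add: card_perms)
  qed
  have total: "(\<Sum>l\<in>?L. ?a l) = 1"
    using inv[OF torsion_one] one by (simp add: character_one)
  have psic: "cnj (orbit_average N l t) = orbit_average N l (\<lambda>x. cnj (t x))" for l
    unfolding orbit_average_def by simp
  \<comment> \<open>Expanding the square gives a double average over permutations \<open>s\<close> and
    \<open>r\<close>; by invariance of \<open>\<phi>\<close> only \<open>r \<circ> inv s\<close>
    matters.\<close>
  have second: "(\<Sum>l\<in>?L. ?a l * (orbit_average N l t * cnj (orbit_average N l t)))
     = (\<Sum>s\<in>?P. \<phi> (\<lambda>x. t x * shuffle N s (\<lambda>x. cnj (t x)) x)) / fact N" (is "?S = ?R / _")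
  proof -
    have "orbit_average N l t * cnj (orbit_average N l t)
      = (\<Sum>s\<in>?P. \<Sum>r\<in>?P. character N l (\<lambda>x. shuffle N s t x * shuffle N r (\<lambda>x. cnj (t x)) x)) / (fact N * fact N)" for l
      unfolding psic orbit_average_eq character_mult by (simp add: sum_product character_cnj)
    then have "?S = (\<Sum>l\<in>?L. \<Sum>s\<in>?P. \<Sum>r\<in>?P. ?a l * character N l (\<lambda>x. shuffle N s t x * shuffle N r (\<lambda>x. cnj (t x)) x)) / (fact N * fact N)"
      by (simp add: sum_distrib_left sum_divide_distrib)
    also have "(\<Sum>l\<in>?L. \<Sum>s\<in>?P. \<Sum>r\<in>?P. ?a l * character N l (\<lambda>x. shuffle N s t x * shuffle N r (\<lambda>x. cnj (t x)) x))
       = (\<Sum>s\<in>?P. \<Sum>r\<in>?P. \<Sum>l\<in>?L. ?a l * character N l (\<lambda>x. shuffle N s t x * shuffle N r (\<lambda>x. cnj (t x)) x))"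
      by (subst sum.swap) (intro sum.cong refl sum.swap)
    also have "\<dots> = (\<Sum>s\<in>?P. ?R)"
    proof (rule sum.cong[OF refl])
      fix s assume s: "s \<in> ?P"
      have s': "s permutes {1..N}" using s by (simp add: perms_def)
      let ?i = "inv_into UNIV s"
      have i: "?i \<in> ?P" "?i permutes {1..N}" using s' by (auto simp: perms_def permutes_inv)
      have "(\<Sum>r\<in>?P. \<Sum>l\<in>?L. ?a l * character N l (\<lambda>x. shuffle N s t x * shuffle N r (\<lambda>x. cnj (t x)) x))
         = (\<Sum>r\<in>?P. \<phi> (\<lambda>x. shuffle N s t x * shuffle N r (\<lambda>x. cnj (t x)) x))"
        using s t' N by (intro sum.cong refl inv torsion_mult torsion_shuffle torsion_cnj)
      also have "\<dots> = (\<Sum>r\<in>?P. \<phi> (\<lambda>x. t x * shuffle N (r \<circ> ?i) (\<lambda>x. cnj (t x)) x))"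
      proof (rule sum.cong[OF refl])
        fix r assume r: "r \<in> ?P"
        have "\<phi> (\<lambda>x. shuffle N s t x * shuffle N r (\<lambda>x. cnj (t x)) x)
          = \<phi> (shuffle N ?i (\<lambda>x. shuffle N s t x * shuffle N r (\<lambda>x. cnj (t x)) x))"
          using s r t' N i by (intro sh[symmetric] torsion_mult torsion_shuffle torsion_cnj)
        also have "\<dots> = \<phi> (\<lambda>x. t x * shuffle N (r \<circ> ?i) (\<lambda>x. cnj (t x)) x)"
          using permutes_inv_o[OF s'] block_perm_id[OF block_closed_atLeast[OF N]]
          by (simp add: shuffle_comp[OF N i(1)])
        finally show "\<phi> (\<lambda>x. shuffle N s t x * shuffle N r (\<lambda>x. cnj (t x)) x)
          = \<phi> (\<lambda>x. t x * shuffle N (r \<circ> ?i) (\<lambda>x. cnj (t x)) x)" .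
      qed
      also have "\<dots> = ?R"
        unfolding perms_def
        using sum_permutations_compose_right[OF i(2), of "\<lambda>r. \<phi> (\<lambda>x. t x * shuffle N r (\<lambda>x. cnj (t x)) x)"]
        by simp
      finally show "(\<Sum>r\<in>?P. \<Sum>l\<in>?L. ?a l * character N l (\<lambda>x. shuffle N s t x * shuffle N r (\<lambda>x. cnj (t x)) x)) = ?R" .
    qed
    finally show ?thesis by (simp add: card_perms)
  qed
  have "of_real (\<Sum>l\<in>?L. Re (?a l) * (cmod (orbit_average N l t - \<phi> t))\<^sup>2)
     = (\<Sum>l\<in>?L. ?a l * ((orbit_average N l t - \<phi> t) * cnj (orbit_average N l t - \<phi> t)))"
    by (simp only: of_real_sum of_real_mult real complex_norm_square)
  also have "\<dots> = ?S - cnj (\<phi> t) * (\<Sum>l\<in>?L. ?a l * orbit_average N l t)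
      - \<phi> t * (\<Sum>l\<in>?L. ?a l * orbit_average N l (\<lambda>x. cnj (t x))) + \<phi> t * cnj (\<phi> t) * (\<Sum>l\<in>?L. ?a l)"
    by (simp add: algebra_simps sum.distrib sum_subtractf sum_distrib_left psic)
  also have "\<dots> = ?S - \<phi> t * cnj (\<phi> t)"
    using mean[OF t'] mean[OF torsion_cnj[OF t']] total cnj_\<phi>[OF k m t] by (simp add: algebra_simps)
  finally show ?thesis using second by simp
qed

text \<open>
  The variances for the finitely many \<open>t \<in> T\<close> tend to 0 by \<open>mult\<close>,
  so even their sum is below \<open>e\<^sup>2\<close> on a high level, and some character must
  do at least as well as the mean over all characters.
\<close>

lemma orbit_approximation:
  assumes J: "J \<ge> 1" and m: "m > 0" and T: "T \<subseteq> torsion m (Nprod n J)" and e: "e > 0"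
  shows "\<forall>\<^sub>F k in sequentially. \<exists>l. \<forall>t\<in>T. cmod (orbit_average (Nprod n k) l t - \<phi> t) < e"
proof -
  let ?V = "\<lambda>k t. (\<Sum>s\<in>perms (Nprod n k). \<phi> (\<lambda>x. t x * shuffle (Nprod n k) s (\<lambda>x. cnj (t x)) x)) / fact (Nprod n k)
      - \<phi> t * cnj (\<phi> t)"
  have fin: "finite T" using T finite_torsion[OF N_pos m] finite_subset by blast
  have "(\<lambda>k. ?V k t) \<longlonglongrightarrow> 0" if "t \<in> T" for t
  proof -
    have t: "t \<in> torsion m (Nprod n J)" using that T by blast
    then have "t \<in> periodic (Nprod n J)" by (simp add: torsion_def)
    from mult[OF J this periodic_cnj[OF this]] have "(\<lambda>k. ?V k t) \<longlonglongrightarrow> \<phi> t * \<phi> (\<lambda>x. cnj (t x)) - \<phi> t * cnj (\<phi> t)"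
      by (intro tendsto_diff tendsto_const)
    then show ?thesis using cnj_\<phi>[OF J m t] by simp
  qed
  then have "(\<lambda>k. \<Sum>t\<in>T. ?V k t) \<longlonglongrightarrow> (\<Sum>t\<in>T. 0)" by (intro tendsto_sum)
  then have "\<forall>\<^sub>F k in sequentially. dist (\<Sum>t\<in>T. ?V k t) 0 < e\<^sup>2"
    using tendstoD[of _ _ _ "e\<^sup>2"] e by force
  moreover have "\<forall>\<^sub>F k in sequentially. k \<ge> J" by (rule eventually_ge_at_top)
  ultimately show ?thesis
  proof eventually_elim
    case (elim k)
    then have k: "k \<ge> 1" using J by simp
    let ?N = "Nprod n k"
    let ?L = "{1..?N} \<rightarrow>\<^sub>E {..<m}"
    let ?a = "\<lambda>l. Re (fourier_coeff m ?N l)"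
    have T': "t \<in> torsion m ?N" if "t \<in> T" for t
      using T torsion_mono[OF N_dvd[OF elim(2)] dvd_refl] that by blast
    have "(\<Sum>t\<in>T. ?V k t) = of_real (\<Sum>t\<in>T. \<Sum>l\<in>?L. ?a l * (cmod (orbit_average ?N l t - \<phi> t))\<^sup>2)"
      unfolding of_real_sum using orbit_variance[OF k m T'] by (intro sum.cong refl) simp
    also have "(\<Sum>t\<in>T. \<Sum>l\<in>?L. ?a l * (cmod (orbit_average ?N l t - \<phi> t))\<^sup>2)
       = (\<Sum>l\<in>?L. ?a l * (\<Sum>t\<in>T. (cmod (orbit_average ?N l t - \<phi> t))\<^sup>2))"
      by (subst sum.swap) (simp add: sum_distrib_left)
    finally have less: "(\<Sum>l\<in>?L. ?a l * (\<Sum>t\<in>T. (cmod (orbit_average ?N l t - \<phi> t))\<^sup>2)) < e\<^sup>2"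
      using elim(1) by (simp add: dist_norm del: of_real_sum) 
    have "(\<Sum>l\<in>?L. fourier_coeff m ?N l) = 1"
      using fourier_inversion[OF k m torsion_one] one by (simp add: character_one)
    then have total: "(\<Sum>l\<in>?L. ?a l) = 1" by (metis Re_sum one_complex.sel(1))
    show ?case
    proof (rule ccontr)
      assume "\<not> ?case"
      \<comment> \<open>Otherwise every character contributes at least \<open>e\<^sup>2\<close>, and the weights
        sum to 1.\<close>
      then have far: "\<exists>t\<in>T. e \<le> cmod (orbit_average ?N l t - \<phi> t)" for l by (meson not_less)
      have "e\<^sup>2 \<le> (\<Sum>t\<in>T. (cmod (orbit_average ?N l t - \<phi> t))\<^sup>2)" for l
      proof -
        obtain t where t: "t \<in> T" "e \<le> cmod (orbit_average ?N l t - \<phi> t)" using far by blast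
        then have "e\<^sup>2 \<le> (cmod (orbit_average ?N l t - \<phi> t))\<^sup>2" using e by (intro power_mono) auto
        also have "\<dots> \<le> (\<Sum>t\<in>T. (cmod (orbit_average ?N l t - \<phi> t))\<^sup>2)"
          using t fin by (intro member_le_sum) auto
        finally show ?thesis .
      qed
      then have "(\<Sum>l\<in>?L. ?a l * e\<^sup>2) \<le> (\<Sum>l\<in>?L. ?a l * (\<Sum>t\<in>T. (cmod (orbit_average ?N l t - \<phi> t))\<^sup>2))"
        using fourier_coeff_nonneg[OF k m] by (intro sum_mono mult_left_mono) auto
      then have "e\<^sup>2 \<le> (\<Sum>l\<in>?L. ?a l * (\<Sum>t\<in>T. (cmod (orbit_average ?N l t - \<phi> t))\<^sup>2))"
        using total by (simp flip: sum_distrib_right)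
      then show False using less by simp
    qed
  qed
qed

end

section \<open>Power means and roots of unity\<close>

definition power_mean :: "nat \<Rightarrow> (nat \<Rightarrow> complex) \<Rightarrow> int \<Rightarrow> complex" where
  "power_mean N t M = (\<Sum>x=1..N. t x powi M) / of_nat N"

lemma cmod_power_mean: "t \<in> periodic N \<Longrightarrow> N' > 0 \<Longrightarrow> cmod (power_mean N' t M) \<le> 1"
proof -
  assume t: "t \<in> periodic N" and N: "N' > 0"
  have "cmod (\<Sum>x=1..N'. t x powi M) \<le> (\<Sum>x=1..N'. 1)"
    by (rule sum_norm_le) (simp add: norm_power_int periodic_cmod[OF t])
  then show ?thesis using N by (simp add: power_mean_def norm_divide)
qed

lemma power_mean_blocks: "t \<in> periodic N \<Longrightarrow> k > 0 \<Longrightarrow> power_mean (k * N) t M = power_mean N t M"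
  unfolding power_mean_def using periodic_sum_blocks(1)[of t N "\<lambda>z. z powi M" k] by simp

lemma power_mean_dvd:
  assumes "t \<in> periodic N" "N dvd N'" "N' > 0"
  shows "power_mean N' t M = power_mean N t M"
proof -
  obtain k where k: "N' = k * N" using assms(2) by (metis dvdE mult.commute)
  then show ?thesis using power_mean_blocks[OF assms(1), of k] assms(3) by simp
qed

lemma root_powi_cong:
  fixes z :: complex
  assumes "z ^ m = 1" "int m dvd a - b" "m > 0"
  shows "z powi a = z powi b"
proof -
  have z: "z \<noteq> 0" using assms by (auto simp: power_0_left)
  obtain k where "a - b = int m * k" using assms(2) by (elim dvdE)
  then have k: "a = b + int m * k" by simp
  have "z powi a = z powi b * (z powi int m) powi k"
    using z by (simp add: k power_int_add power_int_mult)
  then show ?thesis using assms(1) by (simp add: power_int_of_nat)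
qed

lemma power_mean_cong:
  assumes "t \<in> torsion m N" "int m dvd a - b" "m > 0"
  shows "power_mean N' t a = power_mean N' t b"
  unfolding power_mean_def using assms root_powi_cong[OF _ assms(2,3)]
  by (simp add: torsion_def)

lemma prod_shuffle:
  assumes "s \<in> perms N" shows "(\<Prod>x=1..N. f (s x)) = (\<Prod>x=1..N. f x)"
  using prod.permute[of s "{1..N}" f] assms by (simp add: perms_def comp_def)

text \<open>
  On \<open>m\<close>-torsion the exponents count only modulo \<open>m\<close>. Splitting off
  \<open>c\<close> from all of them leaves a function of the positions in \<open>D\<close>
  alone, and these are moved to nearly independent points.
\<close>

lemma orbit_average_approx_few_entries:
  fixes l :: "nat \<Rightarrow> nat" and c :: nat
  assumes N: "N > 0" and m: "m > 0" and t: "t \<in> torsion m N"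
  defines "D \<equiv> {y \<in> {1..N}. \<not> int m dvd int (l y) - int c}"
  shows "cmod (orbit_average N l t - (\<Prod>x=1..N. t x) ^ c * (\<Prod>y\<in>D. power_mean N t (int (l y) - int c)))
       \<le> 2 * real ((card D)\<^sup>2) / real N"
proof -
  have tp: "t \<in> periodic N" and tm: "t x ^ m = 1" for x using t by (auto simp: torsion_def)
  have t0: "t x \<noteq> 0" for x using periodic_cmod[OF tp, of x] by auto
  let ?d = "(\<Prod>x=1..N. t x) ^ c"
  \<comment> \<open>The part of the character that depends on the positions in \<open>D\<close>.\<close>
  define F where "F h = (\<Prod>y\<in>D. t (h y) powi (int (l y) - int c))" for h :: "nat \<Rightarrow> nat"
  have D: "D \<subseteq> {1..N}" "finite D" by (auto simp: D_def)
  have "character N l (shuffle N s t) = ?d * F (\<lambda>y\<in>D. s (id y))" if s: "s \<in> perms N" for s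
  proof -
    have "character N l (shuffle N s t) = (\<Prod>y=1..N. t (s y) ^ c * t (s y) powi (int (l y) - int c))"
      unfolding character_def
    proof (intro prod.cong refl)
      fix y assume y: "y \<in> {1..N}"
      have "t (s y) ^ l y = t (s y) powi (int c + (int (l y) - int c))"
        by (simp add: power_int_of_nat)
      also have "\<dots> = t (s y) ^ c * t (s y) powi (int (l y) - int c)"
        using t0 by (subst power_int_add) (auto simp: power_int_of_nat)
      finally show "shuffle N s t y ^ l y = t (s y) ^ c * t (s y) powi (int (l y) - int c)"
        using y by (simp add: block_perm_inside)
    qed
    also have "\<dots> = ?d * (\<Prod>y=1..N. t (s y) powi (int (l y) - int c))"
      using prod_shuffle[OF s, of "\<lambda>x. t x ^ c"] by (simp add: prod.distrib prod_power_distrib)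
    also have "(\<Prod>y=1..N. t (s y) powi (int (l y) - int c)) = F (\<lambda>y\<in>D. s (id y))"
    proof -
      have "t x powi (int (l y) - int c) = 1" if "y \<in> {1..N} - D" for x y
      proof -
        have "int m dvd int (l y) - int c - 0" using that by (simp add: D_def)
        from root_powi_cong[OF tm this m] show ?thesis by simp
      qed
      then have "(\<Prod>y=1..N. t (s y) powi (int (l y) - int c)) = (\<Prod>y\<in>D. t (s y) powi (int (l y) - int c))"
        using D by (intro prod.mono_neutral_right) auto
      then show ?thesis by (simp add: F_def)
    qed
    finally show ?thesis .
  qed
  then have orbit_average: "orbit_average N l t = ?d * ((\<Sum>s | s permutes {1..N}. F (\<lambda>y\<in>D. s (id y))) / fact (card {1..N}))"
    unfolding orbit_average_eq by (simp add: sum_distrib_left perms_def)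
  have "(\<Sum>h\<in>D \<rightarrow>\<^sub>E {1..N}. F h) / of_nat (card {1..N}) ^ card D
      = (\<Prod>y\<in>D. power_mean N t (int (l y) - int c))"
    unfolding F_def power_mean_def using D
    by (subst prod_sum_PiE[symmetric]) (auto simp: prod_dividef)
  then have "cmod ((\<Sum>s | s permutes {1..N}. F (\<lambda>y\<in>D. s (id y))) / fact (card {1..N})
      - (\<Prod>y\<in>D. power_mean N t (int (l y) - int c))) \<le> 2 * real ((card D)\<^sup>2) / real (card {1..N})"
    using average_permutations_approx[of "{1..N}" D id F] N D
    by (simp add: F_def norm_power_int periodic_cmod[OF tp] flip: prod_norm)
  moreover have "cmod ?d = 1" by (simp add: norm_power periodic_cmod[OF tp] flip: prod_norm)
  moreover have "orbit_average N l t - ?d * (\<Prod>y\<in>D. power_mean N t (int (l y) - int c))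
     = ?d * ((\<Sum>s | s permutes {1..N}. F (\<lambda>y\<in>D. s (id y))) / fact (card {1..N})
      - (\<Prod>y\<in>D. power_mean N t (int (l y) - int c)))"
    unfolding orbit_average by (simp add: algebra_simps)
  ultimately show ?thesis by (simp add: norm_mult)
qed

text \<open>
  The value \<open>z\<close> at the first point of each block of length \<open>N\<close>, and 1
  elsewhere.
\<close>

definition point_fun :: "nat \<Rightarrow> complex \<Rightarrow> nat \<Rightarrow> complex" where
  "point_fun N z x = (if x \<ge> 1 \<and> (x - 1) mod N = 0 then z else 1)"

lemma point_fun_periodic: "cmod z = 1 \<Longrightarrow> point_fun N z \<in> periodic N"
proof -
  assume z: "cmod z = 1"
  have "(x + N - 1) mod N = (x - 1) mod N" if "x \<ge> 1" for x
  proof -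
    have "x + N - 1 = (x - 1) + N" using that by simp
    then show ?thesis by simp
  qed
  then show ?thesis using z by (auto simp: periodic_def point_fun_def)
qed

lemma point_fun_torsion: "cmod z = 1 \<Longrightarrow> z ^ m = 1 \<Longrightarrow> point_fun N z \<in> torsion m N"
  by (simp add: torsion_def point_fun_periodic) (simp add: point_fun_def)

lemma point_fun_inside: "x \<in> {1..N} \<Longrightarrow> point_fun N z x = (if x = 1 then z else 1)"
proof -
  assume x: "x \<in> {1..N}"
  then have "(x - 1) mod N = x - 1" by (intro mod_less) auto
  then show ?thesis using x by (auto simp: point_fun_def)
qed

lemma prod_point_fun: "N > 0 \<Longrightarrow> (\<Prod>x=1..N. point_fun N z x) = z"
proof -
  assume N: "N > 0"
  have "(\<Prod>x=1..N. point_fun N z x) = (\<Prod>x=1..N. if x = 1 then z else 1)"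
    by (intro prod.cong refl point_fun_inside)
  also have "\<dots> = z" using N by (subst prod.delta) auto
  finally show ?thesis .
qed

lemma power_mean_point_fun:
  assumes "N > 0" shows "power_mean N (point_fun N z) M = 1 + (z powi M - 1) / of_nat N"
proof -
  have "(\<Sum>x=1..N. point_fun N z x powi M) = (\<Sum>x=1..N. 1 + (if x = 1 then z powi M - 1 else 0))"
    by (intro sum.cong refl) (simp add: point_fun_inside)
  also have "\<dots> = of_nat N + (z powi M - 1)"
    using assms by (subst sum.distrib) simp
  finally show ?thesis using assms by (simp add: power_mean_def add_divide_distrib)
qed

lemma cmod_power_mean_point_fun:
  assumes "N > 0" "cmod z = 1"
  shows "(cmod (power_mean N (point_fun N z) M))\<^sup>2
       = 1 - 2 / real N * (1 - 1 / real N) * (1 - Re (z powi M))"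
proof -
  define u where "u = z powi M"
  have "(Re u)\<^sup>2 + (Im u)\<^sup>2 = 1"
    using assms(2) unfolding cmod_power2[symmetric] by (simp add: u_def norm_power_int)
  then have "(Im u)\<^sup>2 = 1 - (Re u)\<^sup>2" by simp
  then show ?thesis
    unfolding power_mean_point_fun[OF assms(1)] cmod_power2 u_def[symmetric]
    using assms(1) by (simp add: field_simps power2_eq_square)
qed

text \<open>
  At \<open>point_fun b z\<close> the orbit average of \<open>l\<close> is an average of
  products over the \<open>q\<close> points of the support, which are paired with their right
  neighbours.
\<close>

lemma orbit_average_point_fun_imp_nearly_constant:
  assumes b: "b \<ge> 2" and q: "q > 0" and N: "b * q \<ge> 48" and z: "cmod z = 1"
    and large: "cmod (orbit_average (b * q) l (point_fun b z)) > 3/4"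
  shows "(\<Sum>x=1..b * q. \<Sum>y=1..b * q. 1 - Re (z powi (int (l x) - int (l y)))) \<le> 4 * real b * real (b * q)"
proof -
  let ?X = "{1..b * q}"
  define A where "A = {x \<in> ?X. (x - 1) mod b = 0}"
  define f where "f x = z ^ l x" for x
  have z0: "z \<noteq> 0" using z by auto
  have pf: "(\<Prod>x=1..b * q. point_fun b z x ^ l (s x)) = (\<Prod>x\<in>A. f (s x))" for s
  proof -
    have "(\<Prod>x=1..b * q. point_fun b z x ^ l (s x)) = (\<Prod>x\<in>A. point_fun b z x ^ l (s x))"
      by (intro prod.mono_neutral_right) (auto simp: A_def point_fun_def)
    also have "\<dots> = (\<Prod>x\<in>A. f (s x))"
      by (intro prod.cong refl) (auto simp: A_def point_fun_def f_def)
    finally show ?thesis .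
  qed
  have ineq: "b * i + 2 \<le> b * q" if "i < q" for i
  proof -
    have "b * (i + 1) \<le> b * q" using that by (intro mult_le_mono2) auto
    then show ?thesis using b by (simp add: algebra_simps)
  qed
  have "(\<Sum>x\<in>?X. \<Sum>y\<in>?X. 1 - Re (f x * cnj (f y))) \<le> 4 * real (card ?X) ^ 2 / real q"
  proof (rule large_average_imp_nearly_constant)
    show "finite ?X" "A \<subseteq> ?X" "48 \<le> card ?X" "q > 0" using N q by (auto simp: A_def)
    show "inj_on (\<lambda>i. b * i + 1) {..<q}" "inj_on (\<lambda>i. b * i + 2) {..<q}"
      using b by (auto simp: inj_on_def)
    show "(\<lambda>i. b * i + 1) ` {..<q} \<subseteq> A" 
    proof (rule image_subsetI)
      fix i assume "i \<in> {..<q}"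
      then have "b * i + 2 \<le> b * q" using ineq by simp
      then show "b * i + 1 \<in> A" by (simp add: A_def)
    qed
    have "(b * i + 2 - 1) mod b = 1" for i
    proof -
      have "b * i + 2 - 1 = 1 + b * i" by simp
      also have "\<dots> mod b = 1 mod b" by (rule mod_mult_self2)
      finally show ?thesis using b by simp
    qed
    then show "(\<lambda>i. b * i + 2) ` {..<q} \<subseteq> ?X - A"
    proof (intro image_subsetI)
      fix i assume *: "\<And>i. (b * i + 2 - 1) mod b = 1" and "i \<in> {..<q}"
      then have "b * i + 2 \<in> ?X" using ineq by simp
      moreover have "b * i + 2 \<notin> A" unfolding A_def mem_Collect_eq * by simp
      ultimately show "b * i + 2 \<in> ?X - A" by blast
    qed
    show "cmod (f x) = 1" for x using z by (simp add: f_def norm_power)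
    show "3/4 < cmod ((\<Sum>s | s permutes ?X. \<Prod>x\<in>A. f (s x)) / fact (card ?X))"
      using large by (simp add: orbit_average_def pf perms_def)
  qed
  moreover have "f x * cnj (f y) = z powi (int (l x) - int (l y))" for x y
  proof -
    have "z * cnj z = of_real ((cmod z)\<^sup>2)" by (rule complex_norm_square[symmetric])
    then have "z * cnj z = 1" using z by simp
    then have "cnj z = inverse z" by (rule inverse_unique[symmetric])
    then show ?thesis using z0 by (simp add: f_def power_int_diff power_int_of_nat divide_inverse flip: power_inverse)
  qed
  moreover have "4 * real (card ?X) ^ 2 / real q = 4 * real b * real (b * q)"
    using q by (simp add: power2_eq_square)
  ultimately show ?thesis by simp
qed

lemma cis_root_of_unity:
  assumes "q > 0"
  shows "cis (2 * pi * real s / real q) ^ q = 1"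
proof -
  have "cis (2 * pi * real s / real q) ^ q = cis (2 * pi * of_nat s)"
    unfolding Complex.DeMoivre by (rule arg_cong[where f = cis]) (use assms in \<open>simp add: field_simps\<close>)
  also have "\<dots> = 1" by (rule cis_multiple_2pi) simp
  finally show ?thesis .
qed

text \<open>A geometric sum whose ratio is a \<open>q\<close>-th root of unity.\<close>

lemma sum_roots_of_unity:
  assumes q: "q > 0"
  shows "(\<Sum>j<q. cis (2 * pi * real j / real q) powi a) = (if int q dvd a then of_nat q else 0)"
proof -
  let ?u = "cis (2 * pi / real q) powi a"
  have pow: "cis (2 * pi * real j / real q) powi a = ?u ^ j" for j
    unfolding cis_power_int Complex.DeMoivre by (rule arg_cong[where f = cis]) (simp add: field_simps)
  have "?u ^ q = cis (2 * pi * of_int a)"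
    using q unfolding cis_power_int Complex.DeMoivre by (intro arg_cong[where f = cis]) (simp add: field_simps)
  also have "\<dots> = 1" by (rule cis_multiple_2pi) simp
  finally have uq: "?u ^ q = 1" .
  show ?thesis
  proof (cases "int q dvd a")
    case True
    then obtain b where "a = int q * b" by (elim dvdE)
    then have "?u = cis (2 * pi * of_int b)"
      using q unfolding cis_power_int by (intro arg_cong[where f = cis]) (simp add: field_simps)
    also have "\<dots> = 1" by (rule cis_multiple_2pi) simp
    finally show ?thesis using True pow by simp
  next
    case False
    have "?u \<noteq> 1"
    proof
      assume "?u = 1"
      then have "cos (real_of_int a * (2 * pi / real q)) = 1"
        by (simp add: cis_power_int complex_eq_iff)
      then obtain k :: int where "real_of_int a * (2 * pi / real q) = of_int k * (2 * pi)"
        using cos_one_2pi_int[of "real_of_int a * (2 * pi / real q)"] by (auto simp: mult_ac)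
      then have "real_of_int a = real_of_int (k * int q)" using q by (simp add: field_simps)
      then have "a = k * int q" by (simp only: of_int_eq_iff)
      then show False using False by simp
    qed
    then show ?thesis using False uq by (simp add: pow geometric_sum)
  qed
qed

text \<open>
  Let \<open>a'\<close> be the residue of \<open>a\<close> of least absolute value
  \<open>A\<close>, so that \<open>2 A \<le> m\<close>. If \<open>A > R\<close>, one of the
  points of the arc has its \<open>A\<close>-th power in the left half plane.
\<close>

lemma bounded_exponent:
  fixes a :: int
  assumes m: "m > 0"
    and pos: "\<And>s. s * R \<le> m \<Longrightarrow> 0 < Re (cis (2 * pi * real s / real m) powi a)"
  shows "\<exists>a'. int m dvd a - a' \<and> \<bar>a'\<bar> \<le> int R"
proof -
  define a' where "a' = (if 2 * (a mod int m) \<le> int m then a mod int m else a mod int m - int m)"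
  have d1: "int m dvd a - a mod int m" by (simp add: dvd_minus_mod)
  have d2: "int m dvd a - (a mod int m - int m)"
    using dvd_add[OF d1 dvd_refl] by (simp only: diff_diff_eq2 add_diff_eq diff_add_eq)
  have cong: "int m dvd a - a'" unfolding a'_def by (split if_split) (intro conjI impI d1 d2)
  have small: "2 * \<bar>a'\<bar> \<le> int m"
  proof -
    define r where "r = a mod int m"
    have "0 \<le> r" "r < int m" using m by (auto simp: r_def)
    moreover have "a' = (if 2 * r \<le> int m then r else r - int m)" by (simp only: a'_def r_def)
    ultimately show ?thesis by (cases "2 * r \<le> int m") auto
  qed
  show ?thesis
  proof (cases "\<bar>a'\<bar> \<le> int R")
    case False
    define A where "A = nat \<bar>a'\<bar>"
    have A: "A > R" "2 * A \<le> m" "int A = \<bar>a'\<bar>" using False small by (auto simp: A_def)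
    \<comment> \<open>The least \<open>s\<close> with \<open>4 A s \<ge> m\<close>; then \<open>2 * pi * s * A /
      m\<close> lies between \<open>pi / 2\<close> and \<open>3 * pi / 2\<close>.\<close>
    define s where "s = (m + 4 * A - 1) div (4 * A)"
    have "(m + 4 * A - 1) mod (4 * A) < 4 * A" using A by simp
    moreover have "m + 4 * A - 1 = s * (4 * A) + (m + 4 * A - 1) mod (4 * A)"
      by (simp only: s_def div_mult_mod_eq)
    ultimately have s: "m \<le> s * (4 * A)" "s * (4 * A) \<le> m + 4 * A - 1" using m A by linarith+
    then have sA: "real m \<le> 4 * (real s * real A)" "4 * (real s * real A) \<le> 3 * real m"
    proof -
      have "s * (4 * A) \<le> 3 * m" using s A by linarith
      then have "real (s * (4 * A)) \<le> real (3 * m)" by (simp only: of_nat_le_iff)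
      then show "4 * (real s * real A) \<le> 3 * real m" by (simp add: algebra_simps)
      have "real m \<le> real (s * (4 * A))" using s by (simp only: of_nat_le_iff)
      then show "real m \<le> 4 * (real s * real A)" by (simp add: algebra_simps)
    qed
    have "s * R \<le> s * A" using A by simp
    also have "s * A \<le> m" using s A by linarith
    finally have sR: "s * R \<le> m" .
    let ?th = "2 * pi * real s / real m"
    have "cis ?th ^ m = 1" by (rule cis_root_of_unity[OF m])
    then have "cis ?th powi a = cis ?th powi a'" using root_powi_cong cong m by blast
    then have "Re (cis ?th powi a) = cos (?th * of_int a')" by (simp add: cis_power_int mult.commute)
    also have "\<dots> = cos (?th * real A)"
    proof (cases "a' \<ge> 0")
      case True
      then have "of_int a' = real A" using A(3) by (metis abs_of_nonneg of_int_of_nat_eq)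
      then show ?thesis by simp
    next
      case False
      then have "of_int a' = - real A" using A(3) by (metis abs_of_neg minus_minus not_le of_int_minus of_int_of_nat_eq)
      then show ?thesis by simp
    qed
    also have "\<dots> \<le> 0"
    proof -
      have th: "pi / 2 \<le> ?th * real A" "?th * real A \<le> 3 * pi / 2"
      proof -
        have "pi * real m \<le> pi * (4 * (real s * real A))" using sA(1) by (intro mult_left_mono) auto
        then show "pi / 2 \<le> ?th * real A" using m by (simp add: field_simps)
        have "pi * (4 * (real s * real A)) \<le> pi * (3 * real m)" using sA(2) by (intro mult_left_mono) auto
        then show "?th * real A \<le> 3 * pi / 2" using m by (simp add: field_simps)
      qed
      have "cos (?th * real A - pi) \<ge> 0" using th by (intro cos_ge_zero) auto
      then show ?thesis by (simp add: cos_diff)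
    qed
    finally show ?thesis using pos[OF sR] by simp
  qed (use cong in blast)
qed

text \<open>
  For \<open>w\<close> on the unit circle, \<open>2 (1 - Re w)\<close> is the squared distance
  from \<open>w\<close> to 1, and taking the \<open>R\<close>-th power increases the distance at
  most by the factor \<open>R\<close>.
\<close>

lemma one_minus_Re_power_le:
  assumes "cmod w = 1"
  shows "1 - Re (w ^ R) \<le> (real R)\<^sup>2 * (1 - Re w)"
proof -
  have *: "(cmod (u - 1))\<^sup>2 = 2 * (1 - Re u)" if "cmod u = 1" for u
  proof -
    have "(Re u)\<^sup>2 + (Im u)\<^sup>2 = 1" using that unfolding cmod_power2[symmetric] by simp
    then show ?thesis unfolding cmod_power2 by (simp add: power2_eq_square algebra_simps)
  qed
  have "cmod (w ^ R - 1) \<le> real R * cmod (w - 1)"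
    using norm_power_diff[of w 1 R] assms by simp
  then have "(cmod (w ^ R - 1))\<^sup>2 \<le> (real R * cmod (w - 1))\<^sup>2" by (intro power_mono) auto
  then have "2 * (1 - Re (w ^ R)) \<le> 2 * ((real R)\<^sup>2 * (1 - Re w))"
    using assms by (simp only: power_mult_distrib * norm_power power_one mult_ac)
  then show ?thesis by simp
qed

text \<open>
  The \<open>R\<close>-th powers of the points of the arc run through all \<open>m\<close>-th
  roots of unity, over which the sum of \<open>1 - Re\<close> is exactly \<open>m\<close>.
\<close>

lemma sum_arc_ge:
  assumes m: "m > 0" and R: "R > 0" and d: "\<not> int m dvd d"
  shows "real m / (real R)\<^sup>2 \<le> (\<Sum>j<m. 1 - Re (cis (2 * pi * real j / real (R * m)) powi d))"
proof -
  let ?w = "\<lambda>j. cis (2 * pi * real j / real (R * m)) powi d"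
  let ?v = "\<lambda>j. cis (2 * pi * real j / real m) powi d"
  have wR: "?w j ^ R = ?v j" for j
    unfolding cis_power_int Complex.DeMoivre by (rule arg_cong[where f = cis]) (use R in \<open>simp add: field_simps\<close>)
  have "(\<Sum>j<m. ?v j) = 0" using d by (simp add: sum_roots_of_unity[OF m])
  then have "real m = (\<Sum>j<m. 1 - Re (?v j))" by (simp add: sum_subtractf flip: Re_sum)
  also have "\<dots> \<le> (\<Sum>j<m. (real R)\<^sup>2 * (1 - Re (?w j)))"
    unfolding wR[symmetric] by (intro sum_mono one_minus_Re_power_le) (simp add: norm_power_int)
  also have "\<dots> = (real R)\<^sup>2 * (\<Sum>j<m. 1 - Re (?w j))" by (rule sum_distrib_left[symmetric])
  finally have le: "real m \<le> (real R)\<^sup>2 * (\<Sum>j<m. 1 - Re (?w j))" .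
  have "0 < (real R)\<^sup>2" using R by simp
  from pos_divide_le_eq[OF this] le show ?thesis by (simp only: mult.commute)
qed

section \<open>Multiplicative functions on the torus are products of power means\<close>

lemma prod_list_tendsto:
  fixes f :: "'a \<Rightarrow> 'b \<Rightarrow> complex"
  assumes "\<And>x. x \<in> set xs \<Longrightarrow> ((\<lambda>i. f i x) \<longlongrightarrow> g x) F"
  shows "((\<lambda>i. \<Prod>x\<leftarrow>xs. f i x) \<longlongrightarrow> (\<Prod>x\<leftarrow>xs. g x)) F"
  using assms by (induction xs) (auto intro!: tendsto_mult)

lemma power_mean_tendsto:
  assumes "\<And>x. cmod (t x) = 1" "\<And>x. (\<lambda>i. u i x) \<longlonglongrightarrow> t x"
  shows "(\<lambda>i. power_mean N (u i) M) \<longlonglongrightarrow> power_mean N t M"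
proof -
  have "t x \<noteq> 0" for x using assms(1)[of x] by auto
  then show ?thesis
    unfolding power_mean_def divide_inverse
    by (intro tendsto_mult tendsto_sum tendsto_const tendsto_power_int assms(2))
qed

text \<open>
  Sequential continuity at 1, turned into a bound that is uniform on an arc. The arc starts at
  the point 1 and extends over an \<open>R\<close>-th part of the circle.
\<close>

lemma continuous_near_one_on_arc:
  fixes F :: "(nat \<Rightarrow> complex) \<Rightarrow> complex"
  assumes F: "\<And>u. (\<And>i. u i \<in> periodic N) \<Longrightarrow> (\<And>x. (\<lambda>i. u i x) \<longlonglongrightarrow> 1) \<Longrightarrow> (\<lambda>i. F (u i)) \<longlonglongrightarrow> 1"
    and e: "e > 0"
  obtains R where "R \<ge> 1" "\<And>th. 0 \<le> th \<Longrightarrow> th \<le> 2 * pi / real R \<Longrightarrow> cmod (F (point_fun N (cis th)) - 1) < e"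
proof (rule ccontr)
  assume "\<not> thesis"
  then have "\<forall>R. \<exists>th. R \<ge> 1 \<longrightarrow> 0 \<le> th \<and> th \<le> 2 * pi / real R \<and> \<not> cmod (F (point_fun N (cis th)) - 1) < e"
    using that by blast
  then obtain th where th: "\<And>R. R \<ge> 1 \<Longrightarrow> 0 \<le> th R \<and> th R \<le> 2 * pi / real R \<and> \<not> cmod (F (point_fun N (cis (th R))) - 1) < e"
    by metis
  define u where "u i = point_fun N (cis (th (Suc i)))" for i
  have lim: "(\<lambda>i. th (Suc i)) \<longlonglongrightarrow> 0"
  proof (rule real_tendsto_sandwich[OF _ _ tendsto_const])
    show "\<forall>\<^sub>F i in sequentially. 0 \<le> th (Suc i)" using th by simp
    have "th (Suc i) \<le> 2 * pi * inverse (real (Suc i))" for i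
      using th[of "Suc i"] by (simp add: divide_inverse)
    then show "\<forall>\<^sub>F i in sequentially. th (Suc i) \<le> 2 * pi * inverse (real (Suc i))"
      by (intro always_eventually allI)
    show "(\<lambda>i. 2 * pi * inverse (real (Suc i))) \<longlonglongrightarrow> 0"
      using tendsto_mult_left[OF LIMSEQ_inverse_real_of_nat, of "2 * pi"] by simp
  qed
  have "(\<lambda>i. cis (th (Suc i))) \<longlonglongrightarrow> cis 0"
    unfolding cis_conv_exp by (intro tendsto_intros lim)
  then have "(\<lambda>i. u i x) \<longlonglongrightarrow> 1" for x
  proof (cases "x \<ge> 1 \<and> (x - 1) mod N = 0")
    case True
    then have "u i x = cis (th (Suc i))" for i unfolding u_def point_fun_def by (rule if_P)
    then show ?thesis using \<open>(\<lambda>i. cis (th (Suc i))) \<longlonglongrightarrow> cis 0\<close> by simp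
  next
    case False
    then have "u i x = 1" for i unfolding u_def point_fun_def by (rule if_not_P)
    then show ?thesis by simp
  qed
  moreover have "u i \<in> periodic N" for i by (simp add: u_def point_fun_periodic)
  ultimately have "(\<lambda>i. F (u i)) \<longlonglongrightarrow> 1" by (intro F)
  then have "\<forall>\<^sub>F i in sequentially. dist (F (u i)) 1 < e" using e by (rule tendstoD)
  then obtain i where "dist (F (u i)) 1 < e" by (auto simp: eventually_sequentially)
  then show False using th[of "Suc i"] by (simp add: u_def dist_norm)
qed

lemma Nprod_ge: "\<forall>k\<ge>1. n k > 1 \<Longrightarrow> 2 ^ k \<le> Nprod n k"
proof (induction k)
  case (Suc k)
  have "2 \<le> n (Suc k)" using Suc.prems[rule_format, of "Suc k"] by simp
  then have "2 ^ k * 2 \<le> Nprod n k * n (Suc k)" using Suc by (intro mult_le_mono) auto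
  then show ?case by (simp add: Nprod_def mult.commute)
qed (simp add: Nprod_def)

context multiplicative_limit
begin

text \<open>
  A character whose orbit average is close to \<open>\<phi>\<close> satisfies the hypothesis of
  \<open>orbit_average_point_fun_imp_nearly_constant\<close> for all \<open>z\<close> in the arc. Summing
  over the arc with \<open>sum_arc_ge\<close> and choosing the reference entry \<open>c = l
  x0\<close> well, at most \<open>4 b R\<^sup>2\<close> entries \<open>l y\<close> are not
  congruent to \<open>c\<close>, where \<open>b\<close> is the first level; the product \<open>b
  R\<^sup>2\<close> does not involve \<open>m\<close> or the level of the character. By
  \<open>orbit_average_approx_few_entries\<close> the model then holds up to an error that tends to 0.
  Reduced modulo \<open>m\<close>, there are only finitely many models, so one of them has error
  0.
\<close>

lemma model_on_torsion:
  assumes R: "R \<ge> 1"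
    and big: "\<And>th. 0 \<le> th \<Longrightarrow> th \<le> 2 * pi / real R \<Longrightarrow> 3/4 < cmod (\<phi> (point_fun (Nprod n 1) (cis th)))"
    and J: "J \<ge> 1" and m: "m > 0"
  shows "\<exists>\<beta> as. length as \<le> 4 * Nprod n 1 * R\<^sup>2 \<and> (\<forall>a\<in>set as. \<not> int m dvd a) \<and>
    (\<forall>t\<in>torsion m (Nprod n J). \<phi> t = (\<Prod>x=1..Nprod n J. t x) ^ \<beta> * (\<Prod>a\<leftarrow>as. power_mean (Nprod n J) t a))"
proof -
  define b where "b = Nprod n 1"
  define L where "L = 4 * b * R\<^sup>2"
  define Z where "Z j = cis (2 * pi * real j / real (R * m))" for j :: nat
  have b2: "b \<ge> 2" using Nprod_ge[OF n, of 1] by (simp add: b_def)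
  have Rm: "R * m > 0" using R m by simp
  have Z1: "cmod (Z j) = 1" for j by (simp add: Z_def)
  have Zroot: "Z j ^ (R * m) = 1" for j unfolding Z_def by (rule cis_root_of_unity[OF Rm])
  have Zbig: "3/4 < cmod (\<phi> (point_fun b (Z j)))" if "j < m" for j
    unfolding Z_def b_def
  proof (rule big)
    have "2 * pi * real j * real R \<le> 2 * pi * (real R * real m)" using that R by simp
    then show "2 * pi * real j / real (R * m) \<le> 2 * pi / real R"
      using R m by (simp add: field_simps)
  qed simp
  \<comment> \<open>With this precision the orbit average inherits the bound 3/4 at all points of the arc.\<close>
  define e0 where "e0 = Min ((\<lambda>j. cmod (\<phi> (point_fun b (Z j))) - 3/4) ` {..<m})"
  have e0: "e0 > 0" "\<And>j. j < m \<Longrightarrow> e0 \<le> cmod (\<phi> (point_fun b (Z j))) - 3/4"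
    unfolding e0_def using Zbig m by (subst Min_gr_iff) (auto simp: lessThan_empty_iff)
  let ?val = "\<lambda>\<beta> as t. (\<Prod>x=1..Nprod n J. t x) ^ \<beta> * (\<Prod>a\<leftarrow>as. power_mean (Nprod n J) t a)"
  have bJ: "b dvd Nprod n J" unfolding b_def by (rule N_dvd[OF J])
  have step: "\<exists>\<beta> as. \<beta> < m \<and> set as \<subseteq> {0..<int m} \<and> length as \<le> L \<and> (\<forall>a\<in>set as. \<not> int m dvd a) \<and>
      (\<forall>t\<in>torsion m (Nprod n J). cmod (\<phi> t - ?val \<beta> as t) \<le> (1 + 2 * real (L\<^sup>2)) / real (Suc i))" for i
  proof -
    have "min e0 (1 / real (Suc i)) > 0" using e0 by simp
    \<comment> \<open>The points of the arc are torsion of order \<open>R * m\<close>, so the approximation is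
      needed there and not only on the \<open>m\<close>-torsion. The summand 6 makes the level
      large enough for \<open>48 \<le> N\<close>.\<close>
    from orbit_approximation[OF J Rm order_refl this] eventually_ge_at_top[of "J + i + 6"]
    have "\<forall>\<^sub>F k in sequentially. J + i + 6 \<le> k \<and> (\<exists>l. \<forall>t\<in>torsion (R * m) (Nprod n J).
        cmod (orbit_average (Nprod n k) l t - \<phi> t) < min e0 (1 / real (Suc i)))"
      by eventually_elim blast
    then have "\<exists>k. J + i + 6 \<le> k \<and> (\<exists>l. \<forall>t\<in>torsion (R * m) (Nprod n J).
        cmod (orbit_average (Nprod n k) l t - \<phi> t) < min e0 (1 / real (Suc i)))"
      by (rule eventually_happens'[OF sequentially_bot])
    then obtain k l where k: "J + i + 6 \<le> k" and l: "\<And>t. t \<in> torsion (R * m) (Nprod n J) \<Longrightarrow>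
        cmod (orbit_average (Nprod n k) l t - \<phi> t) < min e0 (1 / real (Suc i))"
      by blast
    define N where "N = Nprod n k"
    have N: "N > 0" unfolding N_def by (rule N_pos)
    have "k < N" using Nprod_ge[OF n, of k] less_exp[of k] unfolding N_def by linarith
    moreover have "(2::nat) ^ 6 \<le> 2 ^ k" using k by (intro power_increasing) auto
    ultimately have Nbig: "Suc i \<le> N" "48 \<le> N" using k Nprod_ge[OF n, of k] unfolding N_def by auto
    have "b dvd N" unfolding b_def N_def using k J by (intro N_dvd) simp
    then obtain q where q: "N = b * q" by (elim dvdE)
    then have q0: "q > 0" using N by (auto intro: gr0I)
    have JN: "Nprod n J dvd N" unfolding N_def using k by (intro N_dvd) simp
    then obtain r where r: "N = r * Nprod n J" by (metis dvdE mult.commute)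
    have each: "(\<Sum>x=1..N. \<Sum>y=1..N. 1 - Re (Z j powi (int (l x) - int (l y)))) \<le> 4 * real b * real N" if "j < m" for j
    proof -
      have pf: "point_fun b (Z j) \<in> torsion (R * m) (Nprod n J)"
        using point_fun_torsion[OF Z1 Zroot] torsion_mono[OF bJ dvd_refl] by blast
      have "cmod (\<phi> (point_fun b (Z j))) \<le> cmod (orbit_average N l (point_fun b (Z j))) + cmod (orbit_average N l (point_fun b (Z j)) - \<phi> (point_fun b (Z j)))"
        using norm_triangle_ineq2[of "\<phi> (point_fun b (Z j))" "orbit_average N l (point_fun b (Z j))"]
        by (simp add: norm_minus_commute)
      then have "3/4 < cmod (orbit_average N l (point_fun b (Z j)))"
        using l[OF pf] e0(2)[OF that] unfolding N_def by linarith
      then show ?thesis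
        using orbit_average_point_fun_imp_nearly_constant[OF b2 q0 _ Z1, of l j] Nbig unfolding q by simp
    qed
    define W where "W x y = (\<Sum>j<m. 1 - Re (Z j powi (int (l x) - int (l y))))" for x y
    have W0: "0 \<le> W x y" for x y
    proof -
      have "Re (Z j powi (int (l x) - int (l y))) \<le> 1" for j
        using complex_Re_le_cmod[of "Z j powi (int (l x) - int (l y))"] by (simp add: norm_power_int Z1)
      then show ?thesis unfolding W_def by (intro sum_nonneg) simp
    qed
    have "(\<Sum>x=1..N. \<Sum>y=1..N. W x y) = (\<Sum>j<m. \<Sum>x=1..N. \<Sum>y=1..N. 1 - Re (Z j powi (int (l x) - int (l y))))"
      unfolding W_def by (simp only: sum.swap[of _ _ "{..<m}"])
    also have "\<dots> \<le> (\<Sum>j<m. 4 * real b * real N)" by (intro sum_mono each) simp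
    finally have total: "(\<Sum>x=1..N. \<Sum>y=1..N. W x y) \<le> real N * (4 * real b * real m)" by (simp add: mult_ac)
    \<comment> \<open>Some row of the matrix \<open>W\<close> is at most the mean of all rows.\<close>
    have "\<exists>x0\<in>{1..N}. (\<Sum>y=1..N. W x0 y) \<le> 4 * real b * real m"
    proof (rule ccontr)
      assume "\<not> ?thesis"
      then have "4 * real b * real m < (\<Sum>y=1..N. W x y)" if "x \<in> {1..N}" for x
        using that by (meson not_le)
      then have "(\<Sum>x=1..N. 4 * real b * real m) < (\<Sum>x=1..N. \<Sum>y=1..N. W x y)"
        using N by (intro sum_strict_mono) auto
      then show False using total by simp
    qed
    then obtain x0 where x0: "x0 \<in> {1..N}" "(\<Sum>y=1..N. W x0 y) \<le> 4 * real b * real m" by blast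
    define c where "c = l x0"
    define D where "D = {y \<in> {1..N}. \<not> int m dvd int (l y) - int c}"
    have D: "finite D" "D \<subseteq> {1..N}" by (auto simp: D_def)
    have "real (card D) * (real m / (real R)\<^sup>2) = (\<Sum>y\<in>D. real m / (real R)\<^sup>2)" by simp
    also have "\<dots> \<le> (\<Sum>y\<in>D. W x0 y)"
    proof (rule sum_mono)
      fix y assume "y \<in> D"
      then have "\<not> int m dvd int (l x0) - int (l y)" by (simp add: D_def c_def dvd_diff_commute)
      then show "real m / (real R)\<^sup>2 \<le> W x0 y" unfolding W_def Z_def using m R by (intro sum_arc_ge) auto
    qed
    also have "\<dots> \<le> (\<Sum>y=1..N. W x0 y)" using D W0 by (intro sum_mono2) auto
    also have "\<dots> \<le> 4 * real b * real m" by (rule x0)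
    finally have "real (card D) \<le> real L" using m R by (simp add: L_def field_simps)
    then have cD: "card D \<le> L" by simp
    define as where "as = map (\<lambda>y. (int (l y) - int c) mod int m) (sorted_list_of_set D)"
    have as: "set as \<subseteq> {0..<int m}" "length as \<le> L" "\<forall>a\<in>set as. \<not> int m dvd a"
      using m D cD by (auto simp: as_def D_def dvd_mod_iff)
    \<comment> \<open>The product over \<open>{1..N}\<close> is the \<open>r\<close>-th power of the product over
      the lower level.\<close>
    define \<beta> where "\<beta> = (r * c) mod m"
    have "cmod (\<phi> t - ?val \<beta> as t) \<le> (1 + 2 * real (L\<^sup>2)) / real (Suc i)" if t: "t \<in> torsion m (Nprod n J)" for t
    proof -
      have tN: "t \<in> torsion m N" using t torsion_mono[OF JN dvd_refl] by blast
      have tp: "t \<in> periodic (Nprod n J)" using t by (simp add: torsion_def)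
      have "t \<in> torsion (R * m) (Nprod n J)" using t torsion_mono[OF dvd_refl dvd_triv_right] by blast
      then have 1: "cmod (orbit_average N l t - \<phi> t) \<le> 1 / real (Suc i)" using l unfolding N_def by fastforce
      have 2: "cmod (orbit_average N l t - (\<Prod>x=1..N. t x) ^ c * (\<Prod>y\<in>D. power_mean N t (int (l y) - int c)))
         \<le> 2 * real ((card D)\<^sup>2) / real N"
        unfolding D_def by (rule orbit_average_approx_few_entries[OF N m tN])
      let ?d = "\<Prod>x=1..Nprod n J. t x"
      have "?d ^ m = 1" using t by (subst prod_power_distrib) (simp add: torsion_def)
      then have "?d ^ (r * c) = ?d ^ \<beta>"
        unfolding \<beta>_def
        by (subst mult_div_mod_eq[of m "r * c", symmetric]) (simp only: power_add power_mult power_one mult_1)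
      moreover have "(\<Prod>x=1..N. t x) = ?d ^ r"
        unfolding r using periodic_sum_blocks(2)[OF tp, of "\<lambda>z. z" r] by simp
      ultimately have det: "(\<Prod>x=1..N. t x) ^ c = ?d ^ \<beta>" by (simp add: power_mult)
      have "(\<Prod>a\<leftarrow>as. power_mean (Nprod n J) t a) = (\<Prod>y\<in>D. power_mean (Nprod n J) t ((int (l y) - int c) mod int m))"
        unfolding as_def using D by (simp add: comp_def prod.distinct_set_conv_list[symmetric])
      also have "\<dots> = (\<Prod>y\<in>D. power_mean N t (int (l y) - int c))"
      proof (rule prod.cong[OF refl])
        fix y
        have "int m dvd (int (l y) - int c) mod int m - (int (l y) - int c)"
          by (simp add: dvd_diff_commute dvd_minus_mod)
        from power_mean_cong[OF t this m]
        show "power_mean (Nprod n J) t ((int (l y) - int c) mod int m) = power_mean N t (int (l y) - int c)"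
          using power_mean_dvd[OF tp JN N] by simp
      qed
      finally have val: "?val \<beta> as t = (\<Prod>x=1..N. t x) ^ c * (\<Prod>y\<in>D. power_mean N t (int (l y) - int c))"
        by (simp only: det)
      have "cmod (\<phi> t - ?val \<beta> as t) \<le> cmod (orbit_average N l t - \<phi> t) + cmod (orbit_average N l t - ?val \<beta> as t)"
        using norm_triangle_ineq4[of "orbit_average N l t - ?val \<beta> as t" "orbit_average N l t - \<phi> t"]
        by (simp add: add.commute)
      also have "\<dots> \<le> cmod (orbit_average N l t - \<phi> t) + 2 * real ((card D)\<^sup>2) / real N"
        using 2 unfolding val by (rule add_left_mono)
      also have "\<dots> \<le> 1 / real (Suc i) + 2 * real (L\<^sup>2) / real (Suc i)"
      proof (rule add_mono[OF 1])
        have "(card D)\<^sup>2 \<le> L\<^sup>2" using cD by (rule power_mono) simp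
        then have "real ((card D)\<^sup>2) \<le> real (L\<^sup>2)" by (simp only: of_nat_le_iff)
        moreover have "real (Suc i) \<le> real N" using Nbig(1) by (simp only: of_nat_le_iff)
        ultimately show "2 * real ((card D)\<^sup>2) / real N \<le> 2 * real (L\<^sup>2) / real (Suc i)"
          by (intro frac_le mult_left_mono) auto
      qed
      finally show ?thesis by (simp add: add_divide_distrib)
    qed
    moreover have "\<beta> < m" using m by (simp add: \<beta>_def)
    ultimately show ?thesis using as by blast
  qed
  then obtain \<beta> as where ba: "\<And>i. \<beta> i < m \<and> set (as i) \<subseteq> {0..<int m} \<and> length (as i) \<le> L \<and> (\<forall>a\<in>set (as i). \<not> int m dvd a) \<and>
      (\<forall>t\<in>torsion m (Nprod n J). cmod (\<phi> t - ?val (\<beta> i) (as i) t) \<le> (1 + 2 * real (L\<^sup>2)) / real (Suc i))"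
    by metis
  have "finite ({..<m} \<times> {xs. set xs \<subseteq> {0..<int m} \<and> length xs \<le> L})"
    using finite_lists_length_le[of "{0..<int m}" L] by simp
  moreover have "range (\<lambda>i. (\<beta> i, as i)) \<subseteq> {..<m} \<times> {xs. set xs \<subseteq> {0..<int m} \<and> length xs \<le> L}"
    using ba by auto
  ultimately have "finite (range (\<lambda>i. (\<beta> i, as i)))" by (rule finite_subset[rotated])
  then obtain i0 where i0: "infinite {i \<in> UNIV. (\<beta> i, as i) = (\<beta> i0, as i0)}"
    using pigeonhole_infinite[OF infinite_UNIV_nat] by blast
  have "\<phi> t = ?val (\<beta> i0) (as i0) t" if t: "t \<in> torsion m (Nprod n J)" for t
  proof (rule ccontr)
    assume "\<phi> t \<noteq> ?val (\<beta> i0) (as i0) t"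
    then have pos: "cmod (\<phi> t - ?val (\<beta> i0) (as i0) t) > 0" by simp
    obtain K where K: "(1 + 2 * real (L\<^sup>2)) / cmod (\<phi> t - ?val (\<beta> i0) (as i0) t) < real K"
      using reals_Archimedean2 by blast
    obtain i where "i > K" "i \<in> {i \<in> UNIV. (\<beta> i, as i) = (\<beta> i0, as i0)}"
      using i0 unfolding infinite_nat_iff_unbounded by blast
    then have i: "i > K" "\<beta> i = \<beta> i0" "as i = as i0" by auto
    have "cmod (\<phi> t - ?val (\<beta> i0) (as i0) t) \<le> (1 + 2 * real (L\<^sup>2)) / real (Suc i)"
      using ba[of i] t unfolding i(2,3) by blast
    then have "cmod (\<phi> t - ?val (\<beta> i0) (as i0) t) * real (Suc i) \<le> 1 + 2 * real (L\<^sup>2)"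
      by (simp add: pos_le_divide_eq)
    moreover have "1 + 2 * real (L\<^sup>2) < cmod (\<phi> t - ?val (\<beta> i0) (as i0) t) * real K"
      using K pos by (simp add: field_simps)
    moreover have "cmod (\<phi> t - ?val (\<beta> i0) (as i0) t) * real K \<le> cmod (\<phi> t - ?val (\<beta> i0) (as i0) t) * real (Suc i)"
      using i(1) by (intro mult_left_mono) auto
    ultimately show False by linarith
  qed
  moreover have "length (as i0) \<le> 4 * Nprod n 1 * R\<^sup>2" "\<forall>a\<in>set (as i0). \<not> int m dvd a"
    using ba[of i0] unfolding L_def b_def by auto
  ultimately show ?thesis by blast
qed

text \<open>
  All factors of the model have absolute value at most 1, so each power mean is at least as
  large as \<open>\<phi>\<close> in absolute value, which is near 1 on an arc; this confines the
  exponents to \<open>{- R..R}\<close> modulo \<open>m\<close>. Exponents divisible by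
  \<open>m\<close> do not occur, so the representatives are nonzero.
\<close>

lemma bounded_model_on_torsion:
  "\<exists>L R :: nat. \<forall>J\<ge>1. \<forall>m>0.
    \<exists>\<beta> as. length as \<le> L \<and> set as \<subseteq> {- int R..int R} - {0} \<and>
    (\<forall>t\<in>torsion m (Nprod n J). \<phi> t = (\<Prod>x=1..Nprod n J. t x) ^ \<beta> * (\<Prod>a\<leftarrow>as. power_mean (Nprod n J) t a))"
proof -
  define b where "b = Nprod n 1"
  have b2: "b \<ge> 2" using Nprod_ge[OF n, of 1] by (simp add: b_def)
  \<comment> \<open>At \<open>point_fun b z\<close> a power mean differs from 1 by at most \<open>2 / b\<close>,
    so the precision has to be of order \<open>1 / b\<close>.\<close>
  define e where "e = 1 / (4 * real b)"
  have e: "e > 0" "e \<le> 1/8" using b2 by (auto simp: e_def field_simps)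
  have "(\<lambda>i. \<phi> (u i)) \<longlonglongrightarrow> 1" if "\<And>i. u i \<in> periodic b" "\<And>x. (\<lambda>i. u i x) \<longlonglongrightarrow> 1" for u
    using cont[of 1 u "\<lambda>_. 1"] that one by (simp add: periodic_one b_def)
  then obtain R where R: "R \<ge> 1" "\<And>th. 0 \<le> th \<Longrightarrow> th \<le> 2 * pi / real R \<Longrightarrow> cmod (\<phi> (point_fun b (cis th)) - 1) < e"
    using continuous_near_one_on_arc[of b \<phi> e] e by metis
  have near: "1 - e < cmod (\<phi> (point_fun b (cis th)))" if "0 \<le> th" "th \<le> 2 * pi / real R" for th
    using R(2)[OF that] norm_triangle_ineq2[of 1 "\<phi> (point_fun b (cis th))"] by (simp add: norm_minus_commute)
  then have big: "3/4 < cmod (\<phi> (point_fun b (cis th)))" if "0 \<le> th" "th \<le> 2 * pi / real R" for th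
    using near[OF that] e by linarith
  have "\<exists>\<beta> as. length as \<le> 4 * b * R\<^sup>2 \<and> set as \<subseteq> {- int R..int R} - {0} \<and>
    (\<forall>t\<in>torsion m (Nprod n J). \<phi> t = (\<Prod>x=1..Nprod n J. t x) ^ \<beta> * (\<Prod>a\<leftarrow>as. power_mean (Nprod n J) t a))"
    if J: "J \<ge> 1" and m: "m > 0" for J m
  proof -
    from model_on_torsion[OF R(1) big[unfolded b_def] J m, folded b_def]
    obtain \<beta> as where as: "length as \<le> 4 * b * R\<^sup>2" "\<And>a. a \<in> set as \<Longrightarrow> \<not> int m dvd a"
      and model: "\<And>t. t \<in> torsion m (Nprod n J) \<Longrightarrow> \<phi> t = (\<Prod>x=1..Nprod n J. t x) ^ \<beta> * (\<Prod>a\<leftarrow>as. power_mean (Nprod n J) t a)"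
      by auto
    have bJ: "b dvd Nprod n J" unfolding b_def by (rule N_dvd[OF J])
    have "\<exists>a'. int m dvd a - a' \<and> \<bar>a'\<bar> \<le> int R" if a: "a \<in> set as" for a
    proof (rule bounded_exponent[OF m])
      fix s assume s: "s * R \<le> m"
      define z where "z = cis (2 * pi * real s / real m)"
      define t where "t = point_fun b z"
      have z1: "cmod z = 1" by (simp add: z_def)
      have "z ^ m = 1" unfolding z_def by (rule cis_root_of_unity[OF m])
      then have tb: "t \<in> torsion m b" unfolding t_def using z1 point_fun_torsion by blast
      then have tJ: "t \<in> torsion m (Nprod n J)" using torsion_mono[OF bJ dvd_refl] by blast
      have tp: "t \<in> periodic b" using tb by (simp add: torsion_def)
      have "real s * real R \<le> real m" using s by (metis of_nat_le_iff of_nat_mult)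
      then have "2 * pi * (real s * real R) \<le> 2 * pi * real m" by (intro mult_left_mono) auto
      then have "2 * pi * real s / real m \<le> 2 * pi / real R" using m R(1) by (simp add: field_simps)
      then have "1 - e < cmod (\<phi> t)" unfolding t_def z_def by (intro near) auto
      also have "cmod (\<phi> t) \<le> cmod (power_mean (Nprod n J) t a)"
      proof -
        have c1: "cmod (\<Prod>a\<leftarrow>xs. power_mean (Nprod n J) t a) \<le> 1" for xs
          by (induction xs) (auto simp: norm_mult intro!: mult_le_one cmod_power_mean[OF tp N_pos])
        obtain ys zs where "as = ys @ a # zs" using a by (meson split_list)
        then have "\<phi> t = (\<Prod>x=1..Nprod n J. t x) ^ \<beta> * ((\<Prod>a\<leftarrow>ys @ zs. power_mean (Nprod n J) t a) * power_mean (Nprod n J) t a)"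
          using model[OF tJ] by simp
        moreover have "cmod ((\<Prod>x=1..Nprod n J. t x) ^ \<beta>) = 1" by (simp add: norm_power periodic_cmod[OF tp] flip: prod_norm)
        ultimately have "cmod (\<phi> t) = cmod (\<Prod>a\<leftarrow>ys @ zs. power_mean (Nprod n J) t a) * cmod (power_mean (Nprod n J) t a)"
          by (simp add: norm_mult)
        then show ?thesis using mult_right_mono[OF c1[of "ys @ zs"] norm_ge_zero] by simp
      qed
      also have "power_mean (Nprod n J) t a = power_mean b t a" by (rule power_mean_dvd[OF tp bJ N_pos])
      finally have "(1 - e)\<^sup>2 < (cmod (power_mean b t a))\<^sup>2" using e by (intro power_strict_mono) auto
      then have "(1 - e)\<^sup>2 < 1 - 2 / real b * (1 - 1 / real b) * (1 - Re (z powi a))"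
        unfolding t_def using b2 z1 by (subst (asm) cmod_power_mean_point_fun) auto
      moreover have "1 - 2 * e \<le> (1 - e)\<^sup>2" by (simp add: power2_eq_square algebra_simps)
      ultimately have 1: "2 / real b * (1 - 1 / real b) * (1 - Re (z powi a)) < 2 * e" by linarith
      have "0 \<le> 1 - Re (z powi a)" using complex_Re_le_cmod[of "z powi a"] z1 by (simp add: norm_power_int)
      moreover have "1 / real b \<le> 2 / real b * (1 - 1 / real b)" using b2 by (simp add: field_simps)
      ultimately have "1 / real b * (1 - Re (z powi a)) \<le> 2 / real b * (1 - 1 / real b) * (1 - Re (z powi a))"
        by (intro mult_right_mono)
      with 1 have "1 / real b * (1 - Re (z powi a)) < 2 * e" by linarith
      then have "1 - Re (z powi a) < 1/2" using b2 by (simp add: e_def field_simps)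
      then show "0 < Re (cis (2 * pi * real s / real m) powi a)" by (simp add: z_def)
    qed
    then obtain f where f: "\<And>a. a \<in> set as \<Longrightarrow> int m dvd a - f a \<and> \<bar>f a\<bar> \<le> int R" by metis
    have "set (map f as) \<subseteq> {- int R..int R} - {0}"
    proof
      fix a' assume "a' \<in> set (map f as)"
      then obtain a where "a \<in> set as" "a' = f a" by auto
      then show "a' \<in> {- int R..int R} - {0}" using f[of a] as(2)[of a] by auto
    qed
    moreover have "\<phi> t = (\<Prod>x=1..Nprod n J. t x) ^ \<beta> * (\<Prod>a\<leftarrow>map f as. power_mean (Nprod n J) t a)"
      if t: "t \<in> torsion m (Nprod n J)" for t
    proof -
      have "map (power_mean (Nprod n J) t) as = map (power_mean (Nprod n J) t) (map f as)"
        using power_mean_cong[OF t _ m] f by simp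
      then show ?thesis by (simp only: model[OF t])
    qed
    moreover have "length (map f as) \<le> 4 * b * R\<^sup>2" using as(1) by simp
    ultimately show ?thesis by blast
  qed
  then show ?thesis by blast
qed

text \<open>
  The models for the \<open>(i + 1)!\<close>-torsion of level \<open>i + 1\<close> have
  exponents from a finite set of lists, so one list \<open>xs\<close> occurs for infinitely many
  \<open>i\<close>. Seen on a fixed level \<open>J\<close>, the remaining factor is the power of
  \<open>\<Prod>x. t x\<close> with exponent \<open>B J i\<close>. By continuity this exponent
  has a representative modulo \<open>m i\<close> that is bounded independently of
  \<open>i\<close>. Comparing level \<open>J\<close> with a much higher level \<open>J1\<close>
  shows that the representative is a multiple of a number exceeding the bound, so it is 0.
\<close>

lemma product_of_power_means_on_torsion:
  "\<exists>xs :: int list. 0 \<notin> set xs \<and>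
    (\<forall>J\<ge>1. \<forall>m>0. \<forall>t\<in>torsion m (Nprod n J). \<phi> t = (\<Prod>a\<leftarrow>xs. power_mean (Nprod n J) t a))"
proof -
  from bounded_model_on_torsion obtain L R :: nat where RL: "\<forall>J\<ge>1. \<forall>m>0.
    \<exists>\<beta> as. length as \<le> L \<and> set as \<subseteq> {- int R..int R} - {0} \<and>
    (\<forall>t\<in>torsion m (Nprod n J). \<phi> t = (\<Prod>x=1..Nprod n J. t x) ^ \<beta> * (\<Prod>a\<leftarrow>as. power_mean (Nprod n J) t a))"
    by (elim exE) (rule that)
  \<comment> \<open>Factorials, so that every order divides all but finitely many of them.\<close>
  define m :: "nat \<Rightarrow> nat" where "m i = fact (Suc i)" for i
  have m0: "m i > 0" for i by (simp add: m_def)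
  have mi: "i < m i" for i using fact_ge_self[of "Suc i"] unfolding m_def by linarith
  have "\<forall>i. \<exists>\<beta> as. length as \<le> L \<and> set as \<subseteq> {- int R..int R} - {0} \<and>
    (\<forall>t\<in>torsion (m i) (Nprod n (Suc i)). \<phi> t = (\<Prod>x=1..Nprod n (Suc i). t x) ^ \<beta> * (\<Prod>a\<leftarrow>as. power_mean (Nprod n (Suc i)) t a))"
    using RL[rule_format, OF _ m0] by (intro allI) simp
  then obtain \<beta> as where as: "\<And>i. length (as i) \<le> L \<and> set (as i) \<subseteq> {- int R..int R} - {0}"
    and model: "\<And>i t. t \<in> torsion (m i) (Nprod n (Suc i)) \<Longrightarrow>
      \<phi> t = (\<Prod>x=1..Nprod n (Suc i). t x) ^ \<beta> i * (\<Prod>a\<leftarrow>as i. power_mean (Nprod n (Suc i)) t a)"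
    by metis
  have "finite {xs. set xs \<subseteq> {- int R..int R} - {0} \<and> length xs \<le> L}"
    by (rule finite_lists_length_le) simp
  moreover have "range as \<subseteq> {xs. set xs \<subseteq> {- int R..int R} - {0} \<and> length xs \<le> L}" using as by auto
  ultimately have "finite (range as)" by (rule finite_subset[rotated])
  then obtain i0 where i0: "infinite {i \<in> UNIV. as i = as i0}"
    using pigeonhole_infinite[OF infinite_UNIV_nat] by blast
  define xs where "xs = as i0"
  have inf: "\<exists>i>K. as i = xs" for K
    using i0 unfolding infinite_nat_iff_unbounded xs_def by auto
  define Psi where "Psi N t = (\<Prod>a\<leftarrow>xs. power_mean N t a)" for N t
  define B where "B J i = \<beta> i * (Nprod n (Suc i) div Nprod n J)" for J i
  have model': "\<phi> t = (\<Prod>x=1..Nprod n J. t x) ^ B J i * Psi (Nprod n J) t"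
    if i: "as i = xs" "J \<le> Suc i" and t: "t \<in> torsion (m i) (Nprod n J)" for J i t
  proof -
    have d: "Nprod n J dvd Nprod n (Suc i)" by (rule N_dvd[OF i(2)])
    have tp: "t \<in> periodic (Nprod n J)" using t by (simp add: torsion_def)
    have "t \<in> torsion (m i) (Nprod n (Suc i))" using t torsion_mono[OF d dvd_refl] by blast
    then have "\<phi> t = (\<Prod>x=1..Nprod n (Suc i). t x) ^ \<beta> i * (\<Prod>a\<leftarrow>xs. power_mean (Nprod n (Suc i)) t a)"
      using model i(1) by simp
    moreover have "(\<Prod>x=1..Nprod n (Suc i). t x) = (\<Prod>x=1..Nprod n J. t x) ^ (Nprod n (Suc i) div Nprod n J)"
      using periodic_sum_blocks(2)[OF tp, of "\<lambda>z. z" "Nprod n (Suc i) div Nprod n J"] d by simp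
    moreover have "power_mean (Nprod n (Suc i)) t a = power_mean (Nprod n J) t a" for a
      by (rule power_mean_dvd[OF tp d N_pos])
    ultimately show ?thesis by (simp add: B_def Psi_def mult.commute flip: power_mult)
  qed
  have small_rep: "\<exists>Q. \<forall>i. as i = xs \<longrightarrow> J \<le> Suc i \<longrightarrow> (\<exists>c. int (m i) dvd int (B J i) - c \<and> \<bar>c\<bar> \<le> int Q)"
    if J: "J \<ge> 1" for J
  proof -
    let ?N = "Nprod n J"
    have "(\<lambda>i. \<phi> (u i)) \<longlonglongrightarrow> 1" if "\<And>i. u i \<in> periodic ?N" "\<And>x. (\<lambda>i. u i x) \<longlonglongrightarrow> 1" for u
      using cont[OF J, of u "\<lambda>_. 1"] that one by (simp add: periodic_one)
    then obtain R1 where R1: "R1 \<ge> 1" "\<And>th. 0 \<le> th \<Longrightarrow> th \<le> 2 * pi / real R1 \<Longrightarrow> cmod (\<phi> (point_fun ?N (cis th)) - 1) < 1/4"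
      using continuous_near_one_on_arc[of ?N \<phi> "1/4"] by auto
    have "(\<lambda>i. Psi ?N (u i)) \<longlonglongrightarrow> 1" if u: "\<And>i. u i \<in> periodic ?N" "\<And>x. (\<lambda>i. u i x) \<longlonglongrightarrow> 1" for u
    proof -
      have "(\<lambda>i. Psi ?N (u i)) \<longlonglongrightarrow> Psi ?N (\<lambda>_. 1)"
        unfolding Psi_def using u by (intro prod_list_tendsto power_mean_tendsto) auto
      moreover have "Psi ?N (\<lambda>_. 1) = 1" using N_pos[of J] by (simp add: Psi_def power_mean_def prod_list_replicate map_replicate_const)
      ultimately show ?thesis by simp
    qed
    then obtain R2 where R2: "R2 \<ge> 1" "\<And>th. 0 \<le> th \<Longrightarrow> th \<le> 2 * pi / real R2 \<Longrightarrow> cmod (Psi ?N (point_fun ?N (cis th)) - 1) < 1/4"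
      using continuous_near_one_on_arc[of ?N "Psi ?N" "1/4"] by auto
    have "\<exists>c. int (m i) dvd int (B J i) - c \<and> \<bar>c\<bar> \<le> int (max R1 R2)" if i: "as i = xs" "J \<le> Suc i" for i
    proof (rule bounded_exponent[OF m0])
      fix s assume s: "s * max R1 R2 \<le> m i"
      define th where "th = 2 * pi * real s / real (m i)"
      define z where "z = cis th"
      have th: "0 \<le> th" "th \<le> 2 * pi / real R'" if "R' \<ge> 1" "R' \<le> max R1 R2" for R'
      proof -
        have "s * R' \<le> s * max R1 R2" using that by (intro mult_le_mono2)
        then have "s * R' \<le> m i" using s by linarith
        then have "real s * real R' \<le> real (m i)" by (metis of_nat_le_iff of_nat_mult)
        then have "2 * pi * (real s * real R') \<le> 2 * pi * real (m i)" by (intro mult_left_mono) auto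
        then show "th \<le> 2 * pi / real R'" using m0[of i] that by (simp add: th_def field_simps)
        show "0 \<le> th" by (simp add: th_def)
      qed
      have "z ^ m i = 1" unfolding z_def th_def by (rule cis_root_of_unity[OF m0])
      then have t: "point_fun ?N z \<in> torsion (m i) ?N" by (intro point_fun_torsion) (simp add: z_def)
      define f p where "f = \<phi> (point_fun ?N z)" and "p = Psi ?N (point_fun ?N z)"
      have fp: "f = z ^ B J i * p"
        using model'[OF i t] prod_point_fun[OF N_pos] by (simp add: f_def p_def)
      have f1: "cmod (f - 1) < 1/4" unfolding f_def z_def using R1 th by auto
      have p1: "cmod (p - 1) < 1/4" unfolding p_def z_def using R2 th by auto
      define w where "w = z ^ B J i"
      have "(w - 1) * p = (f - 1) - (p - 1)" by (simp add: fp w_def algebra_simps)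
      then have "cmod (w - 1) * cmod p \<le> cmod (f - 1) + cmod (p - 1)"
        by (metis norm_mult norm_triangle_ineq4)
      then have wp: "cmod (w - 1) * cmod p < 1/2" using f1 p1 by linarith
      have "cmod p > 3/4" using norm_triangle_ineq2[of 1 p] p1 by (simp add: norm_minus_commute)
      then have "cmod (w - 1) * (3/4) \<le> cmod (w - 1) * cmod p" by (intro mult_left_mono) auto
      then have "cmod (w - 1) < 1" using wp by linarith
      then have "Re w > 0" using complex_Re_le_cmod[of "1 - w"] by (simp add: norm_minus_commute)
      then show "0 < Re (cis (2 * pi * real s / real (m i)) powi int (B J i))"
        by (simp add: w_def z_def th_def power_int_of_nat)
    qed
    then show ?thesis by blast
  qed
  have "\<phi> t = Psi (Nprod n J) t" if J: "J \<ge> 1" and M: "M > 0" and t: "t \<in> torsion M (Nprod n J)" for J M t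
  proof -
    obtain Q where Q: "\<And>i. as i = xs \<Longrightarrow> J \<le> Suc i \<Longrightarrow> \<exists>c. int (m i) dvd int (B J i) - c \<and> \<bar>c\<bar> \<le> int Q"
      using small_rep[OF J] by blast
    \<comment> \<open>High enough for \<open>r = Nprod n J1 / Nprod n J\<close> to exceed \<open>Q\<close>.\<close>
    define J1 where "J1 = J + Nprod n J * (Q + 1)"
    have J1: "J \<le> J1" "1 \<le> J1" using J by (auto simp: J1_def)
    obtain Q1 where Q1: "\<And>i. as i = xs \<Longrightarrow> J1 \<le> Suc i \<Longrightarrow> \<exists>c. int (m i) dvd int (B J1 i) - c \<and> \<bar>c\<bar> \<le> int Q1"
      using small_rep[OF J1(2)] by blast
    obtain r where r: "Nprod n J1 = Nprod n J * r" using N_dvd[OF J1(1)] by (elim dvdE)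
    have "Nprod n J * (Q + 1) \<le> J1" by (simp add: J1_def)
    also have "J1 < 2 ^ J1" by (rule less_exp)
    also have "\<dots> \<le> Nprod n J * r" using Nprod_ge[OF n, of J1] r by simp
    finally have rQ: "Q < r" by simp
    obtain i where i: "i > J1 + M + Q + Q1 * r" "as i = xs" using inf by blast
    have iJ: "J \<le> Suc i" "J1 \<le> Suc i" using i J1 by auto
    obtain c where c: "int (m i) dvd int (B J i) - c" "\<bar>c\<bar> \<le> int Q" using Q[OF i(2) iJ(1)] by blast
    obtain c1 where c1: "int (m i) dvd int (B J1 i) - c1" "\<bar>c1\<bar> \<le> int Q1" using Q1[OF i(2) iJ(2)] by blast
    have "Nprod n (Suc i) div Nprod n J = (Nprod n (Suc i) div Nprod n J1) * r"
    proof -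
      obtain q where "Nprod n (Suc i) = Nprod n J1 * q" using N_dvd[OF iJ(2)] by (elim dvdE)
      then show ?thesis using r N_pos[of J] N_pos[of J1] by simp
    qed
    then have BB: "B J i = B J1 i * r" by (simp add: B_def)
    have "int (m i) dvd (int (B J1 i) - c1) * int r - (int (B J i) - c)"
      by (rule dvd_diff[OF dvd_mult2[OF c1(1)] c(1)])
    \<comment> \<open>Both terms are bounded independently of \<open>i\<close>, and \<open>i\<close> is large, so
      the congruence is an equality.\<close>
    then have "int (m i) dvd c - c1 * int r" by (simp add: BB algebra_simps)
    moreover have "\<bar>c - c1 * int r\<bar> < int (m i)"
    proof -
      have "\<bar>c1 * int r\<bar> \<le> int Q1 * int r" using c1(2) by (simp add: abs_mult mult_right_mono)
      moreover have "int (Q + Q1 * r) < int (m i)" using i mi[of i] by (simp only: of_nat_less_iff)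
      ultimately show ?thesis using c(2) by simp
    qed
    ultimately have "c - c1 * int r = 0" using zdvd_not_zless[of "\<bar>c - c1 * int r\<bar>" "int (m i)"] by (cases "c - c1 * int r = 0") auto
    then have cc: "c = c1 * int r" by simp
    have "c1 = 0"
    proof (rule ccontr)
      assume "c1 \<noteq> 0"
      then have "1 * int r \<le> \<bar>c1\<bar> * int r" by (intro mult_right_mono) auto
      then have "int r \<le> \<bar>c\<bar>" by (simp add: cc abs_mult)
      moreover have "int Q < int r" using rQ by simp
      ultimately show False using c(2) by linarith
    qed
    then have "m i dvd B J i" using c(1) cc by simp
    then obtain h where h: "B J i = m i * h" by (elim dvdE)
    have "M dvd m i" unfolding m_def using M i by (intro dvd_fact) auto
    then have ti: "t \<in> torsion (m i) (Nprod n J)" using t torsion_mono[OF dvd_refl] by blast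
    then have "(\<Prod>x=1..Nprod n J. t x) ^ m i = 1" by (subst prod_power_distrib) (simp add: torsion_def)
    then show ?thesis using model'[OF i(2) iJ(1) ti] by (simp add: h power_mult)
  qed
  moreover have "0 \<notin> set xs" using as[of i0] by (auto simp: xs_def)
  ultimately show ?thesis unfolding Psi_def by blast
qed

text \<open>
  Round the angle of every value down to a multiple of \<open>2 * pi / Suc i\<close>.
\<close>

lemma torsion_approximation:
  assumes t: "t \<in> periodic N"
  shows "\<exists>u. (\<forall>i. u i \<in> torsion (Suc i) N) \<and> (\<forall>x. (\<lambda>i. u i x) \<longlonglongrightarrow> t x)"
proof -
  \<comment> \<open>Since \<open>Arg 1 = 0\<close>, values 1 are preserved, in particular the value at 0.\<close>
  define th where "th x = Arg (t x) / (2 * pi)" for x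
  define a where "a i x = 2 * pi * (of_int \<lfloor>th x * real (Suc i)\<rfloor> / real (Suc i))" for i x
  define u where "u i x = cis (a i x)" for i x
  have tx: "t x = cis (2 * pi * th x)" for x
  proof -
    have "t x \<noteq> 0" using periodic_cmod[OF t, of x] by auto
    then show ?thesis using cis_Arg[of "t x"] periodic_cmod[OF t, of x] by (simp add: th_def sgn_eq)
  qed
  have "u i \<in> torsion (Suc i) N" for i
  proof -
    have "u i x ^ Suc i = 1" for x
    proof -
      have "u i x ^ Suc i = cis (2 * pi * of_int \<lfloor>th x * real (Suc i)\<rfloor>)"
        unfolding u_def a_def Complex.DeMoivre by (intro arg_cong[where f = cis]) (simp add: field_simps)
      also have "\<dots> = 1" by (rule cis_multiple_2pi) simp
      finally show ?thesis .
    qed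
    moreover have "u i \<in> periodic N" using t by (auto simp: periodic_def u_def a_def th_def)
    ultimately show ?thesis by (simp add: torsion_def)
  qed
  moreover have "(\<lambda>i. u i x) \<longlonglongrightarrow> t x" for x
  proof -
    have "(\<lambda>i. of_int \<lfloor>th x * real (Suc i)\<rfloor> / real (Suc i)) \<longlonglongrightarrow> th x"
    proof (rule real_tendsto_sandwich[OF _ _ _ tendsto_const])
      have "th x - inverse (real (Suc i)) \<le> of_int \<lfloor>th x * real (Suc i)\<rfloor> / real (Suc i)" for i
      proof -
        have "th x * real (Suc i) - 1 \<le> of_int \<lfloor>th x * real (Suc i)\<rfloor>" by linarith
        then have "(th x * real (Suc i) - 1) / real (Suc i) \<le> of_int \<lfloor>th x * real (Suc i)\<rfloor> / real (Suc i)"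
          by (rule divide_right_mono) simp
        moreover have "(th x * real (Suc i) - 1) / real (Suc i) = th x - inverse (real (Suc i))"
          by (simp add: diff_divide_distrib inverse_eq_divide del: of_nat_Suc)
        ultimately show ?thesis by linarith
      qed
      then show "\<forall>\<^sub>F i in sequentially. th x - inverse (real (Suc i)) \<le> of_int \<lfloor>th x * real (Suc i)\<rfloor> / real (Suc i)"
        by (intro always_eventually allI)
      have "of_int \<lfloor>th x * real (Suc i)\<rfloor> / real (Suc i) \<le> th x" for i
        by (subst pos_divide_le_eq) auto
      then show "\<forall>\<^sub>F i in sequentially. of_int \<lfloor>th x * real (Suc i)\<rfloor> / real (Suc i) \<le> th x"
        by (intro always_eventually allI)
      show "(\<lambda>i. th x - inverse (real (Suc i))) \<longlonglongrightarrow> th x"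
        using tendsto_diff[OF tendsto_const LIMSEQ_inverse_real_of_nat, of "th x"] by simp
    qed
    then have "(\<lambda>i. a i x) \<longlonglongrightarrow> 2 * pi * th x" unfolding a_def by (intro tendsto_mult tendsto_const)
    then show ?thesis unfolding tx u_def cis_conv_exp by (intro tendsto_intros)
  qed
  ultimately show ?thesis by blast
qed

text \<open>
  Both sides are continuous, and they agree on the dense set of torsion elements.
\<close>

theorem is_product_of_power_means:
  "\<exists>xs :: int list. 0 \<notin> set xs \<and>
    (\<forall>k\<ge>1. \<forall>t\<in>periodic (Nprod n k). \<phi> t = (\<Prod>a\<leftarrow>xs. power_mean (Nprod n k) t a))"
proof -
  obtain xs :: "int list" where xs: "0 \<notin> set xs"
    "\<And>J m t. J \<ge> 1 \<Longrightarrow> m > 0 \<Longrightarrow> t \<in> torsion m (Nprod n J) \<Longrightarrow> \<phi> t = (\<Prod>a\<leftarrow>xs. power_mean (Nprod n J) t a)"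
    using product_of_power_means_on_torsion by auto
  have "\<phi> t = (\<Prod>a\<leftarrow>xs. power_mean (Nprod n k) t a)" if k: "k \<ge> 1" and t: "t \<in> periodic (Nprod n k)" for k t
  proof -
    obtain u where u: "\<And>i. u i \<in> torsion (Suc i) (Nprod n k)" "\<And>x. (\<lambda>i. u i x) \<longlonglongrightarrow> t x"
      using torsion_approximation[OF t] by auto
    have "(\<lambda>i. \<phi> (u i)) \<longlonglongrightarrow> \<phi> t"
      using u by (intro cont[OF k _ t]) (auto simp: torsion_def)
    moreover have "\<phi> (u i) = (\<Prod>a\<leftarrow>xs. power_mean (Nprod n k) (u i) a)" for i
      using xs(2)[OF k _ u(1)] by simp
    ultimately have "(\<lambda>i. \<Prod>a\<leftarrow>xs. power_mean (Nprod n k) (u i) a) \<longlonglongrightarrow> \<phi> t" by simp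
    moreover have "(\<lambda>i. \<Prod>a\<leftarrow>xs. power_mean (Nprod n k) (u i) a) \<longlonglongrightarrow> (\<Prod>a\<leftarrow>xs. power_mean (Nprod n k) t a)"
      using periodic_cmod[OF t] u(2) by (intro prod_list_tendsto power_mean_tendsto)
    ultimately show ?thesis by (rule LIMSEQ_unique)
  qed
  then show ?thesis using xs(1) by blast
qed

end

section \<open>The limit group as an exhausted pair\<close>

text \<open>The image of the group of rank \<open>N\<close> in the inductive limit.\<close>

definition level :: "nat \<Rightarrow> wreath_elt set" where
  "level N = periodic N \<times> block_perm N {1..} ` perms N"

definition sym_elt :: "nat \<Rightarrow> (nat \<Rightarrow> nat) \<Rightarrow> wreath_elt" where
  "sym_elt N s = (\<lambda>_. 1, block_perm N {1..} s)"

lemma image_block_emb: "N > 0 \<Longrightarrow> block_emb N {1..} ` carrier (wreath N) = level N"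
  by (auto simp: level_def block_emb_def wreath_def periodic_eq_image image_iff intro!: bexI)

lemma block_emb_one_fst: "block_emb N {1..} (\<lambda>_. 1, s) = sym_elt N s"
  by (simp add: block_emb_def sym_elt_def block_fun_def)

lemma sym_elt_inject: "N > 0 \<Longrightarrow> inj_on (sym_elt N) (perms N)"
proof (rule inj_onI)
  fix s r assume N: "N > 0" and s: "s \<in> perms N" and r: "r \<in> perms N" and eq: "sym_elt N s = sym_elt N r"
  have "(\<lambda>_. 1, s) \<in> carrier (wreath N)" "(\<lambda>_. 1, r) \<in> carrier (wreath N)"
    using s r by (auto simp: wreath_def torus_fun_def)
  moreover have "block_emb N {1..} (\<lambda>_. 1, s) = block_emb N {1..} (\<lambda>_. 1, r)"
    using eq by (simp only: block_emb_one_fst)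
  ultimately have "(\<lambda>_. 1 :: complex, s) = (\<lambda>_. 1, r)"
    using inj_on_block_emb[OF block_closed_atLeast[OF N]] unfolding inj_on_def by blast
  then show "s = r" by simp
qed

definition prod_mean :: "int list \<Rightarrow> nat \<Rightarrow> (nat \<Rightarrow> complex) \<Rightarrow> complex" where
  "prod_mean l N t = (\<Prod>a\<leftarrow>l. power_mean N t a)"

text \<open>
  The summands of the expansion of a product of power means: the \<open>i\<close>-th factor is
  evaluated at the point \<open>h i\<close>.
\<close>

definition monom_at :: "int list \<Rightarrow> (nat \<Rightarrow> complex) \<Rightarrow> (nat \<Rightarrow> nat) \<Rightarrow> complex" where
  "monom_at l t h = (\<Prod>i<length l. t (h i) powi (l ! i))"

lemma prod_mean_expand:
  "prod_mean l N t = (\<Sum>h\<in>{..<length l} \<rightarrow>\<^sub>E {1..N}. monom_at l t h) / of_nat N ^ length l"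
proof -
  have "prod_mean l N t = (\<Prod>i<length l. power_mean N t (l ! i))"
    unfolding prod_mean_def
    by (induction l) (simp_all add: prod.lessThan_Suc_shift del: prod.lessThan_Suc)
  also have "\<dots> = (\<Prod>i<length l. \<Sum>x=1..N. t x powi (l ! i)) / of_nat N ^ length l"
    unfolding power_mean_def by (simp add: prod_dividef)
  finally show ?thesis unfolding monom_at_def by (subst (asm) prod_sum_PiE) auto
qed

lemma monom_at_mult: "monom_at l (\<lambda>x. t x * u x) h = monom_at l t h * monom_at l u h"
  by (simp add: monom_at_def power_int_mult_distrib prod.distrib)

lemma monom_at_cnj: "monom_at l (\<lambda>x. cnj (t x)) h = cnj (monom_at l t h)"
  by (simp add: monom_at_def)

lemma cmod_monom_at: "(\<And>x. cmod (t x) = 1) \<Longrightarrow> cmod (monom_at l t h) = 1"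
  by (simp add: monom_at_def norm_power_int flip: prod_norm)

lemma prod_mean_shuffle: "s \<in> perms N \<Longrightarrow> prod_mean l N (shuffle N s t) = prod_mean l N t"
proof -
  assume s: "s \<in> perms N"
  have "(\<Sum>x=1..N. shuffle N s t x powi a) = (\<Sum>x=1..N. t x powi a)" for a
  proof -
    have "(\<Sum>x=1..N. shuffle N s t x powi a) = (\<Sum>x=1..N. t (s x) powi a)"
      by (intro sum.cong refl) (simp add: block_perm_inside)
    then show ?thesis using sum.permute[of s "{1..N}" "\<lambda>x. t x powi a"] s by (simp add: perms_def comp_def)
  qed
  then show ?thesis by (simp add: prod_mean_def power_mean_def)
qed

text \<open>
  Expand both products as averages over maps \<open>h\<close> from the set of factors to
  \<open>{1..N}\<close>. For injective \<open>h\<close> a random permutation makes the values of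
  \<open>u\<close> nearly independent, and only a fraction of at most \<open>d\<^sup>2 /
  N\<close> of all maps is not injective.
\<close>

lemma prod_mean_independent:
  assumes N: "N > 0" and t: "\<And>x. cmod (t x) = 1" and u: "\<And>x. cmod (u x) = 1"
  shows "cmod ((\<Sum>s\<in>perms N. prod_mean l N (\<lambda>x. t x * shuffle N s u x)) / fact N - prod_mean l N t * prod_mean l N u)
      \<le> 4 * real ((length l)\<^sup>2) / real N"
proof -
  let ?I = "{..<length l}" and ?X = "{1..N}"
  let ?E = "?I \<rightarrow>\<^sub>E ?X" and ?d = "length l"
  define \<epsilon> where "\<epsilon> = 2 * real (?d\<^sup>2) / real N"
  define A where "A h = (\<Sum>s\<in>perms N. monom_at l (shuffle N s u) h) / fact N" for h
  have fin: "finite ?E" by (intro finite_PiE) auto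
  have cardE: "real (card ?E) = real N ^ ?d" by (simp add: card_funcsetE)
  have sub: "inj_maps ?I ?X \<subseteq> ?E" by (auto simp: inj_maps_def)
  have pm1: "cmod (prod_mean l N u) \<le> 1"
  proof -
    have "cmod (\<Sum>h\<in>?E. monom_at l u h) \<le> (\<Sum>h\<in>?E. 1)"
      using cmod_monom_at[OF u] by (intro sum_norm_le) simp
    then show ?thesis using N cardE by (simp add: prod_mean_expand norm_divide norm_power)
  qed
  have inj: "cmod (A h - prod_mean l N u) \<le> \<epsilon>" if h: "h \<in> inj_maps ?I ?X" for h
  proof -
    define F where "F g = monom_at l u g" for g
    have h': "h ` ?I \<subseteq> ?X" "inj_on h ?I" using h by (auto simp: inj_maps_def)
    have "monom_at l (shuffle N s u) h = F (\<lambda>i\<in>?I. s (h i))" if "s \<in> perms N" for s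
      unfolding F_def monom_at_def using h' by (intro prod.cong refl) (auto simp: block_perm_inside image_subset_iff)
    then have "A h = (\<Sum>s | s permutes ?X. F (\<lambda>i\<in>?I. s (h i))) / fact (card ?X)"
      unfolding A_def perms_def by simp
    moreover have "prod_mean l N u = (\<Sum>g\<in>?E. F g) / of_nat (card ?X) ^ card ?I"
      unfolding F_def prod_mean_expand by simp
    moreover have "cmod (F g) \<le> 1" for g unfolding F_def using cmod_monom_at[OF u] by simp
    ultimately show ?thesis
      using average_permutations_approx[of ?X ?I h F] h' N by (simp add: \<epsilon>_def)
  qed
  have all: "cmod (A h - prod_mean l N u) \<le> 2" for h
  proof -
    have "cmod (\<Sum>s\<in>perms N. monom_at l (shuffle N s u) h) \<le> (\<Sum>s\<in>perms N. 1)"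
      using cmod_monom_at[of "shuffle N _ u"] u by (intro sum_norm_le) simp
    then have "cmod (A h) \<le> 1" by (simp add: A_def norm_divide card_perms)
    then show ?thesis using pm1 norm_triangle_ineq4[of "A h" "prod_mean l N u"] by linarith
  qed
  \<comment> \<open>For the remaining maps the trivial bound 2 suffices.\<close>
  have few: "real (card (?E - inj_maps ?I ?X)) \<le> real N ^ ?d * (real (?d\<^sup>2) / real N)"
  proof -
    have "real (card (?E - inj_maps ?I ?X)) = real N ^ ?d - real (card (inj_maps ?I ?X))"
      using card_Diff_subset[OF finite_subset[OF sub fin] sub] card_mono[OF fin sub] cardE
      by (simp add: of_nat_diff)
    moreover have "real N ^ ?d * (1 - real (?d\<^sup>2) / real N) \<le> real (card (inj_maps ?I ?X))"
      using card_inj_maps_ge[of ?X ?I] N by simp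
    ultimately show ?thesis by (simp add: algebra_simps)
  qed
  have "(\<Sum>s\<in>perms N. prod_mean l N (\<lambda>x. t x * shuffle N s u x)) / fact N
     = (\<Sum>h\<in>?E. monom_at l t h * A h) / of_nat N ^ ?d"
    unfolding prod_mean_expand monom_at_mult A_def sum_divide_distrib[symmetric]
    by (subst sum.swap) (simp add: sum_distrib_left sum_divide_distrib mult_ac)
  moreover have "prod_mean l N t * prod_mean l N u = (\<Sum>h\<in>?E. monom_at l t h * prod_mean l N u) / of_nat N ^ ?d"
    by (subst prod_mean_expand[of l N t]) (simp add: sum_distrib_right)
  ultimately have "(\<Sum>s\<in>perms N. prod_mean l N (\<lambda>x. t x * shuffle N s u x)) / fact N - prod_mean l N t * prod_mean l N u
     = (\<Sum>h\<in>?E. monom_at l t h * (A h - prod_mean l N u)) / of_nat N ^ ?d"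
    by (simp add: diff_divide_distrib[symmetric] sum_subtractf[symmetric] right_diff_distrib)
  moreover have "cmod (\<Sum>h\<in>?E. monom_at l t h * (A h - prod_mean l N u)) \<le> real N ^ ?d * (2 * \<epsilon>)"
  proof -
    have "cmod (\<Sum>h\<in>?E. monom_at l t h * (A h - prod_mean l N u))
        \<le> (\<Sum>h\<in>?E. if h \<in> inj_maps ?I ?X then \<epsilon> else 2)"
      using inj all by (intro sum_norm_le) (auto simp: norm_mult cmod_monom_at[OF t])
    also have "\<dots> = (\<Sum>h\<in>inj_maps ?I ?X. \<epsilon>) + (\<Sum>h\<in>?E - inj_maps ?I ?X. 2)"
    proof -
      have "?E \<inter> {h. h \<in> inj_maps ?I ?X} = inj_maps ?I ?X" using sub by blast
      moreover have "?E \<inter> - {h. h \<in> inj_maps ?I ?X} = ?E - inj_maps ?I ?X" by blast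
      ultimately show ?thesis using sum.If_cases[OF fin, of "\<lambda>h. h \<in> inj_maps ?I ?X" "\<lambda>_. \<epsilon>" "\<lambda>_. 2"] by simp
    qed
    also have "\<dots> = real (card (inj_maps ?I ?X)) * \<epsilon> + 2 * real (card (?E - inj_maps ?I ?X))" by simp
    also have "\<dots> \<le> real N ^ ?d * \<epsilon> + 2 * (real N ^ ?d * (real (?d\<^sup>2) / real N))"
    proof (intro add_mono mult_right_mono mult_left_mono few)
      show "real (card (inj_maps ?I ?X)) \<le> real N ^ ?d" using card_mono[OF fin sub] unfolding cardE[symmetric] by simp
      show "0 \<le> \<epsilon>" by (simp add: \<epsilon>_def)
    qed simp
    also have "\<dots> = real N ^ ?d * (2 * \<epsilon>)" by (simp add: \<epsilon>_def)
    finally show ?thesis .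
  qed
  ultimately have "cmod ((\<Sum>s\<in>perms N. prod_mean l N (\<lambda>x. t x * shuffle N s u x)) / fact N - prod_mean l N t * prod_mean l N u)
     \<le> real N ^ ?d * (2 * \<epsilon>) / real N ^ ?d"
    by (simp only: norm_divide norm_power norm_of_nat) (intro divide_right_mono, auto)
  also have "\<dots> = 4 * real (?d\<^sup>2) / real N" using N by (simp add: \<epsilon>_def)
  finally show ?thesis .
qed

locale sequence =
  fixes n :: "nat \<Rightarrow> nat"
  assumes n: "\<forall>k\<ge>1. n k > 1"
begin

abbreviation (input) N :: "nat \<Rightarrow> nat" where "N \<equiv> Nprod n"
abbreviation (input) GG :: "wreath_elt monoid" where "GG \<equiv> limit_group n"

lemma N_pos: "N k > 0" using Nprod_pos[OF n] .

lemma N_dvd: "j \<le> k \<Longrightarrow> N j dvd N k" using Nprod_dvd[OF n, of j k] by auto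

lemma N_ge: "k < N k" using Nprod_ge[OF n, of k] less_exp[of k] by linarith

lemma level_mono: "j \<le> k \<Longrightarrow> level (N j) \<subseteq> level (N k)"
  using Defs.level_mono[OF n, of j k] by (simp only: image_block_emb[OF N_pos])

lemma carrier_limit: "carrier GG = (\<Union>k\<in>{1..}. level (N k))"
  by (simp add: limit_group_def image_block_emb[OF N_pos])

lemma common_level:
  assumes "finite S" "S \<subseteq> carrier GG"
  obtains k where "k \<ge> 1" "S \<subseteq> level (N k)"
proof -
  have "\<exists>k\<ge>1. S \<subseteq> level (N k)"
    using assms
  proof (induction S rule: finite_induct)
    case (insert g S)
    then obtain k where k: "k \<ge> 1" "S \<subseteq> level (N k)" by auto
    obtain j where j: "j \<ge> 1" "g \<in> level (N j)" using insert.prems carrier_limit by auto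
    have "insert g S \<subseteq> level (N (max j k))"
      using level_mono[of j "max j k"] level_mono[of k "max j k"] j k by auto
    then show ?case using j(1) by (intro exI[of _ "max j k"]) auto
  qed auto
  then show ?thesis using that by blast
qed

lemma level_in_carrier: "k \<ge> 1 \<Longrightarrow> level (N k) \<subseteq> carrier GG"
  using carrier_limit by auto

lemma mult_limit: "(t, a) \<otimes>\<^bsub>GG\<^esub> (u, b) = (\<lambda>x. t x * u (inv_into UNIV a x), a \<circ> b)"
  by (simp add: limit_group_def wreath_mult_def)

lemma one_limit: "\<one>\<^bsub>GG\<^esub> = (\<lambda>_. 1, id)"
  by (simp add: limit_group_def)

lemma block_inv: "s \<in> perms (N k) \<Longrightarrow> inv_into UNIV (block_perm (N k) {1..} s) = block_perm (N k) {1..} (inv_into UNIV s)"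
  using block_perm_inv[OF block_closed_atLeast[OF N_pos]] .

lemma block_comp: "r \<in> perms (N k) \<Longrightarrow> block_perm (N k) {1..} s \<circ> block_perm (N k) {1..} r = block_perm (N k) {1..} (s \<circ> r)"
  using block_perm_comp[OF block_closed_atLeast[OF N_pos]] .

lemma block_id: "block_perm (N k) {1..} id = id"
  using block_perm_id[OF block_closed_atLeast[OF N_pos]] .

lemma perms_comp: "s \<in> perms M \<Longrightarrow> r \<in> perms M \<Longrightarrow> s \<circ> r \<in> perms M"
  by (simp add: perms_def permutes_compose)

lemma id_perms: "id \<in> perms M" by (simp add: perms_def permutes_id)

lemma inv_inv_perms: "s \<in> perms M \<Longrightarrow> inv_into UNIV (inv_into UNIV s) = s"
  by (simp add: perms_def permutes_inv_inv)

lemma inv_limit: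
  assumes k: "k \<ge> 1" and t: "t \<in> periodic (N k)" and s: "s \<in> perms (N k)"
  shows "inv\<^bsub>GG\<^esub> (t, block_perm (N k) {1..} s) = (\<lambda>x. cnj (shuffle (N k) s t x), block_perm (N k) {1..} (inv_into UNIV s))"
proof (rule group.inv_equality[OF group_limit[OF n]])
  note i = perms_inv[OF s]
  have tp: "shuffle (N k) s t \<in> periodic (N k)" by (rule periodic_shuffle[OF N_pos s t])
  show "(t, block_perm (N k) {1..} s) \<in> carrier GG"
    using level_in_carrier[OF k] t s by (auto simp: level_def)
  show "(\<lambda>x. cnj (shuffle (N k) s t x), block_perm (N k) {1..} (inv_into UNIV s)) \<in> carrier GG"
    using level_in_carrier[OF k] periodic_cnj[OF tp] i by (auto simp: level_def)
  have "cnj (shuffle (N k) s t x) * shuffle (N k) s t x = 1" for x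
    using periodic_mult_cnj[OF tp, of x] by (simp add: mult.commute)
  then show "(\<lambda>x. cnj (shuffle (N k) s t x), block_perm (N k) {1..} (inv_into UNIV s)) \<otimes>\<^bsub>GG\<^esub> (t, block_perm (N k) {1..} s) = \<one>\<^bsub>GG\<^esub>"
    using perms_inv_o(2)[OF s] by (simp add: mult_limit one_limit block_inv[OF i] block_comp[OF s] inv_inv_perms[OF s] block_id)
qed

text \<open>
  The index is shifted because the groups of the sequence are indexed from 1.
\<close>

definition sym_level :: "nat \<Rightarrow> wreath_elt set" where
  "sym_level k = sym_elt (N (Suc k)) ` perms (N (Suc k))"

lemma sym_elt_carrier: "k \<ge> 1 \<Longrightarrow> s \<in> perms (N k) \<Longrightarrow> sym_elt (N k) s \<in> carrier GG"
  using level_in_carrier[of k] by (auto simp: level_def sym_elt_def periodic_one)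

lemma sym_elt_mult: "r \<in> perms (N k) \<Longrightarrow> sym_elt (N k) s \<otimes>\<^bsub>GG\<^esub> sym_elt (N k) r = sym_elt (N k) (s \<circ> r)"
  by (simp add: sym_elt_def mult_limit block_comp)

lemma sym_elt_inv:
  assumes "k \<ge> 1" "s \<in> perms (N k)"
  shows "inv\<^bsub>GG\<^esub> (sym_elt (N k) s) = sym_elt (N k) (inv_into UNIV s)"
  using inv_limit[OF assms(1) periodic_one assms(2)] by (simp add: sym_elt_def)

lemma sum_sym_level: "(\<Sum>s\<in>sym_level k. F s) = (\<Sum>s\<in>perms (N (Suc k)). F (sym_elt (N (Suc k)) s))"
  unfolding sym_level_def using sym_elt_inject[OF N_pos] by (subst sum.reindex) auto

lemma card_sym_level: "card (sym_level k) = fact (N (Suc k))"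
  unfolding sym_level_def using sym_elt_inject[OF N_pos] by (simp add: card_image card_perms)

lemma exhausted_pair_limit: "exhausted_pair GG (limit_top n) (limit_sym n) sym_level"
proof (intro exhausted_pair.intro exhausted_pair_axioms.intro group_limit[OF n] topspace_limit_top[OF n])
  fix k
  show "subgroup (sym_level k) GG"
  proof (rule group.subgroupI[OF group_limit[OF n]])
    show "sym_level k \<subseteq> carrier GG" using sym_elt_carrier by (auto simp: sym_level_def)
    show "sym_level k \<noteq> {}" using id_perms by (auto simp: sym_level_def)
  next
    fix a assume "a \<in> sym_level k"
    then obtain s where s: "s \<in> perms (N (Suc k))" "a = sym_elt (N (Suc k)) s" by (auto simp: sym_level_def)
    then have "inv\<^bsub>GG\<^esub> a = sym_elt (N (Suc k)) (inv_into UNIV s)" using sym_elt_inv[of "Suc k" s] by simp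
    then show "inv\<^bsub>GG\<^esub> a \<in> sym_level k" using perms_inv[OF s(1)] by (simp add: sym_level_def)
  next
    fix a b assume "a \<in> sym_level k" "b \<in> sym_level k"
    then obtain s r where "s \<in> perms (N (Suc k))" "r \<in> perms (N (Suc k))"
      "a = sym_elt (N (Suc k)) s" "b = sym_elt (N (Suc k)) r" by (auto simp: sym_level_def)
    then show "a \<otimes>\<^bsub>GG\<^esub> b \<in> sym_level k" by (simp add: sym_elt_mult sym_level_def perms_comp)
  qed
  show "finite (sym_level k)" by (simp add: sym_level_def finite_perms)
next
  fix j k :: nat assume jk: "j \<le> k"
  show "sym_level j \<subseteq> sym_level k"
  proof
    fix g assume "g \<in> sym_level j"
    then obtain s where s: "s \<in> perms (N (Suc j))" "g = sym_elt (N (Suc j)) s" by (auto simp: sym_level_def)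
    then have "g \<in> level (N (Suc j))" by (auto simp: level_def sym_elt_def periodic_one)
    then have "g \<in> level (N (Suc k))" using level_mono[of "Suc j" "Suc k"] jk by blast
    then obtain r where "r \<in> perms (N (Suc k))" "snd g = block_perm (N (Suc k)) {1..} r" by (auto simp: level_def)
    moreover have "fst g = (\<lambda>_. 1)" using s by (simp add: sym_elt_def)
    ultimately show "g \<in> sym_level k" by (auto simp: sym_level_def sym_elt_def image_iff prod_eq_iff)
  qed
next
  have "limit_sym n = (\<Union>k\<in>{1..}. sym_elt (N k) ` perms (N k))"
  proof -
    have "block_emb M {1..} ` ({\<lambda>_. 1} \<times> P) = sym_elt M ` P" for M P
    proof -
      have "block_emb M {1..} ` ({\<lambda>_. 1} \<times> P) = (\<lambda>s. block_emb M {1..} (\<lambda>_. 1, s)) ` P" by auto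
      then show ?thesis by (simp only: block_emb_one_fst)
    qed
    then show ?thesis unfolding limit_sym_def by simp
  qed
  also have "\<dots> = (\<Union>k. sym_level k)"
  proof -
    have "{1..} = range Suc" by (auto simp: image_iff One_nat_def Suc_le_eq gr0_conv_Suc)
    then show ?thesis by (simp add: sym_level_def)
  qed
  finally show "limit_sym n = (\<Union>k. sym_level k)" .
qed

lemma phi_eq_power_mean:
  assumes k: "k \<ge> 1" and t: "t \<in> periodic (N k)"
  shows "phi n M t = power_mean (N k) t M"
proof -
  obtain u where u: "u \<in> torus_fun (N k)" "t = block_fun (N k) {1..} u" using t periodic_eq_image[OF N_pos] by blast
  have "t x = u x" if "x \<in> {1..N k}" for x
    unfolding u(2) using block_fun_apply[of x "N k" 0 "{1..}" u] that by simp
  then show ?thesis using phi_eq[OF n k u(1), of M] unfolding u(2)[symmetric] power_mean_def by simp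
qed

definition prod_phi :: "int list \<Rightarrow> wreath_elt \<Rightarrow> complex" where
  "prod_phi l g = (\<Prod>a\<leftarrow>l. phi n a (fst g))"

lemma prod_phi_level: "k \<ge> 1 \<Longrightarrow> g \<in> level (N k) \<Longrightarrow> prod_phi l g = prod_mean l (N k) (fst g)"
  unfolding prod_phi_def prod_mean_def by (auto simp: level_def phi_eq_power_mean)

end

section \<open>Products of power means are spherical\<close>

lemma continuous_map_complex_mult:
  fixes f g :: "'a \<Rightarrow> complex"
  assumes "continuous_map X euclidean f" "continuous_map X euclidean g"
  shows "continuous_map X euclidean (\<lambda>x. f x * g x)"
proof -
  have "continuous_map X (prod_topology euclidean euclidean) (\<lambda>x. (f x, g x))"
    using assms by (intro continuous_map_pairedI)
  moreover have "continuous_map euclidean euclidean (\<lambda>p :: complex \<times> complex. fst p * snd p)"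
    by (auto intro!: continuous_intros)
  ultimately have "continuous_map X euclidean ((\<lambda>p. fst p * snd p) \<circ> (\<lambda>x. (f x, g x)))"
    by (intro continuous_map_compose) auto
  then show ?thesis by (simp add: comp_def)
qed

lemma continuous_map_power_int:
  fixes f :: "'a \<Rightarrow> complex"
  assumes f: "continuous_map X euclidean f" and nz: "\<And>x. x \<in> topspace X \<Longrightarrow> f x \<noteq> 0"
  shows "continuous_map X euclidean (\<lambda>x. f x powi a)"
proof -
  have "continuous_map X (subtopology euclidean (- {0})) f"
    using f nz by (auto simp: continuous_map_in_subtopology)
  moreover have "continuous_map (subtopology euclidean (- {0})) euclidean (\<lambda>z :: complex. z powi a)"
    unfolding continuous_map_iff_continuous by (intro continuous_intros) auto
  ultimately have "continuous_map X euclidean ((\<lambda>z. z powi a) \<circ> f)" by (rule continuous_map_compose)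
  then show ?thesis by (simp add: comp_def)
qed

text \<open>Zero is excluded because exponents may be negative.\<close>

lemma continuous_map_prod_mean:
  assumes w: "\<And>x. continuous_map X euclidean (\<lambda>g. w g x)" and nz: "\<And>g x. g \<in> topspace X \<Longrightarrow> w g x \<noteq> 0"
  shows "continuous_map X euclidean (\<lambda>g. prod_mean l N (w g))"
proof (induction l)
  case Nil
  then show ?case by (simp add: prod_mean_def)
next
  case (Cons a l)
  have "continuous_map X euclidean (\<lambda>g. (\<Sum>x=1..N. w g x powi a) * inverse (of_nat N))"
    by (intro continuous_map_complex_mult continuous_map_sum continuous_map_power_int w nz) auto
  then have "continuous_map X euclidean (\<lambda>g. power_mean N (w g) a)"
    by (simp add: power_mean_def divide_inverse)
  from continuous_map_complex_mult[OF this Cons] show ?case by (simp add: prod_mean_def)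
qed

text \<open>
  For \<open>xs = ys\<close> the right-hand side is a sum of squares of absolute values.
\<close>

lemma sum_list_gram:
  fixes a :: "'g \<Rightarrow> 'h \<Rightarrow> complex"
  shows "(\<Sum>(c, g)\<leftarrow>xs. \<Sum>(d, k)\<leftarrow>ys. c * cnj d * (\<Sum>h\<in>E. a g h * cnj (a k h)))
    = (\<Sum>h\<in>E. (\<Sum>(c, g)\<leftarrow>xs. c * a g h) * cnj (\<Sum>(d, k)\<leftarrow>ys. d * a k h))"
proof (induction xs)
  case (Cons p xs)
  obtain c g where p: "p = (c, g)" by fastforce
  have "(\<Sum>(d, k)\<leftarrow>ys. c * cnj d * (\<Sum>h\<in>E. a g h * cnj (a k h)))
      = (\<Sum>h\<in>E. c * a g h * cnj (\<Sum>(d, k)\<leftarrow>ys. d * a k h))"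
    by (induction ys) (auto simp: sum.distrib sum_distrib_left algebra_simps)
  then show ?case using Cons by (simp add: p sum.distrib algebra_simps)
qed simp

context sequence
begin

lemma level_mult:
  assumes "g \<in> level (N k)" "h \<in> level (N k)"
  shows "g \<otimes>\<^bsub>GG\<^esub> h \<in> level (N k)"
proof -
  obtain t s u r where e: "g = (t, block_perm (N k) {1..} s)" "h = (u, block_perm (N k) {1..} r)"
    and m: "t \<in> periodic (N k)" "u \<in> periodic (N k)" "s \<in> perms (N k)" "r \<in> perms (N k)"
    using assms by (auto simp: level_def)
  have "(\<lambda>x. t x * shuffle (N k) (inv_into UNIV s) u x) \<in> periodic (N k)"
    by (intro periodic_mult periodic_shuffle m N_pos perms_inv)
  then show ?thesis
    using m by (auto simp: e mult_limit block_inv block_comp level_def intro!: imageI perms_comp)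
qed

lemma sym_elt_in_sym: "k \<ge> 1 \<Longrightarrow> s \<in> perms (N k) \<Longrightarrow> sym_elt (N k) s \<in> limit_sym n"
proof -
  assume k: "k \<ge> 1" and s: "s \<in> perms (N k)"
  interpret E: exhausted_pair GG "limit_top n" "limit_sym n" sym_level by (rule exhausted_pair_limit)
  have "sym_elt (N k) s \<in> sym_level (k - 1)" using k s by (simp add: sym_level_def)
  then show ?thesis using E.K_eq by blast
qed

lemma torus_in_carrier: "k \<ge> 1 \<Longrightarrow> t \<in> periodic (N k) \<Longrightarrow> (t, id) \<in> carrier GG"
  using level_in_carrier[of k] id_perms[of "N k"] block_id[of k] by (force simp: level_def)

lemma common_level_sym:
  assumes g: "g \<in> carrier GG" and s: "s \<in> limit_sym n"
  obtains k r where "k \<ge> 1" "g \<in> level (N k)" "r \<in> perms (N k)" "s = sym_elt (N k) r"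
proof -
  interpret E: exhausted_pair GG "limit_top n" "limit_sym n" sym_level by (rule exhausted_pair_limit)
  obtain k where k: "k \<ge> 1" "{g} \<subseteq> level (N k)" using common_level[of "{g}"] g by auto
  obtain j where j: "s \<in> sym_level j" using s E.K_eq by blast
  have "s \<in> sym_level (max j k)" using E.mono_Ks[of j "max j k"] j by auto
  then obtain r where r: "r \<in> perms (N (Suc (max j k)))" "s = sym_elt (N (Suc (max j k))) r"
    by (auto simp: sym_level_def)
  have "g \<in> level (N (Suc (max j k)))" using level_mono[OF le_SucI[OF max.cobounded2[of k j]]] k by blast
  then show ?thesis using that[of "Suc (max j k)" r] r by simp
qed

text \<open>
  Positive definiteness holds because the expansion of \<open>prod_mean_expand\<close> writes
  the product as an average of characters of the torus; the limit relation is
  \<open>prod_mean_independent\<close>.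
\<close>

lemma spherical_kernel_prod_phi:
  "exhausted_pair.spherical_kernel GG (limit_top n) (limit_sym n) sym_level (prod_phi l)"
proof -
  interpret E: exhausted_pair GG "limit_top n" "limit_sym n" sym_level by (rule exhausted_pair_limit)
  \<comment> \<open>By invariance under permutations the product depends only on the quotient of the torus parts.\<close>
  have quot: "prod_phi l (inv\<^bsub>GG\<^esub> h \<otimes>\<^bsub>GG\<^esub> g) = prod_mean l (N k) (\<lambda>x. fst g x * cnj (fst h x))"
    if k: "k \<ge> 1" and g: "g \<in> level (N k)" and h: "h \<in> level (N k)" for g h k
  proof -
    obtain t s u r where e: "g = (t, block_perm (N k) {1..} s)" "h = (u, block_perm (N k) {1..} r)"
      and m: "t \<in> periodic (N k)" "u \<in> periodic (N k)" "s \<in> perms (N k)" "r \<in> perms (N k)"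
      using g h by (auto simp: level_def)
    note ri = perms_inv[OF m(4)]
    have "(\<lambda>x. cnj (shuffle (N k) r u x), block_perm (N k) {1..} (inv_into UNIV r)) \<in> level (N k)"
      using m ri by (auto simp: level_def intro!: imageI periodic_cnj periodic_shuffle N_pos)
    then have "inv\<^bsub>GG\<^esub> h \<in> level (N k)" by (simp add: e inv_limit[OF k m(2,4)])
    then have "inv\<^bsub>GG\<^esub> h \<otimes>\<^bsub>GG\<^esub> g \<in> level (N k)" using g by (rule level_mult)
    moreover have "fst (inv\<^bsub>GG\<^esub> h \<otimes>\<^bsub>GG\<^esub> g) = shuffle (N k) r (\<lambda>x. t x * cnj (u x))"
      by (simp add: e inv_limit[OF k m(2,4)] mult_limit block_inv[OF ri] inv_inv_perms[OF m(4)] mult.commute)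
    ultimately show ?thesis
      using prod_phi_level[OF k] prod_mean_shuffle[OF m(4), of l "\<lambda>x. t x * cnj (u x)"] by (simp add: e)
  qed
  show ?thesis
    unfolding E.spherical_kernel_def
  proof (intro conjI allI ballI impI)
    have "(\<lambda>_. 1, id) \<in> level (N 1)" using id_perms[of "N 1"] block_id[of 1] periodic_one by (force simp: level_def)
    then have "prod_phi l \<one>\<^bsub>GG\<^esub> = prod_mean l (N 1) (\<lambda>_. 1)" using prod_phi_level[of 1] by (simp add: one_limit)
    then show "prod_phi l \<one>\<^bsub>GG\<^esub> = 1"
      using N_pos[of 1] by (simp add: prod_mean_def power_mean_def map_replicate_const prod_list_replicate)
  next
    fix xs :: "(complex \<times> wreath_elt) list" assume "snd ` set xs \<subseteq> carrier GG"
    then obtain k where k: "k \<ge> 1" "snd ` set xs \<subseteq> level (N k)" using common_level[of "snd ` set xs"] by auto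
    let ?E = "{..<length l} \<rightarrow>\<^sub>E {1..N k}" and ?D = "of_nat (N k) ^ length l :: complex"
    let ?S = "\<Sum>(c, g)\<leftarrow>xs. \<Sum>(d, h)\<leftarrow>xs. c * cnj d * prod_phi l (inv\<^bsub>GG\<^esub> h \<otimes>\<^bsub>GG\<^esub> g)"
    let ?z = "\<lambda>y. \<Sum>(c, g)\<leftarrow>xs. c * monom_at l (fst g) y"
    have "?S = (\<Sum>(c, g)\<leftarrow>xs. \<Sum>(d, h)\<leftarrow>xs. c * cnj d * (\<Sum>y\<in>?E. monom_at l (fst g) y * cnj (monom_at l (fst h) y))) / ?D"
    proof -
      have "?S = (\<Sum>(c, g)\<leftarrow>xs. \<Sum>(d, h)\<leftarrow>xs. c * cnj d * (\<Sum>y\<in>?E. monom_at l (fst g) y * cnj (monom_at l (fst h) y)) * inverse ?D)"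
      proof (intro arg_cong[where f = sum_list] map_cong refl, clarify, intro arg_cong[where f = sum_list] map_cong refl, clarify)
        fix c t s d u r assume "(c, t, s) \<in> set xs" "(d, u, r) \<in> set xs"
        then have "(t, s) \<in> level (N k)" "(u, r) \<in> level (N k)" using k(2) by force+
        from quot[OF k(1) this] show "c * cnj d * prod_phi l (inv\<^bsub>GG\<^esub> (u, r) \<otimes>\<^bsub>GG\<^esub> (t, s))
          = c * cnj d * (\<Sum>y\<in>?E. monom_at l (fst (t, s)) y * cnj (monom_at l (fst (u, r)) y)) * inverse ?D"
          by (simp add: prod_mean_expand monom_at_mult monom_at_cnj divide_inverse mult.assoc)
      qed
      then show ?thesis by (simp add: case_prod_unfold sum_list_mult_const divide_inverse)
    qed
    also have "\<dots> = (\<Sum>y\<in>?E. ?z y * cnj (?z y)) / ?D" by (subst sum_list_gram) simp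
    also have "\<dots> = of_real ((\<Sum>y\<in>?E. (cmod (?z y))\<^sup>2) / real (N k) ^ length l)"
      by (simp only: complex_norm_square[symmetric] of_real_sum of_real_divide of_real_power of_real_of_nat_eq)
    finally have S: "?S = of_real ((\<Sum>y\<in>?E. (cmod (?z y))\<^sup>2) / real (N k) ^ length l)" .
    show "?S \<in> \<real>" unfolding S by (rule Reals_of_real)
    show "0 \<le> Re ?S" unfolding S Re_complex_of_real by (intro divide_nonneg_nonneg sum_nonneg) auto
  next
    fix a b assume ab: "a \<in> carrier GG" "b \<in> carrier GG"
    show "continuous_map (limit_top n) euclidean (\<lambda>g. prod_phi l (a \<otimes>\<^bsub>GG\<^esub> g \<otimes>\<^bsub>GG\<^esub> b))"
      unfolding continuous_map_limit_top[OF n]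
    proof (intro allI impI)
      fix k :: nat assume k: "k \<ge> 1"
      obtain K0 where K0: "K0 \<ge> 1" "{a, b} \<subseteq> level (N K0)" using common_level[of "{a, b}"] ab by auto
      \<comment> \<open>A level on which \<open>a\<close>, \<open>b\<close> and all of level \<open>k\<close>
        live, so that the product has one formula there.\<close>
      define K where "K = max k K0"
      have K: "K \<ge> 1" "k \<le> K" "a \<in> level (N K)" "b \<in> level (N K)"
        using K0 k level_mono[of K0 K] by (auto simp: K_def)
      define w where "w g x = fst a x * block_fun (N k) {1..} (fst g) (inv_into UNIV (snd a) x) *
        fst b (inv_into UNIV (snd a \<circ> block_perm (N k) {1..} (snd g)) x)" for g x
      let ?X = "wreath_top (N k)"
      have top: "topspace ?X = carrier (wreath (N k))" by (rule topspace_wreath_top[OF n])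
      have in_level: "block_emb (N k) {1..} g \<in> level (N K)" if "g \<in> topspace ?X" for g
        using that level_mono[OF K(2)] image_block_emb[OF N_pos, of k] unfolding top by blast
      have eq: "prod_phi l (a \<otimes>\<^bsub>GG\<^esub> block_emb (N k) {1..} g \<otimes>\<^bsub>GG\<^esub> b) = prod_mean l (N K) (w g)"
        if g: "g \<in> topspace ?X" for g
      proof -
        have "a \<otimes>\<^bsub>GG\<^esub> block_emb (N k) {1..} g \<otimes>\<^bsub>GG\<^esub> b \<in> level (N K)"
          using K in_level[OF g] by (intro level_mult)
        moreover have "fst (a \<otimes>\<^bsub>GG\<^esub> block_emb (N k) {1..} g \<otimes>\<^bsub>GG\<^esub> b) = w g"
          by (cases a, cases b, cases g) (simp add: mult_limit block_emb_def w_def fun_eq_iff)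
        ultimately show ?thesis using prod_phi_level[OF K(1)] by simp
      qed
      have nz: "w g x \<noteq> 0" if g: "g \<in> topspace ?X" for g x
      proof -
        have "block_emb (N k) {1..} g \<in> level (N K)" by (rule in_level[OF g])
        then have "block_fun (N k) {1..} (fst g) \<in> periodic (N K)" by (cases g) (auto simp: level_def block_emb_def)
        moreover have "fst a \<in> periodic (N K)" "fst b \<in> periodic (N K)" using K by (auto simp: level_def)
        ultimately have "cmod (w g x) = 1" by (simp add: w_def norm_mult periodic_cmod)
        then show ?thesis by auto
      qed
      have "continuous_map ?X euclidean (\<lambda>g. w g x)" for x
        unfolding w_def
      proof (intro continuous_map_complex_mult)
        show "continuous_map ?X euclidean (\<lambda>g. fst a x)" by simp
        have coord: "continuous_map ?X euclidean (\<lambda>g. fst g y)" for y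
        proof -
          have "continuous_map (subtopology euclidean (torus_fun (N k))) euclidean (\<lambda>t. t y)"
            by (simp add: continuous_map_iff_continuous continuous_on_product_coordinates continuous_on_subset[OF _ subset_UNIV])
          from continuous_map_compose[OF continuous_map_fst this]
          show ?thesis unfolding wreath_top_def by (simp add: comp_def)
        qed
        show "continuous_map ?X euclidean (\<lambda>g. block_fun (N k) {1..} (fst g) (inv_into UNIV (snd a) x))"
          using coord by (cases "inv_into UNIV (snd a) x \<in> {1..}") (simp_all add: block_fun_def)
        have "continuous_map (discrete_topology (perms (N k))) euclidean
            (\<lambda>s. fst b (inv_into UNIV (snd a \<circ> block_perm (N k) {1..} s) x))" by simp
        from continuous_map_compose[OF continuous_map_snd this]
        show "continuous_map ?X euclidean (\<lambda>g. fst b (inv_into UNIV (snd a \<circ> block_perm (N k) {1..} (snd g)) x))"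
          unfolding wreath_top_def by (simp add: comp_def)
      qed
      then have "continuous_map ?X euclidean (\<lambda>g. prod_mean l (N K) (w g))"
        by (intro continuous_map_prod_mean nz)
      then show "continuous_map ?X euclidean ((\<lambda>g. prod_phi l (a \<otimes>\<^bsub>GG\<^esub> g \<otimes>\<^bsub>GG\<^esub> b)) \<circ> block_emb (N k) {1..})"
        by (rule continuous_map_eq) (simp add: eq)
    qed
  next
    fix g s assume g: "g \<in> carrier GG" and s: "s \<in> limit_sym n"
    obtain k r where k: "k \<ge> 1" "g \<in> level (N k)" and r: "r \<in> perms (N k)" "s = sym_elt (N k) r"
      using common_level_sym[OF g s] .
    have sl: "s \<in> level (N k)" using r by (auto simp: level_def sym_elt_def periodic_one)
    obtain t a where ta: "g = (t, a)" by fastforce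
    have "fst (g \<otimes>\<^bsub>GG\<^esub> s) = t" by (simp add: ta r sym_elt_def mult_limit)
    then show "prod_phi l (g \<otimes>\<^bsub>GG\<^esub> s) = prod_phi l g" by (simp add: prod_phi_def ta)
    have "fst (s \<otimes>\<^bsub>GG\<^esub> g) = shuffle (N k) (inv_into UNIV r) t"
      by (simp add: ta r sym_elt_def mult_limit block_inv)
    then show "prod_phi l (s \<otimes>\<^bsub>GG\<^esub> g) = prod_phi l g"
      using prod_phi_level[OF k(1) level_mult[OF sl k(2)]] prod_phi_level[OF k] perms_inv[OF r(1)]
      by (simp add: prod_mean_shuffle ta)
  next
    fix g h assume gh: "g \<in> carrier GG" "h \<in> carrier GG"
    obtain k0 where k0: "k0 \<ge> 1" "{g, h} \<subseteq> level (N k0)" using common_level[of "{g, h}"] gh by auto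
    let ?A = "\<lambda>k. (\<Sum>s\<in>sym_level k. prod_phi l (g \<otimes>\<^bsub>GG\<^esub> s \<otimes>\<^bsub>GG\<^esub> h)) / of_nat (card (sym_level k))"
    have bound: "norm (?A k - prod_phi l g * prod_phi l h) \<le> 4 * real ((length l)\<^sup>2) * (1 / real (Suc k))" if kk: "k \<ge> k0" for k
    proof -
      define K where "K = Suc k"
      have K: "K \<ge> 1" "g \<in> level (N K)" "h \<in> level (N K)"
        using k0 kk level_mono[of k0 K] by (auto simp: K_def)
      obtain t s1 u r where e: "g = (t, block_perm (N K) {1..} s1)" "h = (u, block_perm (N K) {1..} r)"
        and m: "t \<in> periodic (N K)" "u \<in> periodic (N K)" "s1 \<in> perms (N K)" "r \<in> perms (N K)"
        using K by (auto simp: level_def)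
      let ?F = "\<lambda>s. prod_mean l (N K) (\<lambda>x. t x * shuffle (N K) s u x)"
      have summand: "prod_phi l (g \<otimes>\<^bsub>GG\<^esub> sym_elt (N K) s \<otimes>\<^bsub>GG\<^esub> h) = ?F (inv_into UNIV (s1 \<circ> s))"
        if s: "s \<in> perms (N K)" for s
      proof -
        have "sym_elt (N K) s \<in> level (N K)" using s by (auto simp: level_def sym_elt_def periodic_one)
        then have "g \<otimes>\<^bsub>GG\<^esub> sym_elt (N K) s \<otimes>\<^bsub>GG\<^esub> h \<in> level (N K)" using K by (intro level_mult)
        moreover have "fst (g \<otimes>\<^bsub>GG\<^esub> sym_elt (N K) s \<otimes>\<^bsub>GG\<^esub> h) = (\<lambda>x. t x * shuffle (N K) (inv_into UNIV (s1 \<circ> s)) u x)"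
          using block_inv[OF perms_comp[OF m(3) s]] by (simp add: e sym_elt_def mult_limit block_comp[OF s])
        ultimately show ?thesis using prod_phi_level[OF K(1)] by simp
      qed
      have "(\<Sum>s\<in>sym_level k. prod_phi l (g \<otimes>\<^bsub>GG\<^esub> s \<otimes>\<^bsub>GG\<^esub> h)) = (\<Sum>s\<in>perms (N K). ?F (inv_into UNIV (s1 \<circ> s)))"
        unfolding sum_sym_level K_def[symmetric] by (intro sum.cong refl summand)
      also have "\<dots> = (\<Sum>s\<in>perms (N K). ?F (inv_into UNIV s))"
        using setum_permutations_compose_left[of s1 "{1..N K}" "\<lambda>s. ?F (inv_into UNIV s)"] m(3)
        unfolding perms_def by simp
      also have "\<dots> = (\<Sum>s\<in>perms (N K). ?F s)"
        unfolding perms_def by (rule sum_permutations_inverse[symmetric])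
      finally have "?A k = (\<Sum>s\<in>perms (N K). ?F s) / fact (N K)"
        by (simp add: card_sym_level K_def)
      moreover have "prod_phi l g = prod_mean l (N K) t" "prod_phi l h = prod_mean l (N K) u"
        using prod_phi_level[OF K(1,2), of l] prod_phi_level[OF K(1,3), of l] by (simp_all add: e)
      ultimately have "norm (?A k - prod_phi l g * prod_phi l h) \<le> 4 * real ((length l)\<^sup>2) / real (N K)"
        using prod_mean_independent[OF N_pos[of K] periodic_cmod[OF m(1)] periodic_cmod[OF m(2)], of l] by simp
      also have "\<dots> \<le> 4 * real ((length l)\<^sup>2) / real (Suc k)"
        using N_ge[of K] by (intro divide_left_mono) (auto simp: K_def)
      finally show ?thesis by simp
    qed
    have "(\<lambda>k. ?A k - prod_phi l g * prod_phi l h) \<longlonglongrightarrow> 0"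
    proof (rule Lim_null_comparison)
      show "\<forall>\<^sub>F k in sequentially. norm (?A k - prod_phi l g * prod_phi l h) \<le> 4 * real ((length l)\<^sup>2) * (1 / real (Suc k))"
        using eventually_ge_at_top[of k0] by eventually_elim (rule bound)
      show "(\<lambda>k. 4 * real ((length l)\<^sup>2) * (1 / real (Suc k))) \<longlonglongrightarrow> 0"
        using tendsto_mult_left[OF LIMSEQ_inverse_real_of_nat, of "4 * real ((length l)\<^sup>2)"] by (simp add: inverse_eq_divide)
    qed
    then show "?A \<longlonglongrightarrow> prod_phi l g * prod_phi l h" by (simp add: LIM_zero_iff)
  qed
qed

end

section \<open>Classification and uniqueness\<close>

context sequence
begin

lemma tendsto_torus:
  fixes u :: "nat \<Rightarrow> nat \<Rightarrow> complex"
  assumes "\<And>x. (\<lambda>i. u i x) \<longlonglongrightarrow> v x"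
  shows "u \<longlonglongrightarrow> v"
proof -
  have "limitin (product_topology (\<lambda>_. euclidean) UNIV) u v sequentially"
    unfolding limitin_componentwise using assms by simp
  then show ?thesis by (simp add: euclidean_product_topology)
qed

text \<open>
  Invariance under \<open>K\<close> on the right removes the permutation, and on the left it
  becomes invariance under permutations of the torus coordinates.
\<close>

lemma multiplicative_limit_of_kernel:
  assumes "exhausted_pair.spherical_kernel GG (limit_top n) (limit_sym n) sym_level f"
  shows "multiplicative_limit n (\<lambda>t. f (t, id))"
    and "k \<ge> 1 \<Longrightarrow> g \<in> level (N k) \<Longrightarrow> f g = f (fst g, id)"
proof -
  interpret E: exhausted_pair GG "limit_top n" "limit_sym n" sym_level by (rule exhausted_pair_limit)
  note ker = assms[unfolded E.spherical_kernel_def]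
  have inv_l: "f (s \<otimes>\<^bsub>GG\<^esub> g) = f g" and inv_r: "f (g \<otimes>\<^bsub>GG\<^esub> s) = f g" if "g \<in> carrier GG" "s \<in> limit_sym n" for g s
    using ker that by blast+
  have drop: "f g = f (fst g, id)" if k: "k \<ge> 1" and g: "g \<in> level (N k)" for g k
  proof -
    obtain t s where e: "g = (t, block_perm (N k) {1..} s)" and s: "s \<in> perms (N k)" using g by (auto simp: level_def)
    note i = perms_inv[OF s]
    have "g \<otimes>\<^bsub>GG\<^esub> sym_elt (N k) (inv_into UNIV s) = (t, id)"
      using perms_inv_o(1)[OF s] by (simp add: e sym_elt_def mult_limit block_comp[OF i] block_id)
    then show ?thesis
      using inv_r[of g, OF _ sym_elt_in_sym[OF k i]] level_in_carrier[OF k] g by (auto simp: e)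
  qed
  then show "k \<ge> 1 \<Longrightarrow> g \<in> level (N k) \<Longrightarrow> f g = f (fst g, id)" .
  show "multiplicative_limit n (\<lambda>t. f (t, id))"
  proof
    show "\<forall>k\<ge>1. 1 < n k" by (rule n)
    show "f (\<lambda>_. 1, id) = 1" using ker by (simp add: one_limit)
  next
    fix k :: nat and S :: "(nat \<Rightarrow> complex) set" and c :: "(nat \<Rightarrow> complex) \<Rightarrow> complex"
    assume k: "k \<ge> 1" and S: "finite S" "S \<subseteq> periodic (N k)"
    obtain L where L: "set L = S" "distinct L" using finite_distinct_list[OF S(1)] by blast
    define xs where "xs = map (\<lambda>t. (c t, (t, id :: nat \<Rightarrow> nat))) L"
    have "snd ` set xs \<subseteq> carrier GG" using S L torus_in_carrier[OF k] by (auto simp: xs_def)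
    then have pd: "(\<Sum>(c, g)\<leftarrow>xs. \<Sum>(d, h)\<leftarrow>xs. c * cnj d * f (inv\<^bsub>GG\<^esub> h \<otimes>\<^bsub>GG\<^esub> g)) \<in> \<real> \<and>
       0 \<le> Re (\<Sum>(c, g)\<leftarrow>xs. \<Sum>(d, h)\<leftarrow>xs. c * cnj d * f (inv\<^bsub>GG\<^esub> h \<otimes>\<^bsub>GG\<^esub> g))"
      using ker by blast
    have sum_L: "(\<Sum>t\<leftarrow>L. F t) = (\<Sum>t\<in>S. F t)" for F :: "(nat \<Rightarrow> complex) \<Rightarrow> complex"
      using sum_list_distinct_conv_sum_set[OF L(2)] L(1) by simp
    have quot: "inv\<^bsub>GG\<^esub> (u, id) \<otimes>\<^bsub>GG\<^esub> (t, id) = (\<lambda>x. t x * cnj (u x), id)" if "u \<in> S" for t u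
    proof -
      have "inv\<^bsub>GG\<^esub> (u, id) = (\<lambda>x. cnj (u x), id)"
        using inv_limit[OF k _ id_perms, of u] that S(2) by (auto simp: block_id)
      then show ?thesis by (simp add: mult_limit mult.commute)
    qed
    have "(\<Sum>(c, g)\<leftarrow>xs. \<Sum>(d, h)\<leftarrow>xs. c * cnj d * f (inv\<^bsub>GG\<^esub> h \<otimes>\<^bsub>GG\<^esub> g))
       = (\<Sum>t\<in>S. \<Sum>u\<in>S. c t * cnj (c u) * f (inv\<^bsub>GG\<^esub> (u, id) \<otimes>\<^bsub>GG\<^esub> (t, id)))"
      by (simp add: xs_def comp_def sum_L)
    also have "\<dots> = (\<Sum>t\<in>S. \<Sum>u\<in>S. c t * cnj (c u) * f (\<lambda>x. t x * cnj (u x), id))"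
      by (intro sum.cong refl) (simp add: quot)
    finally show "0 \<le> Re (\<Sum>t\<in>S. \<Sum>u\<in>S. c t * cnj (c u) * f (\<lambda>x. t x * cnj (u x), id)) \<and>
        Im (\<Sum>t\<in>S. \<Sum>u\<in>S. c t * cnj (c u) * f (\<lambda>x. t x * cnj (u x), id)) = 0"
      using pd by (simp add: complex_is_Real_iff)
  next
    fix k :: nat and s t assume k: "k \<ge> 1" and s: "s \<in> perms (N k)" and t: "t \<in> periodic (N k)"
    note i = perms_inv[OF s]
    have tc: "(t, id) \<in> carrier GG" by (rule torus_in_carrier[OF k t])
    have "sym_elt (N k) (inv_into UNIV s) \<otimes>\<^bsub>GG\<^esub> (t, id) = (shuffle (N k) s t, block_perm (N k) {1..} (inv_into UNIV s))"
      by (simp add: sym_elt_def mult_limit block_inv[OF i] inv_inv_perms[OF s])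
    moreover have "(shuffle (N k) s t, block_perm (N k) {1..} (inv_into UNIV s)) \<in> level (N k)"
      using periodic_shuffle[OF N_pos s t] i by (auto simp: level_def)
    ultimately show "f (shuffle (N k) s t, id) = f (t, id)"
      using inv_l[OF tc sym_elt_in_sym[OF k i]] drop[OF k] by fastforce
  next
    fix k :: nat and u :: "nat \<Rightarrow> nat \<Rightarrow> complex" and t
    assume k: "k \<ge> 1" and u: "\<And>i. u i \<in> periodic (N k)" and t: "t \<in> periodic (N k)" and lim: "\<And>x. (\<lambda>i. u i x) \<longlonglongrightarrow> t x"
    \<comment> \<open>Continuity is defined on the groups of finite rank, whose functions are extended by 1.\<close>
    define cut where "cut v x = (if x \<in> {1..N k} then v x else 1 :: complex)" for v :: "nat \<Rightarrow> complex" and x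
    have cut: "cut v \<in> torus_fun (N k)" "block_emb (N k) {1..} (cut v, id) = (v, id)" if v: "v \<in> periodic (N k)" for v
    proof -
      show c: "cut v \<in> torus_fun (N k)" using periodic_cmod[OF v] by (auto simp: torus_fun_def cut_def)
      have "block_fun (N k) {1..} (cut v) = v"
      proof (rule periodic_ext[OF N_pos _ v])
        show "block_fun (N k) {1..} (cut v) \<in> periodic (N k)" using c periodic_eq_image[OF N_pos] by blast
        fix x assume x: "x \<in> {1..N k}"
        then show "block_fun (N k) {1..} (cut v) x = v x"
          using block_fun_apply[of x "N k" 0 "{1..}" "cut v"] by (simp add: cut_def)
      qed
      then show "block_emb (N k) {1..} (cut v, id) = (v, id)" by (simp add: block_emb_def block_id)
    qed
    have id1: "\<one>\<^bsub>GG\<^esub> \<in> carrier GG" by (rule E.one_closed)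
    have "continuous_map (limit_top n) euclidean (\<lambda>g. f (\<one>\<^bsub>GG\<^esub> \<otimes>\<^bsub>GG\<^esub> g \<otimes>\<^bsub>GG\<^esub> \<one>\<^bsub>GG\<^esub>))" using ker id1 by blast
    then have "continuous_map (limit_top n) euclidean f"
      by (rule continuous_map_eq) (simp add: E.topspace)
    then have "continuous_map (wreath_top (N k)) euclidean (f \<circ> block_emb (N k) {1..})"
      using k unfolding continuous_map_limit_top[OF n] by blast
    moreover have "limitin (wreath_top (N k)) (\<lambda>i. (cut (u i), id)) (cut t, id) sequentially"
    proof -
      have "(\<lambda>i. cut (u i) x) \<longlonglongrightarrow> cut t x" for x
      proof (cases "x \<in> {1..N k}")
        case True
        then have "cut v x = v x" for v unfolding cut_def by (rule if_P)
        then show ?thesis using lim by simp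
      next
        case False
        then have "cut v x = 1" for v unfolding cut_def by (rule if_not_P)
        then show ?thesis by simp
      qed
      then have "(\<lambda>i. cut (u i)) \<longlonglongrightarrow> cut t" by (rule tendsto_torus)
      then show ?thesis
        unfolding wreath_top_def limitin_pairwise limitin_subtopology
        using cut(1)[OF u] cut(1)[OF t] id_perms by (simp add: comp_def)
    qed
    ultimately have "limitin euclidean ((f \<circ> block_emb (N k) {1..}) \<circ> (\<lambda>i. (cut (u i), id))) ((f \<circ> block_emb (N k) {1..}) (cut t, id)) sequentially"
      by (rule continuous_map_limit)
    then show "(\<lambda>i. f (u i, id)) \<longlonglongrightarrow> f (t, id)" using cut(2)[OF u] cut(2)[OF t] by (simp add: comp_def)
  next
    fix j :: nat and t u assume j: "j \<ge> 1" and t: "t \<in> periodic (N j)" and u: "u \<in> periodic (N j)"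
    let ?F = "\<lambda>k s. f (\<lambda>x. t x * shuffle (N k) s u x, id)"
    let ?A = "\<lambda>k. (\<Sum>s\<in>perms (N k). ?F k s) / fact (N k)"
    have tc: "(t, id) \<in> carrier GG" "(u, id) \<in> carrier GG" using torus_in_carrier[OF j] t u by auto
    have eq: "(\<Sum>s\<in>sym_level k. f ((t, id) \<otimes>\<^bsub>GG\<^esub> s \<otimes>\<^bsub>GG\<^esub> (u, id))) / of_nat (card (sym_level k)) = ?A (Suc k)" for k
    proof -
      have "f ((t, id) \<otimes>\<^bsub>GG\<^esub> sym_elt (N (Suc k)) s \<otimes>\<^bsub>GG\<^esub> (u, id)) = ?F (Suc k) (inv_into UNIV s)"
        if s: "s \<in> perms (N (Suc k))" for s
      proof -
        let ?g = "(t, id) \<otimes>\<^bsub>GG\<^esub> sym_elt (N (Suc k)) s \<otimes>\<^bsub>GG\<^esub> (u, id)"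
        have "?g \<in> carrier GG" using tc sym_elt_carrier[of "Suc k" s] s by simp
        then obtain k' where k': "k' \<ge> 1" "?g \<in> level (N k')" using carrier_limit by auto
        have "fst ?g = (\<lambda>x. t x * shuffle (N (Suc k)) (inv_into UNIV s) u x)"
          using s by (simp add: sym_elt_def mult_limit block_inv)
        then show ?thesis using drop[OF k'] by simp
      qed
      then have "(\<Sum>s\<in>sym_level k. f ((t, id) \<otimes>\<^bsub>GG\<^esub> s \<otimes>\<^bsub>GG\<^esub> (u, id))) = (\<Sum>s\<in>perms (N (Suc k)). ?F (Suc k) (inv_into UNIV s))"
        unfolding sum_sym_level by (intro sum.cong refl)
      also have "\<dots> = (\<Sum>s\<in>perms (N (Suc k)). ?F (Suc k) s)"
        unfolding perms_def by (rule sum_permutations_inverse[symmetric])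
      finally show ?thesis by (simp add: card_sym_level)
    qed
    have "(\<lambda>k. (\<Sum>s\<in>sym_level k. f ((t, id) \<otimes>\<^bsub>GG\<^esub> s \<otimes>\<^bsub>GG\<^esub> (u, id))) / of_nat (card (sym_level k)))
        \<longlonglongrightarrow> f (t, id) * f (u, id)"
      using ker tc by blast
    then have "(\<lambda>k. ?A (Suc k)) \<longlonglongrightarrow> f (t, id) * f (u, id)" unfolding eq .
    then show "?A \<longlonglongrightarrow> f (t, id) * f (u, id)" by (rule LIMSEQ_imp_Suc)
  qed
qed

lemma kernel_is_product:
  assumes "exhausted_pair.spherical_kernel GG (limit_top n) (limit_sym n) sym_level f"
  obtains l where "0 \<notin> set l" "\<And>g. g \<in> carrier GG \<Longrightarrow> f g = prod_phi l g"
proof -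
  interpret multiplicative_limit n "\<lambda>t. f (t, id)" by (rule multiplicative_limit_of_kernel(1)[OF assms])
  from is_product_of_power_means obtain l where l: "0 \<notin> set l"
    "\<forall>k\<ge>1. \<forall>t\<in>periodic (N k). f (t, id) = (\<Prod>a\<leftarrow>l. power_mean (N k) t a)"
    by blast
  have "f g = prod_phi l g" if g: "g \<in> carrier GG" for g
  proof -
    obtain k where k: "k \<ge> 1" "g \<in> level (N k)" using g carrier_limit by auto
    have "fst g \<in> periodic (N k)" using k(2) by (auto simp: level_def)
    then show ?thesis
      using multiplicative_limit_of_kernel(2)[OF assms k] l(2) k prod_phi_level[OF k, of l]
      by (simp add: prod_mean_def)
  qed
  then show ?thesis using that l(1) by blast
qed

lemma spherical_function_is_product:
  assumes "\<phi> \<in> spherical_functions TYPE('h) GG (limit_top n) (limit_sym n)"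
  obtains l where "0 \<notin> set l" "\<phi> = restrict (prod_phi l) (carrier GG)"
proof -
  interpret E: exhausted_pair GG "limit_top n" "limit_sym n" sym_level by (rule exhausted_pair_limit)
  obtain H :: "'h hilbert" and \<rho> \<eta> where \<phi>: "\<phi> = (\<lambda>g\<in>carrier GG. cinner H (\<rho> g \<eta>) \<eta>)"
    and rep: "spherical_rep GG (limit_top n) (limit_sym n) H \<rho>"
    and \<eta>: "\<eta> \<in> fixed_space H \<rho> (limit_sym n)" "cinner H \<eta> \<eta> = 1"
    using assms unfolding spherical_functions_def by blast
  have "unitary_rep GG (limit_top n) H \<rho>" "one_dimensional H (fixed_space H \<rho> (limit_sym n))"
    using rep unfolding spherical_rep_def irreducible_rep_def by blast+
  then interpret R: exhausted_rep GG "limit_top n" "limit_sym n" sym_level H \<rho>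
    by (intro exhausted_rep.intro exhausted_pair_limit)
  have "E.spherical_kernel (\<lambda>g. cinner H (\<rho> g \<eta>) \<eta>)"
    using R.matrix_coefficient_spherical_kernel \<eta> \<open>one_dimensional H _\<close> by blast
  then obtain l where "0 \<notin> set l" "\<And>g. g \<in> carrier GG \<Longrightarrow> cinner H (\<rho> g \<eta>) \<eta> = prod_phi l g"
    using kernel_is_product by blast
  then show ?thesis using that[of l] by (simp add: \<phi> restrict_def fun_eq_iff)
qed

lemma product_is_spherical_function:
  "restrict (prod_phi l) (carrier GG) \<in> spherical_functions TYPE(wreath_elt \<Rightarrow> complex) GG (limit_top n) (limit_sym n)"
proof -
  interpret E: exhausted_pair GG "limit_top n" "limit_sym n" sym_level by (rule exhausted_pair_limit)
  interpret kernel_space GG "limit_top n" "limit_sym n" sym_level "prod_phi l"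
    by (intro kernel_space.intro kernel_space_axioms.intro exhausted_pair_limit spherical_kernel_prod_phi)
  show ?thesis by (rule kernel_in_spherical_functions)
qed

text \<open>
  The derivative of $\prod_a(1+c_ax)$ at \<open>x = 0\<close>, along the sequence $x=1/N_k$.
\<close>

lemma scaled_product_tendsto:
  fixes c :: "int \<Rightarrow> complex"
  shows "(\<lambda>k. of_nat (N k) * ((\<Prod>a\<leftarrow>l. 1 + c a / of_nat (N k)) - 1)) \<longlonglongrightarrow> (\<Sum>a\<leftarrow>l. c a)"
proof -
  have inv0: "(\<lambda>k. inverse (of_nat (N k)) :: complex) \<longlonglongrightarrow> 0"
  proof (rule Lim_null_comparison)
    show "\<forall>\<^sub>F k in sequentially. norm (inverse (of_nat (N k)) :: complex) \<le> inverse (real (Suc k))"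
    proof (intro always_eventually allI)
      fix k
      have "Suc k \<le> N k" using N_ge[of k] by simp
      then show "norm (inverse (of_nat (N k)) :: complex) \<le> inverse (real (Suc k))"
        unfolding norm_inverse norm_of_nat by (intro le_imp_inverse_le) (simp_all only: of_nat_le_iff of_nat_0_less_iff zero_less_Suc)
    qed
  qed (rule LIMSEQ_inverse_real_of_nat)
  have P: "(\<lambda>k. \<Prod>a\<leftarrow>l. 1 + c a / of_nat (N k)) \<longlonglongrightarrow> (\<Prod>a\<leftarrow>l. 1)" for l
  proof (rule prod_list_tendsto)
    fix a
    show "(\<lambda>k. 1 + c a / of_nat (N k)) \<longlonglongrightarrow> 1"
      using tendsto_add[OF tendsto_const tendsto_mult[OF tendsto_const inv0], of 1 "c a"] by (simp add: divide_inverse)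
  qed
  show ?thesis
  proof (induction l)
    case (Cons a l)
    have "(\<lambda>k. of_nat (N k) * ((\<Prod>a\<leftarrow>l. 1 + c a / of_nat (N k)) - 1) + c a * (\<Prod>a\<leftarrow>l. 1 + c a / of_nat (N k)))
      \<longlonglongrightarrow> (\<Sum>a\<leftarrow>l. c a) + c a * (\<Prod>a\<leftarrow>l. 1)"
      by (intro tendsto_add Cons tendsto_mult tendsto_const P)
    moreover have "of_nat (N k) * ((\<Prod>a\<leftarrow>l. 1 + c a / of_nat (N k)) - 1) + c a * (\<Prod>a\<leftarrow>l. 1 + c a / of_nat (N k))
      = of_nat (N k) * ((\<Prod>a\<leftarrow>a # l. 1 + c a / of_nat (N k)) - 1)" for k
      using N_pos[of k] by (simp add: field_simps)
    moreover have "(\<Prod>a\<leftarrow>l. 1) = (1 :: complex)" by (induction l) auto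
    ultimately show ?case by (simp add: add.commute)
  qed simp
qed

text \<open>
  Evaluate both products at the function on \<open>{1..N k}\<close> with value \<open>z\<close>
  at a single point.
\<close>

lemma product_determines_power_sums:
  assumes eq: "\<And>g. g \<in> carrier GG \<Longrightarrow> prod_phi l g = prod_phi l' g" and z: "cmod z = 1"
  shows "(\<Sum>a\<leftarrow>l. z powi a - 1) = (\<Sum>a\<leftarrow>l'. z powi a - 1)"
proof -
  have same: "(\<Prod>a\<leftarrow>l. 1 + (z powi a - 1) / of_nat (N k)) = (\<Prod>a\<leftarrow>l'. 1 + (z powi a - 1) / of_nat (N k))" if k: "k \<ge> 1" for k
  proof -
    let ?t = "point_fun (N k) z"
    have t: "?t \<in> periodic (N k)" using z by (rule point_fun_periodic)
    have lev: "(?t, id) \<in> level (N k)" using t id_perms[of "N k"] block_id[of k] by (force simp: level_def)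
    have "prod_mean l (N k) ?t = prod_mean l' (N k) ?t"
      using eq[OF torus_in_carrier[OF k t]] prod_phi_level[OF k lev, of l] prod_phi_level[OF k lev, of l'] by simp
    then show ?thesis unfolding prod_mean_def power_mean_point_fun[OF N_pos] .
  qed
  have "\<forall>\<^sub>F k in sequentially. of_nat (N k) * ((\<Prod>a\<leftarrow>l. 1 + (z powi a - 1) / of_nat (N k)) - 1)
      = of_nat (N k) * ((\<Prod>a\<leftarrow>l'. 1 + (z powi a - 1) / of_nat (N k)) - 1)"
    by (rule eventually_mono[OF eventually_ge_at_top[of 1]]) (simp only: same)
  from Lim_transform_eventually[OF scaled_product_tendsto[of "\<lambda>a. z powi a - 1" l] this]
  show ?thesis using scaled_product_tendsto[of "\<lambda>a. z powi a - 1" l'] by (rule LIMSEQ_unique)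
qed

end

text \<open>
  The multiplicity of \<open>b\<close> is a Fourier coefficient on the \<open>q\<close>-th roots
  of unity, for \<open>q\<close> so large that congruence modulo \<open>q\<close> is equality
  for all exponents involved. The constants \<open>- 1\<close> contribute to the frequency 0
  only.
\<close>

lemma power_sums_determine_list:
  assumes eq: "\<And>z. cmod z = 1 \<Longrightarrow> (\<Sum>a\<leftarrow>l. z powi a - 1) = (\<Sum>a\<leftarrow>l'. z powi a - 1)"
    and nz: "0 \<notin> set l" "0 \<notin> set l'"
  shows "mset l = mset l'"
proof (rule multiset_eqI)
  fix b
  show "count (mset l) b = count (mset l') b"
  proof (cases "b = 0")
    case True
    then show ?thesis using nz by (simp add: count_eq_zero_iff[THEN iffD2])
  next
    case False
    define S where "S = (\<Sum>a\<leftarrow>b # l @ l'. \<bar>a\<bar>)"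
    \<comment> \<open>Larger than twice the absolute value of every exponent.\<close>
    define q where "q = Suc (nat S * 2)"
    have q0: "q > 0" by (simp add: q_def)
    have big: "2 * \<bar>a\<bar> < int q" if "a \<in> set (b # l @ l')" for a
    proof -
      have "\<bar>a\<bar> \<le> S" unfolding S_def using that by (intro member_le_sum_list) auto
      moreover have "0 \<le> \<bar>a\<bar>" by simp
      ultimately have "0 \<le> S" "\<bar>a\<bar> \<le> S" by linarith+
      then show ?thesis by (simp add: q_def)
    qed
    have fourier: "(\<Sum>j<q. cis (2 * pi * real j / real q) powi (- b) * (\<Sum>a\<leftarrow>xs. cis (2 * pi * real j / real q) powi a - 1))
       = of_nat q * of_nat (count (mset xs) b)" if xs: "set xs \<subseteq> set (b # l @ l')" for xs
    proof -
      have ndvd: "\<not> int q dvd - b"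
        using big[of b] False zdvd_not_zless[of "\<bar>b\<bar>" "int q"] by auto
      have summand: "(\<Sum>j<q. cis (2 * pi * real j / real q) powi (- b) * (cis (2 * pi * real j / real q) powi a - 1))
         = (if a = b then of_nat q else 0)" if a: "a \<in> set xs" for a
      proof -
        have "int q dvd - b + a \<longleftrightarrow> a = b"
        proof
          assume d: "int q dvd - b + a"
          have "\<bar>- b + a\<bar> < int q" using big[of a] big[of b] a xs by auto
          then show "a = b" using d zdvd_not_zless[of "\<bar>- b + a\<bar>" "int q"] by (cases "- b + a = 0") auto
        qed simp
        moreover have "cis (2 * pi * real j / real q) powi (- b) * (cis (2 * pi * real j / real q) powi a - 1)
           = cis (2 * pi * real j / real q) powi (- b + a) - cis (2 * pi * real j / real q) powi (- b)" for j
          by (simp only: power_int_add[OF disjI1[OF cis_neq_zero]] right_diff_distrib mult_1_right)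
        ultimately show ?thesis using ndvd by (simp add: sum_subtractf sum_roots_of_unity[OF q0] del: dvd_minus_iff)
      qed
      have "(\<Sum>j<q. cis (2 * pi * real j / real q) powi (- b) * (\<Sum>a\<leftarrow>xs. cis (2 * pi * real j / real q) powi a - 1))
         = (\<Sum>a\<leftarrow>xs. \<Sum>j<q. cis (2 * pi * real j / real q) powi (- b) * (cis (2 * pi * real j / real q) powi a - 1))"
        by (induction xs) (simp_all add: distrib_left sum.distrib)
      also have "\<dots> = (\<Sum>a\<leftarrow>xs. if a = b then of_nat q else 0)"
        by (intro arg_cong[where f = sum_list] map_cong refl summand)
      also have "\<dots> = of_nat q * of_nat (count (mset xs) b)"
        by (induction xs) (auto simp: algebra_simps)
      finally show ?thesis .
    qed
    have sub: "set l \<subseteq> set (b # l @ l')" "set l' \<subseteq> set (b # l @ l')" by auto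
    have same: "(\<Sum>a\<leftarrow>l. cis th powi a - 1) = (\<Sum>a\<leftarrow>l'. cis th powi a - 1)" for th
      by (rule eq) simp
    have "of_nat q * of_nat (count (mset l) b) = (of_nat q * of_nat (count (mset l') b) :: complex)"
      using fourier[OF sub(1)] fourier[OF sub(2)] by (simp only: same)
    then show ?thesis using q0 by simp
  qed
qed

theorem theorem1p5:
  fixes n :: "nat \<Rightarrow> nat"
  assumes "\<forall>k\<ge>1. n k > 1"
  shows "bij_betw
           (\<lambda>m. \<lambda>g\<in>carrier (limit_group n). \<Prod>M\<in>#m. phi n M (fst g))
           {m :: int multiset. 0 \<notin># m}
           (spherical_functions TYPE(wreath_elt \<Rightarrow> complex)
              (limit_group n) (limit_top n) (limit_sym n))
       \<and> (\<forall>\<phi> \<in> spherical_functions TYPE('h) (limit_group n) (limit_top n) (limit_sym n).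
            \<exists>Ms :: int list. 0 \<notin> set Ms \<and>
              (\<forall>(t, \<sigma>) \<in> carrier (limit_group n).
                 \<phi> (t, \<sigma>) = (\<Prod>M\<leftarrow>Ms. phi n M t)))"
proof -
  interpret sequence n by (rule sequence.intro[OF assms])
  let ?F = "\<lambda>m. \<lambda>g\<in>carrier (limit_group n). \<Prod>M\<in>#m. phi n M (fst g)"
  let ?S = "spherical_functions TYPE(wreath_elt \<Rightarrow> complex) (limit_group n) (limit_top n) (limit_sym n)"
  have F: "?F (mset l) = restrict (prod_phi l) (carrier (limit_group n))" for l
    unfolding prod_phi_def by (simp add: prod_mset_prod_list flip: mset_map)
  have "inj_on ?F {m. 0 \<notin># m}"
  proof (rule inj_onI)
    fix m m' :: "int multiset" assume m: "m \<in> {m. 0 \<notin># m}" "m' \<in> {m. 0 \<notin># m}" and eq: "?F m = ?F m'"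
    obtain l l' where l: "m = mset l" "m' = mset l'" using ex_mset by metis
    have "prod_phi l g = prod_phi l' g" if "g \<in> carrier (limit_group n)" for g
      using eq that unfolding l F by (metis restrict_apply')
    then have "(\<Sum>a\<leftarrow>l. z powi a - 1) = (\<Sum>a\<leftarrow>l'. z powi a - 1)" if "cmod z = 1" for z
      using product_determines_power_sums[OF _ that] by blast
    then show "m = m'" unfolding l using m by (intro power_sums_determine_list) (auto simp: l)
  qed
  moreover have "?F ` {m. 0 \<notin># m} = ?S"
  proof (intro equalityI subsetI)
    fix \<phi> assume "\<phi> \<in> ?F ` {m. 0 \<notin># m}"
    then obtain m where "\<phi> = ?F m" by blast
    moreover obtain l where "m = mset l" using ex_mset by metis
    ultimately show "\<phi> \<in> ?S" using product_is_spherical_function[of l] by (simp only: F)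
  next
    fix \<phi> assume "\<phi> \<in> ?S"
    then obtain l where "0 \<notin> set l" "\<phi> = restrict (prod_phi l) (carrier (limit_group n))"
      by (rule spherical_function_is_product)
    then show "\<phi> \<in> ?F ` {m. 0 \<notin># m}" by (intro image_eqI[of _ _ "mset l"]) (simp_all only: F mem_Collect_eq set_mset_mset not_False_eq_True)
  qed
  moreover have "\<exists>Ms :: int list. 0 \<notin> set Ms \<and>
      (\<forall>(t, \<sigma>) \<in> carrier (limit_group n). \<phi> (t, \<sigma>) = (\<Prod>M\<leftarrow>Ms. phi n M t))"
    if \<phi>: "\<phi> \<in> spherical_functions TYPE('h) (limit_group n) (limit_top n) (limit_sym n)" for \<phi>
  proof -
    obtain l where "0 \<notin> set l" "\<phi> = restrict (prod_phi l) (carrier (limit_group n))"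
      using \<phi> by (rule spherical_function_is_product)
    then show ?thesis by (intro exI[of _ l]) (auto simp: prod_phi_def)
  qed
  ultimately show ?thesis unfolding bij_betw_def by blast
qed

end
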